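(* Let $g=g(x)\in L^p(\mathbb{R}^n)$ and $f=f(t,x)\in L^p(\mathbb{R}^{n+1}_+)$, $1\le p\le\infty$, and define $$v(t,x)=\int_0^t\int_{\mathbb{R}^n}p(t,\tau,y)f(t-\tau,x-y)\,dy\,d\tau+\int_{\mathbb{R}^n}p(t,t,y)g(x-y)\,dy .$$ Then $$\|v\|_{L^p(\mathbb{R}^{n+1}_+)}\le\|f\|_{L^p(\mathbb{R}^{n+1}_+)}+\|g\|_{L^p(\mathbb{R}^n)}.$$ If $f\in C^2_c(\mathbb{R}^{n+1}_+)$ and $g\in C^2_c(\mathbb{R}^n)$ then $v$ is the unique bounded classical solution to the Cauchy problem $$\begin{cases}\partial_tv-a^{ij}(t)\partial_{ij}v+v=f&\text{for }t>0,\ x\in\mathbb{R}^n\\ v(0,x)=g&\text{for }x\in\mathbb{R}^n.\end{cases}$$ In this case the following pointwise limit formulas hold for a.e. $t>0$ and every $x\in\mathbb{R}^n$, $i,j=1,\dots,n$: $$\partial_{ij}v(t,x)=\lim_{\varepsilon\to0}\int_\varepsilon^t\int_{\mathbb{R}^n}\partial_{y_iy_j}p(t,\tau,x-y)f(t-\tau,y)\,dy\,d\tau+\int_{\mathbb{R}^n}\partial_{y_iy_j}p(t,t,y)g(x-y)\,dy$$ and $$\partial_tv(t,x)=\lim_{\varepsilon\to0}\int_\varepsilon^t\int_{\mathbb{R}^n}(\partial_t+\partial_\tau)p(t,\tau,x-y)f(t-\tau,y)\,dy\,d\tau+\int_{\mathbb{R}^n}\partial_tp(t,t,y)g(x-y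)\,dy+f(t,x).$$
   Context: Here $n\ge1$, $\mathbb{R}^{n+1}_+=(0,\infty)\times\mathbb{R}^n$, repeated indices are summed, $\partial_{ij}=\partial_{x_ix_j}$. The coefficient matrix $a(t)=(a^{ij}(t))$ is bounded, measurable, symmetric and uniformly elliptic: there is $\Lambda>0$ such that $\Lambda|\xi|^2\le a^{ij}(t)\xi_i\xi_j\le\Lambda^{-1}|\xi|^2$ for all $\xi\in\mathbb{R}^n$ and a.e. $t\in\mathbb{R}$. For $t\in\mathbb{R}$, $\tau>0$ set $A_{t,\tau}=\int_{t-\tau}^ta(r)\,dr$, $B_{t,\tau}=(A_{t,\tau})^{-1}$, and $$p(t,\tau,x)=\chi_{\tau>0}\,e^{-\tau}\frac{\exp\big(-\tfrac14\langle B_{t,\tau}x,x\rangle\big)}{(4\pi)^{n/2}(\det B_{t,\tau})^{-1/2}},\qquad t,\tau\in\mathbb{R},\ x\in\mathbb{R}^n .$$ The expression $\partial_{y_iy_j}p(t,\tau,x-y)$ is the second derivative of $p$ in its spatial variable evaluated at $x-y$, and $\partial_tp(t,t,y)$ denotes the derivative of the function $t\mapsto p(t,t,y)$. Since $a$ is only measurable in $t$, the equation is understood for a.e. $t$: a bounded classical solution is a bounded function $v$, continuous on $[0,\infty)\times\mathbb{R}^n$ (at $t=0$ taken equal to the initial datum), whose derivatives $\partial_iv,\partial_{ij}v$ exist and are continuous on $\mathbb{R}^{n+1}_+$, such that $t\mapsto v(t,x)$ is locally absolutely continuous on $(0,\infty)$ for each $x$ and the equation holds for a.e. $t>0$ and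 every $x\in\mathbb{R}^n$. *)

theory Defs
  imports "HOL-Analysis.Analysis" "HOL-Probability.Essential_Supremum"
begin

text \<open>
  Points of the closed or open half space are pairs \<open>(t, x)\<close>. All integrals are taken with respect
  to the completed measure \<open>lebesgue\<close>, so that integrands which are only defined almost everywhere
  (such as time derivatives of the kernel) may have arbitrary values on null sets.
\<close>

definition half_space :: "(real \<times> (real^'n)) set" where
  "half_space = {0<..} \<times> UNIV"

definition Lp_norm :: "ennreal \<Rightarrow> 'a measure \<Rightarrow> ('a \<Rightarrow> real) \<Rightarrow> ennreal" where
  "Lp_norm p M h =
     (if p = \<infinity> then esssup M (\<lambda>x. ennreal \<bar>h x\<bar>)
      else let I = (\<integral>\<^sup>+ x. ennreal (\<bar>h x\<bar> powr enn2real p) \<partial>M)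
           in if I = \<infinity> then \<infinity> else ennreal (enn2real I powr (1 / enn2real p)))"

definition in_Lp :: "ennreal \<Rightarrow> 'a measure \<Rightarrow> ('a \<Rightarrow> real) \<Rightarrow> bool" where
  "in_Lp p M h \<longleftrightarrow> h \<in> borel_measurable M \<and> Lp_norm p M h < \<infinity>"

text \<open>Twice continuously differentiable on an open set \<open>S\<close>, via the first and second Frechet
  derivatives; values of \<open>h\<close> outside \<open>S\<close> are irrelevant.\<close>

definition C2_on :: "'a::euclidean_space set \<Rightarrow> ('a \<Rightarrow> real) \<Rightarrow> bool" where
  "C2_on S h \<longleftrightarrow>
     (\<exists>(h' :: 'a \<Rightarrow> 'a \<Rightarrow>\<^sub>L real) (h'' :: 'a \<Rightarrow> 'a \<Rightarrow>\<^sub>L ('a \<Rightarrow>\<^sub>L real)).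
        (\<forall>x\<in>S. (h has_derivative blinfun_apply (h' x)) (at x)) \<and>
        (\<forall>x\<in>S. (h' has_derivative blinfun_apply (h'' x)) (at x)) \<and>
        continuous_on S h'')"

definition C2c_on :: "'a::euclidean_space set \<Rightarrow> ('a \<Rightarrow> real) \<Rightarrow> bool" where
  "C2c_on S h \<longleftrightarrow>
     C2_on S h \<and> compact (closure (support_on S h)) \<and> closure (support_on S h) \<subseteq> S"

text \<open>Partial derivatives on \<open>real^'n\<close>, and their existence (\<^const>\<open>deriv\<close> is a total function).\<close>

definition pdiff :: "'n::finite \<Rightarrow> (real^'n \<Rightarrow> real) \<Rightarrow> real^'n \<Rightarrow> bool" where
  "pdiff i h x \<longleftrightarrow> (\<lambda>s. h (x + s *\<^sub>R axis i 1)) differentiable (at 0)"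

definition pd :: "'n::finite \<Rightarrow> (real^'n \<Rightarrow> real) \<Rightarrow> real^'n \<Rightarrow> real" where
  "pd i h x = deriv (\<lambda>s. h (x + s *\<^sub>R axis i 1)) 0"

definition pd2 :: "'n::finite \<Rightarrow> 'n \<Rightarrow> (real^'n \<Rightarrow> real) \<Rightarrow> real^'n \<Rightarrow> real" where
  "pd2 i j h = pd i (pd j h)"

definition abs_cont_on :: "real \<Rightarrow> real \<Rightarrow> (real \<Rightarrow> real) \<Rightarrow> bool" where
  "abs_cont_on b c h \<longleftrightarrow>
     (\<forall>\<epsilon>>0. \<exists>\<delta>>0. \<forall>(N::nat) l r.
        (\<forall>k<N. b \<le> l k \<and> l k \<le> r k \<and> r k \<le> c) \<longrightarrow>
        (\<forall>k<N. \<forall>m<N. k \<noteq> m \<longrightarrow> {l k<..<r k} \<inter> {l m<..<r m} = {}) \<longrightarrow>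
        (\<Sum>k<N. r k - l k) < \<delta> \<longrightarrow>
        (\<Sum>k<N. \<bar>h (r k) - h (l k)\<bar>) < \<epsilon>)"

definition admissible_coeff :: "real \<Rightarrow> (real \<Rightarrow> real^'n^'n) \<Rightarrow> bool" where
  "admissible_coeff \<Lambda> a \<longleftrightarrow>
     bounded (range a) \<and> a \<in> borel_measurable lebesgue \<and> (\<forall>t. transpose (a t) = a t) \<and>
     (AE t in lebesgue. \<forall>\<xi>.
        \<Lambda> * (norm \<xi>)\<^sup>2 \<le> (\<Sum>i\<in>UNIV. \<Sum>j\<in>UNIV. a t $ i $ j * \<xi> $ i * \<xi> $ j) \<and>
        (\<Sum>i\<in>UNIV. \<Sum>j\<in>UNIV. a t $ i $ j * \<xi> $ i * \<xi> $ j) \<le> inverse \<Lambda> * (norm \<xi>)\<^sup>2)"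

definition A_mat :: "(real \<Rightarrow> real^'n^'n) \<Rightarrow> real \<Rightarrow> real \<Rightarrow> real^'n^'n" where
  "A_mat a t \<tau> = (LINT r:{t - \<tau>..t}|lebesgue. a r)"

definition B_mat :: "(real \<Rightarrow> real^'n^'n) \<Rightarrow> real \<Rightarrow> real \<Rightarrow> real^'n^'n" where
  "B_mat a t \<tau> = matrix_inv (A_mat a t \<tau>)"

definition heat_kernel :: "(real \<Rightarrow> real^'n^'n) \<Rightarrow> real \<Rightarrow> real \<Rightarrow> real^'n \<Rightarrow> real" where
  "heat_kernel a t \<tau> x =
     (if 0 < \<tau>
      then exp (- \<tau>) *
           (exp (- (1/4) * ((B_mat a t \<tau> *v x) \<bullet> x)) /
            ((4 * pi) powr (real CARD('n) / 2) * det (B_mat a t \<tau>) powr (- 1/2)))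
      else 0)"

text \<open>\<open>(\<partial>\<^sub>t + \<partial>\<^sub>\<tau>)\<close> applied to the kernel, as the sum of the two partial derivatives.\<close>

definition heat_kernel_dt_dtau :: "(real \<Rightarrow> real^'n^'n) \<Rightarrow> real \<Rightarrow> real \<Rightarrow> real^'n \<Rightarrow> real" where
  "heat_kernel_dt_dtau a t \<tau> z =
     deriv (\<lambda>s. heat_kernel a s \<tau> z) t + deriv (\<lambda>s. heat_kernel a t s z) \<tau>"

definition heat_potential ::
  "(real \<Rightarrow> real^'n^'n) \<Rightarrow> (real \<times> (real^'n) \<Rightarrow> real) \<Rightarrow> (real^'n \<Rightarrow> real) \<Rightarrow> real \<times> (real^'n) \<Rightarrow> real" where
  "heat_potential a f g = (\<lambda>(t, x).
     (LINT \<tau>:{0<..<t}|lebesgue. LINT y|lebesgue. heat_kernel a t \<tau> y * f (t - \<tau>, x - y)) +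
     (LINT y|lebesgue. heat_kernel a t t y * g (x - y)))"

text \<open>Absolute convergence of the integrals defining \<^const>\<open>heat_potential\<close> at \<open>(t, x)\<close>; Bochner
  integrals that do not converge have the default value 0.\<close>

definition heat_potential_converges ::
  "(real \<Rightarrow> real^'n^'n) \<Rightarrow> (real \<times> (real^'n) \<Rightarrow> real) \<Rightarrow> (real^'n \<Rightarrow> real) \<Rightarrow> real \<Rightarrow> real^'n \<Rightarrow> bool" where
  "heat_potential_converges a f g t x \<longleftrightarrow>
     set_integrable lebesgue ({0<..<t} \<times> UNIV) (\<lambda>(\<tau>, y). heat_kernel a t \<tau> y * f (t - \<tau>, x - y)) \<and>
     integrable lebesgue (\<lambda>y. heat_kernel a t t y * g (x - y))"

text \<open>The exceptional null set of times in the equation does not depend on \<open>x\<close>.\<close>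

definition bounded_classical_solution ::
  "(real \<Rightarrow> real^'n^'n) \<Rightarrow> (real \<times> (real^'n) \<Rightarrow> real) \<Rightarrow> (real^'n \<Rightarrow> real) \<Rightarrow>
   (real \<times> (real^'n) \<Rightarrow> real) \<Rightarrow> bool" where
  "bounded_classical_solution a f g u \<longleftrightarrow>
     bounded (u ` ({0..} \<times> UNIV)) \<and>
     continuous_on ({0..} \<times> UNIV) u \<and>
     (\<forall>x. u (0, x) = g x) \<and>
     (\<forall>i. (\<forall>(t, x)\<in>half_space. pdiff i (\<lambda>y. u (t, y)) x) \<and>
          continuous_on half_space (\<lambda>(t, x). pd i (\<lambda>y. u (t, y)) x)) \<and>
     (\<forall>i j. (\<forall>(t, x)\<in>half_space. pdiff i (pd j (\<lambda>y. u (t, y))) x) \<and>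
          continuous_on half_space (\<lambda>(t, x). pd2 i j (\<lambda>y. u (t, y)) x)) \<and>
     (\<forall>x b c. 0 < b \<and> b \<le> c \<longrightarrow> abs_cont_on b c (\<lambda>t. u (t, x))) \<and>
     (AE t in lebesgue. 0 < t \<longrightarrow> (\<forall>x.
        (\<lambda>s. u (s, x)) differentiable (at t) \<and>
        deriv (\<lambda>s. u (s, x)) t
          - (\<Sum>i\<in>UNIV. \<Sum>j\<in>UNIV. a t $ i $ j * pd2 i j (\<lambda>y. u (t, y)) x)
          + u (t, x) = f (t, x)))"

text \<open>The integrals and the time derivatives of the kernel that occur in the limit formulas for
  \<open>\<partial>\<^sub>i\<^sub>j v(t, x)\<close> and \<open>\<partial>\<^sub>t v(t, x)\<close> exist.\<close>

definition space_formula_terms_exist ::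
  "(real \<Rightarrow> real^'n^'n) \<Rightarrow> (real \<times> (real^'n) \<Rightarrow> real) \<Rightarrow> (real^'n \<Rightarrow> real) \<Rightarrow>
   'n \<Rightarrow> 'n \<Rightarrow> real \<Rightarrow> real^'n \<Rightarrow> bool" where
  "space_formula_terms_exist a f g i j t x \<longleftrightarrow>
     (\<forall>\<epsilon>\<in>{0<..<t}. set_integrable lebesgue ({\<epsilon><..<t} \<times> UNIV)
        (\<lambda>(\<tau>, y). pd2 i j (heat_kernel a t \<tau>) (x - y) * f (t - \<tau>, y))) \<and>
     integrable lebesgue (\<lambda>y. pd2 i j (heat_kernel a t t) y * g (x - y))"

definition time_formula_terms_exist ::
  "(real \<Rightarrow> real^'n^'n) \<Rightarrow> (real \<times> (real^'n) \<Rightarrow> real) \<Rightarrow> (real^'n \<Rightarrow> real) \<Rightarrow>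
   real \<Rightarrow> real^'n \<Rightarrow> bool" where
  "time_formula_terms_exist a f g t x \<longleftrightarrow>
     (AE \<tau> in lebesgue. \<tau> \<in> {0<..<t} \<longrightarrow>
        (\<forall>z. (\<lambda>s. heat_kernel a s \<tau> z) differentiable (at t) \<and>
             (\<lambda>s. heat_kernel a t s z) differentiable (at \<tau>))) \<and>
     (\<forall>z. (\<lambda>s. heat_kernel a s s z) differentiable (at t)) \<and>
     (\<forall>\<epsilon>\<in>{0<..<t}. set_integrable lebesgue ({\<epsilon><..<t} \<times> UNIV)
        (\<lambda>(\<tau>, y). heat_kernel_dt_dtau a t \<tau> (x - y) * f (t - \<tau>, y))) \<and>
     integrable lebesgue (\<lambda>y. deriv (\<lambda>s. heat_kernel a s s y) t * g (x - y))"

end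

theory Submission
  imports Defs "HOL-Probability.Distributions"
begin

text \<open>
  Up to the factor \<open>exp (- \<tau>)\<close>, the kernel is the Gaussian density with covariance \<open>2 A(t,\<tau>)\<close>, and
  the derivative of this density in a direction \<open>H\<close> of the space of matrices is \<open>H\<close> contracted with
  its spatial Hessian. As \<open>a\<close> is only measurable, this is used in integrated form: along the
  Lipschitz paths \<open>t \<mapsto> A(t,\<tau>)\<close> the fundamental theorem of calculus gives \<open>v(t,x)\<close> as the integral
  over \<open>(0,t)\<close> of a bounded function of time, which is the time derivative of \<open>v\<close> wherever \<open>a\<close> is
  the derivative of its primitive. Space derivatives are moved between the kernel and the data by
  integration by parts.

  Uniqueness is a maximum principle with the barrier \<open>\<epsilon> (\<bar>x\<bar>\<^sup>2 + K t)\<close>. Since the equation holds only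
  for almost every time, the contradiction at a maximum comes from the increment of the difference
  of the two solutions over a short time interval, which absolute continuity controls.

  For fixed \<open>(t,x)\<close> the two kernels in the definition of \<open>v\<close> have total mass
  \<open>(1 - exp (- t)) + exp (- t) = 1\<close>. Jensen's inequality applied to both at once, followed by
  integration over \<open>(t,x)\<close>, shows that the \<open>p\<close>-th power of the norm of \<open>v\<close> is at most the sum of
  the \<open>p\<close>-th powers of the norms of \<open>f\<close> and \<open>g\<close>.
\<close>

section \<open>Elliptic matrices\<close>

text \<open>The obstacle is the singularity at \<tau> = 0: the spatial Hessian of the kernel has
  mass of order 1 / \<tau>, so it cannot be integrated against bounded data. Potentials are
  therefore built from the undifferentiated kernel. The source is extended by zero to nonpositive
  times, so that all lags can be integrated over, and is then sliced by its emission time: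
  \<open>duhamel\<close> is the integral over s of \<open>flow s t\<close>, applied to the slice at
  time s. A single slice is differentiated in time away from the singularity, integrated by parts
  there, and only then followed back to time s, where \<open>flow_limit\<close> supplies the initial
  value.

  The exceptional set of times in the equation must not depend on x. For this reason the rate is
  written as a continuous function of time paired with \<open>a\<close>: its primitive is then
  differentiable wherever the primitive of \<open>a\<close> has derivative \<open>a t\<close>. Since
  the kernel sees \<open>a\<close> only through integrals, \<open>a\<close> may be changed on a null
  set, and the argument works with a Borel version that is elliptic at every time.\<close>

definition posdef :: "real^'n^'n \<Rightarrow> bool" where
  "posdef A \<longleftrightarrow> transpose A = A \<and> (\<forall>x. x \<noteq> 0 \<longrightarrow> 0 < (A *v x) \<bullet> x)"

definition elliptic :: "real \<Rightarrow> real \<Rightarrow> real^'n^'n \<Rightarrow> bool" where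
  "elliptic c C A \<longleftrightarrow> 0 < c \<and> transpose A = A \<and>
     (\<forall>x. c * (norm x)\<^sup>2 \<le> (A *v x) \<bullet> x \<and> (A *v x) \<bullet> x \<le> C * (norm x)\<^sup>2)"

lemma inner_matrix_vector_eq_sum:
  fixes A :: "real^'n^'n"
  shows "(A *v x) \<bullet> y = (\<Sum>i\<in>UNIV. \<Sum>j\<in>UNIV. A $ i $ j * y $ i * x $ j)"
  by (simp add: inner_vec_def matrix_vector_mult_def sum_distrib_left sum_distrib_right mult_ac)

lemma inner_matrix_eq_sum:
  fixes A :: "real^'n^'m"
  shows "A \<bullet> B = (\<Sum>i\<in>UNIV. \<Sum>j\<in>UNIV. A $ i $ j * B $ i $ j)"
  by (simp add: inner_vec_def)

lemma inner_symmetric_matrix: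
  fixes A :: "real^'n^'n"
  assumes "transpose A = A"
  shows "(A *v x) \<bullet> y = x \<bullet> (A *v y)"
  by (metis assms dot_lmul_matrix vector_transpose_matrix)

lemma elliptic_pos:
  fixes A :: "real^'n^'n"
  assumes "elliptic c C A"
  shows "0 < c" "c \<le> C" "0 < C" "transpose A = A"
proof -
  \<comment> \<open>Index types are inhabited, so some unit vector exists; it compares the two
    constants.\<close>
  have "c * (norm (axis undefined 1 :: real^'n))\<^sup>2 \<le> C * (norm (axis undefined 1 :: real^'n))\<^sup>2"
    using assms unfolding elliptic_def by (meson order_trans)
  then show "c \<le> C" by simp
  show "0 < c" "transpose A = A" using assms by (auto simp: elliptic_def)
  with \<open>c \<le> C\<close> show "0 < C" by simp
qed

lemma elliptic_imp_posdef: "elliptic c C A \<Longrightarrow> posdef A"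
  unfolding elliptic_def posdef_def
  by (metis less_le_trans mult_pos_pos zero_less_norm_iff zero_less_power)

lemma posdef_inverse:
  fixes A :: "real^'n^'n"
  assumes "posdef A"
  shows "A ** matrix_inv A = mat 1" "matrix_inv A ** A = mat 1" "det A \<noteq> 0"
    "transpose (matrix_inv A) = matrix_inv A" "posdef (matrix_inv A)"
proof -
  have "\<forall>x. A *v x = 0 \<longrightarrow> x = 0"
    using assms unfolding posdef_def by force
  then have inv: "invertible A"
    using matrix_left_invertible_ker invertible_left_inverse by blast
  then show i: "A ** matrix_inv A = mat 1" "matrix_inv A ** A = mat 1"
    unfolding invertible_def matrix_inv_def by (metis (mono_tags, lifting) someI_ex)+
  show "det A \<noteq> 0" using inv invertible_det_nz by blast
  have "transpose (matrix_inv A) ** A = mat 1"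
    using i(1) assms by (metis matrix_transpose_mul posdef_def transpose_mat)
  then show s: "transpose (matrix_inv A) = matrix_inv A"
    using i(1) by (metis matrix_mul_assoc matrix_mul_lid matrix_mul_rid)
  have "0 < (matrix_inv A *v x) \<bullet> x" if "x \<noteq> 0" for x
  proof -
    have x: "A *v (matrix_inv A *v x) = x"
      by (simp add: matrix_vector_mul_assoc i)
    then have "matrix_inv A *v x \<noteq> 0" using that by force
    then have "0 < (A *v (matrix_inv A *v x)) \<bullet> (matrix_inv A *v x)"
      using assms unfolding posdef_def by blast
    with x show ?thesis by (simp add: inner_commute)
  qed
  with s show "posdef (matrix_inv A)" by (simp add: posdef_def)
qed

lemma posdef_Cauchy_Schwarz:
  fixes A :: "real^'n^'n"
  assumes "posdef A"
  shows "((A *v x) \<bullet> y)\<^sup>2 \<le> ((A *v x) \<bullet> x) * ((A *v y) \<bullet> y)"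
proof (cases "y = 0")
  case False
  define b where "b = (A *v y) \<bullet> y"
  have b: "b > 0" using assms False unfolding posdef_def b_def by blast
  \<comment> \<open>The minimiser of the quadratic form of A along the line x - s y.\<close>
  define s where "s = ((A *v x) \<bullet> y) / b"
  have nn: "0 \<le> (A *v z) \<bullet> z" for z
    using assms unfolding posdef_def by (cases "z = 0") (auto intro: less_imp_le)
  have sym: "(A *v y) \<bullet> x = (A *v x) \<bullet> y"
    using assms inner_symmetric_matrix[of A] by (metis inner_commute posdef_def)
  have "0 \<le> (A *v (x - s *\<^sub>R y)) \<bullet> (x - s *\<^sub>R y)" by (rule nn)
  also have "\<dots> = (A *v x) \<bullet> x - 2 * s * ((A *v x) \<bullet> y) + s\<^sup>2 * b"
    by (simp add: matrix_vector_mult_diff_distrib matrix_vector_mult_scaleR inner_diff_left inner_diff_right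
        sym b_def power2_eq_square algebra_simps)
  also have "\<dots> = (A *v x) \<bullet> x - ((A *v x) \<bullet> y)\<^sup>2 / b"
    using b by (simp add: s_def power2_eq_square field_simps)
  finally show ?thesis using b unfolding b_def by (simp add: field_simps)
qed simp

text \<open>Cauchy-Schwarz for the form of A, applied to x and A x, bounds the fourth power of the
  norm of A x by <A x, x> times <A (A x), A x>. Cancelling one square of the norm gives the second
  bound, and the third follows from it.\<close>

lemma elliptic_norm_bounds:
  fixes A :: "real^'n^'n"
  assumes "elliptic c C A"
  shows "c * norm x \<le> norm (A *v x)" "(norm (A *v x))\<^sup>2 \<le> C * ((A *v x) \<bullet> x)" "norm (A *v x) \<le> C * norm x"
proof -
  note p = elliptic_pos[OF assms]
  have l: "c * (norm z)\<^sup>2 \<le> (A *v z) \<bullet> z" and u: "(A *v z) \<bullet> z \<le> C * (norm z)\<^sup>2" for z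
    using assms unfolding elliptic_def by blast+
  have "c * (norm x)\<^sup>2 \<le> norm (A *v x) * norm x"
    using l norm_cauchy_schwarz order_trans by blast
  then show "c * norm x \<le> norm (A *v x)"
    by (cases "x = 0") (auto simp: power2_eq_square)
  show *: "(norm (A *v x))\<^sup>2 \<le> C * ((A *v x) \<bullet> x)"
  proof (cases "A *v x = 0")
    case False
    have nn: "0 \<le> (A *v x) \<bullet> x" using l[of x] p by (smt (verit) mult_nonneg_nonneg zero_le_power2)
    have "((norm (A *v x))\<^sup>2)\<^sup>2 \<le> ((A *v x) \<bullet> x) * ((A *v (A *v x)) \<bullet> (A *v x))"
      using posdef_Cauchy_Schwarz[OF elliptic_imp_posdef[OF assms], of x "A *v x"] by (simp add: power2_norm_eq_inner)
    also have "\<dots> \<le> ((A *v x) \<bullet> x) * (C * (norm (A *v x))\<^sup>2)"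
      by (rule mult_left_mono[OF u nn])
    finally have "(norm (A *v x))\<^sup>2 * (norm (A *v x))\<^sup>2 \<le> (C * ((A *v x) \<bullet> x)) * (norm (A *v x))\<^sup>2"
      by (simp add: power2_eq_square mult_ac)
    then show ?thesis by (rule mult_right_le_imp_le) (use False in simp)
  qed simp
  have "(norm (A *v x))\<^sup>2 \<le> C * (C * (norm x)\<^sup>2)"
    using * u[of x] p by (meson less_imp_le mult_left_mono order_trans)
  also have "\<dots> = (C * norm x)\<^sup>2" by (simp add: power2_eq_square)
  finally show "norm (A *v x) \<le> C * norm x"
    by (rule power2_le_imp_le) (use p in simp)
qed

text \<open>Put x = A y in the norm bounds of A: they turn into bounds for the inverse with the
  reciprocal constants exchanged.\<close>

lemma elliptic_inverse:
  fixes A :: "real^'n^'n"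
  assumes "elliptic c C A"
  shows "elliptic (1 / C) (1 / c) (matrix_inv A)"
proof -
  note p = elliptic_pos[OF assms] and i = posdef_inverse[OF elliptic_imp_posdef[OF assms]]
  {
    fix x
    define y where "y = matrix_inv A *v x"
    have x: "A *v y = x" by (simp add: y_def matrix_vector_mul_assoc i)
    have "(norm x)\<^sup>2 \<le> C * (y \<bullet> x)" using elliptic_norm_bounds(2)[OF assms, of y] x by (simp add: inner_commute)
    then have 1: "1 / C * (norm x)\<^sup>2 \<le> y \<bullet> x" using p by (simp add: field_simps)
    have "c * norm y \<le> norm x" using elliptic_norm_bounds(1)[OF assms, of y] by (simp add: x)
    then have "norm y \<le> norm x / c" using p by (simp add: field_simps)
    then have "y \<bullet> x \<le> norm x / c * norm x" using norm_cauchy_schwarz[of y x] by (smt (verit) mult_right_mono norm_ge_zero)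
    then have "y \<bullet> x \<le> 1 / c * (norm x)\<^sup>2" by (simp add: power2_eq_square)
    with 1 have "1 / C * (norm x)\<^sup>2 \<le> y \<bullet> x \<and> y \<bullet> x \<le> 1 / c * (norm x)\<^sup>2" by blast
  }
  then show ?thesis using i p unfolding elliptic_def by auto
qed

text \<open>Gram-Schmidt in the inner product of the inverse matrix B yields vectors v that are
  orthonormal for B; with these as columns P satisfies transpose P B P = 1, that is A = P transpose
  P. This factorisation replaces the spectral theorem: it gives the sign of the determinant and of
  the contraction of A with a semidefinite matrix.\<close>

lemma posdef_factor:
  fixes A :: "real^'n^'n"
  assumes "posdef A"
  obtains P :: "real^'n^'n" where "A = P ** transpose P"
proof -
  define B where "B = matrix_inv A"
  note i = posdef_inverse[OF assms, folded B_def]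
  have "\<exists>v. \<forall>i\<in>S. \<forall>j\<in>S. (B *v v i) \<bullet> v j = (if i = j then 1 else 0)" for S :: "'n set"
  proof (induction S rule: finite_induct[OF finite])
    case 1
    then show ?case by simp
  next
    case (2 k S)
    then obtain v where v: "\<And>i j. i \<in> S \<Longrightarrow> j \<in> S \<Longrightarrow> (B *v v i) \<bullet> v j = (if i = j then 1 else 0)" by blast
    \<comment> \<open>Fewer than CARD('n) vectors B v i do not span the space, so some nonzero w is
      orthogonal to all of them. Normalised for the form of B, it extends the family.\<close>
    have "dim ((\<lambda>i. B *v v i) ` S) \<le> card ((\<lambda>i. B *v v i) ` S)" by (rule dim_le_card') simp
    also have "\<dots> \<le> card S" by (rule card_image_le) simp
    also have "\<dots> < CARD('n)" using 2 by (intro psubset_card_mono) auto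
    finally obtain w where w: "w \<noteq> 0" "\<And>y. y \<in> span ((\<lambda>i. B *v v i) ` S) \<Longrightarrow> orthogonal w y"
      by (metis DIM_cart DIM_real mult.right_neutral orthogonal_to_subspace_exists)
    define q where "q = (B *v w) \<bullet> w"
    have q: "q > 0" using i(5) w(1) unfolding posdef_def q_def by blast
    define u where "u = (1 / sqrt q) *\<^sub>R w"
    have "w \<bullet> (B *v v i) = 0" if "i \<in> S" for i
      using w(2)[of "B *v v i"] that by (auto simp: orthogonal_def span_base)
    then have uv1: "(B *v v i) \<bullet> u = 0" if "i \<in> S" for i
      using that by (simp add: u_def inner_commute)
    have uv2: "(B *v u) \<bullet> v i = 0" if "i \<in> S" for i
      using uv1[OF that] inner_symmetric_matrix[OF i(4), of u "v i"] by (simp add: inner_commute)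
    note uv = uv1 uv2
    have "(B *v u) \<bullet> u = q / (sqrt q * sqrt q)" by (simp add: u_def matrix_vector_mult_scaleR q_def)
    then have uu: "(B *v u) \<bullet> u = 1" using q by simp
    show ?case
      by (rule exI[of _ "v(k := u)"]) (use v uv uu 2 in auto)
  qed
  from this[of UNIV] have "\<exists>v. \<forall>(i::'n) j. (B *v v i) \<bullet> v j = (if i = j then 1 else 0)"
    by (simp only: ball_UNIV)
  then obtain v where v0: "\<forall>(i::'n) j. (B *v v i) \<bullet> v j = (if i = j then 1 else 0)" ..
  note v = v0[rule_format]
  define P where "P = (\<chi> i j. v j $ i)"
  have "(transpose P ** B) ** P = mat 1"
  proof -
    have "((transpose P ** B) ** P) $ i $ j = (B *v v j) \<bullet> v i" for i j
      unfolding matrix_mul_assoc[symmetric]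
      by (simp add: matrix_matrix_mult_def transpose_def P_def inner_vec_def matrix_vector_mult_def mult_ac)
    then show ?thesis by (simp add: vec_eq_iff v mat_def)
  qed
  then have "(P ** transpose P) ** B = mat 1"
    by (metis matrix_left_right_inverse matrix_mul_assoc)
  then have "P ** transpose P = A"
    using i(2) by (metis matrix_left_right_inverse matrix_mul_assoc matrix_mul_lid matrix_mul_rid)
  then show ?thesis using that[of P] by simp
qed

lemma posdef_det_pos:
  fixes A :: "real^'n^'n"
  assumes "posdef A" shows "0 < det A"
proof -
  obtain P :: "real^'n^'n" where "A = P ** transpose P" using posdef_factor assms by blast
  then have "det A = det P * det P" by (simp add: det_mul)
  with posdef_inverse(3)[OF assms] show ?thesis
    by (metis mult_eq_0_iff not_real_square_gt_zero)
qed

text \<open>With A = P transpose P the contraction is the sum of the quadratic form of M over the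
  columns of P. The maximum principle uses this to give a sign to the second order term.\<close>

lemma posdef_inner_nonpos:
  fixes A M :: "real^'n^'n"
  assumes "posdef A" and M: "\<And>x. (M *v x) \<bullet> x \<le> 0"
  shows "A \<bullet> M \<le> 0"
proof -
  obtain P :: "real^'n^'n" where P: "A = P ** transpose P" using posdef_factor assms by blast
  have "A \<bullet> M = (\<Sum>i\<in>UNIV. \<Sum>j\<in>UNIV. \<Sum>k\<in>UNIV. M $ i $ j * P $ i $ k * P $ j $ k)"
  proof -
    have "A $ i $ j * M $ i $ j = (\<Sum>k\<in>UNIV. M $ i $ j * P $ i $ k * P $ j $ k)" for i j
      unfolding P by (simp add: matrix_matrix_mult_def transpose_def sum_distrib_left mult_ac)
    then show ?thesis by (simp only: inner_matrix_eq_sum)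
  qed
  also have "\<dots> = (\<Sum>i\<in>UNIV. \<Sum>k\<in>UNIV. \<Sum>j\<in>UNIV. M $ i $ j * P $ i $ k * P $ j $ k)"
    by (rule sum.cong[OF refl]) (rule sum.swap)
  also have "\<dots> = (\<Sum>k\<in>UNIV. \<Sum>i\<in>UNIV. \<Sum>j\<in>UNIV. M $ i $ j * P $ i $ k * P $ j $ k)"
    by (rule sum.swap)
  also have "\<dots> = (\<Sum>k\<in>UNIV. (M *v column k P) \<bullet> column k P)"
    by (simp add: inner_matrix_vector_eq_sum column_def)
  also have "\<dots> \<le> 0" by (intro sum_nonpos M)
  finally show ?thesis .
qed

text \<open>In the Leibniz expansion a permutation other than the identity moves at least two
  points. After one factor has been differentiated, an off-diagonal zero of the identity matrix
  remains, so only the trace survives.\<close>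

lemma det_has_derivative_id:
  "(det has_derivative (\<lambda>H::real^'n^'n. trace H)) (at (mat 1))"
proof -
  have "((\<lambda>A::real^'n^'n. \<Sum>p\<in>{p. p permutes UNIV}. of_int (sign p) * (\<Prod>i\<in>UNIV. A $ i $ p i)) has_derivative
     (\<lambda>H. \<Sum>p\<in>{p. p permutes UNIV}. of_int (sign p) * (\<Sum>i\<in>UNIV. H $ i $ p i * (\<Prod>j\<in>UNIV - {i}. (mat 1 :: real^'n^'n) $ j $ p j)))) (at (mat 1))"
    by (intro has_derivative_sum has_derivative_mult_right has_derivative_prod
        bounded_linear.has_derivative[OF bounded_linear_vec_nth] has_derivative_ident)
  moreover have "(\<Sum>p\<in>{p. p permutes UNIV}. of_int (sign p) * (\<Sum>i\<in>UNIV. H $ i $ p i * (\<Prod>j\<in>UNIV - {i}. (mat 1 :: real^'n^'n) $ j $ p j))) = trace H"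
    for H :: "real^'n^'n"
  proof -
    have z: "(\<Prod>j\<in>UNIV - {i}. (mat 1 :: real^'n^'n) $ j $ p j) = 0" if p: "p permutes UNIV" "p \<noteq> id" for p i
    proof -
      have "\<exists>j. j \<noteq> i \<and> p j \<noteq> j"
      proof (rule ccontr)
        assume "\<not> ?thesis"
        then have f: "p j = j" if "j \<noteq> i" for j using that by blast
        then have "p i = i" using p(1) by (metis permutes_def)
        with f have "p = id" by (metis eq_id_iff)
        with p show False by simp
      qed
      then obtain j where "j \<noteq> i" "p j \<noteq> j" by blast
      then show ?thesis by (intro prod_zero) (auto intro!: bexI[of _ j] simp: mat_def)
    qed
    have "(\<Sum>p\<in>{p. p permutes UNIV}. of_int (sign p) * (\<Sum>i\<in>UNIV. H $ i $ p i * (\<Prod>j\<in>UNIV - {i}. (mat 1 :: real^'n^'n) $ j $ p j)))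
      = (\<Sum>p\<in>{id}. of_int (sign p) * (\<Sum>i\<in>UNIV. H $ i $ p i * (\<Prod>j\<in>UNIV - {i}. (mat 1 :: real^'n^'n) $ j $ p j)))"
      by (rule sum.mono_neutral_right) (auto simp: permutes_id z)
    also have "\<dots> = trace H" by (simp add: trace_def mat_def sign_id)
    finally show ?thesis .
  qed
  ultimately show ?thesis by (simp add: det_def[abs_def])
qed

lemma bounded_linear_matrix_mult_left: "bounded_linear (\<lambda>H. (B::real^'n^'n) ** H)"
  by (intro linear_conv_bounded_linear[THEN iffD1] linearI)
     (simp_all add: matrix_add_ldistrib matrix_scalar_ac scalar_matrix_assoc vec_eq_iff matrix_matrix_mult_def sum_distrib_left sum.distrib distrib_left mult_ac)

text \<open>Jacobi's formula, carried from the identity to A by det X = det A * det (B X) with B the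
  inverse of A. The symmetry of B turns the trace of B H into an inner product.\<close>

lemma det_has_derivative:
  fixes A :: "real^'n^'n"
  assumes "posdef A"
  shows "(det has_derivative (\<lambda>H. det A * (matrix_inv A \<bullet> H))) (at A within S)"
proof -
  note i = posdef_inverse[OF assms]
  define B where "B = matrix_inv A"
  have e: "det X = det A * det (B ** X)" for X
    using i(1) by (metis B_def det_I det_mul mult.assoc mult.left_neutral)
  have "((\<lambda>X. det (B ** X)) has_derivative (\<lambda>H. trace (B ** H))) (at A)"
    by (rule has_derivative_compose[of "\<lambda>X. B ** X" "\<lambda>H. B ** H" A UNIV det trace])
       (use i det_has_derivative_id bounded_linear_imp_has_derivative[OF bounded_linear_matrix_mult_left[of B]] in \<open>auto simp: B_def\<close>)
  then have "((\<lambda>X. det A * det (B ** X)) has_derivative (\<lambda>H. det A * trace (B ** H))) (at A)"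
    by (rule has_derivative_mult_right)
  moreover have "trace (B ** H) = B \<bullet> H" for H
  proof -
    have "B $ i $ j = B $ j $ i" for i j using i(4) by (metis B_def transpose_def vec_lambda_beta)
    then show ?thesis
      unfolding trace_def inner_matrix_eq_sum by (subst sum.swap) (simp add: matrix_matrix_mult_def)
  qed
  ultimately show ?thesis
    using e by (metis (no_types, lifting) B_def ext has_derivative_at_withinI)
qed

lemma continuous_on_det[continuous_intros]:
  fixes A :: "'a::topological_space \<Rightarrow> real^'n^'n"
  assumes "continuous_on S A"
  shows "continuous_on S (\<lambda>x. det (A x))"
  unfolding det_def by (intro continuous_intros assms)

text \<open>Cramer's rule; it exhibits the entries of the inverse as quotients of determinants,
  hence as continuous functions of A.\<close>

lemma matrix_inv_nth:
  fixes A :: "real^'n^'n"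
  assumes "posdef A"
  shows "matrix_inv A $ k $ l = det (\<chi> i j. if j = k then mat 1 $ i $ l else A $ i $ j) / det A"
proof -
  note i = posdef_inverse[OF assms]
  have "A *v column l (matrix_inv A) = column l (A ** matrix_inv A)"
    by (simp add: vec_eq_iff column_def matrix_matrix_mult_def matrix_vector_mult_def)
  then have "A *v column l (matrix_inv A) = column l (mat 1)"
    by (simp add: i)
  then have "column l (matrix_inv A) = (\<chi> k. det (\<chi> i j. if j = k then column l (mat 1) $ i else A $ i $ j) / det A)"
    using cramer[OF i(3)] by blast
  then have "column l (matrix_inv A) $ k = det (\<chi> i j. if j = k then column l (mat 1) $ i else A $ i $ j) / det A"
    by simp
  moreover have "column l (mat 1 :: real^'n^'n) $ i = mat 1 $ i $ l" for i by (simp add: column_def)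
  ultimately show ?thesis by (simp add: column_def cong: if_cong)
qed

lemma continuous_on_matrix_inv:
  fixes A :: "'a::topological_space \<Rightarrow> real^'n^'n"
  assumes "continuous_on S A" "\<And>x. x \<in> S \<Longrightarrow> posdef (A x)"
  shows "continuous_on S (\<lambda>x. matrix_inv (A x))"
proof -
  have c: "continuous_on S (\<lambda>x. if j = k then (mat 1 :: real^'n^'n) $ i $ l else A x $ i $ j)" for i j k l
    by (cases "j = k") (auto intro!: continuous_intros assms)
  have "continuous_on S (\<lambda>x. \<chi> k l. det (\<chi> i j. if j = k then mat 1 $ i $ l else A x $ i $ j) / det (A x))"
    by (intro continuous_intros c assms) (use assms(2) posdef_inverse(3) in blast)
  then show ?thesis
    by (rule continuous_on_eq) (auto simp: vec_eq_iff matrix_inv_nth assms(2))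
qed

section \<open>Gaussians and their derivatives\<close>

text \<open>Existence and value of a partial derivative at all points in one relation;
  \<open>has_pd_imp_pd\<close> returns to \<open>pd\<close> and \<open>pdiff\<close>.\<close>

definition has_pd :: "'n::finite \<Rightarrow> (real^'n \<Rightarrow> real) \<Rightarrow> (real^'n \<Rightarrow> real) \<Rightarrow> bool" where
  "has_pd i h h' \<longleftrightarrow> (\<forall>x. ((\<lambda>s. h (x + s *\<^sub>R axis i 1)) has_real_derivative h' x) (at 0))"

lemma has_pd_imp_pd:
  assumes "has_pd i h h'"
  shows "pd i h = h'" "pdiff i h x"
  using assms unfolding has_pd_def pd_def pdiff_def
  by (auto simp: fun_eq_iff real_differentiable_def intro: DERIV_imp_deriv)

lemma has_pd_line:
  assumes "has_pd i h h'"
  shows "((\<lambda>s. h (x + s *\<^sub>R axis i 1)) has_real_derivative h' (x + s *\<^sub>R axis i 1)) (at s)"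
proof -
  have "((\<lambda>r. h ((x + s *\<^sub>R axis i 1) + r *\<^sub>R axis i 1)) has_real_derivative h' (x + s *\<^sub>R axis i 1)) (at 0)"
    using assms unfolding has_pd_def by blast
  then have "((\<lambda>r. h (x + (r + s) *\<^sub>R axis i 1)) has_real_derivative h' (x + s *\<^sub>R axis i 1)) (at 0)"
    by (simp add: algebra_simps)
  then show ?thesis
    using DERIV_shift[of "\<lambda>r. h (x + r *\<^sub>R axis i 1)" "h' (x + s *\<^sub>R axis i 1)" 0 s] by (simp add: add.commute)
qed

definition outer :: "real^'n \<Rightarrow> real^'m \<Rightarrow> real^'m^'n" where
  "outer z y = (\<chi> i j. z $ i * y $ j)"

lemma inner_matrix_vector_eq_outer: "((A :: real^'n^'n) *v y) \<bullet> z = A \<bullet> outer z y"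
  by (simp add: inner_matrix_vector_eq_sum inner_matrix_eq_sum outer_def mult.assoc)

lemma continuous_on_matrix_vector_mult[continuous_intros]:
  fixes A :: "'a::topological_space \<Rightarrow> real^'n^'n"
  assumes "continuous_on S A" "continuous_on S x"
  shows "continuous_on S (\<lambda>z. A z *v x z)"
  unfolding matrix_vector_mult_def by (intro continuous_intros assms)

lemma continuous_on_outer[continuous_intros]:
  assumes "continuous_on S x" "continuous_on S y"
  shows "continuous_on S (\<lambda>z. outer (x z) (y z))"
  unfolding outer_def by (intro continuous_intros assms)

definition gauss :: "real^'n^'n \<Rightarrow> real^'n \<Rightarrow> real" where
  "gauss A x = exp (- (1/4) * ((matrix_inv A *v x) \<bullet> x)) /
     ((4 * pi) powr (real CARD('n) / 2) * det (matrix_inv A) powr (- 1/2))"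

text \<open>One formula in two roles: \<open>gauss_pd\<close> identifies it with the Hessian in x,
  and \<open>gauss_has_derivative\<close> with the gradient in A.\<close>

definition gauss_hess :: "real^'n^'n \<Rightarrow> real^'n \<Rightarrow> real^'n^'n" where
  "gauss_hess A x = gauss A x *\<^sub>R
     ((1/4) *\<^sub>R outer (matrix_inv A *v x) (matrix_inv A *v x) - (1/2) *\<^sub>R matrix_inv A)"

lemma gauss_nonneg: "0 \<le> gauss A x"
  by (simp add: gauss_def)

lemma det_matrix_inv:
  fixes A :: "real^'n^'n"
  assumes "posdef A" shows "det (matrix_inv A) = 1 / det A"
  using posdef_inverse[OF assms] by (metis det_I det_mul nonzero_eq_divide_eq)

text \<open>With the determinant as a logarithm in the exponent, continuity and differentiability in
  A reduce to those of the inverse and of \<open>det\<close>.\<close>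

lemma gauss_eq:
  fixes A :: "real^'n^'n"
  assumes "posdef A"
  shows "gauss A x = exp (- (1/4) * ((matrix_inv A *v x) \<bullet> x) - (1/2) * ln (det A)) / (4 * pi) powr (real CARD('n) / 2)"
proof -
  have "det (matrix_inv A) powr (- 1/2) = exp ((1/2) * ln (det A))"
    using posdef_det_pos[OF assms] by (simp add: det_matrix_inv[OF assms] powr_def ln_div)
  then show ?thesis unfolding gauss_def exp_diff by simp
qed

lemma continuous_on_gauss:
  fixes A :: "'a::topological_space \<Rightarrow> real^'n^'n"
  assumes "continuous_on S A" "continuous_on S x" "\<And>z. z \<in> S \<Longrightarrow> posdef (A z)"
  shows "continuous_on S (\<lambda>z. gauss (A z) (x z))" "continuous_on S (\<lambda>z. gauss_hess (A z) (x z))"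
proof -
  have "det (A z) \<noteq> 0" if "z \<in> S" for z using posdef_det_pos[OF assms(3)[OF that]] by simp
  then have "continuous_on S (\<lambda>z. exp (- (1/4) * ((matrix_inv (A z) *v x z) \<bullet> x z) - (1/2) * ln (det (A z))) / (4 * pi) powr (real CARD('n) / 2))"
    by (intro continuous_intros assms continuous_on_matrix_inv) auto
  then show *: "continuous_on S (\<lambda>z. gauss (A z) (x z))"
    by (rule continuous_on_eq) (simp add: gauss_eq assms)
  show "continuous_on S (\<lambda>z. gauss_hess (A z) (x z))"
    unfolding gauss_hess_def by (intro continuous_intros assms continuous_on_matrix_inv *) auto
qed

text \<open>With y and y' the images of x under the inverses of A and A', the increment of the form
  is exactly - <(A' - A) y, y'>. It therefore suffices that the inverse is continuous, which allows
  y' to be replaced by y up to a small error.\<close>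

lemma inverse_form_has_derivative:
  fixes A :: "real^'n^'n"
  assumes "posdef A"
  shows "((\<lambda>A. (matrix_inv A *v x) \<bullet> x) has_derivative
    (\<lambda>H. - (H \<bullet> outer (matrix_inv A *v x) (matrix_inv A *v x)))) (at A within Collect posdef)"
  unfolding has_derivative_within_alt
proof (intro conjI allI impI)
  show "bounded_linear (\<lambda>H. - (H \<bullet> outer (matrix_inv A *v x) (matrix_inv A *v x)))"
    by (intro bounded_linear_minus bounded_linear_inner_left)
  fix e :: real assume e: "0 < e"
  define y where "y = matrix_inv A *v x"
  have Ay: "A *v y = x" using posdef_inverse(1)[OF assms] by (simp add: y_def matrix_vector_mul_assoc)
  have "continuous_on (Collect posdef) (\<lambda>A'. norm (outer (matrix_inv A' *v x - y) y))"
    by (intro continuous_intros continuous_on_matrix_inv) auto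
  then obtain d where d: "d > 0" "\<And>A'. posdef A' \<Longrightarrow> dist A' A < d \<Longrightarrow>
      dist (norm (outer (matrix_inv A' *v x - y) y)) (norm (outer (matrix_inv A *v x - y) y)) < e"
    using assms e unfolding continuous_on_iff by (metis mem_Collect_eq)
  show "\<exists>d>0. \<forall>A'\<in>Collect posdef. norm (A' - A) < d \<longrightarrow>
      norm ((matrix_inv A' *v x) \<bullet> x - (matrix_inv A *v x) \<bullet> x
        - - ((A' - A) \<bullet> outer (matrix_inv A *v x) (matrix_inv A *v x))) \<le> e * norm (A' - A)"
  proof (rule exI[of _ d], intro conjI d ballI impI)
    fix A' :: "real^'n^'n" assume A': "A' \<in> Collect posdef" "norm (A' - A) < d"
    then have p: "posdef A'" by simp
    define y' where "y' = matrix_inv A' *v x"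
    have Ay': "A' *v y' = x" using posdef_inverse(1)[OF p] by (simp add: y'_def matrix_vector_mul_assoc)
    have "(A' *v y) \<bullet> y' = y \<bullet> x"
      using p inner_symmetric_matrix[of A' y y'] by (simp add: posdef_def Ay')
    then have "y' \<bullet> x - y \<bullet> x = - (((A' - A) *v y) \<bullet> y')"
      by (simp add: matrix_vector_mult_diff_rdistrib inner_diff_left inner_diff_right Ay inner_commute)
    then have "y' \<bullet> x - y \<bullet> x - - ((A' - A) \<bullet> outer y y) = - ((A' - A) \<bullet> outer (y' - y) y)"
      by (simp add: inner_matrix_vector_eq_outer[symmetric] inner_diff_right)
    then have "norm (y' \<bullet> x - y \<bullet> x - - ((A' - A) \<bullet> outer y y)) \<le> norm (A' - A) * norm (outer (y' - y) y)"
      using Cauchy_Schwarz_ineq2[of "A' - A" "outer (y' - y) y"] by simp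
    also have "\<dots> \<le> norm (A' - A) * e"
    proof (rule mult_left_mono)
      have "outer (y - y) y = 0" by (simp add: outer_def vec_eq_iff)
      then show "norm (outer (y' - y) y) \<le> e"
        using d(2)[OF p] A'(2) by (simp add: dist_norm y_def[symmetric] y'_def[symmetric])
    qed simp
    finally show "norm ((matrix_inv A' *v x) \<bullet> x - (matrix_inv A *v x) \<bullet> x
        - - ((A' - A) \<bullet> outer (matrix_inv A *v x) (matrix_inv A *v x))) \<le> e * norm (A' - A)"
      by (simp add: y_def y'_def mult.commute)
  qed
qed

text \<open>The quadratic form contributes a quarter of the outer product, the logarithm of the
  determinant half of the inverse: these are the two terms of the Hessian.\<close>

lemma gauss_has_derivative:
  fixes A :: "real^'n^'n"
  assumes "posdef A"
  shows "((\<lambda>A. gauss A x) has_derivative (\<lambda>H. gauss_hess A x \<bullet> H)) (at A within Collect posdef)"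
proof -
  note d = posdef_det_pos[OF assms]
  have "((\<lambda>A. exp (- (1/4) * ((matrix_inv A *v x) \<bullet> x) - (1/2) * ln (det A)) / (4 * pi) powr (real CARD('n) / 2))
    has_derivative (\<lambda>H. gauss_hess A x \<bullet> H)) (at A within Collect posdef)"
    by (rule derivative_eq_intros inverse_form_has_derivative det_has_derivative assms refl d)+
       (use d in \<open>auto simp: fun_eq_iff gauss_hess_def gauss_eq[OF assms] inner_diff_left inner_diff_right inner_commute field_simps\<close>)
  then show ?thesis
    by (rule has_derivative_transform[rotated 2]) (use assms in \<open>simp_all add: gauss_eq\<close>)
qed

lemma matrix_vector_mult_axis_nth: "(A *v axis j 1) $ i = (A :: real^'n^'m) $ i $ j"
  by (simp add: matrix_vector_mult_def axis_def if_distrib cong: if_cong)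

lemma gauss_pd:
  fixes A :: "real^'n^'n"
  assumes "posdef A"
  shows "has_pd j (gauss A) (\<lambda>x. - (1/2) * (matrix_inv A *v x) $ j * gauss A x)"
    "has_pd i (\<lambda>x. - (1/2) * (matrix_inv A *v x) $ j * gauss A x) (\<lambda>x. gauss_hess A x $ i $ j)"
proof -
  define B where "B = matrix_inv A"
  note i = posdef_inverse[OF assms, folded B_def]
  have Bs: "B $ i $ j = B $ j $ i" for i j using arg_cong[OF i(4), of "\<lambda>M. M $ j $ i"] by (simp add: transpose_def)
  have lin: "(B *v (x + s *\<^sub>R axis k 1)) $ l = (B *v x) $ l + s * B $ l $ k" for x s k l
    by (simp only: matrix_vector_right_distrib matrix_vector_mult_scaleR vector_add_component vector_scaleR_component
        matrix_vector_mult_axis_nth real_scaleR_def)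
  have quad: "(B *v (x + s *\<^sub>R axis k 1)) \<bullet> (x + s *\<^sub>R axis k 1) = (B *v x) \<bullet> x + 2 * s * (B *v x) $ k + s\<^sup>2 * B $ k $ k" for x s k
  proof -
    have "(B *v axis k 1) \<bullet> x = (B *v x) $ k"
      using inner_symmetric_matrix[OF i(4), of "axis k 1" x] by (simp add: inner_axis' )
    then show ?thesis
      by (simp add: matrix_vector_right_distrib matrix_vector_mult_scaleR inner_add_left inner_add_right
          inner_axis matrix_vector_mult_axis_nth power2_eq_square algebra_simps)
  qed
  define R where "R = 1 / ((4 * pi) powr (real CARD('n) / 2) * det B powr (- 1/2))"
  have g: "gauss A x = exp (- (1/4) * ((B *v x) \<bullet> x)) * R" for x
    by (simp add: gauss_def B_def R_def)
  have 1: "((\<lambda>s. gauss A (x + s *\<^sub>R axis k 1)) has_real_derivative - (1/2) * (B *v x) $ k * gauss A x) (at 0)" for x k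
    unfolding g quad by (auto intro!: derivative_eq_intros)
  then show "has_pd j (gauss A) (\<lambda>x. - (1/2) * (matrix_inv A *v x) $ j * gauss A x)"
    by (simp add: has_pd_def B_def)
  have "((\<lambda>s. - (1/2) * (B *v (x + s *\<^sub>R axis i 1)) $ j * gauss A (x + s *\<^sub>R axis i 1)) has_real_derivative gauss_hess A x $ i $ j) (at 0)" for x
    unfolding lin
    by (rule derivative_eq_intros refl 1)+
       (simp add: gauss_hess_def outer_def B_def[symmetric] Bs[of j i] algebra_simps)
  then show "has_pd i (\<lambda>x. - (1/2) * (matrix_inv A *v x) $ j * gauss A x) (\<lambda>x. gauss_hess A x $ i $ j)"
    by (simp add: has_pd_def B_def)
qed

section \<open>Pointwise Gaussian bounds and explicit Gaussian masses\<close>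

definition gexp :: "real \<Rightarrow> real^'n \<Rightarrow> real" where
  "gexp C x = exp (- (norm x)\<^sup>2 / (4 * C))"

text \<open>The square root bounds that of the determinant of the inverse of a matrix with lower
  ellipticity constant c: the Leibniz sum has n! terms, each at most the n-th power of 1 / c. The
  homogeneity in c is what later cancels against the mass of \<open>gexp\<close>.\<close>

definition gcon :: "real \<Rightarrow> 'n itself \<Rightarrow> real" where
  "gcon c _ = sqrt (fact CARD('n) / c ^ CARD('n)) / (4 * pi) powr (real CARD('n) / 2)"

lemma gexp_nonneg: "0 \<le> gexp C x" by (simp add: gexp_def)

lemma continuous_on_gexp[continuous_intros]: "continuous_on S f \<Longrightarrow> continuous_on S (\<lambda>x. gexp C (f x))"
  unfolding gexp_def divide_inverse by (intro continuous_intros)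

lemma elliptic_det_inverse_le:
  fixes A :: "real^'n^'n"
  assumes "elliptic c C A"
  shows "det (matrix_inv A) \<le> fact CARD('n) / c ^ CARD('n)"
    "\<bar>matrix_inv A $ i $ j\<bar> \<le> 1 / c"
proof -
  note p = elliptic_pos[OF assms]
  define B where "B = matrix_inv A"
  show b: "\<bar>matrix_inv A $ i $ j\<bar> \<le> 1 / c" for i j
  proof -
    have "norm (B *v axis j 1) \<le> (1 / c) * norm (axis j 1 :: real^'n)"
      unfolding B_def by (rule elliptic_norm_bounds(3)[OF elliptic_inverse[OF assms]])
    moreover have "\<bar>(B *v axis j 1) $ i\<bar> \<le> norm (B *v axis j 1)" by (rule component_le_norm_cart)
    ultimately show ?thesis by (simp add: matrix_vector_mult_axis_nth B_def)
  qed
  have "det B \<le> (\<Sum>p\<in>{p. p permutes (UNIV::'n set)}. \<bar>of_int (sign p) * (\<Prod>i\<in>UNIV. B $ i $ p i)\<bar>)"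
    unfolding det_def by (intro sum_mono) simp
  also have "\<dots> \<le> (\<Sum>p\<in>{p. p permutes (UNIV::'n set)}. (1 / c) ^ CARD('n))"
  proof (rule sum_mono)
    fix p :: "'n \<Rightarrow> 'n"
    have "(\<Prod>i\<in>UNIV. \<bar>B $ i $ p i\<bar>) \<le> (\<Prod>i\<in>(UNIV::'n set). 1 / c)"
      by (intro prod_mono) (use b in \<open>auto simp: B_def\<close>)
    moreover have "\<bar>of_int (sign p) :: real\<bar> = 1" by (simp add: sign_def)
    ultimately show "\<bar>of_int (sign p) * (\<Prod>i\<in>UNIV. B $ i $ p i)\<bar> \<le> (1 / c) ^ CARD('n)"
      by (simp add: abs_mult abs_prod)
  qed
  also have "\<dots> = fact CARD('n) * (1 / c) ^ CARD('n)"
    by (simp add: card_permutations)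
  finally show "det (matrix_inv A) \<le> fact CARD('n) / c ^ CARD('n)"
    by (simp add: B_def power_divide)
qed

lemma gauss_le:
  fixes A :: "real^'n^'n"
  assumes "elliptic c C A"
  shows "gauss A x \<le> gcon c TYPE('n) * gexp C x"
proof -
  note p = elliptic_pos[OF assms] and pd = elliptic_imp_posdef[OF assms]
  note dp = posdef_det_pos[OF posdef_inverse(5)[OF pd]]
  have "det (matrix_inv A) powr (- 1/2) = 1 / sqrt (det (matrix_inv A))"
    using dp powr_minus[of "det (matrix_inv A)" "1/2"] powr_half_sqrt[of "det (matrix_inv A)"]
    by (simp add: inverse_eq_divide)
  then have e: "gauss A x = exp (- (1/4) * ((matrix_inv A *v x) \<bullet> x)) * (sqrt (det (matrix_inv A)) / (4 * pi) powr (real CARD('n) / 2))"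
    by (simp add: gauss_def)
  have "(1 / C) * (norm x)\<^sup>2 \<le> (matrix_inv A *v x) \<bullet> x"
    using elliptic_inverse[OF assms] unfolding elliptic_def by blast
  then have "- (1/4) * ((matrix_inv A *v x) \<bullet> x) \<le> - (norm x)\<^sup>2 / (4 * C)" by (simp add: field_simps)
  then have "exp (- (1/4) * ((matrix_inv A *v x) \<bullet> x)) \<le> gexp C x" by (simp add: gexp_def)
  moreover have "sqrt (det (matrix_inv A)) / (4 * pi) powr (real CARD('n) / 2) \<le> gcon c TYPE('n)"
    unfolding gcon_def by (intro divide_right_mono real_sqrt_le_mono elliptic_det_inverse_le[OF assms]) simp
  ultimately have "gauss A x \<le> gexp C x * gcon c TYPE('n)"
    unfolding e using dp by (intro mult_mono) (auto simp: gexp_nonneg)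
  then show ?thesis by (simp add: mult.commute)
qed

text \<open>A quadratic factor is absorbed by giving up half of the exponent: u exp (- u) \<le> 1
  with u the squared norm over 8 C, at the price of doubling C.\<close>

lemma norm_sq_gexp_le: "0 < C \<Longrightarrow> (norm x)\<^sup>2 * gexp C x \<le> 8 * C * gexp (2 * C) x"
proof -
  assume C: "0 < C"
  define u where "u = (norm x)\<^sup>2 / (8 * C)"
  have "u \<le> exp u" using exp_ge_add_one_self[of u] by linarith
  then have "u * exp (-u) \<le> 1" by (simp add: exp_minus field_simps)
  then have "8 * C * (u * exp (-u)) * exp (-u) \<le> 8 * C * 1 * exp (-u)"
    using C by (intro mult_right_mono mult_left_mono) auto
  moreover have "gexp C x = exp (-u) * exp (-u)" "gexp (2 * C) x = exp (-u)" "(norm x)\<^sup>2 = 8 * C * u"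
    using C by (simp_all add: gexp_def u_def exp_add[symmetric] field_simps)
  ultimately show ?thesis by (simp add: mult_ac)
qed

lemma gexp_mono: "0 < C \<Longrightarrow> C \<le> D \<Longrightarrow> gexp C x \<le> gexp D x"
  by (simp add: gexp_def divide_left_mono frac_le)

lemma gauss_hess_le:
  fixes A :: "real^'n^'n"
  assumes "elliptic c C A"
  shows "\<bar>gauss_hess A x $ i $ j\<bar> \<le> gcon c TYPE('n) * (2 * C / c\<^sup>2 + 1 / (2 * c)) * gexp (2 * C) x"
    "\<bar>- (1/2) * (matrix_inv A *v x) $ i * gauss A x\<bar> \<le> gcon c TYPE('n) * ((1 + 8 * C) / (2 * c)) * gexp (2 * C) x"
proof -
  note p = elliptic_pos[OF assms]
  define y where "y = matrix_inv A *v x"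
  define K where "K = gcon c TYPE('n)"
  have K: "K \<ge> 0" using p by (simp add: K_def gcon_def)
  have "norm y \<le> (1 / c) * norm x"
    unfolding y_def by (rule elliptic_norm_bounds(3)[OF elliptic_inverse[OF assms]])
  then have y: "\<bar>y $ i\<bar> \<le> norm x / c" for i
    using component_le_norm_cart[of y i] by simp
  have "\<bar>y $ i * y $ j\<bar> \<le> (norm x / c) * (norm x / c)"
    unfolding abs_mult using y p by (intro mult_mono) auto
  then have "\<bar>y $ i * y $ j / 4 - matrix_inv A $ i $ j / 2\<bar> \<le> (norm x)\<^sup>2 / (4 * c\<^sup>2) + 1 / (2 * c)"
    using elliptic_det_inverse_le(2)[OF assms, of i j] p by (simp add: power2_eq_square abs_if split: if_splits)
  then have "\<bar>gauss_hess A x $ i $ j\<bar> \<le> (K * gexp C x) * ((norm x)\<^sup>2 / (4 * c\<^sup>2) + 1 / (2 * c))"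
    using gauss_le[OF assms, of x] gauss_nonneg[of A x] K p
    by (auto simp: gauss_hess_def outer_def abs_mult K_def y_def[symmetric] gexp_nonneg intro!: mult_mono)
  also have "\<dots> = K * (((norm x)\<^sup>2 * gexp C x) / (4 * c\<^sup>2) + gexp C x / (2 * c))" by (simp add: algebra_simps)
  also have "\<dots> \<le> K * ((8 * C * gexp (2 * C) x) / (4 * c\<^sup>2) + gexp (2 * C) x / (2 * c))"
    using p by (intro mult_left_mono add_mono divide_right_mono norm_sq_gexp_le gexp_mono K) auto
  also have "\<dots> = K * (2 * C / c\<^sup>2 + 1 / (2 * c)) * gexp (2 * C) x" by (simp add: algebra_simps)
  finally show "\<bar>gauss_hess A x $ i $ j\<bar> \<le> gcon c TYPE('n) * (2 * C / c\<^sup>2 + 1 / (2 * c)) * gexp (2 * C) x"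
    by (simp add: K_def)
  \<comment> \<open>The first power in the gradient is traded for a square, so that
    \<open>norm_sq_gexp_le\<close> applies here as well.\<close>
  have nx: "norm x \<le> 1 + (norm x)\<^sup>2" 
  proof -
    have "2 * norm x \<le> 1 + (norm x)\<^sup>2" using zero_le_power2[of "norm x - 1"] by (simp add: power2_diff)
    then show ?thesis using norm_ge_zero[of x] by linarith
  qed
  have "\<bar>- (1/2) * (matrix_inv A *v x) $ i * gauss A x\<bar> \<le> (norm x / c / 2) * (K * gexp C x)"
  proof -
    have "\<bar>- (1/2) * (matrix_inv A *v x) $ i * gauss A x\<bar> = (\<bar>y $ i\<bar> / 2) * gauss A x"
      by (simp add: abs_mult gauss_nonneg y_def)
    also have "\<dots> \<le> (norm x / c / 2) * (K * gexp C x)"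
      unfolding K_def
      by (intro mult_mono gauss_le[OF assms]) (use y[of i] p in \<open>auto simp: gauss_nonneg\<close>)
    finally show ?thesis .
  qed
  also have "\<dots> \<le> ((1 + (norm x)\<^sup>2) / c / 2) * (K * gexp C x)"
    using nx p K by (intro mult_right_mono divide_right_mono) (auto simp: gexp_nonneg)
  also have "\<dots> = K / (2 * c) * (gexp C x + (norm x)\<^sup>2 * gexp C x)" by (simp add: field_simps)
  also have "\<dots> \<le> K / (2 * c) * (gexp (2 * C) x + 8 * C * gexp (2 * C) x)"
    using p K by (intro mult_left_mono add_mono norm_sq_gexp_le gexp_mono) auto
  also have "\<dots> = K * ((1 + 8 * C) / (2 * c)) * gexp (2 * C) x" by (simp add: field_simps)
  finally show "\<bar>- (1/2) * (matrix_inv A *v x) $ i * gauss A x\<bar> \<le> gcon c TYPE('n) * ((1 + 8 * C) / (2 * c)) * gexp (2 * C) x"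
    by (simp add: K_def)
qed

lemma gexp_integral:
  assumes C: "0 < C"
  shows "integrable lborel (gexp C :: real^'n \<Rightarrow> real)"
    "(LINT x|lborel. gexp C (x :: real^'n)) = (4 * pi * C) powr (real CARD('n) / 2)"
proof -
  have m: "gexp C \<in> borel_measurable (borel :: (real^'n) measure)"
    by (intro borel_measurable_continuous_onI continuous_intros)
  have 1: "(\<integral>\<^sup>+ x. ennreal (exp (- x\<^sup>2 / (4 * C))) \<partial>lborel) = ennreal (sqrt (4 * pi * C))"
  proof -
    \<comment> \<open>The exponent is that of a centred normal density with variance 2 C.\<close>
    have "exp (- x\<^sup>2 / (4 * C)) = sqrt (4 * pi * C) * normal_density 0 (sqrt (2 * C)) x" for x
      using C by (simp add: normal_density_def power2_eq_square real_sqrt_mult mult_ac)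
    then have "(\<integral>\<^sup>+ x. ennreal (exp (- x\<^sup>2 / (4 * C))) \<partial>lborel)
        = (\<integral>\<^sup>+ x. ennreal (sqrt (4 * pi * C)) * ennreal (normal_density 0 (sqrt (2 * C)) x) \<partial>lborel)"
      using C by (simp add: ennreal_mult)
    also have "\<dots> = ennreal (sqrt (4 * pi * C)) * (\<integral>\<^sup>+ x. ennreal (normal_density 0 (sqrt (2 * C)) x) \<partial>lborel)"
      by (rule nn_integral_cmult) auto
    also have "(\<integral>\<^sup>+ x. ennreal (normal_density 0 (sqrt (2 * C)) x) \<partial>lborel) = 1"
      using C by (subst nn_integral_eq_integral) auto
    finally show ?thesis by simp
  qed
  have "gexp C (x :: real^'n) = (\<Prod>b\<in>Basis. exp (- (x \<bullet> b)\<^sup>2 / (4 * C)))" for x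
  proof -
    have "(norm x)\<^sup>2 = (\<Sum>b\<in>Basis. (x \<bullet> b)\<^sup>2)"
      unfolding power2_norm_eq_inner by (subst euclidean_inner) (simp add: power2_eq_square)
    then show ?thesis
      by (simp add: gexp_def exp_sum[symmetric] sum_divide_distrib[symmetric] sum_negf)
  qed
  then have "(\<integral>\<^sup>+ x. ennreal (gexp C (x::real^'n)) \<partial>lborel) = (\<integral>\<^sup>+ x. (\<Prod>b\<in>Basis. ennreal (exp (- ((x::real^'n) \<bullet> b)\<^sup>2 / (4 * C)))) \<partial>lborel)"
    by (simp add: prod_ennreal)
  also have "\<dots> = (\<Prod>b\<in>(Basis::(real^'n) set). ennreal (sqrt (4 * pi * C)))"
    by (subst nn_integral_lborel_prod) (use 1 in auto)
  also have "\<dots> = ennreal ((sqrt (4 * pi * C)) ^ CARD('n))"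
    using C by (simp add: ennreal_power)
  also have "(sqrt (4 * pi * C)) ^ CARD('n) = (4 * pi * C) powr (real CARD('n) / 2)"
    using C by (simp add: powr_half_sqrt[symmetric] powr_realpow[symmetric] powr_powr mult.commute)
  finally have "(\<integral>\<^sup>+ x. ennreal (gexp C (x::real^'n)) \<partial>lborel) = ennreal ((4 * pi * C) powr (real CARD('n) / 2))" .
  then have "has_bochner_integral lborel (gexp C :: real^'n \<Rightarrow> real) ((4 * pi * C) powr (real CARD('n) / 2))"
    by (intro has_bochner_integral_nn_integral) (use m in \<open>auto simp: gexp_nonneg\<close>)
  then show "integrable lborel (gexp C :: real^'n \<Rightarrow> real)"
    "(LINT x|lborel. gexp C (x :: real^'n)) = (4 * pi * C) powr (real CARD('n) / 2)"
    by (auto simp: has_bochner_integral_iff)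
qed

text \<open>For multiples of the identity the mass is explicit; this is the starting point of the
  homotopy in \<open>gauss_integral\<close>.\<close>

lemma gauss_mat:
  fixes x :: "real^'n"
  assumes "0 < \<sigma>"
  shows "gauss (mat \<sigma>) x = gexp \<sigma> x / (4 * pi * \<sigma>) powr (real CARD('n) / 2)" "elliptic \<sigma> \<sigma> (mat \<sigma> :: real^'n^'n)"
proof -
  have mv: "(mat c :: real^'n^'n) *v x = c *\<^sub>R x" for c x
    by (simp add: vec_eq_iff matrix_vector_mult_def mat_def if_distrib if_distribR cong: if_cong)
  show e: "elliptic \<sigma> \<sigma> (mat \<sigma> :: real^'n^'n)"
    using assms by (simp add: elliptic_def mv transpose_mat power2_norm_eq_inner)
  note p = elliptic_imp_posdef[OF e]
  have "matrix_inv (mat \<sigma>) *v x = (1 / \<sigma>) *\<^sub>R x"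
  proof -
    have "mat \<sigma> *v ((1 / \<sigma>) *\<^sub>R x) = x" using assms by (simp add: mv)
    then show ?thesis
      by (metis matrix_vector_mul_assoc matrix_vector_mul_lid posdef_inverse(2)[OF p])
  qed
  then have q: "(matrix_inv (mat \<sigma>) *v x) \<bullet> x = (norm x)\<^sup>2 / \<sigma>" by (simp add: power2_norm_eq_inner)
  have "det (mat \<sigma> :: real^'n^'n) = \<sigma> ^ CARD('n)"
    by (subst det_diagonal) (auto simp: mat_def)
  then have "det (matrix_inv (mat \<sigma> :: real^'n^'n)) powr (-1/2) = \<sigma> powr (real CARD('n) / 2)"
    using assms by (simp add: det_matrix_inv[OF p] powr_divide powr_realpow[symmetric] powr_powr powr_minus field_simps)
  then show "gauss (mat \<sigma>) x = gexp \<sigma> x / (4 * pi * \<sigma>) powr (real CARD('n) / 2)"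
    using assms by (simp add: gauss_def q gexp_def powr_mult)
qed

section \<open>Primitives of bounded measurable functions\<close>

lemma lborel_distr_reflect: "distr lborel borel (\<lambda>x. t - x) = (lborel :: 'a::euclidean_space measure)"
  using lborel_affine[of "-1" t] by (simp add: density_1)

lemma
  fixes f :: "'a::euclidean_space \<Rightarrow> 'b::{banach, second_countable_topology}"
  assumes [measurable]: "f \<in> borel_measurable borel"
  shows lborel_integral_translate: "(LINT x|lborel. f (x + c)) = (LINT x|lborel. f x)"
    and lborel_integrable_translate: "integrable lborel (\<lambda>x. f (x + c)) \<longleftrightarrow> integrable lborel f"
    and lborel_integral_reflect: "(LINT x|lborel. f (c - x)) = (LINT x|lborel. f x)"
    and lborel_integrable_reflect: "integrable lborel (\<lambda>x. f (c - x)) \<longleftrightarrow> integrable lborel f"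
proof -
  show "(LINT x|lborel. f (x + c)) = (LINT x|lborel. f x)"
    using integral_distr[of "(+) c" lborel borel f] by (simp add: lborel_distr_plus add.commute)
  show "integrable lborel (\<lambda>x. f (x + c)) \<longleftrightarrow> integrable lborel f"
    using integrable_distr_eq[of "(+) c" lborel borel f] by (simp add: lborel_distr_plus add.commute)
  show "(LINT x|lborel. f (c - x)) = (LINT x|lborel. f x)"
    using integral_distr[of "\<lambda>x. c - x" lborel borel f] by (simp add: lborel_distr_reflect)
  show "integrable lborel (\<lambda>x. f (c - x)) \<longleftrightarrow> integrable lborel f"
    using integrable_distr_eq[of "\<lambda>x. c - x" lborel borel f] by (simp add: lborel_distr_reflect)
qed

text \<open>The increment h (x + e) - h x is the integral of h' over a unit segment. Integrated over
  x, the increment vanishes by translation invariance, while Fubini turns the other side into the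
  integral of h'. Integrability alone controls infinity, and all integrations by parts reduce to
  this fact applied to a product.\<close>

lemma integral_pd_eq_0:
  fixes h h' :: "real^'n \<Rightarrow> real"
  assumes pd: "has_pd i h h'" and c: "continuous_on UNIV h'"
    and h: "integrable lborel h" and h': "integrable lborel h'"
  shows "(LINT x|lborel. h' x) = 0"
proof -
  define e :: "real^'n" where "e = axis i 1"
  have m[measurable]: "h' \<in> borel_measurable borel" "h \<in> borel_measurable borel"
    using h h' by auto
  define G where "G = (\<lambda>(s::real, x). indicator {0..1} s *\<^sub>R h' (x + s *\<^sub>R e))"
  have Gm: "G \<in> borel_measurable (lborel \<Otimes>\<^sub>M lborel)" unfolding G_def by measurable
  have tr: "(LINT x|lborel. h' (x + s *\<^sub>R e)) = (LINT x|lborel. h' x)"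
    "(LINT x|lborel. \<bar>h' (x + s *\<^sub>R e)\<bar>) = (LINT x|lborel. \<bar>h' x\<bar>)"
    "integrable lborel (\<lambda>x. h' (x + s *\<^sub>R e))" for s
    using lborel_integral_translate[of h' "s *\<^sub>R e"] lborel_integral_translate[of "\<lambda>x. \<bar>h' x\<bar>" "s *\<^sub>R e"]
      lborel_integrable_translate[of h' "s *\<^sub>R e"] h' by auto
  have Gi: "integrable (lborel \<Otimes>\<^sub>M lborel) G"
  proof (rule lborel_pair.Fubini_integrable[OF Gm])
    show "integrable lborel (\<lambda>s. LINT x|lborel. norm (G (s, x)))"
      by (simp add: G_def abs_mult tr(2) mult.commute)
    show "AE s in lborel. integrable lborel (\<lambda>x. G (s, x))"
      by (simp add: G_def tr(3))
  qed
  have line: "(LINT s|lborel. G (s, x)) = h (x + e) - h x" for x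
  proof -
    have "(LINT s|lborel. h' (x + s *\<^sub>R e) * indicator {0..1} s) = h (x + 1 *\<^sub>R e) - h (x + 0 *\<^sub>R e)"
    proof (rule integral_FTC_Icc_real)
      have "continuous_on UNIV (\<lambda>s. h' (x + s *\<^sub>R e))"
        by (rule continuous_on_compose2[OF c]) (auto intro!: continuous_intros)
      then show "isCont (\<lambda>s. h' (x + s *\<^sub>R e)) s" for s
        by (simp add: continuous_on_eq_continuous_at)
    qed (use has_pd_line[OF pd, of x, folded e_def] in auto)
    then show ?thesis by (simp add: G_def mult.commute)
  qed
  have "(LINT x|lborel. LINT s|lborel. G (s, x)) = (LINT s|lborel. LINT x|lborel. G (s, x))"
    using lborel_pair.Fubini_integral[of "\<lambda>s x. G (s, x)"] Gi by simp
  moreover have "(LINT x|lborel. LINT s|lborel. G (s, x)) = 0"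
    using lborel_integral_translate[of h e] lborel_integrable_translate[of h e] h by (simp add: line)
  moreover have "(LINT s|lborel. LINT x|lborel. G (s, x)) = (LINT x|lborel. h' x)"
    by (simp add: G_def tr(1))
  ultimately show ?thesis by simp
qed

section \<open>Lipschitz primitives and the fundamental theorem of calculus along them\<close>

lemma integrable_indicat_Icc:
  fixes r r' :: real
  shows "integrable lborel (indicat_real {r..r'})"
  by (intro integrable_real_indicator) (auto simp: emeasure_lborel_Icc_eq)

text \<open>The integral is oriented, so that differences of values are integrals for either order
  of the end points.\<close>

definition prim :: "(real \<Rightarrow> 'e::{banach, second_countable_topology}) \<Rightarrow> real \<Rightarrow> 'e" where
  "prim \<beta> t = (LBINT s=0..t. \<beta> s)"

locale bounded_borel =
  fixes \<beta> :: "real \<Rightarrow> 'e::{banach, second_countable_topology}" and K :: real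
  assumes borel[measurable]: "\<beta> \<in> borel_measurable borel" and bound: "\<And>t. norm (\<beta> t) \<le> K"
begin

lemma K_nonneg: "0 \<le> K" using bound[of 0] norm_ge_zero order_trans by blast

lemma set_integrable_Icc: "set_integrable lborel {r..r'} \<beta>"
proof -
  have "integrable lborel (\<lambda>s. indicator {r..r'} s *\<^sub>R K)" by (simp add: integrable_indicat_Icc)
  then show ?thesis unfolding set_integrable_def
    by (rule Bochner_Integration.integrable_bound) (use bound K_nonneg in \<open>auto simp: indicator_def\<close>)
qed

lemma interval_integrable: "interval_lebesgue_integrable lborel (ereal r) (ereal r') \<beta>"
proof -
  have "set_integrable lborel {r<..<r'} \<beta>" for r r'
    by (rule set_integrable_subset[OF set_integrable_Icc[of r r']]) auto
  then show ?thesis by (simp add: interval_lebesgue_integrable_def)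
qed

lemma prim_diff: "prim \<beta> r' - prim \<beta> r = (LBINT s=r..r'. \<beta> s)"
proof -
  have "(LBINT s=ereal 0..ereal r. \<beta> s) + (LBINT s=ereal r..ereal r'. \<beta> s) = (LBINT s=ereal 0..ereal r'. \<beta> s)"
    by (rule interval_integral_sum)
       (use interval_integrable[of "min 0 (min r r')" "max 0 (max r r')"] in \<open>simp add: min_def max_def split: if_splits\<close>)
  then show ?thesis by (simp add: prim_def zero_ereal_def algebra_simps)
qed

lemma prim_diff_Icc: "r \<le> r' \<Longrightarrow> prim \<beta> r' - prim \<beta> r = (LINT s:{r..r'}|lborel. \<beta> s)"
  unfolding prim_diff by (rule interval_integral_Icc) simp

lemma prim_diff_le: "norm (prim \<beta> r' - prim \<beta> r) \<le> K * \<bar>r' - r\<bar>"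
proof -
  have *: "norm (prim \<beta> r' - prim \<beta> r) \<le> K * (r' - r)" if "r \<le> r'" for r r'
  proof -
    have "norm (prim \<beta> r' - prim \<beta> r) \<le> (LINT s:{r..r'}|lborel. norm (\<beta> s))"
      unfolding prim_diff_Icc[OF that] by (rule set_integral_norm_bound[OF set_integrable_Icc])
    also have "\<dots> \<le> (LINT s:{r..r'}|lborel. K)"
      by (rule set_integral_mono) (use bound set_integrable_norm[OF set_integrable_Icc] in \<open>auto simp: set_integrable_def integrable_indicat_Icc\<close>)
    also have "\<dots> = K * (r' - r)" using that by (simp add: set_lebesgue_integral_def)
    finally show ?thesis .
  qed
  show ?thesis using *[of r r'] *[of r' r] by (cases "r \<le> r'") (auto simp: norm_minus_commute)
qed

end

text \<open>Freezing the factor d at d0 costs only the oscillation of d on the interval, times the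
  bound on \<alpha>. Both orders of r and r' are covered because the estimate feeds two-sided
  derivatives.\<close>

lemma prim_inner_approx:
  fixes \<alpha> d :: "real \<Rightarrow> 'e::euclidean_space" and \<gamma> :: "real \<Rightarrow> real"
  assumes a: "bounded_borel \<alpha> K" and g: "bounded_borel \<gamma> K'"
    and e: "\<And>s. s \<in> {min r r'..max r r'} \<Longrightarrow> \<gamma> s = d s \<bullet> \<alpha> s \<and> norm (d s - d0) \<le> e"
  shows "\<bar>prim \<gamma> r' - prim \<gamma> r - d0 \<bullet> (prim \<alpha> r' - prim \<alpha> r)\<bar> \<le> e * K * \<bar>r' - r\<bar>"
proof -
  interpret a: bounded_borel \<alpha> K by fact
  interpret g: bounded_borel \<gamma> K' by fact
  have *: "\<bar>prim \<gamma> q' - prim \<gamma> q - d0 \<bullet> (prim \<alpha> q' - prim \<alpha> q)\<bar> \<le> e * K * (q' - q)"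
    if q: "q \<le> q'" and e: "\<And>s. s \<in> {q..q'} \<Longrightarrow> \<gamma> s = d s \<bullet> \<alpha> s \<and> norm (d s - d0) \<le> e" for q q'
  proof -
    have 1: "set_integrable lborel {q..q'} (\<lambda>s. d0 \<bullet> \<alpha> s)"
      using integrable_inner_right[OF a.set_integrable_Icc[of q q', unfolded set_integrable_def], of d0]
      by (simp add: set_integrable_def)
    have "d0 \<bullet> (prim \<alpha> q' - prim \<alpha> q) = (LINT s:{q..q'}|lborel. d0 \<bullet> \<alpha> s)"
      unfolding a.prim_diff_Icc[OF q] set_lebesgue_integral_def
      using a.set_integrable_Icc[of q q'] unfolding set_integrable_def
      by (subst integral_inner_right[symmetric]) auto
    then have "prim \<gamma> q' - prim \<gamma> q - d0 \<bullet> (prim \<alpha> q' - prim \<alpha> q) = (LINT s:{q..q'}|lborel. \<gamma> s - d0 \<bullet> \<alpha> s)"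
      unfolding g.prim_diff_Icc[OF q] by (simp add: set_integral_diff[OF g.set_integrable_Icc 1])
    also have "\<bar>\<dots>\<bar> \<le> (LINT s:{q..q'}|lborel. \<bar>\<gamma> s - d0 \<bullet> \<alpha> s\<bar>)"
      using set_integral_norm_bound[OF set_integral_diff(1)[OF g.set_integrable_Icc 1]] by simp
    also have "\<dots> \<le> (LINT s:{q..q'}|lborel. e * K)"
    proof (rule set_integral_mono)
      show "set_integrable lborel {q..q'} (\<lambda>s. \<bar>\<gamma> s - d0 \<bullet> \<alpha> s\<bar>)"
        by (rule set_integrable_abs[OF set_integral_diff(1)[OF g.set_integrable_Icc 1]])
      show "\<bar>\<gamma> s - d0 \<bullet> \<alpha> s\<bar> \<le> e * K" if "s \<in> {q..q'}" for s
      proof -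
        have "\<bar>\<gamma> s - d0 \<bullet> \<alpha> s\<bar> = \<bar>(d s - d0) \<bullet> \<alpha> s\<bar>" using e[OF that] by (simp add: inner_diff_left)
        also have "\<dots> \<le> norm (d s - d0) * norm (\<alpha> s)" by (rule Cauchy_Schwarz_ineq2)
        also have "\<dots> \<le> e * K"
          using e[OF that] a.bound[of s] by (intro mult_mono) (auto intro: order_trans[OF norm_ge_zero])
        finally show ?thesis .
      qed
    qed (simp add: set_integrable_def integrable_indicat_Icc)
    also have "\<dots> = e * K * (q' - q)" using q by (simp add: set_lebesgue_integral_def)
    finally show ?thesis .
  qed
  show ?thesis
  proof (cases "r \<le> r'")
    case True
    then show ?thesis using *[of r r'] e by (auto simp: min_def max_def)
  next
    case False
    then have "\<bar>prim \<gamma> r - prim \<gamma> r' - d0 \<bullet> (prim \<alpha> r - prim \<alpha> r')\<bar> \<le> e * K * (r - r')"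
      using *[of r' r] e by (auto simp: min_def max_def)
    also have "prim \<gamma> r - prim \<gamma> r' - d0 \<bullet> (prim \<alpha> r - prim \<alpha> r')
      = - (prim \<gamma> r' - prim \<gamma> r - d0 \<bullet> (prim \<alpha> r' - prim \<alpha> r))" by (simp add: inner_diff_right)
    finally show ?thesis using False by simp
  qed
qed

text \<open>Near t the primitive of d paired with \<alpha> differs from d t paired with the
  primitive of \<alpha> by o(|r - t|), since d is continuous. So the points of differentiability are
  inherited from \<alpha> and do not depend on d.\<close>

lemma prim_inner_has_derivative:
  fixes \<alpha> d :: "real \<Rightarrow> 'e::euclidean_space" and \<gamma> :: "real \<Rightarrow> real"
  assumes a: "bounded_borel \<alpha> K" and g: "bounded_borel \<gamma> K'"
    and S: "open S" "t \<in> S" "\<And>s. s \<in> S \<Longrightarrow> \<gamma> s = d s \<bullet> \<alpha> s" and d: "continuous_on S d"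
    and t: "(prim \<alpha> has_vector_derivative a0) (at t)"
  shows "(prim \<gamma> has_real_derivative d t \<bullet> a0) (at t)"
proof -
  have K: "0 \<le> K" using a by (rule bounded_borel.K_nonneg)
  have "((\<lambda>r. d t \<bullet> prim \<alpha> r) has_real_derivative d t \<bullet> a0) (at t)"
    using t unfolding has_vector_derivative_def has_field_derivative_def
    by (auto intro!: derivative_eq_intros)
  moreover have "((\<lambda>r. prim \<gamma> r - d t \<bullet> prim \<alpha> r) has_real_derivative 0) (at t)"
    unfolding has_field_derivative_def has_derivative_at_alt
  proof (intro conjI allI impI)
    fix e :: real assume e: "0 < e"
    have "isCont d t" using d S by (simp add: continuous_on_eq_continuous_at)
    then obtain \<delta> where \<delta>: "\<delta> > 0" "\<And>s. dist s t < \<delta> \<Longrightarrow> dist (d s) (d t) < e / (K + 1)"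
      unfolding continuous_at_eps_delta using e K by (metis add_nonneg_pos divide_pos_pos zero_less_one)
    obtain \<delta>' where \<delta>': "\<delta>' > 0" "ball t \<delta>' \<subseteq> S" using S open_contains_ball by blast
    show "\<exists>\<delta>>0. \<forall>r. norm (r - t) < \<delta> \<longrightarrow>
       norm (prim \<gamma> r - d t \<bullet> prim \<alpha> r - (prim \<gamma> t - d t \<bullet> prim \<alpha> t) - (*) 0 (r - t)) \<le> e * norm (r - t)"
    proof (rule exI[of _ "min \<delta> \<delta>'"], intro conjI allI impI)
      fix r assume r: "norm (r - t) < min \<delta> \<delta>'"
      have "\<bar>prim \<gamma> r - prim \<gamma> t - d t \<bullet> (prim \<alpha> r - prim \<alpha> t)\<bar> \<le> (e / (K + 1)) * K * \<bar>r - t\<bar>"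
      proof (rule prim_inner_approx[OF a g])
        fix s assume "s \<in> {min t r..max t r}"
        then have "dist s t < \<delta>" "dist t s < \<delta>'" using r by (auto simp: dist_real_def min_def max_def split: if_splits)
        then show "\<gamma> s = d s \<bullet> \<alpha> s \<and> norm (d s - d t) \<le> e / (K + 1)"
          using \<delta> \<delta>' S(3) by (force simp: dist_norm)
      qed
      also have "\<dots> \<le> e * \<bar>r - t\<bar>"
        using K e by (intro mult_right_mono) (auto simp: field_simps)
      finally show "norm (prim \<gamma> r - d t \<bullet> prim \<alpha> r - (prim \<gamma> t - d t \<bullet> prim \<alpha> t) - (*) 0 (r - t)) \<le> e * norm (r - t)"
        by (simp add: inner_diff_right algebra_simps)
    qed (use \<delta> \<delta>' in auto)
  qed (rule bounded_linear_mult_right)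
  ultimately have "((\<lambda>r. (prim \<gamma> r - d t \<bullet> prim \<alpha> r) + d t \<bullet> prim \<alpha> r) has_real_derivative 0 + d t \<bullet> a0) (at t)"
    by (rule DERIV_add[rotated])
  then show ?thesis by simp
qed

text \<open>No differentiability of \<open>X\<close> is needed: the difference of the two sides has derivative zero
  at every point, also where the bounded measurable function \<open>\<alpha>\<close> has no Lebesgue value.\<close>

lemma path_FTC:
  fixes X \<alpha> d :: "real \<Rightarrow> 'e::euclidean_space" and Q :: "'e \<Rightarrow> real"
  assumes bc: "b \<le> c" and a: "bounded_borel \<alpha> K"
    and X: "\<And>r r'. r \<in> {b..c} \<Longrightarrow> r' \<in> {b..c} \<Longrightarrow> X r' - X r = prim \<alpha> r' - prim \<alpha> r"
    and S: "\<And>r. r \<in> {b..c} \<Longrightarrow> X r \<in> S"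
    and Q: "\<And>r. r \<in> {b..c} \<Longrightarrow> (Q has_derivative (\<lambda>H. d r \<bullet> H)) (at (X r) within S)"
    and d: "continuous_on {b..c} d"
  shows "Q (X c) - Q (X b) = (LINT r:{b..c}|lborel. d r \<bullet> \<alpha> r)"
proof -
  interpret a: bounded_borel \<alpha> K by fact
  note K = a.K_nonneg
  define \<gamma> where "\<gamma> s = (indicator {b..c} s *\<^sub>R d s) \<bullet> \<alpha> s" for s
  have "compact (d ` {b..c})" using d by (intro compact_continuous_image) auto
  then obtain Kd where Kd: "\<And>s. s \<in> {b..c} \<Longrightarrow> norm (d s) \<le> Kd" "0 < Kd"
    by (metis bounded_pos compact_imp_bounded image_eqI)
  have dm: "(\<lambda>s. indicator {b..c} s *\<^sub>R d s) \<in> borel_measurable borel"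
    using borel_measurable_continuous_on_indicator[OF _ d] by simp
  have g: "bounded_borel \<gamma> (Kd * K)"
  proof
    show "\<gamma> \<in> borel_measurable borel" unfolding \<gamma>_def using dm by measurable
    show "norm (\<gamma> t) \<le> Kd * K" for t
    proof -
      have "norm (\<gamma> t) \<le> norm (indicator {b..c} t *\<^sub>R d t) * norm (\<alpha> t)"
        unfolding \<gamma>_def real_norm_def by (rule Cauchy_Schwarz_ineq2)
      also have "\<dots> \<le> Kd * K"
        using Kd a.bound[of t] by (intro mult_mono) (auto simp: indicator_def)
      finally show ?thesis .
    qed
  qed
  interpret g: bounded_borel \<gamma> "Kd * K" by fact
  \<comment> \<open>Both terms have the same first order part, d r paired with the increment of
    \<open>prim \<alpha>\<close>: the first by the derivative of Q, the second by
    \<open>prim_inner_approx\<close>. Each leaves an error e1 * K * |r' - r|, and e1 is chosen so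
    that the two together stay below e; dividing by K + 1 also covers K = 0.\<close>
  have "((\<lambda>r. Q (X r) - prim \<gamma> r) has_derivative (\<lambda>h. 0)) (at r within {b..c})" if r: "r \<in> {b..c}" for r
    unfolding has_derivative_within_alt
  proof (intro conjI allI impI)
    fix e :: real assume e: "0 < e"
    define e1 where "e1 = e / (2 * (K + 1))"
    have e1: "e1 > 0" "e1 * K \<le> e / 2" using e K by (auto simp: e1_def field_simps)
    obtain \<delta>1 where \<delta>1: "\<delta>1 > 0" "\<And>Y. Y \<in> S \<Longrightarrow> norm (Y - X r) < \<delta>1 \<Longrightarrow>
        norm (Q Y - Q (X r) - d r \<bullet> (Y - X r)) \<le> e1 * norm (Y - X r)"
      using Q[OF r] e1 unfolding has_derivative_within_alt by meson
    obtain \<delta>2 where \<delta>2: "\<delta>2 > 0" "\<And>s. s \<in> {b..c} \<Longrightarrow> dist s r < \<delta>2 \<Longrightarrow> dist (d s) (d r) < e1"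
      using d r e1 unfolding continuous_on_iff by meson
    show "\<exists>\<delta>>0. \<forall>r'\<in>{b..c}. norm (r' - r) < \<delta> \<longrightarrow>
       norm (Q (X r') - prim \<gamma> r' - (Q (X r) - prim \<gamma> r) - 0) \<le> e * norm (r' - r)"
    proof (rule exI[of _ "min (\<delta>1 / (K + 1)) \<delta>2"], intro conjI ballI impI)
      fix r' assume r': "r' \<in> {b..c}" and n: "norm (r' - r) < min (\<delta>1 / (K + 1)) \<delta>2"
      have nX: "norm (X r' - X r) \<le> K * \<bar>r' - r\<bar>" using X[OF r r'] a.prim_diff_le by simp
      also have "\<dots> \<le> (K + 1) * \<bar>r' - r\<bar>" by (simp add: mult_right_mono)
      also have "\<dots> < \<delta>1" using n K by (auto simp: field_simps)
      finally have "norm (Q (X r') - Q (X r) - d r \<bullet> (X r' - X r)) \<le> e1 * norm (X r' - X r)"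
        using \<delta>1(2)[OF S[OF r']] by blast
      also have "\<dots> \<le> e1 * (K * \<bar>r' - r\<bar>)" using nX e1 by (intro mult_left_mono) auto
      finally have 1: "\<bar>Q (X r') - Q (X r) - d r \<bullet> (X r' - X r)\<bar> \<le> e1 * K * \<bar>r' - r\<bar>" by simp
      have 2: "\<bar>prim \<gamma> r' - prim \<gamma> r - d r \<bullet> (prim \<alpha> r' - prim \<alpha> r)\<bar> \<le> e1 * K * \<bar>r' - r\<bar>"
      proof (rule prim_inner_approx[OF a g])
        fix s assume s: "s \<in> {min r r'..max r r'}"
        then have "s \<in> {b..c}" "dist s r < \<delta>2" using r r' n by (auto simp: dist_real_def min_def max_def split: if_splits)
        then show "\<gamma> s = d s \<bullet> \<alpha> s \<and> norm (d s - d r) \<le> e1"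
          using \<delta>2(2)[of s] by (simp add: \<gamma>_def dist_norm)
      qed
      have "\<bar>(Q (X r') - prim \<gamma> r') - (Q (X r) - prim \<gamma> r)\<bar> \<le> e1 * K * \<bar>r' - r\<bar> + e1 * K * \<bar>r' - r\<bar>"
        using 1 2 unfolding X[OF r r'] by linarith
      also have "\<dots> \<le> e * \<bar>r' - r\<bar>"
        using mult_right_mono[OF e1(2), of "\<bar>r' - r\<bar>"] by (simp add: algebra_simps)
      finally show "norm (Q (X r') - prim \<gamma> r' - (Q (X r) - prim \<gamma> r) - 0) \<le> e * norm (r' - r)" by simp
    qed (use \<delta>1 \<delta>2 K in auto)
  qed simp
  then have "\<exists>k. \<forall>r\<in>{b..c}. Q (X r) - prim \<gamma> r = k"
    by (intro has_derivative_zero_constant) simp_all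
  then obtain k where k: "\<And>r. r \<in> {b..c} \<Longrightarrow> Q (X r) - prim \<gamma> r = k" by blast
  have "Q (X b) - prim \<gamma> b = Q (X c) - prim \<gamma> c"
    using k[of b] k[of c] bc by simp
  then have "Q (X c) - Q (X b) = (LINT r:{b..c}|lborel. \<gamma> r)"
    using g.prim_diff_Icc[OF bc] by simp
  also have "\<dots> = (LINT r:{b..c}|lborel. d r \<bullet> \<alpha> r)"
    by (rule set_lebesgue_integral_cong) (auto simp: \<gamma>_def)
  finally show ?thesis .
qed

section \<open>The heat kernel\<close>

lemma integrable_gexp_bound:
  fixes f :: "real^'n \<Rightarrow> real"
  assumes "f \<in> borel_measurable borel" "0 < C" "\<And>x. \<bar>f x\<bar> \<le> K * gexp C x"
  shows "integrable lborel f"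
  by (rule Bochner_Integration.integrable_bound[where f="\<lambda>x. K * gexp C x"])
     (use assms gexp_integral(1) order_trans[OF abs_ge_zero assms(3)] in auto)

lemma gauss_measurable:
  assumes "posdef A"
  shows "gauss A \<in> borel_measurable borel" "(\<lambda>x. gauss_hess A x $ i $ j) \<in> borel_measurable borel"
    "(\<lambda>x. - (1/2) * (matrix_inv A *v x) $ i * gauss A x) \<in> borel_measurable borel"
  by (intro borel_measurable_continuous_onI continuous_intros continuous_on_gauss assms)+

lemma gauss_integrable:
  fixes A :: "real^'n^'n"
  assumes e: "elliptic c C A"
  shows "integrable lborel (gauss A)" "integrable lborel (\<lambda>x. gauss_hess A x $ i $ j)"
    "(LINT x|lborel. gauss_hess A x $ i $ j) = 0"
proof -
  note p = elliptic_pos[OF e] and pd = elliptic_imp_posdef[OF e]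
  show "integrable lborel (gauss A)"
    by (rule integrable_gexp_bound[OF _ p(3), where K="gcon c TYPE('n)"])
       (use gauss_le[OF e] gauss_measurable[OF pd] in \<open>auto simp: gauss_nonneg\<close>)
  have C2: "0 < 2 * C" using p by simp
  have "integrable lborel (\<lambda>x. - (1/2) * (matrix_inv A *v x) $ j * gauss A x)"
    by (rule integrable_gexp_bound[OF _ C2, where K="gcon c TYPE('n) * ((1 + 8 * C) / (2 * c))"])
       (use gauss_hess_le(2)[OF e] gauss_measurable[OF pd] in blast)+
  moreover show "integrable lborel (\<lambda>x. gauss_hess A x $ i $ j)"
    by (rule integrable_gexp_bound[OF _ C2, where K="gcon c TYPE('n) * (2 * C / c\<^sup>2 + 1 / (2 * c))"])
       (use gauss_hess_le(1)[OF e] gauss_measurable[OF pd] in blast)+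
  ultimately show "(LINT x|lborel. gauss_hess A x $ i $ j) = 0"
    using gauss_pd(2)[OF pd] by (intro integral_pd_eq_0[where i=i and h="\<lambda>x. - (1/2) * (matrix_inv A *v x) $ j * gauss A x"])
       (auto intro!: continuous_intros continuous_on_gauss pd)
qed

lemma elliptic_convex:
  fixes A B :: "real^'n^'n"
  assumes A: "elliptic c C A" and B: "elliptic c C B" and u: "0 \<le> u" "u \<le> 1"
  shows "elliptic c C (A + u *\<^sub>R (B - A))"
  unfolding elliptic_def
proof (intro conjI allI)
  show "0 < c" using A by (simp add: elliptic_def)
  have "transpose A = A" "transpose B = B" using A B by (auto simp: elliptic_def)
  then show "transpose (A + u *\<^sub>R (B - A)) = A + u *\<^sub>R (B - A)"
    by (simp add: transpose_def vec_eq_iff)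
  fix x
  have e: "((A + u *\<^sub>R (B - A)) *v x) \<bullet> x = (1 - u) * ((A *v x) \<bullet> x) + u * ((B *v x) \<bullet> x)"
    by (simp add: inner_matrix_vector_eq_outer inner_add_left inner_diff_left algebra_simps)
  have "c * (norm x)\<^sup>2 = (1 - u) * (c * (norm x)\<^sup>2) + u * (c * (norm x)\<^sup>2)" by algebra
  also have "\<dots> \<le> ((A + u *\<^sub>R (B - A)) *v x) \<bullet> x"
    unfolding e using A B u by (intro add_mono mult_left_mono) (auto simp: elliptic_def)
  finally show "c * (norm x)\<^sup>2 \<le> ((A + u *\<^sub>R (B - A)) *v x) \<bullet> x" .
  have "((A + u *\<^sub>R (B - A)) *v x) \<bullet> x \<le> (1 - u) * (C * (norm x)\<^sup>2) + u * (C * (norm x)\<^sup>2)"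
    unfolding e using A B u by (intro add_mono mult_left_mono) (auto simp: elliptic_def)
  also have "\<dots> = C * (norm x)\<^sup>2" by algebra
  finally show "((A + u *\<^sub>R (B - A)) *v x) \<bullet> x \<le> C * (norm x)\<^sup>2" .
qed

lemma elliptic_weaken:
  assumes "elliptic c C A" "0 < c'" "c' \<le> c" "C \<le> C'"
  shows "elliptic c' C' A"
proof -
  have "c' * (norm x)\<^sup>2 \<le> c * (norm x)\<^sup>2" "C * (norm x)\<^sup>2 \<le> C' * (norm x)\<^sup>2" for x :: "real^'b"
    using assms by (auto intro: mult_right_mono)
  then show ?thesis using assms unfolding elliptic_def by (meson order_trans)
qed

text \<open>A homotopy from the identity takes the place of a change of variables. Along the segment
  from I to A the derivative of the density is its Hessian contracted with A - I, and the Hessian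
  has integral zero; Fubini then shows that the mass does not change.\<close>

lemma gauss_integral:
  fixes A :: "real^'n^'n"
  assumes "elliptic c C A"
  shows "(LINT x|lborel. gauss A x) = 1"
proof -
  \<comment> \<open>Constants common to A and the identity, hence to the whole segment; they provide
    one Gaussian majorant for Fubini.\<close>
  define c' C' where "c' = min c 1" and "C' = max C 1"
  define I :: "real^'n^'n" where "I = mat 1"
  note p = elliptic_pos[OF assms]
  have eA: "elliptic c' C' A" by (rule elliptic_weaken[OF assms]) (use p in \<open>auto simp: c'_def C'_def\<close>)
  have eI: "elliptic c' C' I" unfolding I_def
    by (rule elliptic_weaken[OF gauss_mat(2)[of 1]]) (use p in \<open>auto simp: c'_def C'_def\<close>)
  define X where "X u = I + u *\<^sub>R (A - I)" for u
  have eX: "elliptic c' C' (X u)" if "u \<in> {0..1}" for u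
    unfolding X_def using that elliptic_convex[OF eI eA] by auto
  note pX = elliptic_imp_posdef[OF eX]
  have cX: "continuous_on T (\<lambda>z. X (u z))" if "continuous_on T u" for T and u :: "'z::topological_space \<Rightarrow> real"
    unfolding X_def by (intro continuous_intros that)
  have bb: "bounded_borel (\<lambda>_. A - I) (norm (A - I))" by standard auto
  have pr: "prim (\<lambda>_. A - I) r' - prim (\<lambda>_. A - I) r = (r' - r) *\<^sub>R (A - I)" for r r'
  proof -
    have *: "prim (\<lambda>_. A - I) r' - prim (\<lambda>_. A - I) r = (r' - r) *\<^sub>R (A - I)" if "r \<le> r'" for r r'
      unfolding bounded_borel.prim_diff_Icc[OF bb that] set_lebesgue_integral_def
      by (subst integral_scaleR_left) (use that in \<open>simp_all add: integrable_indicat_Icc\<close>)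
    show ?thesis
      using *[of r r'] *[of r' r] by (cases "r \<le> r'") (simp_all add: algebra_simps)
  qed
  have line: "gauss A x - gauss I x = (LINT u:{0..1}|lborel. gauss_hess (X u) x \<bullet> (A - I))" for x
  proof -
    have "gauss (X 1) x - gauss (X 0) x = (LINT u:{0..1}|lborel. gauss_hess (X u) x \<bullet> (A - I))"
    proof (rule path_FTC[OF _ bb, where S="Collect posdef"])
      show "continuous_on {0..1} (\<lambda>u. gauss_hess (X u) x)"
        by (intro continuous_on_gauss cX continuous_intros pX)
    qed (use pX gauss_has_derivative pr in \<open>auto simp: X_def scaleR_left_diff_distrib\<close>)
    then show ?thesis by (simp add: X_def)
  qed
  define G where "G = (\<lambda>(u::real, x::real^'n). indicator {0..1} u *\<^sub>R (gauss_hess (X u) x \<bullet> (A - I)))"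
  define K where "K = gcon c' TYPE('n) * (2 * C' / c'\<^sup>2 + 1 / (2 * c'))"
  define N where "N = (\<Sum>i\<in>UNIV. \<Sum>j\<in>UNIV. \<bar>(A - I) $ i $ j\<bar>)"
  have Gb: "\<bar>G (u, x)\<bar> \<le> indicator {0..1} u * (K * N * gexp (2 * C') x)" for u x
  proof (cases "u \<in> {0..1}")
    case True
    have "\<bar>gauss_hess (X u) x \<bullet> (A - I)\<bar> \<le> (\<Sum>i\<in>UNIV. \<Sum>j\<in>UNIV. \<bar>gauss_hess (X u) x $ i $ j * (A - I) $ i $ j\<bar>)"
      unfolding inner_matrix_eq_sum by (intro order_trans[OF sum_abs] sum_mono order_refl)
    also have "\<dots> \<le> (\<Sum>i\<in>UNIV. \<Sum>j\<in>UNIV. (K * gexp (2 * C') x) * \<bar>(A - I) $ i $ j\<bar>)"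
      unfolding abs_mult K_def by (intro sum_mono mult_right_mono gauss_hess_le(1)[OF eX[OF True]]) simp
    also have "\<dots> = K * N * gexp (2 * C') x" by (simp add: N_def sum_distrib_left[symmetric])
    finally show ?thesis using True by (simp add: G_def)
  qed (simp add: G_def)
  have Gm: "G \<in> borel_measurable (lborel \<Otimes>\<^sub>M lborel)"
  proof -
    have "(\<lambda>z. indicator ({0..1} \<times> UNIV) z *\<^sub>R (gauss_hess (X (fst z)) (snd z) \<bullet> (A - I))) \<in> borel_measurable (borel :: (real \<times> (real^'n)) measure)"
      by (rule borel_measurable_continuous_on_indicator)
         (auto intro!: borel_closed closed_Times continuous_intros continuous_on_gauss cX pX)
    also have "(\<lambda>z. indicator ({0..1} \<times> UNIV) z *\<^sub>R (gauss_hess (X (fst z)) (snd z) \<bullet> (A - I))) = G"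
      by (auto simp: G_def fun_eq_iff indicator_def)
    finally show ?thesis by (simp add: lborel_prod)
  qed
  have C': "0 < 2 * C'" by (simp add: C'_def)
  have i1: "integrable lborel (\<lambda>x. G (u, x))" for u
    by (rule integrable_gexp_bound[OF _ C', where K="indicator {0..1} u * (K * N)"])
       (use Gm Gb in \<open>auto simp: mult.assoc\<close>)
  have Gi: "integrable (lborel \<Otimes>\<^sub>M lborel) G"
  proof (rule lborel_pair.Fubini_integrable[OF Gm])
    let ?J = "LINT x|lborel. K * N * gexp (2 * C') (x::real^'n)"
    show "integrable lborel (\<lambda>u. LINT x|lborel. norm (G (u, x)))"
    proof (rule Bochner_Integration.integrable_bound[where f="\<lambda>u. indicator {0..1} u * ?J"])
      show "(\<lambda>u. LINT x|lborel. norm (G (u, x))) \<in> borel_measurable lborel"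
        using Gm by measurable
      have "norm (LINT x|lborel. norm (G (u, x))) \<le> norm (indicator {0..1} u * ?J)" for u
      proof -
        have "(LINT x|lborel. norm (G (u, x))) \<le> (LINT x|lborel. indicator {0..1} u * (K * N * gexp (2 * C') (x::real^'n)))"
          by (intro integral_mono) (use i1 Gb gexp_integral(1)[OF C'] in auto)
        then have "(LINT x|lborel. norm (G (u, x))) \<le> indicator {0..1} u * ?J" by simp
        moreover have "0 \<le> (LINT x|lborel. norm (G (u, x)))" by simp
        ultimately show ?thesis by (simp add: order_trans[OF _ abs_ge_self])
      qed
      then show "AE u in lborel. norm (LINT x|lborel. norm (G (u, x))) \<le> norm (indicator {0..1} u * ?J)"
        by (rule AE_I2)
    qed simp
  qed (use i1 in simp)
  have G0: "(LINT x|lborel. G (u, x)) = 0" for u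
  proof (cases "u \<in> {0..1}")
    case True
    note gi = gauss_integrable[OF eX[OF True]]
    have "(LINT x|lborel. G (u, x)) = (\<Sum>i\<in>UNIV. \<Sum>j\<in>UNIV. LINT x|lborel. gauss_hess (X u) x $ i $ j * (A - I) $ i $ j)"
      using True by (simp add: G_def inner_matrix_eq_sum integral_sum gi integrable_sum del: vector_minus_component)
    also have "\<dots> = 0" by (simp add: gi)
    finally show ?thesis .
  qed (simp add: G_def)
  have "(LINT x|lborel. gauss A x - gauss I x) = (LINT x|lborel. LINT u|lborel. G (u, x))"
    by (simp add: line set_lebesgue_integral_def G_def)
  also have "\<dots> = (LINT u|lborel. LINT x|lborel. G (u, x))"
    using lborel_pair.Fubini_integral[of "\<lambda>u x. G (u, x)"] Gi by simp
  also have "\<dots> = 0" by (simp add: G0)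
  finally have "(LINT x|lborel. gauss A x) = (LINT x|lborel. gauss I x)"
    by (simp add: gauss_integrable[OF eA] gauss_integrable[OF eI])
  also have "\<dots> = 1" unfolding I_def
    by (simp add: gauss_mat(1) gexp_integral(2))
  finally show ?thesis .
qed

lemma bounded_borel_matrix:
  fixes a :: "real \<Rightarrow> real^'n^'n"
  assumes "a \<in> borel_measurable borel" "\<And>t. elliptic c C (a t)"
  shows "\<bar>a t $ i $ j\<bar> \<le> C" "bounded_borel a (real CARD('n) * real CARD('n) * C)"
proof -
  show *: "\<bar>a t $ i $ j\<bar> \<le> C" for t i j
  proof -
    have "\<bar>(a t *v axis j 1) $ i\<bar> \<le> norm (a t *v axis j 1)" by (rule component_le_norm_cart)
    also have "\<dots> \<le> C * norm (axis j 1 :: real^'n)" by (rule elliptic_norm_bounds(3)[OF assms(2)])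
    finally show ?thesis by (simp add: matrix_vector_mult_axis_nth)
  qed
  show "bounded_borel a (real CARD('n) * real CARD('n) * C)"
  proof
    fix t
    have "norm (a t) \<le> (\<Sum>i\<in>UNIV. norm (a t $ i))" by (simp add: norm_vec_def L2_set_le_sum)
    also have "\<dots> \<le> (\<Sum>i\<in>UNIV. \<Sum>j\<in>UNIV. \<bar>a t $ i $ j\<bar>)" by (intro sum_mono norm_le_l1_cart)
    also have "\<dots> \<le> (\<Sum>i\<in>(UNIV::'n set). \<Sum>j\<in>(UNIV::'n set). C)" by (intro sum_mono *)
    finally show "norm (a t) \<le> real CARD('n) * real CARD('n) * C" by simp
  qed (rule assms(1))
qed

text \<open>Pairing \<open>a\<close> with the constant 1 makes time itself a coordinate of the path.
  The damping factor and the Gaussian can then be differentiated in one application of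
  \<open>path_FTC\<close>, and terms of the rate without the factor \<open>a\<close> fit the same
  scheme.\<close>

lemma prim_Pair:
  fixes f :: "real \<Rightarrow> 'a::euclidean_space" and g :: "real \<Rightarrow> 'b::euclidean_space"
  assumes f: "bounded_borel f K" and g: "bounded_borel g L"
  shows "bounded_borel (\<lambda>t. (f t, g t)) (K + L)"
    "prim (\<lambda>t. (f t, g t)) r' - prim (\<lambda>t. (f t, g t)) r = (prim f r' - prim f r, prim g r' - prim g r)"
proof -
  interpret f: bounded_borel f K by fact
  interpret g: bounded_borel g L by fact
  show b: "bounded_borel (\<lambda>t. (f t, g t)) (K + L)"
  proof
    show "norm (f t, g t) \<le> K + L" for t
      using norm_Pair_le[of "f t" "g t"] f.bound[of t] g.bound[of t] by linarith
  qed measurable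
  interpret fg: bounded_borel "\<lambda>t. (f t, g t)" "K + L" by fact
  have *: "prim (\<lambda>t. (f t, g t)) r' - prim (\<lambda>t. (f t, g t)) r = (prim f r' - prim f r, prim g r' - prim g r)"
    if "r \<le> r'" for r r'
  proof -
    have i: "integrable lborel (\<lambda>x. indicat_real {r..r'} x *\<^sub>R (f x, g x))"
      using fg.set_integrable_Icc[of r r'] by (simp add: set_integrable_def)
    show ?thesis
      unfolding fg.prim_diff_Icc[OF that] f.prim_diff_Icc[OF that] g.prim_diff_Icc[OF that] set_lebesgue_integral_def
      using integral_bounded_linear[OF bounded_linear_fst i] integral_bounded_linear[OF bounded_linear_snd i]
      by (simp add: prod_eq_iff)
  qed
  show "prim (\<lambda>t. (f t, g t)) r' - prim (\<lambda>t. (f t, g t)) r = (prim f r' - prim f r, prim g r' - prim g r)"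
  proof (cases "r \<le> r'")
    case False
    have "prim (\<lambda>t. (f t, g t)) r' - prim (\<lambda>t. (f t, g t)) r = - (prim (\<lambda>t. (f t, g t)) r - prim (\<lambda>t. (f t, g t)) r')"
      by simp
    also have "\<dots> = - (prim f r - prim f r', prim g r - prim g r')" using *[of r' r] False by simp
    finally show ?thesis by simp
  qed (rule *)
qed

lemma prim_const: "prim (\<lambda>_. k :: real) r' - prim (\<lambda>_. k) r = (r' - r) * k"
proof -
  have bb: "bounded_borel (\<lambda>_::real. k) (norm k)" by standard auto
  have *: "prim (\<lambda>_. k) r' - prim (\<lambda>_. k) r = (r' - r) * k" if "r \<le> r'" for r r'
    unfolding bounded_borel.prim_diff_Icc[OF bb that] using that by (simp add: set_lebesgue_integral_def)
  show ?thesis using *[of r r'] *[of r' r] by (cases "r \<le> r'") (simp_all add: algebra_simps)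
qed

section \<open>Bounded C2 data and integration by parts against a Gaussian\<close>

definition Cb :: "('a::topological_space \<Rightarrow> real) \<Rightarrow> bool" where
  "Cb h \<longleftrightarrow> continuous_on UNIV h \<and> bounded (range h)"

lemma Cb_D:
  assumes "Cb h"
  shows "continuous_on S h" "\<exists>B\<ge>0. \<forall>x. \<bar>h x\<bar> \<le> B"
proof -
  show "continuous_on S h" using assms continuous_on_subset by (auto simp: Cb_def)
  obtain B where B: "\<forall>x. \<bar>h x\<bar> \<le> B" using assms by (auto simp: Cb_def bounded_iff)
  then have "0 \<le> B" using abs_ge_zero order_trans by blast
  with B show "\<exists>B\<ge>0. \<forall>x. \<bar>h x\<bar> \<le> B" by blast
qed

lemma Cb_measurable: "Cb (h :: 'a::euclidean_space \<Rightarrow> real) \<Longrightarrow> h \<in> borel_measurable borel"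
  by (rule borel_measurable_continuous_onI[OF Cb_D(1)])

lemma has_pd_mult:
  assumes "has_pd i f f'" "has_pd i g g'"
  shows "has_pd i (\<lambda>x. f x * g x) (\<lambda>x. f' x * g x + f x * g' x)"
  unfolding has_pd_def
proof
  fix x
  have "((\<lambda>s. f (x + s *\<^sub>R axis i 1)) has_real_derivative f' x) (at 0)"
    "((\<lambda>s. g (x + s *\<^sub>R axis i 1)) has_real_derivative g' x) (at 0)"
    using assms unfolding has_pd_def by blast+
  from DERIV_mult[OF this]
  show "((\<lambda>s. f (x + s *\<^sub>R axis i 1) * g (x + s *\<^sub>R axis i 1)) has_real_derivative f' x * g x + f x * g' x) (at 0)"
    by (simp add: mult.commute add.commute)
qed

lemma has_pd_reflect:
  assumes "has_pd i f f'"
  shows "has_pd i (\<lambda>y. f (x - y)) (\<lambda>y. - f' (x - y))"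
  unfolding has_pd_def
proof
  fix y
  have "((\<lambda>s. f ((x - y) + s *\<^sub>R axis i 1)) has_real_derivative f' (x - y)) (at (- 0))"
    using assms unfolding has_pd_def by simp
  from DERIV_chain2[OF this DERIV_minus[OF DERIV_ident]]
  show "((\<lambda>s. f (x - (y + s *\<^sub>R axis i 1))) has_real_derivative - f' (x - y)) (at 0)"
    by (simp add: algebra_simps)
qed

text \<open>The derivatives are explicit arguments, because the potentials are later applied to them
  in place of h.\<close>

definition C2b :: "(real^'n \<Rightarrow> real) \<Rightarrow> ('n \<Rightarrow> real^'n \<Rightarrow> real) \<Rightarrow> ('n \<Rightarrow> 'n \<Rightarrow> real^'n \<Rightarrow> real) \<Rightarrow> bool" where
  "C2b h h1 h2 \<longleftrightarrow> Cb h \<and> (\<forall>j. has_pd j h (h1 j) \<and> Cb (h1 j)) \<and> (\<forall>i j. has_pd i (h1 j) (h2 i j) \<and> Cb (h2 i j))"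

lemma integrable_gauss_mult:
  fixes h :: "real^'n \<Rightarrow> real"
  assumes e: "elliptic c C A" and h: "Cb h"
  shows "integrable lborel (\<lambda>y. gauss A y * h (x - y))" (is ?A)
    "integrable lborel (\<lambda>y. - (1/2) * (matrix_inv A *v y) $ j * gauss A y * h (x - y))" (is ?B)
    "integrable lborel (\<lambda>y. gauss_hess A y $ i $ j * h (x - y))" (is ?C)
proof -
  note p = elliptic_pos[OF e] and pd = elliptic_imp_posdef[OF e]
  note m[measurable] = Cb_measurable[OF h] gauss_measurable[OF pd]
  obtain B where B: "0 \<le> B" "\<And>x. \<bar>h x\<bar> \<le> B" using Cb_D(2)[OF h] by blast
  have *: "integrable lborel (\<lambda>y. k y * h (x - y))"
    if k[measurable]: "k \<in> borel_measurable borel" and kb: "\<And>y. \<bar>k y\<bar> \<le> K * gexp C' y" and C': "0 < C'" for k K C'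
  proof (rule integrable_gexp_bound[OF _ C', where K="K * B"])
    show "\<bar>k y * h (x - y)\<bar> \<le> K * B * gexp C' y" for y
    proof -
      have "\<bar>k y\<bar> * \<bar>h (x - y)\<bar> \<le> (K * gexp C' y) * B"
        using kb[of y] B by (intro mult_mono) (auto intro: order_trans[OF abs_ge_zero])
      then show ?thesis by (simp add: abs_mult mult_ac)
    qed
  qed measurable
  show ?A by (rule *[OF m(2) _ p(3), where K="gcon c TYPE('n)"]) (use gauss_le[OF e] in \<open>simp add: gauss_nonneg\<close>)
  have C2: "0 < 2 * C" using p by simp
  show ?B by (rule *[OF m(4) gauss_hess_le(2)[OF e] C2])
  show ?C by (rule *[OF m(3) gauss_hess_le(1)[OF e] C2])
qed

text \<open>Two passes of \<open>integral_pd_eq_0\<close> on a product, one for each derivative. In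
  each pass the sign of the integration by parts is cancelled by the sign from reflecting the datum
  in x - y.\<close>

lemma gauss_integration_by_parts:
  fixes h :: "real^'n \<Rightarrow> real"
  assumes e: "elliptic c C A" and h: "C2b h h1 h2"
  shows "(LINT y|lborel. gauss_hess A y $ i $ j * h (x - y)) = (LINT y|lborel. gauss A y * h2 i j (x - y))"
proof -
  note p = elliptic_pos[OF e] and pd = elliptic_imp_posdef[OF e]
  note [continuous_intros] = continuous_on_gauss
  have C: "Cb h" "Cb (h1 j)" "Cb (h2 i j)" and d: "has_pd j h (h1 j)" "has_pd i (h1 j) (h2 i j)"
    using h by (auto simp: C2b_def)
  define g1 where "g1 y = - (1/2) * (matrix_inv A *v y) $ i * gauss A y" for y
  have g1: "has_pd i (gauss A) g1" unfolding g1_def by (rule gauss_pd(1)[OF pd])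
  have g2: "has_pd j g1 (\<lambda>y. gauss_hess A y $ j $ i)" unfolding g1_def by (rule gauss_pd(2)[OF pd])
  have sym: "gauss_hess A y $ j $ i = gauss_hess A y $ i $ j" for y
    using arg_cong[OF posdef_inverse(4)[OF pd], of "\<lambda>M. M $ i $ j"]
    by (simp add: gauss_hess_def outer_def transpose_def mult.commute)
  have ch: "continuous_on UNIV (\<lambda>y. k (x - y))" if "Cb k" for k :: "real^'n \<Rightarrow> real"
    by (rule continuous_on_compose2[OF Cb_D(1)[OF that]]) (auto intro!: continuous_intros)
  have cg: "continuous_on UNIV g1" "continuous_on UNIV (gauss A)" "continuous_on UNIV (\<lambda>y. gauss_hess A y $ j $ i)"
    unfolding g1_def by (auto intro!: continuous_intros continuous_on_gauss pd)
  note int = integrable_gauss_mult[OF e C(1)] integrable_gauss_mult[OF e C(2)] integrable_gauss_mult[OF e C(3)]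
  have ig: "integrable lborel (\<lambda>y. g1 y * h (x - y))" "integrable lborel (\<lambda>y. g1 y * h1 j (x - y))"
    unfolding g1_def by (rule int)+
  have "(LINT y|lborel. gauss_hess A y $ j $ i * h (x - y) + g1 y * - h1 j (x - y)) = 0"
    by (rule integral_pd_eq_0[OF has_pd_mult[OF g2 has_pd_reflect[OF d(1)]]])
       (use int ig in \<open>auto intro!: continuous_intros cg ch C\<close>)
  then have 1: "(LINT y|lborel. gauss_hess A y $ j $ i * h (x - y)) = (LINT y|lborel. g1 y * h1 j (x - y))"
    using int ig by simp
  have "(LINT y|lborel. g1 y * h1 j (x - y) + gauss A y * - h2 i j (x - y)) = 0"
    by (rule integral_pd_eq_0[OF has_pd_mult[OF g1 has_pd_reflect[OF d(2)]]])
       (use int ig in \<open>auto intro!: continuous_intros cg ch C\<close>)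
  then have 2: "(LINT y|lborel. g1 y * h1 j (x - y)) = (LINT y|lborel. gauss A y * h2 i j (x - y))"
    using int ig by simp
  show ?thesis using 1 2 by (simp add: sym)
qed

text \<open>Borel measurable and elliptic at every time, whereas admissible coefficients are
  elliptic almost everywhere; \<open>admissible_coeff_borel_version\<close> provides the
  reduction.\<close>

locale elliptic_coeff =
  fixes a :: "real \<Rightarrow> real^'n^'n" and \<Lambda> :: real
  assumes a_borel[measurable]: "a \<in> borel_measurable borel"
    and a_elliptic: "\<And>t. elliptic \<Lambda> (1 / \<Lambda>) (a t)"
begin

lemma Lambda_pos: "0 < \<Lambda>" using elliptic_pos[OF a_elliptic] by blast

sublocale a: bounded_borel a "real CARD('n) * real CARD('n) * (1 / \<Lambda>)"
  by (rule bounded_borel_matrix[OF a_borel a_elliptic])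

text \<open>The two end points of the interval separate, so that moving t or \<tau> means moving
  along one Lipschitz path.\<close>

lemma A_mat_eq: "0 \<le> \<tau> \<Longrightarrow> A_mat a t \<tau> = prim a t - prim a (t - \<tau>)"
  unfolding A_mat_def
  by (subst a.prim_diff_Icc) (auto simp: set_lebesgue_integral_def integral_completion)

lemma A_mat_elliptic:
  assumes "0 < \<tau>"
  shows "elliptic (\<Lambda> * \<tau>) (\<tau> / \<Lambda>) (A_mat a t \<tau>)"
proof -
  have e: "A_mat a t \<tau> = (LINT r:{t-\<tau>..t}|lborel. a r)"
    using assms by (simp add: A_mat_eq a.prim_diff_Icc)
  note si = a.set_integrable_Icc[of "t-\<tau>" t, unfolded set_integrable_def]
  have i: "A_mat a t \<tau> \<bullet> M = (LINT r:{t-\<tau>..t}|lborel. a r \<bullet> M)" for M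
    unfolding e set_lebesgue_integral_def using si by (subst integral_inner_left[symmetric]) auto
  have ii: "set_integrable lborel {t-\<tau>..t} (\<lambda>r. a r \<bullet> M)" for M
    using integrable_inner_left[OF si, of M] by (simp add: set_integrable_def)
  have ic: "set_integrable lborel {t-\<tau>..t} (\<lambda>r. k)" for k :: real
    by (simp add: set_integrable_def integrable_indicat_Icc)
  have lc: "(LINT r:{t-\<tau>..t}|lborel. k) = \<tau> * k" for k :: real
    using assms by (simp add: set_lebesgue_integral_def)
  have "transpose (A_mat a t \<tau>) $ i $ j = A_mat a t \<tau> $ i $ j" for i j
  proof -
    have o: "M $ k $ l = M \<bullet> outer (axis k 1) (axis l 1)" for M :: "real^'n^'n" and k l
      using inner_matrix_vector_eq_outer[of M "axis l 1" "axis k 1"]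
      by (simp add: inner_axis matrix_vector_mult_axis_nth)
    have "a r $ i $ j = a r $ j $ i" for r
      using arg_cong[OF elliptic_pos(4)[OF a_elliptic[of r]], of "\<lambda>M. M $ j $ i"] by (simp add: transpose_def)
    then have "A_mat a t \<tau> $ i $ j = A_mat a t \<tau> $ j $ i" unfolding o i by simp
    then show ?thesis by (simp add: transpose_def)
  qed
  then have t: "transpose (A_mat a t \<tau>) = A_mat a t \<tau>" by (simp add: vec_eq_iff)
  {
    fix x
    have b: "\<Lambda> * (norm x)\<^sup>2 \<le> a r \<bullet> outer x x" "a r \<bullet> outer x x \<le> (1 / \<Lambda>) * (norm x)\<^sup>2" for r
      using a_elliptic[of r] unfolding elliptic_def inner_matrix_vector_eq_outer by blast+
    have "(LINT r:{t-\<tau>..t}|lborel. \<Lambda> * (norm x)\<^sup>2) \<le> (LINT r:{t-\<tau>..t}|lborel. a r \<bullet> outer x x)"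
      by (rule set_integral_mono[OF ic ii b(1)])
    moreover have "(LINT r:{t-\<tau>..t}|lborel. a r \<bullet> outer x x) \<le> (LINT r:{t-\<tau>..t}|lborel. (1 / \<Lambda>) * (norm x)\<^sup>2)"
      by (rule set_integral_mono[OF ii ic b(2)])
    ultimately have "\<Lambda> * \<tau> * (norm x)\<^sup>2 \<le> A_mat a t \<tau> \<bullet> outer x x \<and> A_mat a t \<tau> \<bullet> outer x x \<le> \<tau> / \<Lambda> * (norm x)\<^sup>2"
      by (simp add: i lc mult_ac)
  }
  with t show ?thesis
    using assms Lambda_pos unfolding elliptic_def inner_matrix_vector_eq_outer by auto
qed

lemmas A_mat_posdef = elliptic_imp_posdef[OF A_mat_elliptic]

lemma continuous_on_prim: "continuous_on S (prim a)"
proof (rule continuous_onI)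
  fix x e :: real assume e: "0 < e"
  define Ka where "Ka = real CARD('n) * real CARD('n) * (1 / \<Lambda>)"
  show "\<exists>d>0. \<forall>x'\<in>S. dist x' x < d \<longrightarrow> dist (prim a x') (prim a x) \<le> e"
  proof (rule exI[of _ "e / (Ka + 1)"], intro conjI ballI impI)
    have K: "0 \<le> Ka" unfolding Ka_def by (rule a.K_nonneg)
    show "0 < e / (Ka + 1)" using e K by simp
    fix x' assume d: "dist x' x < e / (Ka + 1)"
    have "dist (prim a x') (prim a x) \<le> Ka * \<bar>x' - x\<bar>" using a.prim_diff_le by (simp add: dist_norm Ka_def)
    also have "\<dots> \<le> (Ka + 1) * \<bar>x' - x\<bar>" by (simp add: mult_right_mono)
    also have "\<dots> \<le> e" using d K by (simp add: dist_norm field_simps)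
    finally show "dist (prim a x') (prim a x) \<le> e" .
  qed
qed

lemma continuous_on_A_mat:
  assumes "continuous_on S t" "continuous_on S \<tau>" "\<And>z. z \<in> S \<Longrightarrow> 0 \<le> \<tau> z"
  shows "continuous_on S (\<lambda>z. A_mat a (t z) (\<tau> z))"
proof -
  have "continuous_on S (\<lambda>z. prim a (t z) - prim a (t z - \<tau> z))"
    by (intro continuous_intros continuous_on_compose2[OF continuous_on_prim[of UNIV]] assms) auto
  then show ?thesis by (rule continuous_on_eq) (simp add: A_mat_eq assms)
qed

lemma heat_kernel_eq: "heat_kernel a t \<tau> x = (if 0 < \<tau> then exp (- \<tau>) * gauss (A_mat a t \<tau>) x else 0)"
  by (simp add: heat_kernel_def gauss_def B_mat_def)

lemma heat_kernel_nonneg: "0 \<le> heat_kernel a t \<tau> x"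
  by (simp add: heat_kernel_eq gauss_nonneg)

lemma continuous_on_heat_kernel:
  assumes "continuous_on S t" "continuous_on S \<tau>" "continuous_on S x" "\<And>z. z \<in> S \<Longrightarrow> 0 < \<tau> z"
  shows "continuous_on S (\<lambda>z. heat_kernel a (t z) (\<tau> z) (x z))"
proof -
  have "continuous_on S (\<lambda>z. exp (- \<tau> z) * gauss (A_mat a (t z) (\<tau> z)) (x z))"
    by (intro continuous_intros continuous_on_gauss continuous_on_A_mat assms A_mat_posdef)
       (use assms in \<open>auto intro: less_imp_le\<close>)
  then show ?thesis by (rule continuous_on_eq) (simp add: heat_kernel_eq assms)
qed

lemma heat_kernel_measurable[measurable (raw)]:
  assumes [measurable]: "t \<in> borel_measurable M" "\<tau> \<in> borel_measurable M" "x \<in> borel_measurable M"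
  shows "(\<lambda>z. heat_kernel a (t z) (\<tau> z) (x z)) \<in> borel_measurable M"
proof -
  \<comment> \<open>The kernel is jointly continuous on this open set and zero off it; measurability
    in arbitrary measurable arguments follows by composition.\<close>
  let ?S = "{z :: real \<times> real \<times> (real^'n). 0 < fst (snd z)}"
  have o: "open ?S" by (intro open_Collect_less continuous_intros)
  have "(\<lambda>z. indicator ?S z *\<^sub>R heat_kernel a (fst z) (fst (snd z)) (snd (snd z))) \<in> borel_measurable borel"
    by (rule borel_measurable_continuous_on_indicator)
       (use o in \<open>auto intro!: continuous_on_heat_kernel continuous_intros\<close>)
  also have "(\<lambda>z. indicator ?S z *\<^sub>R heat_kernel a (fst z) (fst (snd z)) (snd (snd z)))
     = (\<lambda>z. heat_kernel a (fst z) (fst (snd z)) (snd (snd z)))"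
    by (auto simp: fun_eq_iff indicator_def heat_kernel_eq)
  finally have [measurable]: "(\<lambda>z. heat_kernel a (fst z) (fst (snd z)) (snd (snd z))) \<in> borel_measurable borel" .
  have "(\<lambda>z. (t z, \<tau> z, x z)) \<in> borel_measurable M" by measurable
  from measurable_compose[OF this \<open>(\<lambda>z. heat_kernel a (fst z) (fst (snd z)) (snd (snd z))) \<in> borel_measurable borel\<close>]
  show ?thesis by simp
qed

lemma heat_kernel_integral:
  assumes "0 < \<tau>"
  shows "integrable lborel (heat_kernel a t \<tau>)" "(LINT y|lborel. heat_kernel a t \<tau> y) = exp (- \<tau>)"
  using gauss_integrable(1)[OF A_mat_elliptic[OF assms, of t]] gauss_integral[OF A_mat_elliptic[OF assms, of t]] assms
  by (simp_all add: heat_kernel_eq[abs_def])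

lemma heat_kernel_le:
  assumes "0 < \<tau>"
  shows "heat_kernel a t \<tau> y \<le> exp (- \<tau>) * (gcon (\<Lambda> * \<tau>) TYPE('n) * gexp (\<tau> / \<Lambda>) y)"
  using gauss_le[OF A_mat_elliptic[OF assms, of t], of y] assms by (simp add: heat_kernel_eq)

end

section \<open>The heat flow and the Duhamel potential\<close>

lemma fst_snd_borel_measurable[measurable]:
  "fst \<in> borel_measurable (borel :: ('a::euclidean_space \<times> 'b::euclidean_space) measure)"
  "snd \<in> borel_measurable (borel :: ('a::euclidean_space \<times> 'b::euclidean_space) measure)"
  by (intro borel_measurable_continuous_onI continuous_intros)+

lemma has_pd_translate:
  assumes "has_pd i f f'"
  shows "has_pd i (\<lambda>x. f (x - y)) (\<lambda>x. f' (x - y))"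
  unfolding has_pd_def
proof
  fix x
  have "((\<lambda>s. f ((x - y) + s *\<^sub>R axis i 1)) has_real_derivative f' (x - y)) (at 0)"
    using assms unfolding has_pd_def by blast
  then show "((\<lambda>s. f (x + s *\<^sub>R axis i 1 - y)) has_real_derivative f' (x - y)) (at 0)"
    by (simp add: diff_add_eq)
qed

lemma integrable_mult_bounded:
  fixes k h :: "'z \<Rightarrow> real"
  assumes k: "integrable M k" and h[measurable]: "h \<in> borel_measurable M" and b: "\<And>z. \<bar>h z\<bar> \<le> B"
  shows "integrable M (\<lambda>z. k z * h z)"
proof (rule Bochner_Integration.integrable_bound[where f="\<lambda>z. k z * B"])
  have m[measurable]: "k \<in> borel_measurable M" using k by simp
  show "(\<lambda>z. k z * h z) \<in> borel_measurable M" by measurable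
  have "\<bar>k z\<bar> * \<bar>h z\<bar> \<le> \<bar>k z\<bar> * \<bar>B\<bar>" for z
    using b[of z] by (intro mult_left_mono) auto
  then show "AE z in M. norm (k z * h z) \<le> norm (k z * B)" by (simp add: abs_mult)
qed (use k in simp)

lemma continuous_on_integral_dominated:
  fixes f :: "'p::metric_space \<Rightarrow> 'z \<Rightarrow> real"
  assumes m: "\<And>p. p \<in> S \<Longrightarrow> f p \<in> borel_measurable M"
    and c: "\<And>z. continuous_on S (\<lambda>p. f p z)"
    and b: "\<And>p z. p \<in> S \<Longrightarrow> \<bar>f p z\<bar> \<le> w z" and w: "integrable M w"
  shows "continuous_on S (\<lambda>p. LINT z|M. f p z)"
  unfolding continuous_on_sequentially
proof (intro allI ballI impI, elim conjE)
  fix X p assume p: "p \<in> S" "\<forall>n. X n \<in> S" "X \<longlonglongrightarrow> p"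
  show "((\<lambda>p. LINT z|M. f p z) \<circ> X) \<longlonglongrightarrow> (LINT z|M. f p z)"
    unfolding o_def
  proof (rule integral_dominated_convergence[where w=w])
    show "AE z in M. (\<lambda>n. f (X n) z) \<longlonglongrightarrow> f p z"
      using c p unfolding continuous_on_sequentially o_def by blast
  qed (use m b w p in auto)
qed

lemma has_pd_diff_le:
  assumes h: "has_pd i h h'" and b: "\<And>x. \<bar>h' x\<bar> \<le> B"
  shows "\<bar>h (x + s *\<^sub>R axis i 1) - h x\<bar> \<le> B * \<bar>s\<bar>"
proof -
  have "norm (h (x + s *\<^sub>R axis i 1) - h (x + 0 *\<^sub>R axis i 1)) \<le> B * norm (s - 0)"
    by (rule field_differentiable_bound[where S=UNIV and f'="\<lambda>s. h' (x + s *\<^sub>R axis i 1)" and f="\<lambda>s. h (x + s *\<^sub>R axis i 1)"])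
       (use has_pd_line[OF h] b in auto)
  then show ?thesis by simp
qed

text \<open>By the mean value inequality the difference quotients of h are bounded by B', so |k| B'
  dominates and the limit passes under the integral.\<close>

lemma has_pd_integral:
  fixes k :: "'z \<Rightarrow> real" and h h' :: "'z \<Rightarrow> real^'n \<Rightarrow> real"
  assumes k: "integrable M k" and h: "\<And>z. has_pd i (h z) (h' z)"
    and m: "\<And>x. (\<lambda>z. h z x) \<in> borel_measurable M" "\<And>x. (\<lambda>z. h' z x) \<in> borel_measurable M"
    and b: "\<And>z x. \<bar>h z x\<bar> \<le> B" "\<And>z x. \<bar>h' z x\<bar> \<le> B'"
  shows "has_pd i (\<lambda>x. LINT z|M. k z * h z x) (\<lambda>x. LINT z|M. k z * h' z x)"
  unfolding has_pd_def has_field_derivative_iff tendsto_at_iff_sequentially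
proof (intro allI impI)
  fix x and X :: "nat \<Rightarrow> real" assume X: "\<forall>n. X n \<in> UNIV - {0}" "X \<longlonglongrightarrow> 0"
  note [measurable] = m borel_measurable_integrable[OF k]
  have int: "integrable M (\<lambda>z. k z * h z y)" for y
    by (rule integrable_mult_bounded[OF k m(1) b(1)])
  have eq: "((LINT z|M. k z * h z (x + X n *\<^sub>R axis i 1)) - (LINT z|M. k z * h z (x + 0 *\<^sub>R axis i 1))) / (X n - 0)
      = (LINT z|M. k z * ((h z (x + X n *\<^sub>R axis i 1) - h z x) / X n))" for n
  proof -
    have "(LINT z|M. k z * ((h z (x + X n *\<^sub>R axis i 1) - h z x) / X n))
        = (LINT z|M. (k z * h z (x + X n *\<^sub>R axis i 1) - k z * h z x) / X n)"
      by (simp add: right_diff_distrib)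
    also have "\<dots> = ((LINT z|M. k z * h z (x + X n *\<^sub>R axis i 1)) - (LINT z|M. k z * h z x)) / X n"
      by (simp only: integral_divide_zero Bochner_Integration.integral_diff[OF int int])
    finally have *: "(LINT z|M. k z * ((h z (x + X n *\<^sub>R axis i 1) - h z x) / X n))
        = ((LINT z|M. k z * h z (x + X n *\<^sub>R axis i 1)) - (LINT z|M. k z * h z x)) / X n" .
    show ?thesis unfolding * by simp
  qed
  show "((\<lambda>s. ((LINT z|M. k z * h z (x + s *\<^sub>R axis i 1)) - (LINT z|M. k z * h z (x + 0 *\<^sub>R axis i 1))) / (s - 0)) \<circ> X)
      \<longlonglongrightarrow> (LINT z|M. k z * h' z x)"
    unfolding o_def eq
  proof (rule integral_dominated_convergence[where w="\<lambda>z. \<bar>k z\<bar> * B'"])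
    show "integrable M (\<lambda>z. \<bar>k z\<bar> * B')" using k by simp
    show "AE z in M. (\<lambda>n. k z * ((h z (x + X n *\<^sub>R axis i 1) - h z x) / X n)) \<longlonglongrightarrow> k z * h' z x"
    proof (rule AE_I2)
      fix z
      have "((\<lambda>s. (h z (x + s *\<^sub>R axis i 1) - h z (x + 0 *\<^sub>R axis i 1)) / (s - 0)) \<circ> X) \<longlonglongrightarrow> h' z x"
        using h[of z] X unfolding has_pd_def has_field_derivative_iff tendsto_at_iff_sequentially by blast
      then show "(\<lambda>n. k z * ((h z (x + X n *\<^sub>R axis i 1) - h z x) / X n)) \<longlonglongrightarrow> k z * h' z x"
        by (intro tendsto_mult_left) (simp add: o_def)
    qed
    show "AE z in M. norm (k z * ((h z (x + X n *\<^sub>R axis i 1) - h z x) / X n)) \<le> \<bar>k z\<bar> * B'" for n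
    proof (rule AE_I2)
      fix z
      have "\<bar>h z (x + X n *\<^sub>R axis i 1) - h z x\<bar> / \<bar>X n\<bar> \<le> B'"
        using has_pd_diff_le[OF h b(2)] X(1) by (simp add: divide_le_eq)
      then have "\<bar>k z\<bar> * (\<bar>h z (x + X n *\<^sub>R axis i 1) - h z x\<bar> / \<bar>X n\<bar>) \<le> \<bar>k z\<bar> * B'"
        by (rule mult_left_mono) simp
      then show "norm (k z * ((h z (x + X n *\<^sub>R axis i 1) - h z x) / X n)) \<le> \<bar>k z\<bar> * B'"
        by (simp add: abs_mult)
    qed
  qed measurable
qed

context elliptic_coeff
begin

text \<open>A bound on the kernel that is independent of t, which allows dominated convergence when
  t varies. It stays integrable at \<tau> = 0 because its mass in y is a constant multiple of exp (-
  \<tau>).\<close>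

definition majorant :: "real \<times> (real^'n) \<Rightarrow> real" where
  "majorant z = (if 0 < fst z then exp (- fst z) * (gcon (\<Lambda> * fst z) TYPE('n) * gexp (fst z / \<Lambda>) (snd z)) else 0)"

lemma heat_kernel_le_majorant: "\<bar>heat_kernel a t \<tau> y\<bar> \<le> majorant (\<tau>, y)"
  using heat_kernel_le[of \<tau> t y] heat_kernel_nonneg[of t \<tau> y]
  by (auto simp: majorant_def heat_kernel_eq)

lemma majorant_nonneg: "0 \<le> majorant z"
  using heat_kernel_le_majorant[of 0 "fst z" "snd z"] by (simp add: order_trans[OF abs_ge_zero])

text \<open>The powers of \<tau> cancel between the constant and the mass of the Gaussian. The value
  m = 1 serves the majorant of the kernel, m = 2 its second moment.\<close>

lemma gcon_gexp_integral:
  assumes "0 < \<tau>" "0 < m"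
  shows "gcon (\<Lambda> * \<tau>) TYPE('n) * (LINT y|lborel. gexp (m * (\<tau> / \<Lambda>)) (y::real^'n))
    = sqrt (fact CARD('n)) * (m powr (real CARD('n) / 2) / \<Lambda> ^ CARD('n))"
proof -
  have L: "0 < \<Lambda>" by (rule Lambda_pos)
  have p: "sqrt (x ^ CARD('n)) = x powr (real CARD('n) / 2)" if "0 < x" for x
    using that by (simp add: powr_half_sqrt[symmetric] powr_realpow[symmetric] powr_powr)
  have "\<Lambda> ^ CARD('n) = \<Lambda> powr (real CARD('n) / 2) * \<Lambda> powr (real CARD('n) / 2)"
    using L by (simp add: powr_add[symmetric] powr_realpow)
  then show ?thesis
    using assms L
    by (simp add: gcon_def gexp_integral(2) real_sqrt_divide p powr_mult powr_divide)
qed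

lemma integrable_exp_Ioi: "integrable lborel (\<lambda>\<tau>::real. indicator {0<..} \<tau> * exp (- \<tau>))"
  and nn_integral_exp_Ioi: "(\<integral>\<^sup>+ \<tau>. indicator {0<..} \<tau> * ennreal (exp (- \<tau>)) \<partial>lborel) = 1"
proof -
  have "(\<integral>\<^sup>+ \<tau>. indicator {0<..} \<tau> * ennreal (exp (- \<tau>)) \<partial>lborel) = (\<integral>\<^sup>+ \<tau>. ennreal (\<tau> ^ 0 * exp (- \<tau>)) * indicator {0..} \<tau> \<partial>lborel)"
  proof (rule nn_integral_cong_AE)
    have "AE \<tau> in lborel. \<tau> \<noteq> (0::real)" by (rule AE_lborel_singleton)
    then show "AE \<tau> in lborel. indicator {0<..} \<tau> * ennreal (exp (- \<tau>)) = ennreal (\<tau> ^ 0 * exp (- \<tau>)) * indicator {0..} \<tau>"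
      by eventually_elim (auto simp: indicator_def)
  qed
  also have "\<dots> = 1" by (subst nn_intergal_power_times_exp_Ici) simp
  finally show *: "(\<integral>\<^sup>+ \<tau>. indicator {0<..} \<tau> * ennreal (exp (- \<tau>)) \<partial>lborel) = 1" .
  show "integrable lborel (\<lambda>\<tau>::real. indicator {0<..} \<tau> * exp (- \<tau>))"
  proof (rule integrableI_bounded)
    have "(\<integral>\<^sup>+ \<tau>. ennreal (norm (indicator {0<..} \<tau> * exp (- \<tau>) :: real)) \<partial>lborel)
       = (\<integral>\<^sup>+ \<tau>. indicator {0<..} \<tau> * ennreal (exp (- \<tau>)) \<partial>lborel)"
      by (intro nn_integral_cong) (auto simp: indicator_def)
    then show "(\<integral>\<^sup>+ \<tau>. ennreal (norm (indicator {0<..} \<tau> * exp (- \<tau>) :: real)) \<partial>lborel) < \<infinity>"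
      using * by simp
  qed measurable
qed

lemma gexp_integrable: "0 < m \<Longrightarrow> integrable lborel (gexp (m / \<Lambda>) :: real^'n \<Rightarrow> real)"
  by (rule gexp_integral(1)) (use Lambda_pos in simp)

lemma majorant_integrable: "integrable lborel majorant"
proof -
  have m: "majorant \<in> borel_measurable (lborel \<Otimes>\<^sub>M lborel)"
    unfolding lborel_prod majorant_def gcon_def gexp_def by measurable
  have "integrable (lborel \<Otimes>\<^sub>M lborel) majorant"
  proof (rule lborel_pair.Fubini_integrable[OF m])
    have "(LINT y|lborel. norm (majorant (\<tau>, y))) = (sqrt (fact CARD('n)) * (1 / \<Lambda> ^ CARD('n))) * (indicator {0<..} \<tau> * exp (- \<tau>))" for \<tau>
    proof (cases "0 < \<tau>")
      case True
      have "(LINT y|lborel. norm (majorant (\<tau>, y))) = (LINT y|lborel. majorant (\<tau>, y))"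
        by (simp add: majorant_nonneg)
      also have "\<dots> = exp (- \<tau>) * (gcon (\<Lambda> * \<tau>) TYPE('n) * (LINT y|lborel. gexp (1 * (\<tau> / \<Lambda>)) (y::real^'n)))"
        using True by (simp add: majorant_def)
      finally show ?thesis unfolding gcon_gexp_integral[OF True zero_less_one] using True by simp
    qed (simp add: majorant_def)
    then show "integrable lborel (\<lambda>\<tau>. LINT y|lborel. norm (majorant (\<tau>, y)))"
      using integrable_exp_Ioi by simp
    have "integrable lborel (\<lambda>y. majorant (\<tau>, y))" for \<tau>
      using gexp_integrable[of \<tau>] by (cases "0 < \<tau>") (simp_all add: majorant_def)
    then show "AE \<tau> in lborel. integrable lborel (\<lambda>y. majorant (\<tau>, y))" by simp
  qed
  then show ?thesis by (simp add: lborel_prod)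
qed

lemma heat_kernel_integrable_prod: "integrable lborel (\<lambda>z. heat_kernel a t (fst z) (snd z))"
  by (rule Bochner_Integration.integrable_bound[OF majorant_integrable])
     (use heat_kernel_le_majorant majorant_nonneg in \<open>auto intro!: AE_I2 simp: abs_of_nonneg\<close>)

lemma heat_kernel_integrable: "integrable lborel (heat_kernel a t \<tau>)"
proof (cases "0 < \<tau>")
  case False
  then have "heat_kernel a t \<tau> = (\<lambda>y. 0)" by (simp add: heat_kernel_eq fun_eq_iff)
  then show ?thesis by simp
qed (rule heat_kernel_integral)

text \<open>All lags are integrated over: those with \<tau> \<le> 0 drop out because the kernel is
  zero there, those with \<tau> \<ge> t because the sources considered vanish at nonpositive
  times.\<close>

definition duhamel :: "(real \<times> (real^'n) \<Rightarrow> real) \<Rightarrow> real \<Rightarrow> real^'n \<Rightarrow> real" where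
  "duhamel \<phi> t x = (LINT z|lborel. heat_kernel a t (fst z) (snd z) * \<phi> (t - fst z, x - snd z))"

text \<open>The evolution from time s to time t. For t \<le> s its value is 0; the datum itself
  appears only as the limit from the right at s.\<close>

definition flow :: "real \<Rightarrow> real \<Rightarrow> (real^'n \<Rightarrow> real) \<Rightarrow> real^'n \<Rightarrow> real" where
  "flow s t \<psi> x = (LINT y|lborel. heat_kernel a t (t - s) y * \<psi> (x - y))"

lemma Cb_slice: "Cb \<phi> \<Longrightarrow> Cb (\<lambda>x. \<phi> (t, x))"
proof -
  assume "Cb \<phi>"
  then have "continuous_on UNIV (\<lambda>x. \<phi> (t, x))"
    by (intro continuous_on_compose2[OF Cb_D(1)[of \<phi> UNIV]]) (auto intro!: continuous_intros)
  moreover have "bounded (range (\<lambda>x. \<phi> (t, x)))"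
    using \<open>Cb \<phi>\<close> unfolding Cb_def by (blast intro: bounded_subset)
  ultimately show ?thesis by (simp add: Cb_def)
qed

lemma Cb_duhamel_integrable:
  assumes "Cb \<phi>"
  shows "integrable lborel (\<lambda>z. heat_kernel a t (fst z) (snd z) * \<phi> (t - fst z, x - snd z))"
proof -
  note [measurable] = Cb_measurable[OF assms]
  obtain B where "\<And>z. \<bar>\<phi> z\<bar> \<le> B" using Cb_D(2)[OF assms] by blast
  then show ?thesis
    by (intro integrable_mult_bounded[OF heat_kernel_integrable_prod, where B=B]) auto
qed

lemma Cb_flow_integrable:
  assumes "Cb \<psi>"
  shows "integrable lborel (\<lambda>y. heat_kernel a t \<tau> y * \<psi> (x - y))"
proof -
  note [measurable] = Cb_measurable[OF assms]
  obtain B where "\<And>z. \<bar>\<psi> z\<bar> \<le> B" using Cb_D(2)[OF assms] by blast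
  then show ?thesis
    by (intro integrable_mult_bounded[OF heat_kernel_integrable, where B=B]) auto
qed

lemma duhamel_continuous:
  assumes "Cb \<phi>"
  shows "continuous_on UNIV (\<lambda>(t, x). duhamel \<phi> t x)"
proof -
  note [measurable] = Cb_measurable[OF assms]
  obtain B where B: "\<And>z. \<bar>\<phi> z\<bar> \<le> B" using Cb_D(2)[OF assms] by blast
  have "continuous_on UNIV (\<lambda>p. LINT z|lborel. heat_kernel a (fst p) (fst z) (snd z) * \<phi> (fst p - fst z, snd p - snd z))"
  proof (rule continuous_on_integral_dominated[where w="\<lambda>z. majorant z * B"])
    show "continuous_on UNIV (\<lambda>p. heat_kernel a (fst p) (fst z) (snd z) * \<phi> (fst p - fst z, snd p - snd z))" for z :: "real \<times> (real^'n)"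
    proof (cases "0 < fst z")
      case True
      show ?thesis
        by (intro continuous_intros continuous_on_heat_kernel continuous_on_compose2[OF Cb_D(1)[OF assms, of UNIV]])
           (use True in auto)
    qed (simp add: heat_kernel_eq)
    show "\<bar>heat_kernel a (fst p) (fst z) (snd z) * \<phi> (fst p - fst z, snd p - snd z)\<bar> \<le> majorant z * B" for p z
      unfolding abs_mult using heat_kernel_le_majorant[of "fst p" "fst z" "snd z"] B majorant_nonneg
      by (intro mult_mono) auto
    show "integrable lborel (\<lambda>z. majorant z * B)" using majorant_integrable by simp
  qed measurable
  then show ?thesis by (simp add: duhamel_def case_prod_beta)
qed

lemma heat_kernel_le_local:
  assumes "0 < m" "m \<le> \<tau>" "\<tau> \<le> m'"
  shows "\<bar>heat_kernel a t \<tau> y\<bar> \<le> gcon (\<Lambda> * m) TYPE('n) * gexp (m' / \<Lambda>) y"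
proof -
  have e: "elliptic (\<Lambda> * m) (m' / \<Lambda>) (A_mat a t \<tau>)"
    by (rule elliptic_weaken[OF A_mat_elliptic[of \<tau> t]])
       (use assms Lambda_pos in \<open>auto intro: mult_left_mono divide_right_mono\<close>)
  have "exp (- \<tau>) * gauss (A_mat a t \<tau>) y \<le> 1 * (gcon (\<Lambda> * m) TYPE('n) * gexp (m' / \<Lambda>) y)"
    by (intro mult_mono gauss_le[OF e]) (use assms in \<open>auto simp: gauss_nonneg\<close>)
  then show ?thesis using assms by (simp add: heat_kernel_eq gauss_nonneg)
qed

lemma flow_continuous:
  assumes "Cb \<psi>"
  shows "continuous_on ({s<..} \<times> UNIV) (\<lambda>(t, x). flow s t \<psi> x)"
proof -
  note [measurable] = Cb_measurable[OF assms]
  obtain B where B: "0 \<le> B" "\<And>z. \<bar>\<psi> z\<bar> \<le> B" using Cb_D(2)[OF assms] by blast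
  \<comment> \<open>The bound on the kernel degenerates as t approaches s. On a box where t - s
    stays between m and m' a single Gaussian dominates, and such boxes suffice for continuity at
    each point.\<close>
  have box: "continuous_on ({s + m<..<s + m'} \<times> UNIV) (\<lambda>p. LINT y|lborel. heat_kernel a (fst p) (fst p - s) y * \<psi> (snd p - y))"
    if m: "0 < m" "m < m'" for m m'
  proof (rule continuous_on_integral_dominated[where w="\<lambda>y. (gcon (\<Lambda> * m) TYPE('n) * gexp (m' / \<Lambda>) y) * B"])
    show "continuous_on ({s + m<..<s + m'} \<times> UNIV) (\<lambda>p. heat_kernel a (fst p) (fst p - s) y * \<psi> (snd p - y))" for y :: "real^'n"
      by (intro continuous_intros continuous_on_heat_kernel continuous_on_compose2[OF Cb_D(1)[OF assms, of UNIV]])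
         (use m in auto)
    show "\<bar>heat_kernel a (fst p) (fst p - s) y * \<psi> (snd p - y)\<bar> \<le> (gcon (\<Lambda> * m) TYPE('n) * gexp (m' / \<Lambda>) y) * B"
      if p: "p \<in> {s + m<..<s + m'} \<times> UNIV" for p and y :: "real^'n"
    proof -
      have h: "\<bar>heat_kernel a (fst p) (fst p - s) y\<bar> \<le> gcon (\<Lambda> * m) TYPE('n) * gexp (m' / \<Lambda>) y"
        by (rule heat_kernel_le_local) (use p m in auto)
      show ?thesis unfolding abs_mult
        using B order_trans[OF abs_ge_zero h] by (intro mult_mono h) auto
    qed
    show "integrable lborel (\<lambda>y. gcon (\<Lambda> * m) TYPE('n) * gexp (m' / \<Lambda>) (y::real^'n) * B)"
      using gexp_integrable[of m'] m by simp
  qed measurable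
  have "isCont (\<lambda>(t, x). flow s t \<psi> x) p" if p: "p \<in> {s<..} \<times> UNIV" for p
  proof -
    define d where "d = fst p - s"
    have d: "0 < d" using p by (auto simp: d_def)
    have "continuous_on ({s + d/2<..<s + 2*d} \<times> UNIV) (\<lambda>(t, x). flow s t \<psi> x)"
      using box[of "d/2" "2*d"] d by (simp add: flow_def case_prod_beta)
    moreover have "open ({s + d/2<..<s + 2*d} \<times> (UNIV :: (real^'n) set))" by (intro open_Times) auto
    moreover have "p \<in> {s + d/2<..<s + 2*d} \<times> UNIV" using d by (cases p) (auto simp: d_def field_simps)
    ultimately show ?thesis by (meson continuous_on_eq_continuous_at)
  qed
  then show ?thesis by (simp add: continuous_at_imp_continuous_on)
qed

lemma duhamel_has_pd:
  assumes "Cb \<phi>" "Cb \<phi>'" "\<And>t. has_pd i (\<lambda>x. \<phi> (t, x)) (\<lambda>x. \<phi>' (t, x))"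
  shows "has_pd i (duhamel \<phi> t) (duhamel \<phi>' t)"
proof -
  note [measurable] = Cb_measurable[OF assms(1)] Cb_measurable[OF assms(2)]
  obtain B where B: "\<And>z. \<bar>\<phi> z\<bar> \<le> B" using Cb_D(2)[OF assms(1)] by blast
  obtain B' where B': "\<And>z. \<bar>\<phi>' z\<bar> \<le> B'" using Cb_D(2)[OF assms(2)] by blast
  have tr: "has_pd i (\<lambda>x. \<phi> (r, x - y)) (\<lambda>x. \<phi>' (r, x - y))" for r y
    by (rule has_pd_translate[OF assms(3)])
  show ?thesis
    unfolding duhamel_def[abs_def]
    by (rule has_pd_integral[OF heat_kernel_integrable_prod, where B=B and B'=B'])
       (use tr B B' in auto)
qed

lemma flow_has_pd:
  assumes "Cb \<psi>" "Cb \<psi>'" "has_pd i \<psi> \<psi>'"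
  shows "has_pd i (flow s t \<psi>) (flow s t \<psi>')"
proof -
  note [measurable] = Cb_measurable[OF assms(1)] Cb_measurable[OF assms(2)]
  obtain B where B: "\<And>z. \<bar>\<psi> z\<bar> \<le> B" using Cb_D(2)[OF assms(1)] by blast
  obtain B' where B': "\<And>z. \<bar>\<psi>' z\<bar> \<le> B'" using Cb_D(2)[OF assms(2)] by blast
  have tr: "has_pd i (\<lambda>x. \<psi> (x - y)) (\<lambda>x. \<psi>' (x - y))" for y
    by (rule has_pd_translate[OF assms(3)])
  show ?thesis
    unfolding flow_def[abs_def]
    by (rule has_pd_integral[OF heat_kernel_integrable, where B=B and B'=B'])
       (use tr B B' in auto)
qed

lemma heat_kernel_integral_le: "(LINT y|lborel. heat_kernel a t \<tau> y) \<le> 1"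
proof (cases "0 < \<tau>")
  case True
  then show ?thesis using heat_kernel_integral(2)[OF True] by simp
qed (simp add: heat_kernel_eq)

lemma flow_le:
  assumes "Cb \<psi>" "\<And>x. \<bar>\<psi> x\<bar> \<le> B"
  shows "\<bar>flow s t \<psi> x\<bar> \<le> B"
proof -
  have B: "0 \<le> B" using assms(2)[of 0] abs_ge_zero order_trans by blast
  have "\<bar>flow s t \<psi> x\<bar> \<le> (LINT y|lborel. \<bar>heat_kernel a t (t - s) y * \<psi> (x - y)\<bar>)"
    unfolding flow_def by (rule integral_abs_bound)
  also have "\<dots> \<le> (LINT y|lborel. heat_kernel a t (t - s) y * B)"
  proof (rule integral_mono)
    show "integrable lborel (\<lambda>y. \<bar>heat_kernel a t (t - s) y * \<psi> (x - y)\<bar>)"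
      by (rule integrable_abs[OF Cb_flow_integrable[OF assms(1)]])
    show "integrable lborel (\<lambda>y. heat_kernel a t (t - s) y * B)"
      using heat_kernel_integrable by simp
  qed (use assms(2) in \<open>simp add: abs_mult heat_kernel_nonneg mult_left_mono\<close>)
  also have "\<dots> = (LINT y|lborel. heat_kernel a t (t - s) y) * B" by simp
  also have "\<dots> \<le> 1 * B" by (intro mult_right_mono heat_kernel_integral_le B)
  finally show ?thesis by simp
qed

lemma duhamel_le:
  assumes "Cb \<phi>" "\<And>x. \<bar>\<phi> x\<bar> \<le> B"
  shows "\<bar>duhamel \<phi> t x\<bar> \<le> B * (LINT z|lborel. majorant z)"
proof -
  have "\<bar>duhamel \<phi> t x\<bar> \<le> (LINT z|lborel. \<bar>heat_kernel a t (fst z) (snd z) * \<phi> (t - fst z, x - snd z)\<bar>)"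
    unfolding duhamel_def by (rule integral_abs_bound)
  also have "\<dots> \<le> (LINT z|lborel. majorant z * B)"
  proof (rule integral_mono)
    show "\<bar>heat_kernel a t (fst z) (snd z) * \<phi> (t - fst z, x - snd z)\<bar> \<le> majorant z * B" for z
      unfolding abs_mult using heat_kernel_le_majorant[of t "fst z" "snd z"] assms(2) majorant_nonneg
      by (intro mult_mono) auto
  qed (use Cb_duhamel_integrable[OF assms(1)] majorant_integrable in auto)
  finally show ?thesis by (simp add: mult.commute)
qed

end

section \<open>Evolution of the initial datum\<close>

lemma borel_measurable_vec_nth[measurable (raw)]:
  fixes f :: "'a \<Rightarrow> ('b::euclidean_space)^'n"
  assumes "f \<in> borel_measurable M"
  shows "(\<lambda>x. f x $ i) \<in> borel_measurable M"
  by (rule measurable_compose[OF assms borel_measurable_continuous_onI]) (intro continuous_intros)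

text \<open>The spatial majorant is the same for all times of the strip, so its mass times the
  length of the strip bounds the double integral.\<close>

lemma integrable_strip:
  fixes G :: "real \<times> (real^'n) \<Rightarrow> real"
  assumes m[measurable]: "G \<in> borel_measurable borel" and k: "integrable lborel k"
    and b: "\<And>r y. \<bar>G (r, y)\<bar> \<le> indicator {b..c} r * k y"
  shows "integrable (lborel \<Otimes>\<^sub>M lborel) G" "\<And>r. integrable lborel (\<lambda>y. G (r, y))"
proof -
  have m': "G \<in> borel_measurable (lborel \<Otimes>\<^sub>M lborel)" by (simp add: lborel_prod)
  have ik: "integrable lborel (\<lambda>y. indicator {b..c} r * k y)" for r using k by simp
  show i1: "integrable lborel (\<lambda>y. G (r, y))" for r
    by (rule Bochner_Integration.integrable_bound[OF ik[of r]])
       (use order_trans[OF b abs_ge_self] in auto)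
  show "integrable (lborel \<Otimes>\<^sub>M lborel) G"
  proof (rule lborel_pair.Fubini_integrable[OF m'])
    let ?J = "LINT x|lborel. k x"
    show "integrable lborel (\<lambda>r. LINT x|lborel. norm (G (r, x)))"
    proof (rule Bochner_Integration.integrable_bound[where f="\<lambda>r. indicator {b..c} r * ?J"])
      show "(\<lambda>r. LINT x|lborel. norm (G (r, x))) \<in> borel_measurable lborel"
        using m' by measurable
      have "norm (LINT x|lborel. norm (G (r, x))) \<le> norm (indicator {b..c} r * ?J)" for r
      proof -
        have "(LINT x|lborel. norm (G (r, x))) \<le> (LINT x|lborel. indicator {b..c} r * k x)"
          by (intro integral_mono) (use i1 b ik in auto)
        then have "(LINT x|lborel. norm (G (r, x))) \<le> indicator {b..c} r * ?J" by simp
        moreover have "0 \<le> (LINT x|lborel. norm (G (r, x)))" by simp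
        ultimately show ?thesis by (simp add: order_trans[OF _ abs_ge_self])
      qed
      then show "AE r in lborel. norm (LINT x|lborel. norm (G (r, x))) \<le> norm (indicator {b..c} r * ?J)"
        by (rule AE_I2)
    qed (simp add: integrable_indicat_Icc)
  qed (use i1 in simp)
qed

context elliptic_coeff
begin

text \<open>The value of a : D^2 u - u for u = \<open>flow s r \<psi>\<close>, with the second
  derivatives already on the datum; \<open>\<psi>2\<close> stands for the Hessian of \<psi>.\<close>

definition flow_rate :: "real \<Rightarrow> (real^'n \<Rightarrow> real) \<Rightarrow> ('n \<Rightarrow> 'n \<Rightarrow> real^'n \<Rightarrow> real) \<Rightarrow> real \<Rightarrow> real^'n \<Rightarrow> real" where
  "flow_rate s \<psi> \<psi>2 r x = (\<Sum>i\<in>UNIV. \<Sum>j\<in>UNIV. a r $ i $ j * flow s r (\<psi>2 i j) x) - flow s r \<psi> x"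

lemma flow_eq_gauss:
  "s < r \<Longrightarrow> flow s r \<psi> x = exp (- (r - s)) * (LINT y|lborel. gauss (A_mat a r (r - s)) y * \<psi> (x - y))"
  by (simp add: flow_def heat_kernel_eq mult.assoc)

text \<open>On an interval that stays away from s the matrices are elliptic with common constants.
  For fixed y the increment of the kernel is a time integral by \<open>path_FTC\<close>; Fubini
  moves the integral over y inside, and integration by parts converts the Hessian of the Gaussian
  into that of the datum.\<close>

lemma flow_step:
  assumes sb: "s < b" "b \<le> c" and \<psi>: "C2b \<psi> \<psi>1 \<psi>2"
  shows "flow s c \<psi> x - flow s b \<psi> x = (LINT r:{b..c}|lborel. flow_rate s \<psi> \<psi>2 r x)"
proof -
  note L = Lambda_pos
  have Cb: "Cb \<psi>" "Cb (\<psi>2 i j)" for i j using \<psi> by (auto simp: C2b_def)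
  note [measurable] = Cb_measurable[OF Cb(1)]
  obtain B where B: "0 \<le> B" "\<And>x. \<bar>\<psi> x\<bar> \<le> B" using Cb_D(2)[OF Cb(1)] by blast
  define c' C' where "c' = \<Lambda> * (b - s)" and "C' = (c - s) / \<Lambda>"
  define Ar where "Ar r = prim a r - prim a s" for r
  have ArA: "A_mat a r (r - s) = Ar r" if "s \<le> r" for r using that by (simp add: A_mat_eq Ar_def)
  have e: "elliptic c' C' (Ar r)" if "r \<in> {b..c}" for r
  proof -
    have "s < r" using that sb by auto
    then have "elliptic (\<Lambda> * (r - s)) ((r - s) / \<Lambda>) (Ar r)" using A_mat_elliptic[of "r - s" r] ArA by simp
    then show ?thesis
      by (rule elliptic_weaken) (use that sb L in \<open>auto simp: c'_def C'_def intro: mult_left_mono divide_right_mono\<close>)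
  qed
  note pd = elliptic_imp_posdef[OF e]
  have cA: "continuous_on T (\<lambda>z. Ar (u z))" if "continuous_on T u" for T and u :: "'z::topological_space \<Rightarrow> real"
    unfolding Ar_def by (intro continuous_intros continuous_on_compose2[OF continuous_on_prim[of UNIV]] that) auto
  have b1: "bounded_borel (\<lambda>_::real. 1::real) 1" by standard auto
  note bp = prim_Pair[OF a.bounded_borel_axioms b1]
  \<comment> \<open>The gradient of exp (- u) * gauss A y in the pair (A, u), along the path r
    \<mapsto> (Ar r, r - s) whose velocity is (a r, 1).\<close>
  define d where "d y r = (exp (- (r - s)) *\<^sub>R gauss_hess (Ar r) y, - (exp (- (r - s)) * gauss (Ar r) y))" for y r
  have ptw: "exp (- (c - s)) * gauss (Ar c) y - exp (- (b - s)) * gauss (Ar b) y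
      = (LINT r:{b..c}|lborel. exp (- (r - s)) * (gauss_hess (Ar r) y \<bullet> a r - gauss (Ar r) y))" for y
  proof -
    have "exp (- snd (Ar c, c - s)) * gauss (fst (Ar c, c - s)) y - exp (- snd (Ar b, b - s)) * gauss (fst (Ar b, b - s)) y
      = (LINT r:{b..c}|lborel. d y r \<bullet> (a r, 1))"
    proof (rule path_FTC[where Q="\<lambda>z. exp (- snd z) * gauss (fst z) y" and X="\<lambda>r. (Ar r, r - s)" and S="Collect posdef \<times> UNIV", OF sb(2) bp(1)])
      show "(Ar r', r' - s) - (Ar r, r - s) = prim (\<lambda>t. (a t, 1)) r' - prim (\<lambda>t. (a t, 1)) r" for r r'
        unfolding bp(2) prim_const by (simp add: Ar_def)
      show "continuous_on {b..c} (d y)"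
        unfolding d_def by (intro continuous_intros continuous_on_gauss cA pd)
      fix r assume r: "r \<in> {b..c}"
      then show "(Ar r, r - s) \<in> Collect posdef \<times> UNIV" using pd by simp
      have g: "((\<lambda>z::(real^'n^'n) \<times> real. gauss (fst z) y) has_derivative (\<lambda>H. gauss_hess (Ar r) y \<bullet> fst H)) (at (Ar r, r - s) within Collect posdef \<times> UNIV)"
        by (rule has_derivative_in_compose2[of "Collect posdef" "\<lambda>A. gauss A y" "\<lambda>A H. gauss_hess A y \<bullet> H" fst "Collect posdef \<times> UNIV" "(Ar r, r - s)" fst, simplified])
           (use gauss_has_derivative pd[OF r] in \<open>auto intro!: derivative_intros\<close>)
      show "((\<lambda>z. exp (- snd z) * gauss (fst z) y) has_derivative (\<lambda>H. d y r \<bullet> H)) (at (Ar r, r - s) within Collect posdef \<times> UNIV)"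
        by (rule derivative_eq_intros g refl)+ (auto simp: fun_eq_iff d_def inner_prod_def algebra_simps)
    qed
    then show ?thesis by (simp add: d_def algebra_simps)
  qed
  define K where "K = gcon c' TYPE('n) * (2 * C' / c'\<^sup>2 + 1 / (2 * c'))"
  define N where "N = real CARD('n) * real CARD('n) * (1 / \<Lambda>)"
  define K' where "K' = (K * N + gcon c' TYPE('n)) * B"
  have C': "0 < C'" "0 < 2 * C'" using sb L by (auto simp: C'_def)
  define G where "G = (\<lambda>(r, y). indicator {b..c} r * (exp (- (r - s)) * (gauss_hess (Ar r) y \<bullet> a r - gauss (Ar r) y) * \<psi> (x - y)))"
  have Gb: "\<bar>G (r, y)\<bar> \<le> indicator {b..c} r * (K' * gexp (2 * C') y)" for r y
  proof (cases "r \<in> {b..c}")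
    case True
    have "\<bar>gauss_hess (Ar r) y \<bullet> a r\<bar> \<le> (\<Sum>i\<in>UNIV. \<Sum>j\<in>UNIV. \<bar>gauss_hess (Ar r) y $ i $ j\<bar> * \<bar>a r $ i $ j\<bar>)"
      unfolding inner_matrix_eq_sum abs_mult[symmetric] by (intro order_trans[OF sum_abs] sum_mono order_refl)
    also have "\<dots> \<le> (\<Sum>i\<in>(UNIV::'n set). \<Sum>j\<in>(UNIV::'n set). (K * gexp (2 * C') y) * (1 / \<Lambda>))"
      unfolding K_def
      by (intro sum_mono mult_mono gauss_hess_le(1)[OF e[OF True]] bounded_borel_matrix(1)[OF a_borel a_elliptic]
          order_trans[OF abs_ge_zero gauss_hess_le(1)[OF e[OF True]]]) simp
    also have "\<dots> = K * N * gexp (2 * C') y" by (simp add: N_def)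
    finally have 1: "\<bar>gauss_hess (Ar r) y \<bullet> a r\<bar> \<le> K * N * gexp (2 * C') y" .
    have "gauss (Ar r) y \<le> gcon c' TYPE('n) * gexp C' y" by (rule gauss_le[OF e[OF True]])
    also have "\<dots> \<le> gcon c' TYPE('n) * gexp (2 * C') y"
      using C' elliptic_pos(1)[OF e[OF True]] by (intro mult_left_mono gexp_mono) (auto simp: gcon_def)
    finally have "\<bar>gauss_hess (Ar r) y \<bullet> a r - gauss (Ar r) y\<bar> \<le> (K * N + gcon c' TYPE('n)) * gexp (2 * C') y"
      using 1 gauss_nonneg[of "Ar r" y] by (simp add: distrib_right)
    moreover have "exp (- (r - s)) \<le> 1" using True sb by auto
    ultimately have "exp (- (r - s)) * \<bar>gauss_hess (Ar r) y \<bullet> a r - gauss (Ar r) y\<bar> \<le> 1 * ((K * N + gcon c' TYPE('n)) * gexp (2 * C') y)"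
      by (intro mult_mono) auto
    then have h: "exp (- (r - s)) * \<bar>gauss_hess (Ar r) y \<bullet> a r - gauss (Ar r) y\<bar> \<le> (K * N + gcon c' TYPE('n)) * gexp (2 * C') y"
      by simp
    have "exp (- (r - s)) * \<bar>gauss_hess (Ar r) y \<bullet> a r - gauss (Ar r) y\<bar> * \<bar>\<psi> (x - y)\<bar>
        \<le> ((K * N + gcon c' TYPE('n)) * gexp (2 * C') y) * B"
      by (rule mult_mono[OF h B(2)]) (auto intro: order_trans[OF _ h])
    then show ?thesis using True by (simp add: G_def abs_mult K'_def mult_ac)
  qed (simp add: G_def)
  have Gm: "G \<in> borel_measurable borel"
  proof -
    have 1: "(\<lambda>z. indicator ({b..c} \<times> UNIV) z *\<^sub>R gauss_hess (Ar (fst z)) (snd z)) \<in> borel_measurable (borel :: (real \<times> (real^'n)) measure)"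
      "(\<lambda>z. indicator ({b..c} \<times> UNIV) z *\<^sub>R gauss (Ar (fst z)) (snd z)) \<in> borel_measurable (borel :: (real \<times> (real^'n)) measure)"
      by (rule borel_measurable_continuous_on_indicator;
          auto intro!: borel_closed closed_Times continuous_intros continuous_on_gauss cA pd)+
    have "G = (\<lambda>z. exp (- (fst z - s)) * ((indicator ({b..c} \<times> UNIV) z *\<^sub>R gauss_hess (Ar (fst z)) (snd z)) \<bullet> a (fst z)
         - indicator ({b..c} \<times> UNIV) z *\<^sub>R gauss (Ar (fst z)) (snd z)) * \<psi> (x - snd z))"
      by (auto simp: G_def fun_eq_iff indicator_def)
    note eq = this and [measurable] = 1
    show ?thesis unfolding eq by measurable
  qed
  have "integrable lborel (\<lambda>y. K' * gexp (2 * C') (y::real^'n))" by (intro integrable_mult_right gexp_integral(1) C')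
  note Gi = integrable_strip[OF Gm this Gb]
  have "flow s c \<psi> x - flow s b \<psi> x = (LINT y|lborel. (exp (- (c - s)) * gauss (Ar c) y - exp (- (b - s)) * gauss (Ar b) y) * \<psi> (x - y))"
  proof -
    have "Ar c = A_mat a c (c - s)" "Ar b = A_mat a b (b - s)" using ArA sb by auto
    then show ?thesis
      using Cb_flow_integrable[OF Cb(1), of c "c - s" x] Cb_flow_integrable[OF Cb(1), of b "b - s" x] sb
      by (simp add: flow_def heat_kernel_eq left_diff_distrib)
  qed
  also have "\<dots> = (LINT y|lborel. LINT r|lborel. G (r, y))"
    unfolding ptw by (simp add: G_def set_lebesgue_integral_def mult.assoc[symmetric])
  also have "\<dots> = (LINT r|lborel. LINT y|lborel. G (r, y))"
    using lborel_pair.Fubini_integral[of "\<lambda>r y. G (r, y)"] Gi by simp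
  also have "\<dots> = (LINT r:{b..c}|lborel. flow_rate s \<psi> \<psi>2 r x)"
    unfolding set_lebesgue_integral_def
  proof (rule Bochner_Integration.integral_cong[OF refl])
    fix r
    show "(LINT y|lborel. G (r, y)) = indicator {b..c} r *\<^sub>R flow_rate s \<psi> \<psi>2 r x"
    proof (cases "r \<in> {b..c}")
      case True
      then have sr: "s < r" using sb by simp
      note er = e[OF True]
      note ig = integrable_gauss_mult[OF er Cb(1), where x=x]
      have "(LINT y|lborel. G (r, y)) = (LINT y|lborel. exp (- (r - s)) * ((\<Sum>i\<in>UNIV. \<Sum>j\<in>UNIV. a r $ i $ j * (gauss_hess (Ar r) y $ i $ j * \<psi> (x - y)))
            - gauss (Ar r) y * \<psi> (x - y)))"
      proof (rule Bochner_Integration.integral_cong[OF refl])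
        fix y
        have e: "(\<Sum>i\<in>UNIV. \<Sum>j\<in>UNIV. a r $ i $ j * (gauss_hess (Ar r) y $ i $ j * \<psi> (x - y))) = (gauss_hess (Ar r) y \<bullet> a r) * \<psi> (x - y)"
          by (simp add: inner_matrix_eq_sum sum_distrib_left sum_distrib_right mult_ac)
        show "G (r, y) = exp (- (r - s)) * ((\<Sum>i\<in>UNIV. \<Sum>j\<in>UNIV. a r $ i $ j * (gauss_hess (Ar r) y $ i $ j * \<psi> (x - y)))
            - gauss (Ar r) y * \<psi> (x - y))"
          unfolding e using True by (simp add: G_def algebra_simps)
      qed
      also have "\<dots> = exp (- (r - s)) * ((\<Sum>i\<in>UNIV. \<Sum>j\<in>UNIV. a r $ i $ j * (LINT y|lborel. gauss_hess (Ar r) y $ i $ j * \<psi> (x - y)))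
            - (LINT y|lborel. gauss (Ar r) y * \<psi> (x - y)))"
        using ig by (simp add: integrable_sum integral_sum)
      also have "\<dots> = exp (- (r - s)) * ((\<Sum>i\<in>UNIV. \<Sum>j\<in>UNIV. a r $ i $ j * (LINT y|lborel. gauss (Ar r) y * \<psi>2 i j (x - y)))
            - (LINT y|lborel. gauss (Ar r) y * \<psi> (x - y)))"
        by (simp only: gauss_integration_by_parts[OF er \<psi>])
      also have "\<dots> = flow_rate s \<psi> \<psi>2 r x"
        using sr by (simp add: flow_rate_def flow_eq_gauss ArA sum_distrib_left right_diff_distrib mult.left_commute)
      finally show ?thesis using True by simp
    qed (simp add: G_def)
  qed
  finally show ?thesis .
qed

text \<open>A Chebyshev argument. Near x the continuity of \<psi> is used; farther away the
  oscillation 2 B is at most 2 B |y|^2 / \<delta>^2, whose average against the kernel is of order b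
  - s. The comparison is with exp (- (b - s)) \<psi> x, because that exponential is the mass of the
  kernel.\<close>

lemma flow_limit:
  assumes \<psi>: "Cb \<psi>"
  shows "((\<lambda>b. flow s b \<psi> x) \<longlongrightarrow> \<psi> x) (at_right s)"
proof -
  note L = Lambda_pos
  note [measurable] = Cb_measurable[OF \<psi>]
  obtain B where B: "0 \<le> B" "\<And>x. \<bar>\<psi> x\<bar> \<le> B" using Cb_D(2)[OF \<psi>] by blast
  \<comment> \<open>The second moment of the kernel with lag \<tau> is at most 8 \<tau> / \<Lambda>
    times M: absorbing |y|^2 doubles the width of the Gaussian, hence the base 2.\<close>
  define M where "M = sqrt (fact CARD('n)) * (2 powr (real CARD('n) / 2) / \<Lambda> ^ CARD('n))"
  have M: "0 \<le> M" using L by (simp add: M_def)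
  have sm: "\<bar>flow s b \<psi> x - exp (- (b - s)) * \<psi> x\<bar> \<le> \<eta> + (2 * B / \<delta>\<^sup>2) * (8 * (b - s) / \<Lambda> * M)"
    if b: "s < b" and \<delta>: "0 < \<delta>" and \<eta>: "0 \<le> \<eta>" and c: "\<And>y. norm y < \<delta> \<Longrightarrow> \<bar>\<psi> (x - y) - \<psi> x\<bar> \<le> \<eta>" for b \<delta> \<eta>
  proof -
    define \<tau> where "\<tau> = b - s"
    have \<tau>: "0 < \<tau>" using b by (simp add: \<tau>_def)
    note hi = heat_kernel_integral[OF \<tau>, of b]
    have ptw: "\<bar>\<psi> (x - y) - \<psi> x\<bar> \<le> \<eta> + (2 * B / \<delta>\<^sup>2) * (norm y)\<^sup>2" for y
    proof (cases "norm y < \<delta>")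
      case False
      then have "1 \<le> (norm y)\<^sup>2 / \<delta>\<^sup>2" using \<delta> by (simp add: power_mono)
      then have "2 * B * 1 \<le> 2 * B * ((norm y)\<^sup>2 / \<delta>\<^sup>2)" using B by (intro mult_left_mono) auto
      moreover have "\<bar>\<psi> (x - y) - \<psi> x\<bar> \<le> 2 * B" using B(2)[of x] B(2)[of "x - y"] by linarith
      ultimately show ?thesis using \<eta> by simp
    qed (use c[of y] B in \<open>simp add: add_increasing2\<close>)
    have sqb: "heat_kernel a b \<tau> y * (norm y)\<^sup>2 \<le> 8 * \<tau> / \<Lambda> * (gcon (\<Lambda> * \<tau>) TYPE('n) * gexp (2 * (\<tau> / \<Lambda>)) y)" for y
    proof -
      have g: "0 \<le> gcon (\<Lambda> * \<tau>) TYPE('n)" using L \<tau> by (simp add: gcon_def)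
      have "heat_kernel a b \<tau> y * (norm y)\<^sup>2 \<le> (1 * (gcon (\<Lambda> * \<tau>) TYPE('n) * gexp (\<tau> / \<Lambda>) y)) * (norm y)\<^sup>2"
      proof (rule mult_right_mono)
        have "heat_kernel a b \<tau> y \<le> exp (- \<tau>) * (gcon (\<Lambda> * \<tau>) TYPE('n) * gexp (\<tau> / \<Lambda>) y)" by (rule heat_kernel_le[OF \<tau>])
        also have "\<dots> \<le> 1 * (gcon (\<Lambda> * \<tau>) TYPE('n) * gexp (\<tau> / \<Lambda>) y)"
          using \<tau> g by (intro mult_right_mono) (auto simp: gexp_nonneg)
        finally show "heat_kernel a b \<tau> y \<le> 1 * (gcon (\<Lambda> * \<tau>) TYPE('n) * gexp (\<tau> / \<Lambda>) y)" .
      qed simp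
      also have "\<dots> = gcon (\<Lambda> * \<tau>) TYPE('n) * ((norm y)\<^sup>2 * gexp (\<tau> / \<Lambda>) y)" by simp
      also have "\<dots> \<le> gcon (\<Lambda> * \<tau>) TYPE('n) * (8 * (\<tau> / \<Lambda>) * gexp (2 * (\<tau> / \<Lambda>)) y)"
        using \<tau> L by (intro mult_left_mono norm_sq_gexp_le g) simp
      finally show ?thesis by (simp add: mult_ac)
    qed
    have gi: "integrable lborel (\<lambda>y. 8 * \<tau> / \<Lambda> * (gcon (\<Lambda> * \<tau>) TYPE('n) * gexp (2 * (\<tau> / \<Lambda>)) (y::real^'n)))"
      using gexp_integrable[of "2 * \<tau>"] \<tau> by simp
    have sqi: "integrable lborel (\<lambda>y. heat_kernel a b \<tau> y * (norm y)\<^sup>2)"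
      by (rule Bochner_Integration.integrable_bound[OF gi])
         (use order_trans[OF sqb abs_ge_self] in \<open>simp_all add: heat_kernel_nonneg abs_mult[of "heat_kernel a b \<tau> _"] del: abs_mult\<close>)
    have "(LINT y|lborel. heat_kernel a b \<tau> y * (norm y)\<^sup>2) \<le> (LINT y|lborel. 8 * \<tau> / \<Lambda> * (gcon (\<Lambda> * \<tau>) TYPE('n) * gexp (2 * (\<tau> / \<Lambda>)) (y::real^'n)))"
      by (rule integral_mono[OF sqi gi sqb])
    also have "\<dots> = 8 * \<tau> / \<Lambda> * M"
      using gcon_gexp_integral[OF \<tau>, of 2] by (simp add: M_def)
    finally have sq: "(LINT y|lborel. heat_kernel a b \<tau> y * (norm y)\<^sup>2) \<le> 8 * \<tau> / \<Lambda> * M" .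
    have i1: "integrable lborel (\<lambda>y. heat_kernel a b \<tau> y * (\<psi> (x - y) - \<psi> x))"
      using Cb_flow_integrable[OF \<psi>, of b \<tau> x] hi by (simp add: right_diff_distrib)
    have "flow s b \<psi> x - exp (- (b - s)) * \<psi> x = (LINT y|lborel. heat_kernel a b \<tau> y * (\<psi> (x - y) - \<psi> x))"
      using Cb_flow_integrable[OF \<psi>, of b \<tau> x] hi by (simp add: flow_def \<tau>_def[symmetric] right_diff_distrib)
    also have "\<bar>\<dots>\<bar> \<le> (LINT y|lborel. \<bar>heat_kernel a b \<tau> y * (\<psi> (x - y) - \<psi> x)\<bar>)" by (rule integral_abs_bound)
    also have "\<dots> \<le> (LINT y|lborel. heat_kernel a b \<tau> y * \<eta> + (2 * B / \<delta>\<^sup>2) * (heat_kernel a b \<tau> y * (norm y)\<^sup>2))"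
    proof (rule integral_mono[OF integrable_abs[OF i1]])
      show "integrable lborel (\<lambda>y. heat_kernel a b \<tau> y * \<eta> + (2 * B / \<delta>\<^sup>2) * (heat_kernel a b \<tau> y * (norm y)\<^sup>2))"
        using hi sqi by simp
      show "\<bar>heat_kernel a b \<tau> y * (\<psi> (x - y) - \<psi> x)\<bar> \<le> heat_kernel a b \<tau> y * \<eta> + (2 * B / \<delta>\<^sup>2) * (heat_kernel a b \<tau> y * (norm y)\<^sup>2)" for y
        using mult_left_mono[OF ptw[of y] heat_kernel_nonneg[of b \<tau> y]]
        unfolding abs_mult abs_of_nonneg[OF heat_kernel_nonneg] by (simp add: distrib_left mult_ac)
    qed
    also have "\<dots> = exp (- \<tau>) * \<eta> + (2 * B / \<delta>\<^sup>2) * (LINT y|lborel. heat_kernel a b \<tau> y * (norm y)\<^sup>2)"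
      using hi sqi by simp
    also have "\<dots> \<le> 1 * \<eta> + (2 * B / \<delta>\<^sup>2) * (8 * \<tau> / \<Lambda> * M)"
      using sq \<tau> \<eta> B by (intro add_mono mult_left_mono mult_right_mono) auto
    finally show ?thesis by (simp add: \<tau>_def)
  qed
  have "((\<lambda>b. flow s b \<psi> x - exp (- (b - s)) * \<psi> x) \<longlongrightarrow> 0) (at_right s)"
  proof (rule tendstoI)
    fix \<epsilon> :: real assume \<epsilon>: "0 < \<epsilon>"
    obtain \<delta> where \<delta>: "\<delta> > 0" "\<And>z. dist z x < \<delta> \<Longrightarrow> dist (\<psi> z) (\<psi> x) < \<epsilon> / 2"
      using Cb_D(1)[OF \<psi>, of UNIV] \<epsilon> unfolding continuous_on_iff by (metis UNIV_I half_gt_zero)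
    have c: "\<bar>\<psi> (x - y) - \<psi> x\<bar> \<le> \<epsilon> / 2" if "norm y < \<delta>" for y
      using \<delta>(2)[of "x - y"] that by (simp add: dist_norm)
    have "((\<lambda>b. \<epsilon> / 2 + (2 * B / \<delta>\<^sup>2) * (8 * (b - s) / \<Lambda> * M)) \<longlongrightarrow> \<epsilon> / 2 + (2 * B / \<delta>\<^sup>2) * (8 * (s - s) / \<Lambda> * M)) (at_right s)"
      using L by (intro tendsto_intros) auto
    then have "\<forall>\<^sub>F b in at_right s. \<epsilon> / 2 + (2 * B / \<delta>\<^sup>2) * (8 * (b - s) / \<Lambda> * M) < \<epsilon>"
      by (rule order_tendstoD) (use \<epsilon> in simp)
    moreover have "\<forall>\<^sub>F b in at_right s. s < b" by (simp add: eventually_at_right_less)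
    ultimately show "\<forall>\<^sub>F b in at_right s. dist (flow s b \<psi> x - exp (- (b - s)) * \<psi> x) 0 < \<epsilon>"
    proof eventually_elim
      case (elim b)
      then show ?case using sm[OF elim(2) \<delta>(1) _ c] \<epsilon> by simp
    qed
  qed
  moreover have "((\<lambda>b. exp (- (b - s)) * \<psi> x) \<longlongrightarrow> exp (- (s - s)) * \<psi> x) (at_right s)"
    by (intro tendsto_intros)
  ultimately have "((\<lambda>b. (flow s b \<psi> x - exp (- (b - s)) * \<psi> x) + exp (- (b - s)) * \<psi> x) \<longlongrightarrow> 0 + exp (- (s - s)) * \<psi> x) (at_right s)"
    by (rule tendsto_add)
  then show ?thesis by simp
qed

lemma flow_measurable:
  assumes [measurable]: "\<phi> \<in> borel_measurable borel" "s \<in> borel_measurable N" "r \<in> borel_measurable N" "x \<in> borel_measurable N"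
  shows "(\<lambda>w. flow (s w) (r w) (\<lambda>y. \<phi> (s w, y)) (x w)) \<in> borel_measurable N"
  unfolding flow_def by measurable

lemma flow_zero: "r \<le> s \<Longrightarrow> flow s r \<psi> x = 0"
  by (simp add: flow_def heat_kernel_eq)

lemma flow_rate_le:
  assumes "Cb \<psi>" "\<And>i j. Cb (\<psi>2 i j)" "\<And>x. \<bar>\<psi> x\<bar> \<le> B" "\<And>i j x. \<bar>\<psi>2 i j x\<bar> \<le> B"
  shows "\<bar>flow_rate s \<psi> \<psi>2 r x\<bar> \<le> (real CARD('n) * real CARD('n) * (1 / \<Lambda>) + 1) * B"
proof -
  have "\<bar>\<Sum>i\<in>UNIV. \<Sum>j\<in>UNIV. a r $ i $ j * flow s r (\<psi>2 i j) x\<bar> \<le> (\<Sum>i\<in>UNIV. \<Sum>j\<in>UNIV. \<bar>a r $ i $ j\<bar> * \<bar>flow s r (\<psi>2 i j) x\<bar>)"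
    unfolding abs_mult[symmetric] by (intro order_trans[OF sum_abs] sum_mono order_refl)
  also have "\<dots> \<le> (\<Sum>i\<in>(UNIV::'n set). \<Sum>j\<in>(UNIV::'n set). (1 / \<Lambda>) * B)"
    using Lambda_pos by (intro sum_mono mult_mono bounded_borel_matrix(1)[OF a_borel a_elliptic] flow_le assms) auto
  finally have "\<bar>\<Sum>i\<in>UNIV. \<Sum>j\<in>UNIV. a r $ i $ j * flow s r (\<psi>2 i j) x\<bar> \<le> real CARD('n) * real CARD('n) * (1 / \<Lambda>) * B" by simp
  moreover have "\<bar>flow s r \<psi> x\<bar> \<le> B" by (rule flow_le[OF assms(1,3)])
  ultimately show ?thesis unfolding flow_rate_def by (simp add: distrib_right)
qed

text \<open>Let b decrease to s in \<open>flow_step\<close>. With the derivatives on the datum the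
  rate stays bounded up to s, so its primitive is continuous there, and \<open>flow_limit\<close>
  identifies the remaining term.\<close>

lemma flow_identity:
  assumes st: "s \<le> t" and \<psi>: "C2b \<psi> \<psi>1 \<psi>2"
  shows "s < t \<Longrightarrow> flow s t \<psi> x = \<psi> x + (LINT r:{s..t}|lborel. flow_rate s \<psi> \<psi>2 r x)"
proof -
  assume lt: "s < t"
  have Cb: "Cb \<psi>" "Cb (\<psi>2 i j)" for i j using \<psi> by (auto simp: C2b_def)
  note [measurable] = Cb_measurable[OF Cb(1)] Cb_measurable[OF Cb(2)]
  obtain B1 where B1: "\<And>x. \<bar>\<psi> x\<bar> \<le> B1" using Cb_D(2)[OF Cb(1)] by blast
  have "\<forall>i j. \<exists>B. \<forall>x. \<bar>\<psi>2 i j x\<bar> \<le> B" using Cb_D(2)[OF Cb(2)] by blast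
  then obtain B2 where B2: "\<And>i j x. \<bar>\<psi>2 i j x\<bar> \<le> B2 i j" by metis
  define B where "B = Max (insert B1 (range (\<lambda>(i, j). B2 i j)))"
  have "B1 \<le> B" unfolding B_def by (rule Max_ge) auto
  moreover have "B2 i j \<le> B" for i j
    unfolding B_def by (rule Max_ge) (use rangeI[of "\<lambda>(i, j). B2 i j" "(i, j)"] in auto)
  ultimately have B: "\<bar>\<psi> x\<bar> \<le> B" "\<bar>\<psi>2 i j x\<bar> \<le> B" for i j x using B1 B2 order_trans by blast+
  have sm: "(\<lambda>r. flow s r h x) \<in> borel_measurable borel" if [measurable]: "h \<in> borel_measurable borel" for h
    unfolding flow_def by measurable
  define K where "K = (real CARD('n) * real CARD('n) * (1 / \<Lambda>) + 1) * B"
  interpret g: bounded_borel "\<lambda>r. flow_rate s \<psi> \<psi>2 r x" K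
  proof
    show "(\<lambda>r. flow_rate s \<psi> \<psi>2 r x) \<in> borel_measurable borel"
    proof -
      note [measurable] = sm[OF Cb_measurable[OF Cb(1)]] sm[OF Cb_measurable[OF Cb(2)]]
      show ?thesis unfolding flow_rate_def by measurable
    qed
    show "norm (flow_rate s \<psi> \<psi>2 t x) \<le> K" for t
      unfolding real_norm_def K_def by (rule flow_rate_le[OF Cb(1) Cb(2) B])
  qed
  define P where "P = prim (\<lambda>r. flow_rate s \<psi> \<psi>2 r x)"
  have ev: "\<forall>\<^sub>F b in at_right s. flow s b \<psi> x = flow s t \<psi> x - (P t - P b)"
    using eventually_at_right_real[OF lt]
  proof eventually_elim
    case (elim b)
    then have "flow s t \<psi> x - flow s b \<psi> x = P t - P b"
      using flow_step[OF _ _ \<psi>, of s b t x] g.prim_diff_Icc[of b t] by (simp add: P_def)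
    then show ?case by simp
  qed
  have "(P \<longlongrightarrow> P s) (at_right s)"
  proof (rule Lim_null_comparison[THEN LIM_zero_cancel])
    show "\<forall>\<^sub>F b in at_right s. norm (P b - P s) \<le> K * \<bar>b - s\<bar>"
      unfolding P_def using g.prim_diff_le by simp
    have "((\<lambda>b. K * \<bar>b - s\<bar>) \<longlongrightarrow> K * \<bar>s - s\<bar>) (at_right s)" by (intro tendsto_intros)
    then show "((\<lambda>b. K * \<bar>b - s\<bar>) \<longlongrightarrow> 0) (at_right s)" by simp
  qed
  then have "((\<lambda>b. flow s t \<psi> x - (P t - P b)) \<longlongrightarrow> flow s t \<psi> x - (P t - P s)) (at_right s)"
    by (intro tendsto_intros)
  then have "((\<lambda>b. flow s b \<psi> x) \<longlongrightarrow> flow s t \<psi> x - (P t - P s)) (at_right s)"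
    using ev by (simp add: tendsto_cong)
  then have "\<psi> x = flow s t \<psi> x - (P t - P s)"
    using flow_limit[OF Cb(1)] tendsto_unique trivial_limit_at_right_real by blast
  then show ?thesis using g.prim_diff_Icc[OF st] by (simp add: P_def)
qed

end

section \<open>Evolution of the Duhamel potential\<close>

lemma has_pd_const_zero:
  assumes "has_pd i h h'" "\<And>x. h x = 0" shows "h' x = 0"
proof -
  have "((\<lambda>s. h (x + s *\<^sub>R axis i 1)) has_real_derivative h' x) (at 0)"
    using assms(1) by (simp add: has_pd_def)
  then have "((\<lambda>s::real. 0) has_real_derivative h' x) (at 0)" by (simp add: assms(2))
  then show ?thesis using DERIV_unique[OF _ DERIV_const] by blast
qed

lemma has_pd_add: "has_pd i f f' \<Longrightarrow> has_pd i g g' \<Longrightarrow> has_pd i (\<lambda>x. f x + g x) (\<lambda>x. f' x + g' x)"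
  unfolding has_pd_def by (auto intro!: DERIV_add)

text \<open>A source extended by zero to nonpositive times; compact support in the open half space
  is what makes the extension continuous. Only space derivatives are recorded.\<close>

definition C2b_source :: "(real \<times> (real^'n) \<Rightarrow> real) \<Rightarrow> ('n \<Rightarrow> real \<times> (real^'n) \<Rightarrow> real) \<Rightarrow>
    ('n \<Rightarrow> 'n \<Rightarrow> real \<times> (real^'n) \<Rightarrow> real) \<Rightarrow> bool" where
  "C2b_source \<phi> \<phi>1 \<phi>2 \<longleftrightarrow> Cb \<phi> \<and> (\<forall>t\<le>0. \<forall>x. \<phi> (t, x) = 0) \<and>
     (\<forall>j. Cb (\<phi>1 j) \<and> (\<forall>t. has_pd j (\<lambda>x. \<phi> (t, x)) (\<lambda>x. \<phi>1 j (t, x)))) \<and>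
     (\<forall>i j. Cb (\<phi>2 i j) \<and> (\<forall>t. has_pd i (\<lambda>x. \<phi>1 j (t, x)) (\<lambda>x. \<phi>2 i j (t, x))))"

context elliptic_coeff
begin

lemma flow_bounded_borel:
  assumes \<phi>: "Cb \<phi>" and B: "\<And>z. \<bar>\<phi> z\<bar> \<le> B"
  shows "bounded_borel (\<lambda>s. flow s r (\<lambda>y. \<phi> (s, y)) x) B" "bounded_borel (\<lambda>r. flow s r (\<lambda>y. \<phi> (s, y)) x) B"
proof -
  show "bounded_borel (\<lambda>s. flow s r (\<lambda>y. \<phi> (s, y)) x) B"
  proof
    show "(\<lambda>s. flow s r (\<lambda>y. \<phi> (s, y)) x) \<in> borel_measurable borel"
      by (rule flow_measurable[OF Cb_measurable[OF \<phi>]]) auto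
    show "norm (flow s r (\<lambda>y. \<phi> (s, y)) x) \<le> B" for s
      using flow_le[OF Cb_slice[OF \<phi>], where B=B] B by simp
  qed
  show "bounded_borel (\<lambda>r. flow s r (\<lambda>y. \<phi> (s, y)) x) B"
  proof
    show "(\<lambda>r. flow s r (\<lambda>y. \<phi> (s, y)) x) \<in> borel_measurable borel"
      by (rule flow_measurable[OF Cb_measurable[OF \<phi>], where s="\<lambda>_. s"]) auto
    show "norm (flow s r (\<lambda>y. \<phi> (s, y)) x) \<le> B" for r
      using flow_le[OF Cb_slice[OF \<phi>], where B=B] B by simp
  qed
qed

text \<open>The substitution s = t - \<tau> passes from lag to emission time. The upper limit may
  exceed t because the flow is 0 for s \<ge> t; a range of s that is the same for all times prepares
  Fubini.\<close>

lemma duhamel_eq_flow: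
  assumes \<phi>: "Cb \<phi>" and z: "\<And>t x. t \<le> 0 \<Longrightarrow> \<phi> (t, x) = 0" and t: "t \<le> t'"
  shows "duhamel \<phi> t x = (LINT s:{0..t'}|lborel. flow s t (\<lambda>y. \<phi> (s, y)) x)"
proof -
  note [measurable] = Cb_measurable[OF \<phi>]
  define f where "f \<tau> = (LINT y|lborel. heat_kernel a t \<tau> y * \<phi> (t - \<tau>, x - y))" for \<tau>
  have fm: "f \<in> borel_measurable borel" unfolding f_def by measurable
  have "duhamel \<phi> t x = (LINT \<tau>|lborel. f \<tau>)"
    using lborel_pair.integral_fst'[of "\<lambda>z. heat_kernel a t (fst z) (snd z) * \<phi> (t - fst z, x - snd z)"] Cb_duhamel_integrable[OF \<phi>, of t x]
    by (simp add: duhamel_def f_def lborel_prod)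
  also have "\<dots> = (LINT s|lborel. f (t - s))" by (rule lborel_integral_reflect[OF fm, symmetric])
  also have "\<dots> = (LINT s:{0..t'}|lborel. flow s t (\<lambda>y. \<phi> (s, y)) x)"
    unfolding set_lebesgue_integral_def
  proof (rule Bochner_Integration.integral_cong[OF refl])
    fix s
    have e: "f (t - s) = flow s t (\<lambda>y. \<phi> (s, y)) x" by (simp add: f_def flow_def)
    show "f (t - s) = indicator {0..t'} s *\<^sub>R flow s t (\<lambda>y. \<phi> (s, y)) x"
    proof (cases "s \<in> {0..t'}")
      case False
      then consider "s < 0" | "t \<le> s" using t by force
      then have "flow s t (\<lambda>y. \<phi> (s, y)) x = 0"
      proof cases
        case 1 then show ?thesis by (simp add: flow_def z)
      next
        case 2 then show ?thesis by (rule flow_zero)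
      qed
      then show ?thesis by (simp add: e)
    qed (simp add: e)
  qed
  finally show ?thesis .
qed

lemma C2b_source_D:
  assumes "C2b_source \<phi> \<phi>1 \<phi>2"
  shows "Cb \<phi>" "\<And>j. Cb (\<phi>1 j)" "\<And>i j. Cb (\<phi>2 i j)"
    "\<And>t x. t \<le> 0 \<Longrightarrow> \<phi> (t, x) = 0" "\<And>j t x. t \<le> 0 \<Longrightarrow> \<phi>1 j (t, x) = 0" "\<And>i j t x. t \<le> 0 \<Longrightarrow> \<phi>2 i j (t, x) = 0"
    "\<And>j t. has_pd j (\<lambda>x. \<phi> (t, x)) (\<lambda>x. \<phi>1 j (t, x))"
    "\<And>i j t. has_pd i (\<lambda>x. \<phi>1 j (t, x)) (\<lambda>x. \<phi>2 i j (t, x))"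
    "\<And>t. C2b (\<lambda>x. \<phi> (t, x)) (\<lambda>j x. \<phi>1 j (t, x)) (\<lambda>i j x. \<phi>2 i j (t, x))"
proof -
  show 1: "Cb \<phi>" "\<And>j. Cb (\<phi>1 j)" "\<And>i j. Cb (\<phi>2 i j)"
    "\<And>t x. t \<le> 0 \<Longrightarrow> \<phi> (t, x) = 0"
    "\<And>j t. has_pd j (\<lambda>x. \<phi> (t, x)) (\<lambda>x. \<phi>1 j (t, x))"
    "\<And>i j t. has_pd i (\<lambda>x. \<phi>1 j (t, x)) (\<lambda>x. \<phi>2 i j (t, x))"
    using assms by (auto simp: C2b_source_def)
  show z1: "\<phi>1 j (t, x) = 0" if "t \<le> 0" for j t x
    using has_pd_const_zero[OF 1(5)] 1(4) that by blast
  show "\<phi>2 i j (t, x) = 0" if "t \<le> 0" for i j t x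
    using has_pd_const_zero[OF 1(6)] z1 that by blast
  show "C2b (\<lambda>x. \<phi> (t, x)) (\<lambda>j x. \<phi>1 j (t, x)) (\<lambda>i j x. \<phi>2 i j (t, x))" for t
    using 1 by (auto simp: C2b_def intro: Cb_slice)
qed

lemma common_bound:
  fixes h2 :: "'n \<Rightarrow> 'n \<Rightarrow> 'a::topological_space \<Rightarrow> real"
  assumes "Cb h" "\<And>i j. Cb (h2 i j)"
  shows "\<exists>B\<ge>0. (\<forall>z. \<bar>h z\<bar> \<le> B) \<and> (\<forall>i j z. \<bar>h2 i j z\<bar> \<le> B)"
proof -
  obtain B1 where B1: "0 \<le> B1" "\<And>x. \<bar>h x\<bar> \<le> B1" using Cb_D(2)[OF assms(1)] by blast
  have "\<forall>i j. \<exists>B. \<forall>x. \<bar>h2 i j x\<bar> \<le> B" using Cb_D(2)[OF assms(2)] by blast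
  then obtain B2 where B2: "\<And>i j x. \<bar>h2 i j x\<bar> \<le> B2 i j" by metis
  define B where "B = Max (insert B1 (range (\<lambda>(i, j). B2 i j)))"
  have b1: "B1 \<le> B" unfolding B_def by (rule Max_ge) auto
  have b2: "B2 i j \<le> B" for i j
    unfolding B_def by (rule Max_ge) (use rangeI[of "\<lambda>(i, j). B2 i j" "(i, j)"] in auto)
  show ?thesis
    by (rule exI[of _ B]) (use b1 b2 B1 B2 order_trans in blast)
qed

definition duhamel_rate :: "(real \<times> (real^'n) \<Rightarrow> real) \<Rightarrow> ('n \<Rightarrow> 'n \<Rightarrow> real \<times> (real^'n) \<Rightarrow> real) \<Rightarrow> real \<Rightarrow> real^'n \<Rightarrow> real" where
  "duhamel_rate \<phi> \<phi>2 r x = (\<Sum>i\<in>UNIV. \<Sum>j\<in>UNIV. a r $ i $ j * duhamel (\<phi>2 i j) r x) - duhamel \<phi> r x"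

text \<open>Each slice starts from \<phi> (s, x) at its emission time and then evolves with its own
  rate. Integrating \<open>flow_identity\<close> over s and exchanging the order of integration
  produces the rate of the whole potential. The triangle s < r may be replaced by a square, since
  the rate of a slice is 0 before its emission.\<close>

lemma duhamel_identity:
  assumes src: "C2b_source \<phi> \<phi>1 \<phi>2" and t: "0 < t"
  shows "duhamel \<phi> t x = (LINT r:{0..t}|lborel. duhamel_rate \<phi> \<phi>2 r x + \<phi> (r, x))"
proof -
  note D = C2b_source_D[OF src]
  obtain B where B: "0 \<le> B" "\<And>z. \<bar>\<phi> z\<bar> \<le> B" "\<And>i j z. \<bar>\<phi>2 i j z\<bar> \<le> B"
    using common_bound[OF D(1), of \<phi>2] D(3) by blast
  note [measurable] = Cb_measurable[OF D(1)] Cb_measurable[OF D(3)]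
  define H where "H s r = flow_rate s (\<lambda>y. \<phi> (s, y)) (\<lambda>i j y. \<phi>2 i j (s, y)) r x" for s r
  define K where "K = (real CARD('n) * real CARD('n) * (1 / \<Lambda>) + 1) * B"
  have Hb: "\<bar>H s r\<bar> \<le> K" for s r
    unfolding H_def K_def by (rule flow_rate_le) (use D B in \<open>auto intro: Cb_slice\<close>)
  have Hm: "(\<lambda>z. H (fst z) (snd z)) \<in> borel_measurable (borel :: (real \<times> real) measure)"
  proof -
    have [measurable]: "(\<lambda>z::real \<times> real. flow (fst z) (snd z) (\<lambda>y. h (fst z, y)) x) \<in> borel_measurable borel"
      if "h \<in> borel_measurable borel" for h
      by (rule flow_measurable[OF that]) auto
    show ?thesis unfolding H_def flow_rate_def by measurable
  qed
  have Hz: "H s r = 0" if "r \<le> s" for s r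
    using that by (simp add: H_def flow_rate_def flow_zero)
  define G where "G = (\<lambda>(s, r). indicator {0..t} s * indicator {0..t} r * H s r)"
  have Gi: "integrable (lborel \<Otimes>\<^sub>M lborel) G"
  proof (unfold lborel_prod, rule Bochner_Integration.integrable_bound[where f="\<lambda>z. indicator ({0..t} \<times> {0..t}) z * K"])
    have "emeasure lborel ({0..t} \<times> {0..t}) < \<infinity>"
      by (intro emeasure_compact_finite compact_Times compact_Icc)
    then show "integrable lborel (\<lambda>z::real \<times> real. indicator ({0..t} \<times> {0..t}) z * K)"
      by (intro integrable_mult_left integrable_real_indicator) (auto intro!: borel_closed closed_Times)
    have "G = (\<lambda>z. indicator {0..t} (fst z) * indicator {0..t} (snd z) * H (fst z) (snd z))"
      by (auto simp: G_def)
    then show "G \<in> borel_measurable lborel" using Hm by simp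
    show "AE z in lborel. norm (G z) \<le> norm (indicator ({0..t} \<times> {0..t}) z * K)"
      by (intro AE_I2) (use order_trans[OF Hb abs_ge_self] in \<open>auto simp: G_def indicator_def\<close>)
  qed
  interpret p: bounded_borel "\<lambda>s. indicator {0..} s * \<phi> (s, x)" B
    by standard (use B in \<open>auto simp: indicator_def\<close>)
  have pi: "set_integrable lborel {0..t} (\<lambda>s. \<phi> (s, x))"
    using p.set_integrable_Icc[of 0 t] by (rule set_integrable_cong[THEN iffD1, rotated 3]) auto
  have inner: "(LINT s|lborel. G (s, r)) = indicator {0..t} r *\<^sub>R duhamel_rate \<phi> \<phi>2 r x" for r
  proof (cases "r \<in> {0..t}")
    case True
    have i: "integrable lborel (\<lambda>s. indicator {0..t} s * flow s r (\<lambda>y. h (s, y)) x)" if "Cb h" "\<And>z. \<bar>h z\<bar> \<le> B" for h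
      using bounded_borel.set_integrable_Icc[OF flow_bounded_borel(1)[OF that], of 0 t] by (simp add: set_integrable_def)
    have v: "(LINT s|lborel. indicator {0..t} s * flow s r (\<lambda>y. h (s, y)) x) = duhamel h r x" if "Cb h" "\<And>t x. t \<le> 0 \<Longrightarrow> h (t, x) = 0" for h
      using duhamel_eq_flow[OF that, of r t x] True by (simp add: set_lebesgue_integral_def)
    have "(LINT s|lborel. G (s, r)) = (LINT s|lborel. (\<Sum>i\<in>UNIV. \<Sum>j\<in>UNIV. a r $ i $ j * (indicator {0..t} s * flow s r (\<lambda>y. \<phi>2 i j (s, y)) x))
        - indicator {0..t} s * flow s r (\<lambda>y. \<phi> (s, y)) x)"
      by (rule Bochner_Integration.integral_cong[OF refl])
         (use True in \<open>auto simp: G_def H_def flow_rate_def indicator_def\<close>)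
    also have "\<dots> = (\<Sum>i\<in>UNIV. \<Sum>j\<in>UNIV. a r $ i $ j * (LINT s|lborel. indicator {0..t} s * flow s r (\<lambda>y. \<phi>2 i j (s, y)) x))
        - (LINT s|lborel. indicator {0..t} s * flow s r (\<lambda>y. \<phi> (s, y)) x)"
      using i[OF D(3) B(3)] i[OF D(1) B(2)] by (simp add: integrable_sum integral_sum)
    also have "\<dots> = duhamel_rate \<phi> \<phi>2 r x"
      by (simp add: v[OF D(3) D(6)] v[OF D(1) D(4)] duhamel_rate_def)
    finally show ?thesis using True by simp
  qed (simp add: G_def)
  have "duhamel \<phi> t x = (LINT s:{0..t}|lborel. flow s t (\<lambda>y. \<phi> (s, y)) x)"
    by (rule duhamel_eq_flow[OF D(1) D(4) order_refl])
  also have "\<dots> = (LINT s|lborel. indicator {0..t} s *\<^sub>R \<phi> (s, x) + (LINT r|lborel. G (s, r)))"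
    unfolding set_lebesgue_integral_def
  proof (rule integral_cong_AE)
    have "(\<lambda>s. flow s t (\<lambda>y. \<phi> (s, y)) x) \<in> borel_measurable borel"
      using flow_bounded_borel(1)[OF D(1) B(2)] by (rule bounded_borel.borel)
    then show "(\<lambda>s. indicator {0..t} s *\<^sub>R flow s t (\<lambda>y. \<phi> (s, y)) x) \<in> borel_measurable lborel" by measurable
    show "(\<lambda>s. indicator {0..t} s *\<^sub>R \<phi> (s, x) + (LINT r|lborel. G (s, r))) \<in> borel_measurable lborel"
      using borel_measurable_integrable[OF Gi] by measurable
    \<comment> \<open>At s = t the flow has the value 0 instead of the datum; this single time is
      discarded.\<close>
    have "AE s in lborel. s \<noteq> t" by (rule AE_lborel_singleton)
    then show "AE s in lborel. indicator {0..t} s *\<^sub>R flow s t (\<lambda>y. \<phi> (s, y)) x = indicator {0..t} s *\<^sub>R \<phi> (s, x) + (LINT r|lborel. G (s, r))"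
    proof eventually_elim
      case (elim s)
      show ?case
      proof (cases "s \<in> {0..t}")
        case True
        then have st: "s < t" using elim by simp
        have "flow s t (\<lambda>y. \<phi> (s, y)) x = \<phi> (s, x) + (LINT r:{s..t}|lborel. H s r)"
          unfolding H_def by (rule flow_identity[OF less_imp_le[OF st] D(9) st])
        also have "(LINT r:{s..t}|lborel. H s r) = (LINT r|lborel. G (s, r))"
          unfolding set_lebesgue_integral_def
          by (rule Bochner_Integration.integral_cong[OF refl]) (use True Hz in \<open>auto simp: G_def indicator_def\<close>)
        finally show ?thesis using True by simp
      qed (simp add: G_def)
    qed
  qed
  also have "\<dots> = (LINT s|lborel. indicator {0..t} s *\<^sub>R \<phi> (s, x)) + (LINT s|lborel. LINT r|lborel. G (s, r))"
    by (rule Bochner_Integration.integral_add) (use pi lborel_pair.integrable_fst'[OF Gi] in \<open>auto simp: set_integrable_def\<close>)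
  also have "(LINT s|lborel. LINT r|lborel. G (s, r)) = (LINT r|lborel. LINT s|lborel. G (s, r))"
    using lborel_pair.Fubini_integral[of "\<lambda>s r. G (s, r)"] Gi by simp
  also have "(LINT r|lborel. LINT s|lborel. G (s, r)) = (LINT r|lborel. indicator {0..t} r *\<^sub>R duhamel_rate \<phi> \<phi>2 r x)"
    by (simp only: inner)
  also have "(LINT s|lborel. indicator {0..t} s *\<^sub>R \<phi> (s, x)) + (LINT r|lborel. indicator {0..t} r *\<^sub>R duhamel_rate \<phi> \<phi>2 r x)
      = (LINT r:{0..t}|lborel. duhamel_rate \<phi> \<phi>2 r x + \<phi> (r, x))"
  proof -
    have "integrable lborel (\<lambda>r. indicator {0..t} r *\<^sub>R duhamel_rate \<phi> \<phi>2 r x)"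
      unfolding inner[symmetric]
      using lborel_pair.integrable_fst'[OF lborel_pair.integrable_product_swap[OF Gi]] by simp
    then show ?thesis
      using pi by (simp add: set_lebesgue_integral_def set_integrable_def scaleR_add_right distrib_left add.commute)
  qed
  finally show ?thesis .
qed

end

section \<open>The potential of smooth data as a primitive in time\<close>

locale C2_data = elliptic_coeff a \<Lambda> for a :: "real \<Rightarrow> real^'n^'n" and \<Lambda> +
  fixes \<phi> :: "real \<times> (real^'n) \<Rightarrow> real" and \<phi>1 \<phi>2 and \<psi> :: "real^'n \<Rightarrow> real" and \<psi>1 \<psi>2
  assumes src: "C2b_source \<phi> \<phi>1 \<phi>2" and ini: "C2b \<psi> \<psi>1 \<psi>2"
begin

text \<open>The heat potential of smooth data, see \<open>heat_potential_eq_W\<close>. By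
  \<open>W_has_pd\<close> the functions \<open>W1\<close> and \<open>W2\<close> are its gradient and
  Hessian, written as potentials of the differentiated data.\<close>

definition W :: "real \<Rightarrow> real^'n \<Rightarrow> real" where "W t x = duhamel \<phi> t x + flow 0 t \<psi> x"
definition W1 :: "'n \<Rightarrow> real \<Rightarrow> real^'n \<Rightarrow> real" where "W1 j t x = duhamel (\<phi>1 j) t x + flow 0 t (\<psi>1 j) x"
definition W2 :: "real \<Rightarrow> real^'n \<Rightarrow> real^'n^'n" where "W2 t x = (\<chi> i j. duhamel (\<phi>2 i j) t x + flow 0 t (\<psi>2 i j) x)"

lemmas srcD = C2b_source_D[OF src]

lemma iniD: "Cb \<psi>" "Cb (\<psi>1 j)" "Cb (\<psi>2 i j)" "has_pd j \<psi> (\<psi>1 j)" "has_pd i (\<psi>1 j) (\<psi>2 i j)"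
  using ini by (auto simp: C2b_def)

lemma W_has_pd: "has_pd j (W t) (W1 j t)" "has_pd i (W1 j t) (\<lambda>x. W2 t x $ i $ j)"
  unfolding W_def[abs_def] W1_def[abs_def] W2_def
  using has_pd_add[OF duhamel_has_pd[OF srcD(1) srcD(2) srcD(7)] flow_has_pd[OF iniD(1,2,4)]]
    has_pd_add[OF duhamel_has_pd[OF srcD(2) srcD(3) srcD(8)] flow_has_pd[OF iniD(2,3,5)]] by auto

lemma W_continuous:
  "continuous_on ({0<..} \<times> UNIV) (\<lambda>(t, x). W t x)"
  "continuous_on ({0<..} \<times> UNIV) (\<lambda>(t, x). W1 j t x)"
  "continuous_on ({0<..} \<times> UNIV) (\<lambda>(t, x). W2 t x)"
proof -
  have *: "continuous_on ({0<..} \<times> UNIV) (\<lambda>p. duhamel h (fst p) (snd p) + flow 0 (fst p) k (snd p))" if "Cb h" "Cb k" for h k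
    using continuous_on_subset[OF duhamel_continuous[OF that(1)], of "{0<..} \<times> UNIV"] flow_continuous[OF that(2), of 0]
    by (auto simp: case_prod_beta intro!: continuous_on_add)
  show "continuous_on ({0<..} \<times> UNIV) (\<lambda>(t, x). W t x)" "continuous_on ({0<..} \<times> UNIV) (\<lambda>(t, x). W1 j t x)"
    "continuous_on ({0<..} \<times> UNIV) (\<lambda>(t, x). W2 t x)"
    unfolding W_def W1_def W2_def case_prod_beta
    by (intro continuous_on_vec_lambda * srcD iniD)+
qed

lemma W_bounded:
  obtains B where "0 \<le> B" "\<And>t x. \<bar>W t x\<bar> \<le> B" "\<And>t x i j. \<bar>W2 t x $ i $ j\<bar> \<le> B" "\<And>z. \<bar>\<phi> z\<bar> \<le> B"
proof -
  obtain B where B: "0 \<le> B" "\<And>z. \<bar>\<phi> z\<bar> \<le> B" "\<And>i j z. \<bar>\<phi>2 i j z\<bar> \<le> B"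
    using common_bound[OF srcD(1), of \<phi>2] srcD(3) by blast
  obtain B' where B': "0 \<le> B'" "\<And>z. \<bar>\<psi> z\<bar> \<le> B'" "\<And>i j z. \<bar>\<psi>2 i j z\<bar> \<le> B'"
    using common_bound[OF iniD(1), of \<psi>2] iniD(3) by blast
  define J where "J = (LINT z|lborel. majorant z)"
  have J: "0 \<le> J" unfolding J_def by (simp add: majorant_nonneg)
  show ?thesis
  proof (rule that[of "B * J + B' + B"])
    show "0 \<le> B * J + B' + B" using B(1) B'(1) J by simp
    show "\<bar>W t x\<bar> \<le> B * J + B' + B" for t x
      using duhamel_le[OF srcD(1) B(2), of t x] flow_le[OF iniD(1) B'(2), of 0 t x] B(1) unfolding W_def J_def by linarith
    show "\<bar>W2 t x $ i $ j\<bar> \<le> B * J + B' + B" for t x i j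
      using duhamel_le[OF srcD(3) B(3), of i j t x] flow_le[OF iniD(3) B'(3), of 0 t i j x] B(1) unfolding W2_def J_def by simp
    show "\<bar>\<phi> z\<bar> \<le> B * J + B' + B" for z
      using B(2)[of z] B'(1) mult_nonneg_nonneg[OF B(1) J] by linarith
  qed
qed

text \<open>The equation solved for the time derivative. The value 0 at nonpositive times makes it
  one bounded Borel function on the line, to which \<open>prim\<close> applies.\<close>

definition rate :: "real^'n \<Rightarrow> real \<Rightarrow> real" where
  "rate x r = (if 0 < r then a r \<bullet> W2 r x - W r x + \<phi> (r, x) else 0)"

lemma W_slice_continuous:
  "continuous_on {0<..} (\<lambda>t. W t x)" "continuous_on {0<..} (\<lambda>t. W2 t x)" "continuous_on S (\<lambda>t. \<phi> (t, x))"
proof -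
  have c: "continuous_on {0<..} (\<lambda>t. (t, x))" "(\<lambda>t. (t, x)) ` {0<..} \<subseteq> {0<..} \<times> UNIV" by (auto intro!: continuous_intros)
  show "continuous_on {0<..} (\<lambda>t. W t x)" "continuous_on {0<..} (\<lambda>t. W2 t x)"
    using continuous_on_compose2[OF W_continuous(1) c] continuous_on_compose2[OF W_continuous(3) c] by simp_all
  show "continuous_on S (\<lambda>t. \<phi> (t, x))"
    by (rule continuous_on_compose2[OF Cb_D(1)[OF srcD(1), of UNIV]]) (auto intro!: continuous_intros)
qed

lemma rate_bounded_borel:
  obtains K where "\<And>x. bounded_borel (rate x) K"
proof -
  obtain B where B: "0 \<le> B" "\<And>t x. \<bar>W t x\<bar> \<le> B" "\<And>t x i j. \<bar>W2 t x $ i $ j\<bar> \<le> B" "\<And>z. \<bar>\<phi> z\<bar> \<le> B"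
    using W_bounded by metis
  define K where "K = real CARD('n) * real CARD('n) * ((1 / \<Lambda>) * B) + B + B"
  have "bounded_borel (rate x) K" for x
  proof
    have 1: "(\<lambda>r. indicator {0<..} r *\<^sub>R W2 r x) \<in> borel_measurable borel" "(\<lambda>r. indicator {0<..} r *\<^sub>R W r x) \<in> borel_measurable borel"
      "(\<lambda>r. indicator {0<..} r *\<^sub>R \<phi> (r, x)) \<in> borel_measurable borel"
      by (rule borel_measurable_continuous_on_indicator; simp add: W_slice_continuous)+
    have eq: "rate x = (\<lambda>r. a r \<bullet> (indicator {0<..} r *\<^sub>R W2 r x) - indicator {0<..} r *\<^sub>R W r x + indicator {0<..} r *\<^sub>R \<phi> (r, x))"
      by (auto simp: rate_def fun_eq_iff)
    note [measurable] = 1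
    show "rate x \<in> borel_measurable borel" unfolding eq by measurable
    show "norm (rate x r) \<le> K" for r
    proof -
      have "\<bar>a r \<bullet> W2 r x\<bar> \<le> (\<Sum>i\<in>UNIV. \<Sum>j\<in>UNIV. \<bar>a r $ i $ j\<bar> * \<bar>W2 r x $ i $ j\<bar>)"
        unfolding inner_matrix_eq_sum abs_mult[symmetric] by (intro order_trans[OF sum_abs] sum_mono order_refl)
      also have "\<dots> \<le> (\<Sum>i\<in>(UNIV::'n set). \<Sum>j\<in>(UNIV::'n set). (1 / \<Lambda>) * B)"
        using Lambda_pos by (intro sum_mono mult_mono bounded_borel_matrix(1)[OF a_borel a_elliptic] B) auto
      finally have "\<bar>a r \<bullet> W2 r x\<bar> \<le> real CARD('n) * real CARD('n) * ((1 / \<Lambda>) * B)" by simp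
      moreover have "0 \<le> real CARD('n) * real CARD('n) * ((1 / \<Lambda>) * B)" using B(1) Lambda_pos by simp
      ultimately show ?thesis
        using B(2)[of r x] B(4)[of "(r, x)"] B(1) unfolding rate_def K_def by (simp add: abs_le_iff)
    qed
  qed
  then show ?thesis using that by blast
qed

text \<open>\<open>flow_identity\<close> started at time 0 and \<open>duhamel_identity\<close> are
  added, so that both parts of the potential share one primitive.\<close>

lemma W_identity:
  assumes t: "0 < t"
  shows "W t x = \<psi> x + (prim (rate x) t - prim (rate x) 0)"
proof -
  obtain K where K: "\<And>x. bounded_borel (rate x) K" using rate_bounded_borel by blast
  interpret r: bounded_borel "rate x" K by (rule K)
  obtain B where B: "0 \<le> B" "\<And>z. \<bar>\<psi> z\<bar> \<le> B" "\<And>i j z. \<bar>\<psi>2 i j z\<bar> \<le> B"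
    using common_bound[OF iniD(1), of \<psi>2] iniD(3) by blast
  have Sgm: "(\<lambda>r. flow 0 r h x) \<in> borel_measurable borel" if "Cb h" for h
  proof -
    note [measurable] = Cb_measurable[OF that]
    show ?thesis unfolding flow_def by measurable
  qed
  interpret g: bounded_borel "\<lambda>r. flow_rate 0 \<psi> \<psi>2 r x" "(real CARD('n) * real CARD('n) * (1 / \<Lambda>) + 1) * B"
  proof
    note [measurable] = Sgm[OF iniD(1)] Sgm[OF iniD(3)]
    show "(\<lambda>r. flow_rate 0 \<psi> \<psi>2 r x) \<in> borel_measurable borel" unfolding flow_rate_def by measurable
    show "norm (flow_rate 0 \<psi> \<psi>2 t x) \<le> (real CARD('n) * real CARD('n) * (1 / \<Lambda>) + 1) * B" for t
      unfolding real_norm_def by (rule flow_rate_le[OF iniD(1) iniD(3) B(2) B(3)])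
  qed
  have e: "rate x r = flow_rate 0 \<psi> \<psi>2 r x + (duhamel_rate \<phi> \<phi>2 r x + \<phi> (r, x))" if "0 < r" for r
    using that by (simp add: rate_def flow_rate_def duhamel_rate_def W_def W2_def inner_matrix_eq_sum sum.distrib distrib_left)
  \<comment> \<open>The two sides may differ at r = 0, where \<open>rate\<close> is set to
    0.\<close>
  have ae: "AE r in lborel. r \<in> {0..t} \<longrightarrow> rate x r - flow_rate 0 \<psi> \<psi>2 r x = duhamel_rate \<phi> \<phi>2 r x + \<phi> (r, x)"
  proof -
    have "AE r in lborel. r \<noteq> (0::real)" by (rule AE_lborel_singleton)
    then show ?thesis by eventually_elim (auto simp: e)
  qed
  have "prim (rate x) t - prim (rate x) 0 = (LINT r:{0..t}|lborel. rate x r)"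
    using t by (simp add: r.prim_diff_Icc)
  also have "\<dots> = (LINT r:{0..t}|lborel. flow_rate 0 \<psi> \<psi>2 r x) + (LINT r:{0..t}|lborel. rate x r - flow_rate 0 \<psi> \<psi>2 r x)"
    using set_integral_diff(2)[OF r.set_integrable_Icc g.set_integrable_Icc, of 0 t] by simp
  also have "(LINT r:{0..t}|lborel. rate x r - flow_rate 0 \<psi> \<psi>2 r x) = (LINT r:{0..t}|lborel. duhamel_rate \<phi> \<phi>2 r x + \<phi> (r, x))"
  proof (rule set_lebesgue_integral_cong_AE[OF _ _ _ ae])
    have Vm: "(\<lambda>r. duhamel h r x) \<in> borel_measurable borel" if "Cb h" for h
    proof (rule borel_measurable_continuous_onI)
      show "continuous_on UNIV (\<lambda>r. duhamel h r x)"
        using continuous_on_compose2[OF duhamel_continuous[OF that], of UNIV "\<lambda>r. (r, x)"] by (simp add: continuous_on_Pair)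
    qed
    note [measurable] = Vm[OF srcD(1)] Vm[OF srcD(3)] Cb_measurable[OF srcD(1)]
    show "(\<lambda>r. duhamel_rate \<phi> \<phi>2 r x + \<phi> (r, x)) \<in> borel_measurable lborel" unfolding duhamel_rate_def by measurable
    show "(\<lambda>r. rate x r - flow_rate 0 \<psi> \<psi>2 r x) \<in> borel_measurable lborel" by measurable
  qed auto
  also have "\<dots> = duhamel \<phi> t x" by (rule duhamel_identity[OF src t, symmetric])
  also have "(LINT r:{0..t}|lborel. flow_rate 0 \<psi> \<psi>2 r x) = flow 0 t \<psi> x - \<psi> x"
    using flow_identity[OF less_imp_le[OF t] ini t, of x] by simp
  finally show ?thesis by (simp add: W_def)
qed

text \<open>At positive times the rate is the pairing of the continuous function (W2, \<phi> - W)
  with (a, 1). By \<open>prim_inner_has_derivative\<close> the only condition on t concerns the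
  primitive of \<open>a\<close>, so it is the same for every x.\<close>

lemma W_has_derivative:
  assumes t: "0 < t" and d: "(prim a has_vector_derivative a t) (at t)"
  shows "((\<lambda>t. W t x) has_real_derivative a t \<bullet> W2 t x - W t x + \<phi> (t, x)) (at t)"
proof -
  obtain K where K: "\<And>x. bounded_borel (rate x) K" using rate_bounded_borel by blast
  have b1: "bounded_borel (\<lambda>_::real. 1::real) 1" by standard auto
  note bp = prim_Pair[OF a.bounded_borel_axioms b1]
  have pe: "prim (\<lambda>t. (a t, 1::real)) = (\<lambda>r. prim (\<lambda>t. (a t, 1)) 0 + (prim a r - prim a 0, r))"
  proof
    fix r
    have "prim (\<lambda>t. (a t, 1::real)) r = prim (\<lambda>t. (a t, 1)) 0 + (prim (\<lambda>t. (a t, 1)) r - prim (\<lambda>t. (a t, 1)) 0)" by simp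
    also have "\<dots> = prim (\<lambda>t. (a t, 1)) 0 + (prim a r - prim a 0, r)" unfolding bp(2) prim_const by simp
    finally show "prim (\<lambda>t. (a t, 1::real)) r = prim (\<lambda>t. (a t, 1)) 0 + (prim a r - prim a 0, r)" .
  qed
  have pr: "((\<lambda>r. (prim a r - prim a 0, r)) has_vector_derivative (a t, 1)) (at t)"
    by (rule has_vector_derivative_Pair) (use d in \<open>auto intro!: derivative_eq_intros\<close>)
  have pd: "(prim (\<lambda>t. (a t, 1::real)) has_vector_derivative (a t, 1)) (at t)"
    by (subst pe) (use has_vector_derivative_add[OF has_vector_derivative_const pr] in simp)
  have "(prim (rate x) has_real_derivative (W2 t x, \<phi> (t, x) - W t x) \<bullet> (a t, 1::real)) (at t)"
    by (rule prim_inner_has_derivative[OF bp(1) K, where S="{0<..}" and d="\<lambda>t. (W2 t x, \<phi> (t, x) - W t x)", OF _ _ _ _ pd])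
       (use t in \<open>auto simp: rate_def inner_commute intro!: continuous_intros W_slice_continuous\<close>)
  then have "((\<lambda>t. \<psi> x + (prim (rate x) t - prim (rate x) 0)) has_real_derivative a t \<bullet> W2 t x - W t x + \<phi> (t, x)) (at t)"
    by (auto intro!: derivative_eq_intros simp: inner_commute)
  then show ?thesis
    by (rule has_field_derivative_transform_within_open[of _ _ _ "{0<..}"]) (use t W_identity in auto)
qed

end

section \<open>Time derivatives of the kernel\<close>

lemma (in bounded_borel) bounded_borel_reflect: "bounded_borel (\<lambda>t. \<beta> (- t)) K"
  by standard (use bound in auto)

text \<open>The averages in the differentiation theorem are taken over intervals to the right of the
  point, so it yields one side only; reflection supplies the other.\<close>

lemma prim_right_derivative:
  fixes \<beta> :: "real \<Rightarrow> 'e::euclidean_space"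
  assumes "bounded_borel \<beta> K"
  obtains N where "negligible N"
    "\<And>t e. t \<notin> N \<Longrightarrow> 0 < e \<Longrightarrow> \<exists>d>0. \<forall>h. 0 < h \<and> h < d \<longrightarrow> norm (prim \<beta> (t + h) - prim \<beta> t - h *\<^sub>R \<beta> t) \<le> e * h"
proof -
  interpret bounded_borel \<beta> K by fact
  have io: "\<beta> integrable_on cbox b c" for b c
    using set_borel_integral_eq_integral(1)[OF set_integrable_Icc[of b c]] by simp
  obtain N where N: "negligible N" "\<And>x e. \<lbrakk>x \<notin> N; 0 < e\<rbrakk> \<Longrightarrow>
      \<exists>d>0. \<forall>h. 0 < h \<and> h < d \<longrightarrow> norm (integral (cbox x (x + h *\<^sub>R One)) \<beta> /\<^sub>R h ^ DIM(real) - \<beta> x) < e"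
    using integrable_ccontinuous_explicit[OF io] by blast
  show ?thesis
  proof (rule that[OF N(1)])
    fix t e :: real assume t: "t \<notin> N" and e: "0 < e"
    then obtain d where d: "d > 0" "\<And>h. 0 < h \<Longrightarrow> h < d \<Longrightarrow> norm (integral (cbox t (t + h *\<^sub>R One)) \<beta> /\<^sub>R h ^ DIM(real) - \<beta> t) < e"
      using N(2) by meson
    show "\<exists>d>0. \<forall>h. 0 < h \<and> h < d \<longrightarrow> norm (prim \<beta> (t + h) - prim \<beta> t - h *\<^sub>R \<beta> t) \<le> e * h"
    proof (intro exI[of _ d] conjI allI impI d(1))
      fix h assume h: "0 < h \<and> h < d"
      have I: "prim \<beta> (t + h) - prim \<beta> t = integral (cbox t (t + h *\<^sub>R One)) \<beta>"
        using prim_diff_Icc[of t "t + h"] set_borel_integral_eq_integral(2)[OF set_integrable_Icc[of t "t + h"]] h by simp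
      have "prim \<beta> (t + h) - prim \<beta> t - h *\<^sub>R \<beta> t = h *\<^sub>R (integral (cbox t (t + h *\<^sub>R One)) \<beta> /\<^sub>R h ^ DIM(real) - \<beta> t)"
        unfolding I using h by (simp add: scaleR_diff_right)
      then have "norm (prim \<beta> (t + h) - prim \<beta> t - h *\<^sub>R \<beta> t) = h * norm (integral (cbox t (t + h *\<^sub>R One)) \<beta> /\<^sub>R h ^ DIM(real) - \<beta> t)"
        using h by simp
      also have "\<dots> \<le> h * e" using d(2)[of h] h by (intro mult_left_mono) auto
      finally show "norm (prim \<beta> (t + h) - prim \<beta> t - h *\<^sub>R \<beta> t) \<le> e * h" by (simp add: mult.commute)
    qed
  qed
qed

lemma prim_reflect:
  fixes \<beta> :: "real \<Rightarrow> 'e::euclidean_space"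
  assumes "bounded_borel \<beta> K" "r \<le> r'"
  shows "prim (\<lambda>t. \<beta> (- t)) r' - prim (\<lambda>t. \<beta> (- t)) r = prim \<beta> (- r) - prim \<beta> (- r')"
proof -
  interpret bounded_borel \<beta> K by fact
  interpret m: bounded_borel "\<lambda>t. \<beta> (- t)" K by (rule bounded_borel_reflect)
  define F where "F s = indicator {- r'..- r} s *\<^sub>R \<beta> s" for s
  have Fm: "F \<in> borel_measurable borel" unfolding F_def by measurable
  have "prim (\<lambda>t. \<beta> (- t)) r' - prim (\<lambda>t. \<beta> (- t)) r = (LINT s|lborel. F (0 - s))"
    unfolding m.prim_diff_Icc[OF assms(2)] set_lebesgue_integral_def
    by (rule Bochner_Integration.integral_cong[OF refl]) (auto simp: F_def indicator_def)
  also have "\<dots> = (LINT s|lborel. F s)" by (rule lborel_integral_reflect[OF Fm])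
  also have "\<dots> = prim \<beta> (- r) - prim \<beta> (- r')"
    using assms(2) by (simp add: F_def prim_diff_Icc set_lebesgue_integral_def)
  finally show ?thesis .
qed

lemma AE_lborel_reflect:
  fixes c :: "'a::euclidean_space"
  assumes "AE z in lborel. P z"
  shows "AE z in lborel. P (c - z)"
proof -
  obtain N where N: "{z \<in> space lborel. \<not> P z} \<subseteq> N" "emeasure lborel N = 0" "N \<in> sets lborel"
    using assms by (rule AE_E)
  have "(\<lambda>z. c - z) -` N \<in> null_sets lborel"
  proof (rule null_setsI)
    have "emeasure lborel N = emeasure (distr lborel borel (\<lambda>z. c - z)) N" by (simp add: lborel_distr_reflect)
    also have "\<dots> = emeasure lborel ((\<lambda>z. c - z) -` N)" using N by (subst emeasure_distr) auto
    finally show "emeasure lborel ((\<lambda>z. c - z) -` N) = 0" using N by simp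
    show "(\<lambda>z. c - z) -` N \<in> sets lborel"
      using measurable_sets[of "\<lambda>z. c - z" borel borel N] N by simp
  qed
  then show ?thesis by (rule AE_I') (use N in auto)
qed

lemma AE_prim_has_vector_derivative:
  fixes \<beta> :: "real \<Rightarrow> 'e::euclidean_space"
  assumes b: "bounded_borel \<beta> K"
  shows "AE t in lborel. (prim \<beta> has_vector_derivative \<beta> t) (at t)"
proof -
  interpret bounded_borel \<beta> K by fact
  obtain N where N: "negligible N" "\<And>t e. t \<notin> N \<Longrightarrow> 0 < e \<Longrightarrow>
      \<exists>d>0. \<forall>h. 0 < h \<and> h < d \<longrightarrow> norm (prim \<beta> (t + h) - prim \<beta> t - h *\<^sub>R \<beta> t) \<le> e * h"
    using prim_right_derivative[OF b] by blast
  \<comment> \<open>The right derivative of the reflected primitive at - t controls the left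
    derivative at t.\<close>
  obtain N' where N': "negligible N'" "\<And>t e. t \<notin> N' \<Longrightarrow> 0 < e \<Longrightarrow>
      \<exists>d>0. \<forall>h. 0 < h \<and> h < d \<longrightarrow> norm (prim (\<lambda>t. \<beta> (- t)) (t + h) - prim (\<lambda>t. \<beta> (- t)) t - h *\<^sub>R \<beta> (- t)) \<le> e * h"
    using prim_right_derivative[OF bounded_borel_reflect] by blast
  have null: "AE t in lborel. t \<notin> M" if "negligible M" for M :: "real set"
    using AE_not_in[of M lebesgue] that by (simp add: negligible_iff_null_sets AE_completion_iff)
  have ae: "AE t in lborel. t \<notin> N \<and> - t \<notin> N'"
    using null[OF N(1)] AE_lborel_reflect[OF null[OF N'(1)], of 0] by (auto elim: eventually_elim2)
  have "(prim \<beta> has_vector_derivative \<beta> t) (at t)" if t': "t \<notin> N \<and> - t \<notin> N'" for t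
    unfolding has_vector_derivative_def has_derivative_at_alt
  proof (intro conjI allI impI bounded_linear_scaleR_left)
    fix e :: real assume e: "0 < e"
    obtain d where d: "d > 0" "\<And>h. 0 < h \<Longrightarrow> h < d \<Longrightarrow> norm (prim \<beta> (t + h) - prim \<beta> t - h *\<^sub>R \<beta> t) \<le> e * h"
      using N(2)[OF conjunct1[OF t'] e] by blast
    obtain d' where d': "d' > 0" "\<And>h. 0 < h \<Longrightarrow> h < d' \<Longrightarrow> norm (prim (\<lambda>t. \<beta> (- t)) (- t + h) - prim (\<lambda>t. \<beta> (- t)) (- t) - h *\<^sub>R \<beta> t) \<le> e * h"
      using N'(2)[OF conjunct2[OF t'] e] by auto
    show "\<exists>d>0. \<forall>y. norm (y - t) < d \<longrightarrow> norm (prim \<beta> y - prim \<beta> t - (y - t) *\<^sub>R \<beta> t) \<le> e * norm (y - t)"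
    proof (intro exI[of _ "min d d'"] conjI allI impI)
      fix y assume y: "norm (y - t) < min d d'"
      consider "y = t" | "t < y" | "y < t" by linarith
      then show "norm (prim \<beta> y - prim \<beta> t - (y - t) *\<^sub>R \<beta> t) \<le> e * norm (y - t)"
      proof cases
        case 2 then show ?thesis using d(2)[of "y - t"] y by simp
      next
        case 3
        have "prim (\<lambda>t. \<beta> (- t)) (- y) - prim (\<lambda>t. \<beta> (- t)) (- t) = prim \<beta> t - prim \<beta> y"
          using prim_reflect[OF b, of "- t" "- y"] 3 by simp
        then have "norm (prim \<beta> t - prim \<beta> y - (t - y) *\<^sub>R \<beta> t) \<le> e * (t - y)"
          using d'(2)[of "t - y"] y 3 by simp
        moreover have "prim \<beta> y - prim \<beta> t - (y - t) *\<^sub>R \<beta> t = - (prim \<beta> t - prim \<beta> y - (t - y) *\<^sub>R \<beta> t)"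
          by (simp add: algebra_simps)
        ultimately show ?thesis using 3 by (metis abs_minus_commute abs_of_pos diff_gt_0_iff_gt norm_minus_cancel real_norm_def)
      qed simp
    qed (use d d' in auto)
  qed
  then show ?thesis using ae by (auto elim: eventually_mono)
qed

lemma AE_lborel_prodD:
  fixes P :: "'a::euclidean_space \<times> 'b::euclidean_space \<Rightarrow> bool"
  assumes "AE z in lborel. P z"
  shows "AE x in lborel. AE y in lborel. P (x, y)"
  using assms unfolding lborel_prod[symmetric] by (rule lborel_pair.AE_pair)

text \<open>The bridge from the completed measure to Borel integrands. The function f may be
  arbitrary on a null set, as the time derivatives of the kernel are.\<close>

lemma lebesgue_AE_eq_borel:
  fixes f g :: "'a::euclidean_space \<Rightarrow> 'b::euclidean_space"
  assumes g: "g \<in> borel_measurable borel" and e: "AE x in lborel. f x = g x"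
  shows "f \<in> borel_measurable lebesgue" "integral\<^sup>L lebesgue f = integral\<^sup>L lborel g"
    "integrable lebesgue f \<longleftrightarrow> integrable lborel g"
proof -
  have gl: "g \<in> borel_measurable lebesgue" using g by (simp add: measurable_completion)
  have el: "AE x in lebesgue. g x = f x" using e by (auto simp: AE_completion_iff elim: eventually_mono)
  show fl: "f \<in> borel_measurable lebesgue" by (rule borel_measurable_AE[OF gl el])
  show "integral\<^sup>L lebesgue f = integral\<^sup>L lborel g"
    using integral_cong_AE[OF gl fl el] integral_completion[of g lborel] g by simp
  show "integrable lebesgue f \<longleftrightarrow> integrable lborel g"
    using integrable_cong_AE[OF gl fl el] integrable_completion[of g lborel] g by simp
qed

section \<open>Derivatives of the kernel at regular times\<close>

context elliptic_coeff
begin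

text \<open>Times that are not regular form the one exceptional null set in t. Kernels with lag
  \<tau> also need t - \<tau> to be regular, which holds for almost every \<tau>.\<close>

definition regular_time :: "real \<Rightarrow> bool" where
  "regular_time t \<longleftrightarrow> (prim a has_vector_derivative a t) (at t)"

lemma AE_regular_time: "AE t in lborel. regular_time t"
  unfolding regular_time_def by (rule AE_prim_has_vector_derivative[OF a.bounded_borel_axioms])

text \<open>One chain rule for the three curves below: t moving with \<tau> fixed, \<tau> moving
  with t fixed, and both moving along the diagonal. Continuity keeps \<tau> positive near s0, hence
  the matrices positive definite, where the derivative of the Gaussian is available.\<close>

lemma gauss_curve_derivative:
  assumes d: "((\<lambda>s. prim a (t s) - prim a (t s - \<tau> s)) has_vector_derivative H) (at s0)"
    and o: "0 < \<tau> s0" and c: "isCont \<tau> s0"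
  shows "((\<lambda>s. gauss (A_mat a (t s) (\<tau> s)) z) has_real_derivative gauss_hess (A_mat a (t s0) (\<tau> s0)) z \<bullet> H) (at s0)"
proof -
  have "\<forall>\<^sub>F s in at s0. 0 < \<tau> s" using order_tendstoD(1)[OF c[unfolded isCont_def] o] .
  then have "\<forall>\<^sub>F s in nhds s0. 0 < \<tau> s" 
    unfolding eventually_at_filter by (rule eventually_mono) (metis o UNIV_I)
  then obtain U where U: "open U" "s0 \<in> U" "\<And>s. s \<in> U \<Longrightarrow> 0 < \<tau> s" unfolding eventually_nhds by blast
  define A where "A s = prim a (t s) - prim a (t s - \<tau> s)" for s
  have A: "A_mat a (t s) (\<tau> s) = A s" if "s \<in> U" for s using U(3)[OF that] by (simp add: A_def A_mat_eq)
  have pd: "A ` U \<subseteq> Collect posdef" 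
  proof (intro image_subsetI CollectI)
    fix s assume s: "s \<in> U"
    show "posdef (A s)" using A_mat_posdef[OF U(3)[OF s], of "t s"] A[OF s] by simp
  qed
  have "(A has_derivative (\<lambda>h. h *\<^sub>R H)) (at s0 within U)"
    using d unfolding has_vector_derivative_def A_def by (rule has_derivative_at_withinI)
  moreover have "((\<lambda>A. gauss A z) has_derivative (\<lambda>K. gauss_hess (A s0) z \<bullet> K)) (at (A s0) within A ` U)"
    using gauss_has_derivative[of "A s0" z] pd U(2) by (auto intro: has_derivative_subset)
  ultimately have "((\<lambda>s. gauss (A s) z) has_derivative (\<lambda>h. gauss_hess (A s0) z \<bullet> (h *\<^sub>R H))) (at s0 within U)"
    by (rule has_derivative_in_compose)
  moreover have "(\<lambda>h. gauss_hess (A s0) z \<bullet> (h *\<^sub>R H)) = (*) (gauss_hess (A s0) z \<bullet> H)"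
    by (rule ext) simp
  ultimately have "((\<lambda>s. gauss (A s) z) has_real_derivative gauss_hess (A s0) z \<bullet> H) (at s0)"
    unfolding has_field_derivative_def by (simp only: at_within_open[OF U(2) U(1)])
  then have "((\<lambda>s. gauss (A_mat a (t s) (\<tau> s)) z) has_real_derivative gauss_hess (A s0) z \<bullet> H) (at s0)"
    by (rule has_field_derivative_transform_within_open[OF _ U(1,2)]) (simp add: A)
  then show ?thesis using A U by simp
qed

lemma heat_kernel_dt:
  assumes "0 < \<tau>" "regular_time t" "regular_time (t - \<tau>)"
  shows "((\<lambda>s. heat_kernel a s \<tau> z) has_real_derivative exp (- \<tau>) * (gauss_hess (A_mat a t \<tau>) z \<bullet> (a t - a (t - \<tau>)))) (at t)"
proof -
  have "((\<lambda>s. prim a (s - \<tau>)) has_vector_derivative a (t - \<tau>)) (at t)"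
    using assms(3) unfolding regular_time_def has_vector_derivative_def
    by (auto intro!: has_derivative_compose[of "\<lambda>s. s - \<tau>" "\<lambda>h. h" t UNIV "prim a" "\<lambda>h. h *\<^sub>R a (t - \<tau>)"] derivative_eq_intros)
  then have "((\<lambda>s. prim a s - prim a (s - \<tau>)) has_vector_derivative a t - a (t - \<tau>)) (at t)"
    using assms(2) unfolding regular_time_def by (intro has_vector_derivative_diff)
  from gauss_curve_derivative[OF this, of z] assms(1)
  have "((\<lambda>s. gauss (A_mat a s \<tau>) z) has_real_derivative gauss_hess (A_mat a t \<tau>) z \<bullet> (a t - a (t - \<tau>))) (at t)" by simp
  from DERIV_cmult[OF this, of "exp (- \<tau>)"] show ?thesis using assms(1) by (simp add: heat_kernel_eq)
qed

lemma heat_kernel_dtau: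
  assumes "0 < \<tau>" "regular_time (t - \<tau>)"
  shows "((\<lambda>s. heat_kernel a t s z) has_real_derivative
     exp (- \<tau>) * (gauss_hess (A_mat a t \<tau>) z \<bullet> a (t - \<tau>)) - heat_kernel a t \<tau> z) (at \<tau>)"
proof -
  have "((\<lambda>s. prim a (t - s)) has_vector_derivative - a (t - \<tau>)) (at \<tau>)"
    using assms(2) unfolding regular_time_def has_vector_derivative_def
    by (auto intro!: has_derivative_compose[of "\<lambda>s. t - s" "\<lambda>h. - h" \<tau> UNIV "prim a" "\<lambda>h. h *\<^sub>R a (t - \<tau>)", simplified] derivative_eq_intros)
  then have "((\<lambda>s. prim a t - prim a (t - s)) has_vector_derivative 0 - - a (t - \<tau>)) (at \<tau>)"
    by (intro has_vector_derivative_diff has_vector_derivative_const)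
  from gauss_curve_derivative[OF this, of z] assms(1)
  have "((\<lambda>s. gauss (A_mat a t s) z) has_real_derivative gauss_hess (A_mat a t \<tau>) z \<bullet> a (t - \<tau>)) (at \<tau>)" by simp
  then have "((\<lambda>s. exp (- s) * gauss (A_mat a t s) z) has_real_derivative
      exp (- \<tau>) * (gauss_hess (A_mat a t \<tau>) z \<bullet> a (t - \<tau>)) - exp (- \<tau>) * gauss (A_mat a t \<tau>) z) (at \<tau>)"
    by (auto intro!: derivative_eq_intros)
  then have "((\<lambda>s. heat_kernel a t s z) has_real_derivative
      exp (- \<tau>) * (gauss_hess (A_mat a t \<tau>) z \<bullet> a (t - \<tau>)) - exp (- \<tau>) * gauss (A_mat a t \<tau>) z) (at \<tau>)"
    by (rule has_field_derivative_transform_within_open[where S="{0<..}"]) (use assms in \<open>auto simp: heat_kernel_eq\<close>)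
  then show ?thesis using assms by (simp add: heat_kernel_eq)
qed

lemma heat_kernel_diagonal_dt:
  assumes "0 < t" "regular_time t"
  shows "((\<lambda>s. heat_kernel a s s z) has_real_derivative
     exp (- t) * (gauss_hess (A_mat a t t) z \<bullet> a t) - heat_kernel a t t z) (at t)"
proof -
  have "((\<lambda>s. prim a s - prim a (s - s)) has_vector_derivative a t - 0) (at t)"
    using assms(2) unfolding regular_time_def by (intro has_vector_derivative_diff) auto
  from gauss_curve_derivative[OF this, of z] assms(1)
  have "((\<lambda>s. gauss (A_mat a s s) z) has_real_derivative gauss_hess (A_mat a t t) z \<bullet> a t) (at t)" by simp
  then have "((\<lambda>s. exp (- s) * gauss (A_mat a s s) z) has_real_derivative
      exp (- t) * (gauss_hess (A_mat a t t) z \<bullet> a t) - exp (- t) * gauss (A_mat a t t) z) (at t)"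
    by (auto intro!: derivative_eq_intros)
  then have "((\<lambda>s. heat_kernel a s s z) has_real_derivative
      exp (- t) * (gauss_hess (A_mat a t t) z \<bullet> a t) - exp (- t) * gauss (A_mat a t t) z) (at t)"
    by (rule has_field_derivative_transform_within_open[where S="{0<..}"]) (use assms in \<open>auto simp: heat_kernel_eq\<close>)
  then show ?thesis using assms by (simp add: heat_kernel_eq)
qed

lemma heat_kernel_pd2:
  assumes "0 < \<tau>"
  shows "pd2 i j (heat_kernel a t \<tau>) z = exp (- \<tau>) * gauss_hess (A_mat a t \<tau>) z $ i $ j"
proof -
  note p = gauss_pd[OF A_mat_posdef[OF assms]]
  have e: "heat_kernel a t \<tau> = (\<lambda>z. exp (- \<tau>) * gauss (A_mat a t \<tau>) z)" using assms by (simp add: heat_kernel_eq fun_eq_iff)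
  have c: "has_pd k (\<lambda>x. exp (- \<tau>) * h x) (\<lambda>x. exp (- \<tau>) * h' x)" if "has_pd k h h'" for k :: 'n and h h'
    using that unfolding has_pd_def by (auto intro!: derivative_eq_intros)
  show ?thesis
    unfolding pd2_def e has_pd_imp_pd(1)[OF c[OF p(1)]] has_pd_imp_pd(1)[OF c[OF p(2)]] by simp
qed

text \<open>The terms with a (t - \<tau>) cancel in the sum: in the direction (1, 1) the lower end
  point t - \<tau> of the averaging interval stands still and only the upper one moves.\<close>

lemma heat_kernel_dt_dtau_eq:
  assumes "0 < \<tau>" "regular_time t" "regular_time (t - \<tau>)"
  shows "heat_kernel_dt_dtau a t \<tau> z = (\<Sum>i\<in>UNIV. \<Sum>j\<in>UNIV. a t $ i $ j * pd2 i j (heat_kernel a t \<tau>) z) - heat_kernel a t \<tau> z"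
  using DERIV_imp_deriv[OF heat_kernel_dt[OF assms, of z]] DERIV_imp_deriv[OF heat_kernel_dtau[OF assms(1,3), of z]]
  by (simp add: heat_kernel_dt_dtau_def inner_diff_right heat_kernel_pd2[OF assms(1)] inner_matrix_eq_sum sum_distrib_left
      right_diff_distrib sum_subtractf mult_ac)

lemma heat_kernel_diagonal_deriv:
  assumes "0 < t" "regular_time t"
  shows "deriv (\<lambda>s. heat_kernel a s s z) t = (\<Sum>i\<in>UNIV. \<Sum>j\<in>UNIV. a t $ i $ j * pd2 i j (heat_kernel a t t) z) - heat_kernel a t t z"
  using DERIV_imp_deriv[OF heat_kernel_diagonal_dt[OF assms, of z]]
  by (simp add: heat_kernel_pd2[OF assms(1)] inner_matrix_eq_sum sum_distrib_left mult_ac)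

end

section \<open>Extension by zero of compactly supported C2 data\<close>

lemma C2c_extend:
  fixes h :: "'a::euclidean_space \<Rightarrow> real"
  assumes h: "C2c_on S h" and S: "open S"
  obtains K and h' :: "'a \<Rightarrow> 'a \<Rightarrow>\<^sub>L real" and h'' :: "'a \<Rightarrow> 'a \<Rightarrow>\<^sub>L 'a \<Rightarrow>\<^sub>L real" where
    "compact K" "K \<subseteq> S" "\<And>x. x \<notin> K \<Longrightarrow> h' x = 0" "\<And>x. x \<notin> K \<Longrightarrow> h'' x = 0"
    "\<And>x. x \<notin> K \<Longrightarrow> (if x \<in> S then h x else 0) = 0"
    "\<And>x. ((\<lambda>x. if x \<in> S then h x else 0) has_derivative blinfun_apply (h' x)) (at x)"
    "\<And>x. (h' has_derivative blinfun_apply (h'' x)) (at x)" "continuous_on UNIV h''"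
proof -
  obtain g' :: "'a \<Rightarrow> 'a \<Rightarrow>\<^sub>L real" and g'' :: "'a \<Rightarrow> 'a \<Rightarrow>\<^sub>L 'a \<Rightarrow>\<^sub>L real" where
    g: "\<And>x. x \<in> S \<Longrightarrow> (h has_derivative blinfun_apply (g' x)) (at x)"
      "\<And>x. x \<in> S \<Longrightarrow> (g' has_derivative blinfun_apply (g'' x)) (at x)" "continuous_on S g''"
    using h unfolding C2c_on_def C2_on_def by blast
  define K where "K = closure (support_on S h)"
  have K: "compact K" "K \<subseteq> S" using h by (auto simp: C2c_on_def K_def)
  have oK: "open (- K)" using K(1) compact_imp_closed by blast
  define he where "he x = (if x \<in> S then h x else 0)" for x
  define h' where "h' x = (if x \<in> S then g' x else 0)" for x
  define h'' where "h'' x = (if x \<in> S then g'' x else 0)" for x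
  have he0: "he x = 0" if "x \<notin> K" for x
    using that closure_subset[of "support_on S h"] by (auto simp: he_def K_def support_on_def)
  have dS: "(he has_derivative blinfun_apply (h' x)) (at x)" "(h' has_derivative blinfun_apply (h'' x)) (at x)" if "x \<in> S" for x
    using has_derivative_transform_within_open[OF g(1)[OF that] S that, of he]
      has_derivative_transform_within_open[OF g(2)[OF that] S that, of h'] that
    by (simp_all add: he_def h'_def h''_def)
  have d0: "(he has_derivative (\<lambda>_. 0)) (at x)" if "x \<notin> K" for x
    by (rule has_derivative_transform_within_open[OF has_derivative_const[of 0] oK]) (use that he0 in auto)
  \<comment> \<open>On S - K the given derivatives must vanish by uniqueness, since the function is
    zero on the open complement of K. The pieces on the open sets S and - K therefore agree where
    they overlap; the Hessian is treated in the same way below.\<close>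
  have h'0: "h' x = 0" if x: "x \<notin> K" for x
  proof (cases "x \<in> S")
    case True
    have "blinfun_apply (h' x) = (\<lambda>_. 0)" using has_derivative_unique[OF dS(1)[OF True] d0[OF x]] .
    then show ?thesis by (intro blinfun_eqI) simp
  qed (simp add: h'_def)
  have d1: "(h' has_derivative (\<lambda>_. 0)) (at x)" if "x \<notin> K" for x
    by (rule has_derivative_transform_within_open[OF has_derivative_const[of 0] oK]) (use that h'0 in auto)
  have h''0: "h'' x = 0" if x: "x \<notin> K" for x
  proof (cases "x \<in> S")
    case True
    have "blinfun_apply (h'' x) = (\<lambda>_. 0)" using has_derivative_unique[OF dS(2)[OF True] d1[OF x]] .
    then show ?thesis by (intro blinfun_eqI) simp
  qed (simp add: h''_def)
  have "continuous_on (S \<union> - K) h''"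
  proof (rule continuous_on_open_Un[OF S oK])
    show "continuous_on S h''" using g(3) by (rule continuous_on_eq) (simp add: h''_def)
    show "continuous_on (- K) h''" using continuous_on_const[of "- K" 0] by (rule continuous_on_eq) (simp add: h''0)
  qed
  moreover have "S \<union> - K = UNIV" using K by blast
  ultimately have c: "continuous_on UNIV h''" by simp
  have D: "(he has_derivative blinfun_apply (h' x)) (at x)" "(h' has_derivative blinfun_apply (h'' x)) (at x)" for x
  proof -
    have "(he has_derivative blinfun_apply (h' x)) (at x) \<and> (h' has_derivative blinfun_apply (h'' x)) (at x)"
    proof (cases "x \<in> K")
      case True
      then show ?thesis using dS K by blast
    next
      case False
      have e: "blinfun_apply (h' x) = (\<lambda>_. 0)" "blinfun_apply (h'' x) = (\<lambda>_. 0)"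
        using h'0[OF False] h''0[OF False] by (simp_all add: fun_eq_iff)
      show ?thesis unfolding e using d0[OF False] d1[OF False] by blast
    qed
    then show "(he has_derivative blinfun_apply (h' x)) (at x)" "(h' has_derivative blinfun_apply (h'' x)) (at x)" by blast+
  qed
  show ?thesis
    by (rule that[OF K h'0 h''0 he0[unfolded he_def] D(1)[unfolded he_def[abs_def]] D(2) c])
qed

lemma Cb_compact_support:
  fixes h :: "'a::euclidean_space \<Rightarrow> real"
  assumes c: "continuous_on UNIV h" and K: "compact K" "\<And>x. x \<notin> K \<Longrightarrow> h x = 0"
  shows "Cb h"
proof -
  have "bounded (h ` K)" by (intro compact_imp_bounded compact_continuous_image continuous_on_subset[OF c] K) auto
  moreover have "range h \<subseteq> insert 0 (h ` K)" using K(2) by auto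
  ultimately show ?thesis using c by (auto simp: Cb_def intro: bounded_subset[of "insert 0 (h ` K)"])
qed

lemma has_pd_from_derivative:
  fixes h :: "'a::real_normed_vector \<Rightarrow> real"
  assumes h: "\<And>z. (h has_derivative D z) (at z)" and L: "\<And>x s. L (x + s *\<^sub>R axis i 1) = L x + s *\<^sub>R v"
  shows "has_pd i (\<lambda>x. h (L x)) (\<lambda>x. D (L x) v)"
  unfolding has_pd_def
proof
  fix x
  have "((\<lambda>s. h (L x + s *\<^sub>R v)) has_derivative (\<lambda>s. D (L x) (s *\<^sub>R v))) (at 0)"
    by (rule has_derivative_compose[of "\<lambda>s. L x + s *\<^sub>R v" "\<lambda>s. s *\<^sub>R v" 0 UNIV h "D (L x)"])
       (use h[of "L x"] in \<open>auto intro!: derivative_eq_intros\<close>)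
  moreover have "(\<lambda>s. D (L x) (s *\<^sub>R v)) = (*) (D (L x) v)"
    using linear_cmul[OF has_derivative_linear[OF h[of "L x"]], of _ v] by (simp add: fun_eq_iff mult.commute)
  ultimately show "((\<lambda>s. h (L (x + s *\<^sub>R axis i 1))) has_real_derivative D (L x) v) (at 0)"
    unfolding L has_field_derivative_def by simp
qed

text \<open>The map L is either a time slice x \<mapsto> (t, x) or the identity, and v gives the
  images of the axes; thus source and initial datum are handled together.\<close>

lemma C2c_family:
  fixes h :: "'a::euclidean_space \<Rightarrow> real" and v :: "'n::finite \<Rightarrow> 'a"
  assumes h: "C2c_on S h" and S: "open S"
  obtains h1 h2 where "Cb (\<lambda>x. if x \<in> S then h x else 0)" "\<And>j. Cb (h1 j)" "\<And>i j. Cb (h2 i j)"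
    "\<And>j L. (\<And>(x::real^'n) s. L (x + s *\<^sub>R axis j 1) = L x + s *\<^sub>R v j) \<Longrightarrow> has_pd j (\<lambda>x. if L x \<in> S then h (L x) else 0) (\<lambda>x. h1 j (L x))"
    "\<And>i j L. (\<And>(x::real^'n) s. L (x + s *\<^sub>R axis i 1) = L x + s *\<^sub>R v i) \<Longrightarrow> has_pd i (\<lambda>x. h1 j (L x)) (\<lambda>x. h2 i j (L x))"
proof -
  obtain K and h' :: "'a \<Rightarrow> 'a \<Rightarrow>\<^sub>L real" and h'' :: "'a \<Rightarrow> 'a \<Rightarrow>\<^sub>L 'a \<Rightarrow>\<^sub>L real" where
    K: "compact K" "K \<subseteq> S" "\<And>x. x \<notin> K \<Longrightarrow> h' x = 0" "\<And>x. x \<notin> K \<Longrightarrow> h'' x = 0"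
    "\<And>x. x \<notin> K \<Longrightarrow> (if x \<in> S then h x else 0) = 0"
    "\<And>x. ((\<lambda>x. if x \<in> S then h x else 0) has_derivative blinfun_apply (h' x)) (at x)"
    "\<And>x. (h' has_derivative blinfun_apply (h'' x)) (at x)" "continuous_on UNIV h''"
    using C2c_extend[OF h S] by blast
  have c: "continuous_on UNIV h'" "continuous_on UNIV (\<lambda>x. if x \<in> S then h x else 0)"
    by (rule has_derivative_continuous_on[OF has_derivative_at_withinI[OF K(7)]],
        rule has_derivative_continuous_on[OF has_derivative_at_withinI[OF K(6)]])
  show ?thesis
  proof (rule that[of "\<lambda>j z. blinfun_apply (h' z) (v j)" "\<lambda>i j z. blinfun_apply (blinfun_apply (h'' z) (v i)) (v j)"])
    show "Cb (\<lambda>x. if x \<in> S then h x else 0)" by (rule Cb_compact_support[OF c(2) K(1) K(5)])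
    show "Cb (\<lambda>z. blinfun_apply (h' z) (v j))" for j
      by (rule Cb_compact_support[OF _ K(1)]) (use K(3) in \<open>auto intro!: continuous_intros c\<close>)
    show "Cb (\<lambda>z. blinfun_apply (blinfun_apply (h'' z) (v i)) (v j))" for i j
      by (rule Cb_compact_support[OF _ K(1)]) (use K(4) in \<open>auto intro!: continuous_intros K(8)\<close>)
    show "has_pd j (\<lambda>x. if L x \<in> S then h (L x) else 0) (\<lambda>x. blinfun_apply (h' (L x)) (v j))"
      if "\<And>(x::real^'n) s. L (x + s *\<^sub>R axis j 1) = L x + s *\<^sub>R v j" for j L
      by (rule has_pd_from_derivative[OF K(6) that])
    have d2: "((\<lambda>z. blinfun_apply (h' z) w) has_derivative (\<lambda>u. blinfun_apply (blinfun_apply (h'' z) u) w)) (at z)" for z w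
      by (rule derivative_eq_intros K(7) refl)+ simp
    show "has_pd i (\<lambda>x. blinfun_apply (h' (L x)) (v j)) (\<lambda>x. blinfun_apply (blinfun_apply (h'' (L x)) (v i)) (v j))"
      if "\<And>(x::real^'n) s. L (x + s *\<^sub>R axis i 1) = L x + s *\<^sub>R v i" for i j L
      by (rule has_pd_from_derivative[OF d2 that])
  qed
qed

lemma open_half_space: "open (half_space :: (real \<times> (real^'n)) set)"
  unfolding half_space_def by (intro open_Times) auto

lemma C2c_on_half_space_source:
  fixes f :: "real \<times> (real^'n) \<Rightarrow> real"
  assumes "C2c_on half_space f"
  obtains \<phi>1 \<phi>2 where "C2b_source (\<lambda>z. if 0 < fst z then f z else 0) \<phi>1 \<phi>2"
proof -
  have hs: "z \<in> half_space \<longleftrightarrow> 0 < fst z" for z :: "real \<times> (real^'n)"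
    by (cases z) (simp add: half_space_def)
  obtain h1 :: "'n \<Rightarrow> real \<times> (real^'n) \<Rightarrow> real" and h2 where
    h: "Cb (\<lambda>x. if x \<in> half_space then f x else 0)" "\<And>j. Cb (h1 j)" "\<And>i j. Cb (h2 i j)"
    "\<And>j L. (\<And>(x::real^'n) s. L (x + s *\<^sub>R axis j 1) = L x + s *\<^sub>R (0, axis j 1)) \<Longrightarrow> has_pd j (\<lambda>x. if L x \<in> half_space then f (L x) else 0) (\<lambda>x. h1 j (L x))"
    "\<And>i j L. (\<And>(x::real^'n) s. L (x + s *\<^sub>R axis i 1) = L x + s *\<^sub>R (0, axis i 1)) \<Longrightarrow> has_pd i (\<lambda>x. h1 j (L x)) (\<lambda>x. h2 i j (L x))"
    using C2c_family[OF assms open_half_space, of "\<lambda>i. (0, axis i 1)"] by blast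
  have "has_pd j (\<lambda>x. if (t, x) \<in> half_space then f (t, x) else 0) (\<lambda>x. h1 j (t, x))"
    "has_pd i (\<lambda>x. h1 j (t, x)) (\<lambda>x. h2 i j (t, x))" for i j t
    by (rule h(4)[where L="\<lambda>x. (t, x)"], simp) (rule h(5)[where L="\<lambda>x. (t, x)"], simp)
  then have "C2b_source (\<lambda>z. if 0 < fst z then f z else 0) h1 h2"
    using h(1-3) unfolding C2b_source_def hs by simp
  then show ?thesis by (rule that)
qed

lemma C2c_on_UNIV_C2b:
  fixes g :: "real^'n \<Rightarrow> real"
  assumes "C2c_on UNIV g"
  obtains \<psi>1 \<psi>2 where "C2b g \<psi>1 \<psi>2"
proof -
  obtain h1 :: "'n \<Rightarrow> real^'n \<Rightarrow> real" and h2 where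
    h: "Cb (\<lambda>x. if x \<in> UNIV then g x else 0)" "\<And>j. Cb (h1 j)" "\<And>i j. Cb (h2 i j)"
    "\<And>j L. (\<And>(x::real^'n) s. L (x + s *\<^sub>R axis j 1) = L x + s *\<^sub>R axis j 1) \<Longrightarrow> has_pd j (\<lambda>x. if L x \<in> UNIV then g (L x) else 0) (\<lambda>x. h1 j (L x))"
    "\<And>i j L. (\<And>(x::real^'n) s. L (x + s *\<^sub>R axis i 1) = L x + s *\<^sub>R axis i 1) \<Longrightarrow> has_pd i (\<lambda>x. h1 j (L x)) (\<lambda>x. h2 i j (L x))"
    using C2c_family[OF assms open_UNIV, of "\<lambda>i. axis i 1"] by blast
  have "C2b g h1 h2"
    using h(1-3) h(4)[where L="\<lambda>x. x"] h(5)[where L="\<lambda>x. x"] unfolding C2b_def by simp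
  then show ?thesis by (rule that)
qed

section \<open>Limit formulas and existence\<close>

lemma AE_lborel_fst:
  assumes "AE r in lborel. P (r::real)"
  shows "AE z in (lborel :: (real \<times> 'b::euclidean_space) measure). P (fst z)"
proof -
  obtain N where N: "{r \<in> space lborel. \<not> P r} \<subseteq> N" "emeasure lborel N = 0" "N \<in> sets lborel"
    using assms by (rule AE_E)
  have "emeasure (lborel \<Otimes>\<^sub>M (lborel :: 'b measure)) (N \<times> UNIV) = emeasure lborel N * emeasure (lborel :: 'b measure) UNIV"
    by (rule lborel.emeasure_pair_measure_Times) (use N in auto)
  then have "emeasure (lborel :: (real \<times> 'b) measure) (N \<times> UNIV) = 0" using N(2) by (simp add: lborel_prod)
  moreover have "N \<times> (UNIV :: 'b set) \<in> sets lborel"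
  proof -
    have "N \<times> (UNIV :: 'b set) \<in> sets (borel \<Otimes>\<^sub>M borel)" using N(3) by (intro pair_measureI) auto
    then show ?thesis unfolding borel_prod sets_lborel .
  qed
  ultimately have "N \<times> (UNIV :: 'b set) \<in> null_sets lborel" by (rule null_setsI)
  then show ?thesis by (rule AE_I') (use N in auto)
qed

context elliptic_coeff
begin

definition duhamel_slice :: "(real \<times> (real^'n) \<Rightarrow> real) \<Rightarrow> real \<Rightarrow> real^'n \<Rightarrow> real \<Rightarrow> real" where
  "duhamel_slice h t x \<tau> = (LINT y|lborel. heat_kernel a t \<tau> y * h (t - \<tau>, x - y))"

lemma duhamel_slice_measurable:
  assumes [measurable]: "h \<in> borel_measurable borel"
  shows "duhamel_slice h t x \<in> borel_measurable borel"
  unfolding duhamel_slice_def[abs_def] by measurable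

lemma duhamel_slice_integrable:
  assumes "Cb h" shows "integrable lborel (duhamel_slice h t x)" "duhamel h t x = (LINT \<tau>|lborel. duhamel_slice h t x \<tau>)"
  using lborel_pair.integrable_fst'[of "\<lambda>z. heat_kernel a t (fst z) (snd z) * h (t - fst z, x - snd z)"]
    lborel_pair.integral_fst'[of "\<lambda>z. heat_kernel a t (fst z) (snd z) * h (t - fst z, x - snd z)"]
    Cb_duhamel_integrable[OF assms, of t x]
  by (simp_all add: duhamel_def duhamel_slice_def[abs_def] lborel_prod)

lemma duhamel_slice_zero:
  assumes "\<And>t x. t \<le> 0 \<Longrightarrow> h (t, x) = 0" "\<tau> \<notin> {0<..<t}"
  shows "duhamel_slice h t x \<tau> = 0"
proof -
  have "heat_kernel a t \<tau> y * h (t - \<tau>, x - y) = 0" for y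
    using assms(2) assms(1)[of "t - \<tau>"] by (cases "0 < \<tau>") (auto simp: heat_kernel_eq)
  then show ?thesis unfolding duhamel_slice_def by (simp only: Bochner_Integration.integral_zero)
qed

text \<open>Passage to Borel representatives at every point (t, x), not only at almost every one:
  reflection about (t, x) preserves null sets, and almost every slice in \<tau> of a null set is
  null. As f0 vanishes at nonpositive times, the cutoff to lags below t is built into it.\<close>

lemma heat_potential_AE:
  assumes f0: "f0 \<in> borel_measurable borel" and z: "\<And>t x. t \<le> 0 \<Longrightarrow> f0 (t, x) = 0"
    and f: "AE z in lborel. 0 < fst z \<longrightarrow> f z = f0 z"
    and g0: "g0 \<in> borel_measurable borel" and g: "AE x in lborel. g x = g0 x"
  shows "heat_potential a f g (t, x) = (LINT \<tau>|lborel. duhamel_slice f0 t x \<tau>) + flow 0 t g0 x"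
    "heat_potential_converges a f g t x \<longleftrightarrow>
       integrable lborel (\<lambda>z. heat_kernel a t (fst z) (snd z) * f0 (t - fst z, x - snd z)) \<and>
       integrable lborel (\<lambda>y. heat_kernel a t t y * g0 (x - y))"
proof -
  note [measurable] = f0 g0
  have aef: "AE z in lborel. 0 < t - fst z \<longrightarrow> f (t - fst z, x - snd z) = f0 (t - fst z, x - snd z)"
    using AE_lborel_reflect[OF f, of "(t, x)"] by (simp add: minus_prod_def case_prod_beta)
  have aeg: "AE y in lborel. heat_kernel a t t y * g (x - y) = heat_kernel a t t y * g0 (x - y)"
    using AE_lborel_reflect[OF g, of x] by (auto elim: eventually_mono)
  have gm: "(\<lambda>y. heat_kernel a t t y * g0 (x - y)) \<in> borel_measurable borel" by measurable
  note G = lebesgue_AE_eq_borel[OF gm aeg]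
  have "AE z in lborel. indicator ({0<..<t} \<times> UNIV) z *\<^sub>R (case z of (\<tau>, y) \<Rightarrow> heat_kernel a t \<tau> y * f (t - \<tau>, x - y))
      = heat_kernel a t (fst z) (snd z) * f0 (t - fst z, x - snd z)"
    using aef
  proof eventually_elim
    case (elim z)
    then show ?case using z[of "t - fst z"]
      by (cases z) (auto simp: indicator_def heat_kernel_eq)
  qed
  then have "set_integrable lebesgue ({0<..<t} \<times> UNIV) (\<lambda>(\<tau>, y). heat_kernel a t \<tau> y * f (t - \<tau>, x - y)) \<longleftrightarrow>
     integrable lborel (\<lambda>z. heat_kernel a t (fst z) (snd z) * f0 (t - fst z, x - snd z))"
    unfolding set_integrable_def by (intro lebesgue_AE_eq_borel(3)) measurable
  then show "heat_potential_converges a f g t x \<longleftrightarrow>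
       integrable lborel (\<lambda>z. heat_kernel a t (fst z) (snd z) * f0 (t - fst z, x - snd z)) \<and>
       integrable lborel (\<lambda>y. heat_kernel a t t y * g0 (x - y))"
    using G(3) by (simp add: heat_potential_converges_def)
  have "AE \<tau> in lborel. indicator {0<..<t} \<tau> *\<^sub>R (LINT y|lebesgue. heat_kernel a t \<tau> y * f (t - \<tau>, x - y)) = duhamel_slice f0 t x \<tau>"
    using AE_lborel_prodD[OF aef]
  proof eventually_elim
    case (elim \<tau>)
    show ?case
    proof (cases "\<tau> \<in> {0<..<t}")
      case True
      then have "AE y in lborel. heat_kernel a t \<tau> y * f (t - \<tau>, x - y) = heat_kernel a t \<tau> y * f0 (t - \<tau>, x - y)"
        using elim by (auto elim: eventually_mono)
      then have "(LINT y|lebesgue. heat_kernel a t \<tau> y * f (t - \<tau>, x - y)) = (LINT y|lborel. heat_kernel a t \<tau> y * f0 (t - \<tau>, x - y))"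
        by (intro lebesgue_AE_eq_borel(2)) measurable
      then show ?thesis using True by (simp add: duhamel_slice_def)
    qed (simp add: duhamel_slice_zero[of f0, OF z])
  qed
  then have "(LINT \<tau>:{0<..<t}|lebesgue. LINT y|lebesgue. heat_kernel a t \<tau> y * f (t - \<tau>, x - y)) = (LINT \<tau>|lborel. duhamel_slice f0 t x \<tau>)"
    unfolding set_lebesgue_integral_def by (intro lebesgue_AE_eq_borel(2) duhamel_slice_measurable f0)
  then show "heat_potential a f g (t, x) = (LINT \<tau>|lborel. duhamel_slice f0 t x \<tau>) + flow 0 t g0 x"
    using G(2) by (simp add: heat_potential_def flow_def)
qed

text \<open>Once the derivatives are on the data the slices are integrable up to \<tau> = 0, so the
  truncation at \<epsilon> disappears by dominated convergence. The limits in both formulas are of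
  this kind.\<close>

lemma duhamel_slice_limit:
  assumes h: "Cb h" "\<And>t x. t \<le> 0 \<Longrightarrow> h (t, x) = 0"
  shows "((\<lambda>\<epsilon>. LINT \<tau>:{\<epsilon><..<t}|lborel. duhamel_slice h t x \<tau>) \<longlongrightarrow> duhamel h t x) (at_right 0)"
  unfolding tendsto_at_iff_sequentially
proof (intro allI impI)
  fix X :: "nat \<Rightarrow> real" assume X: "\<forall>n. X n \<in> {0<..} - {0}" "X \<longlonglongrightarrow> 0"
  have m[measurable]: "duhamel_slice h t x \<in> borel_measurable borel" by (rule duhamel_slice_measurable[OF Cb_measurable[OF h(1)]])
  have "(\<lambda>n. LINT \<tau>|lborel. indicator {X n<..<t} \<tau> *\<^sub>R duhamel_slice h t x \<tau>) \<longlonglongrightarrow> (LINT \<tau>|lborel. duhamel_slice h t x \<tau>)"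
  proof (rule integral_dominated_convergence[where w="\<lambda>\<tau>. \<bar>duhamel_slice h t x \<tau>\<bar>"])
    show "integrable lborel (\<lambda>\<tau>. \<bar>duhamel_slice h t x \<tau>\<bar>)" using duhamel_slice_integrable(1)[OF h(1)] by simp
    show "AE \<tau> in lborel. (\<lambda>n. indicator {X n<..<t} \<tau> *\<^sub>R duhamel_slice h t x \<tau>) \<longlonglongrightarrow> duhamel_slice h t x \<tau>"
    proof (rule AE_I2)
      fix \<tau>
      show "(\<lambda>n. indicator {X n<..<t} \<tau> *\<^sub>R duhamel_slice h t x \<tau>) \<longlonglongrightarrow> duhamel_slice h t x \<tau>"
      proof (cases "\<tau> \<in> {0<..<t}")
        case True
        then have "\<forall>\<^sub>F n in sequentially. X n < \<tau>" using order_tendstoD(2)[OF X(2)] by simp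
        then have "\<forall>\<^sub>F n in sequentially. indicator {X n<..<t} \<tau> *\<^sub>R duhamel_slice h t x \<tau> = duhamel_slice h t x \<tau>"
          by eventually_elim (use True in simp)
        then show ?thesis by (rule tendsto_eventually)
      qed (simp add: duhamel_slice_zero[of h, OF h(2)])
    qed
  qed (auto simp: indicator_def)
  then show "((\<lambda>\<epsilon>. LINT \<tau>:{\<epsilon><..<t}|lborel. duhamel_slice h t x \<tau>) \<circ> X) \<longlonglongrightarrow> duhamel h t x"
    by (simp add: o_def set_lebesgue_integral_def duhamel_slice_integrable(2)[OF h(1)])
qed

text \<open>Both placements of the shift are given, because the formulas put x - y into the kernel
  for the source and into the datum for the initial value.\<close>

lemma pd2_kernel_integral:
  assumes \<tau>: "0 < \<tau>" and h: "C2b h h1 h2"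
  shows "integrable lborel (\<lambda>y. pd2 i j (heat_kernel a t \<tau>) y * h (x - y))"
    "(LINT y|lborel. pd2 i j (heat_kernel a t \<tau>) y * h (x - y)) = (LINT y|lborel. heat_kernel a t \<tau> y * h2 i j (x - y))"
    "integrable lborel (\<lambda>y. pd2 i j (heat_kernel a t \<tau>) (x - y) * h y)"
    "(LINT y|lborel. pd2 i j (heat_kernel a t \<tau>) (x - y) * h y) = (LINT y|lborel. heat_kernel a t \<tau> y * h2 i j (x - y))"
    "(\<lambda>y. pd2 i j (heat_kernel a t \<tau>) y) \<in> borel_measurable borel"
proof -
  note e = A_mat_elliptic[OF \<tau>, of t]
  have Cb: "Cb h" using h by (simp add: C2b_def)
  note [measurable] = Cb_measurable[OF Cb] gauss_measurable[OF elliptic_imp_posdef[OF e]]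
  show m[measurable]: "(\<lambda>y. pd2 i j (heat_kernel a t \<tau>) y) \<in> borel_measurable borel"
    unfolding heat_kernel_pd2[OF \<tau>] by measurable
  show 1: "integrable lborel (\<lambda>y. pd2 i j (heat_kernel a t \<tau>) y * h (x - y))"
    using integrable_gauss_mult(3)[OF e Cb, where x=x] by (simp add: heat_kernel_pd2[OF \<tau>] mult.assoc)
  show 2: "(LINT y|lborel. pd2 i j (heat_kernel a t \<tau>) y * h (x - y)) = (LINT y|lborel. heat_kernel a t \<tau> y * h2 i j (x - y))"
    using gauss_integration_by_parts[OF e h, of i j x] \<tau> by (simp add: heat_kernel_pd2[OF \<tau>] heat_kernel_eq mult.assoc)
  define F where "F u = pd2 i j (heat_kernel a t \<tau>) u * h (x - u)" for u
  have Fm: "F \<in> borel_measurable borel" unfolding F_def by measurable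
  have "F (x - y) = pd2 i j (heat_kernel a t \<tau>) (x - y) * h y" for y by (simp add: F_def)
  then show "integrable lborel (\<lambda>y. pd2 i j (heat_kernel a t \<tau>) (x - y) * h y)"
    "(LINT y|lborel. pd2 i j (heat_kernel a t \<tau>) (x - y) * h y) = (LINT y|lborel. heat_kernel a t \<tau> y * h2 i j (x - y))"
    using lborel_integrable_reflect[OF Fm, of x] lborel_integral_reflect[OF Fm, of x] 1 2 by (simp_all add: F_def[abs_def])
qed

lemma kernel_integral_reflect:
  assumes h: "Cb h"
  shows "integrable lborel (\<lambda>y. heat_kernel a t \<tau> (x - y) * h y)"
    "(LINT y|lborel. heat_kernel a t \<tau> (x - y) * h y) = (LINT y|lborel. heat_kernel a t \<tau> y * h (x - y))"
proof -
  note [measurable] = Cb_measurable[OF h]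
  define F where "F u = heat_kernel a t \<tau> u * h (x - u)" for u
  have Fm: "F \<in> borel_measurable borel" unfolding F_def by measurable
  have "F (x - y) = heat_kernel a t \<tau> (x - y) * h y" for y by (simp add: F_def)
  then show "integrable lborel (\<lambda>y. heat_kernel a t \<tau> (x - y) * h y)"
    "(LINT y|lborel. heat_kernel a t \<tau> (x - y) * h y) = (LINT y|lborel. heat_kernel a t \<tau> y * h (x - y))"
    using lborel_integrable_reflect[OF Fm, of x] lborel_integral_reflect[OF Fm, of x] Cb_flow_integrable[OF h, of t \<tau> x]
    by (simp_all add: F_def[abs_def])
qed

text \<open>For lags between \<epsilon> and t the matrices have the common constants \<Lambda>
  \<epsilon> and t / \<Lambda>, so one Gaussian dominates. This is the absolute convergence of the
  truncated integrals.\<close>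

lemma pd2_strip:
  fixes x :: "real^'n" and t :: real
  assumes \<epsilon>: "0 < \<epsilon>" and h: "Cb h"
  defines "G \<equiv> \<lambda>i j z. indicator ({\<epsilon><..<t} \<times> UNIV) z *\<^sub>R (pd2 i j (heat_kernel a t (fst z)) (x - snd z) * h (t - fst z, snd z))"
    and "G0 \<equiv> \<lambda>z. indicator ({\<epsilon><..<t} \<times> UNIV) z *\<^sub>R (heat_kernel a t (fst z) (x - snd z) * h (t - fst z, snd z))"
  shows "G i j \<in> borel_measurable borel" "integrable lborel (G i j)" "G0 \<in> borel_measurable borel" "integrable lborel G0"
proof -
  note [measurable] = Cb_measurable[OF h]
  obtain B where B: "0 \<le> B" "\<And>z. \<bar>h z\<bar> \<le> B" using Cb_D(2)[OF h] by blast
  have S[measurable]: "({\<epsilon><..<t} \<times> UNIV) \<in> sets (borel :: (real \<times> (real^'n)) measure)"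
    by (intro borel_open open_Times) auto
  have o: "(\<lambda>z. indicator ({\<epsilon><..<t} \<times> UNIV) z *\<^sub>R gauss_hess (A_mat a t (fst z)) (x - snd z)) \<in> borel_measurable (borel :: (real \<times> (real^'n)) measure)"
    by (rule borel_measurable_continuous_on_indicator[OF S])
       (use \<epsilon> in \<open>auto intro!: continuous_intros continuous_on_gauss continuous_on_A_mat A_mat_posdef\<close>)
  note [measurable] = o
  have Ge: "G i j = (\<lambda>z. exp (- fst z) * (indicator ({\<epsilon><..<t} \<times> UNIV) z *\<^sub>R gauss_hess (A_mat a t (fst z)) (x - snd z)) $ i $ j * h (t - fst z, snd z))"
    using \<epsilon> by (auto simp: G_def fun_eq_iff indicator_def heat_kernel_pd2)
  show Gm: "G i j \<in> borel_measurable borel" unfolding Ge by measurable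
  show G0m: "G0 \<in> borel_measurable borel" unfolding G0_def by measurable
  have ir: "integrable lborel (\<lambda>y. K * gexp (m / \<Lambda>) (x - y))" if "0 < m" for K m
  proof -
    have "(\<lambda>y. K * gexp (m / \<Lambda>) y) \<in> borel_measurable (borel :: (real^'n) measure)" using gexp_integrable[OF that] by simp
    from lborel_integrable_reflect[OF this, of x] gexp_integrable[OF that] show ?thesis by simp
  qed
  have t: "0 < t" if "z \<in> {\<epsilon><..<t} \<times> UNIV" for z :: "real \<times> (real^'n)" using that \<epsilon> by auto
  show "integrable lborel G0"
  proof (cases "\<epsilon> < t")
    case True
    then have t: "0 < t" using \<epsilon> by simp
    have "integrable (lborel \<Otimes>\<^sub>M lborel) G0"
    proof (rule integrable_strip(1)[OF G0m, where b=\<epsilon> and c=t])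
      show "integrable lborel (\<lambda>y. (gcon (\<Lambda> * \<epsilon>) TYPE('n) * B) * gexp (t / \<Lambda>) (x - y))" by (rule ir[OF t])
      show "\<bar>G0 (r, y)\<bar> \<le> indicator {\<epsilon>..t} r * ((gcon (\<Lambda> * \<epsilon>) TYPE('n) * B) * gexp (t / \<Lambda>) (x - y))" for r y
      proof (cases "r \<in> {\<epsilon><..<t}")
        case True
        have k: "\<bar>heat_kernel a t r (x - y)\<bar> \<le> gcon (\<Lambda> * \<epsilon>) TYPE('n) * gexp (t / \<Lambda>) (x - y)"
          by (rule heat_kernel_le_local) (use True \<epsilon> in auto)
        have "\<bar>heat_kernel a t r (x - y)\<bar> * \<bar>h (t - r, y)\<bar> \<le> (gcon (\<Lambda> * \<epsilon>) TYPE('n) * gexp (t / \<Lambda>) (x - y)) * B"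
          by (rule mult_mono[OF k B(2)]) (auto intro: order_trans[OF _ k])
        then show ?thesis using True by (simp add: G0_def abs_mult mult_ac)
      qed (use B \<epsilon> Lambda_pos in \<open>auto simp: G0_def gexp_nonneg gcon_def indicator_def\<close>)
    qed
    then show ?thesis by (simp add: lborel_prod)
  qed (simp add: G0_def)
  show "integrable lborel (G i j)"
  proof (cases "\<epsilon> < t")
    case True
    then have t: "0 < 2 * t" using \<epsilon> by simp
    define c C where "c = \<Lambda> * \<epsilon>" and "C = t / \<Lambda>"
    have c: "0 < c" "0 < C" using Lambda_pos \<epsilon> t by (auto simp: c_def C_def)
    define K where "K = gcon c TYPE('n) * (2 * C / c\<^sup>2 + 1 / (2 * c))"
    have K: "0 \<le> K" using c by (simp add: K_def gcon_def)
    have "integrable (lborel \<Otimes>\<^sub>M lborel) (G i j)"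
    proof (rule integrable_strip(1)[OF Gm, where b=\<epsilon> and c=t])
      show "integrable lborel (\<lambda>y. (K * B) * gexp (2 * t / \<Lambda>) (x - y))" by (rule ir[OF t])
      show "\<bar>G i j (r, y)\<bar> \<le> indicator {\<epsilon>..t} r * ((K * B) * gexp (2 * t / \<Lambda>) (x - y))" for r y
      proof (cases "r \<in> {\<epsilon><..<t}")
        case True
        then have r: "0 < r" using \<epsilon> by simp
        have e: "elliptic c C (A_mat a t r)"
          by (rule elliptic_weaken[OF A_mat_elliptic[OF r]])
             (use True \<epsilon> Lambda_pos in \<open>auto simp: c_def C_def intro: mult_left_mono divide_right_mono\<close>)
        have g: "\<bar>gauss_hess (A_mat a t r) (x - y) $ i $ j\<bar> \<le> K * gexp (2 * t / \<Lambda>) (x - y)"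
          using gauss_hess_le(1)[OF e, of "x - y" i j] by (simp add: K_def C_def)
        have "exp (- r) * \<bar>gauss_hess (A_mat a t r) (x - y) $ i $ j\<bar> \<le> 1 * (K * gexp (2 * t / \<Lambda>) (x - y))"
          by (rule mult_mono[OF _ g]) (use r in auto)
        then have k: "\<bar>pd2 i j (heat_kernel a t r) (x - y)\<bar> \<le> K * gexp (2 * t / \<Lambda>) (x - y)"
          by (simp add: heat_kernel_pd2[OF r] abs_mult)
        have "\<bar>pd2 i j (heat_kernel a t r) (x - y)\<bar> * \<bar>h (t - r, y)\<bar> \<le> (K * gexp (2 * t / \<Lambda>) (x - y)) * B"
          by (rule mult_mono[OF k B(2)]) (auto intro: order_trans[OF _ k])
        then show ?thesis using True by (simp add: G_def abs_mult mult_ac)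
      qed (use B K in \<open>auto simp: G_def gexp_nonneg indicator_def\<close>)
    qed
    then show ?thesis by (simp add: lborel_prod)
  qed (simp add: G_def)
qed

end

context C2_data
begin

lemma source_space_formula:
  assumes t: "0 < t" and f: "\<And>t x. 0 < t \<Longrightarrow> f (t, x) = \<phi> (t, x)"
  shows "space_formula_terms_exist a f \<psi> i j t x"
    "((\<lambda>\<epsilon>. LINT \<tau>:{\<epsilon><..<t}|lebesgue. LINT y|lebesgue. pd2 i j (heat_kernel a t \<tau>) (x - y) * f (t - \<tau>, y)) \<longlongrightarrow> duhamel (\<phi>2 i j) t x) (at_right 0)"
    "(LINT y|lebesgue. pd2 i j (heat_kernel a t t) y * \<psi> (x - y)) = flow 0 t (\<psi>2 i j) x"
proof -
  note P0 = pd2_kernel_integral[OF t ini, of i j t]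
  note [measurable] = Cb_measurable[OF iniD(1)] P0(5)
  have gm: "(\<lambda>y. pd2 i j (heat_kernel a t t) y * \<psi> (x - y)) \<in> borel_measurable borel" by measurable
  have gi: "integrable lebesgue (\<lambda>y. pd2 i j (heat_kernel a t t) y * \<psi> (x - y))"
    using P0(1) gm by (simp add: integrable_completion)
  have "set_integrable lebesgue ({\<epsilon><..<t} \<times> UNIV) (\<lambda>(\<tau>, y). pd2 i j (heat_kernel a t \<tau>) (x - y) * f (t - \<tau>, y))"
    if \<epsilon>: "\<epsilon> \<in> {0<..<t}" for \<epsilon>
  proof -
    note s = pd2_strip(1,2)[OF _ srcD(1), where \<epsilon>=\<epsilon> and t=t and x=x and i=i and j=j]
    have "(\<lambda>z. indicator ({\<epsilon><..<t} \<times> UNIV) z *\<^sub>R (case z of (\<tau>, y) \<Rightarrow> pd2 i j (heat_kernel a t \<tau>) (x - y) * f (t - \<tau>, y)))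
       = (\<lambda>z. indicator ({\<epsilon><..<t} \<times> UNIV) z *\<^sub>R (pd2 i j (heat_kernel a t (fst z)) (x - snd z) * \<phi> (t - fst z, snd z)))"
      using f by (auto simp: fun_eq_iff indicator_def)
    then show ?thesis
      using s \<epsilon> unfolding set_integrable_def by (simp add: integrable_completion)
  qed
  then show "space_formula_terms_exist a f \<psi> i j t x"
    using gi by (simp add: space_formula_terms_exist_def)
  show "(LINT y|lebesgue. pd2 i j (heat_kernel a t t) y * \<psi> (x - y)) = flow 0 t (\<psi>2 i j) x"
    using P0(2)[of x] gm by (simp add: integral_completion flow_def)
  have "(LINT \<tau>:{\<epsilon><..<t}|lebesgue. LINT y|lebesgue. pd2 i j (heat_kernel a t \<tau>) (x - y) * f (t - \<tau>, y)) = (LINT \<tau>:{\<epsilon><..<t}|lborel. duhamel_slice (\<phi>2 i j) t x \<tau>)"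
    if \<epsilon>: "0 < \<epsilon>" for \<epsilon>
  proof -
    have "(LINT y|lebesgue. pd2 i j (heat_kernel a t \<tau>) (x - y) * f (t - \<tau>, y)) = duhamel_slice (\<phi>2 i j) t x \<tau>" if \<tau>: "\<tau> \<in> {\<epsilon><..<t}" for \<tau>
    proof -
      have \<tau>0: "0 < \<tau>" using \<tau> \<epsilon> by simp
      note P = pd2_kernel_integral[OF \<tau>0 srcD(9)[of "t - \<tau>"], of i j t]
      have "(LINT y|lebesgue. pd2 i j (heat_kernel a t \<tau>) (x - y) * f (t - \<tau>, y)) = (LINT y|lebesgue. pd2 i j (heat_kernel a t \<tau>) (x - y) * \<phi> (t - \<tau>, y))"
        using f \<tau> by simp
      also have "\<dots> = (LINT y|lborel. pd2 i j (heat_kernel a t \<tau>) (x - y) * \<phi> (t - \<tau>, y))"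
        using P(3)[of x] by (intro integral_completion) auto
      finally show ?thesis using P(4)[of x] by (simp add: duhamel_slice_def)
    qed
    then have "(LINT \<tau>:{\<epsilon><..<t}|lebesgue. LINT y|lebesgue. pd2 i j (heat_kernel a t \<tau>) (x - y) * f (t - \<tau>, y)) = (LINT \<tau>:{\<epsilon><..<t}|lebesgue. duhamel_slice (\<phi>2 i j) t x \<tau>)"
      unfolding set_lebesgue_integral_def by (intro Bochner_Integration.integral_cong refl) (auto simp: indicator_def)
    also have "\<dots> = (LINT \<tau>:{\<epsilon><..<t}|lborel. duhamel_slice (\<phi>2 i j) t x \<tau>)"
      unfolding set_lebesgue_integral_def using duhamel_slice_measurable[OF Cb_measurable[OF srcD(3)], of i j t x]
      by (intro integral_completion) measurable
    finally show ?thesis .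
  qed
  then have "\<forall>\<^sub>F \<epsilon> in at_right 0. (LINT \<tau>:{\<epsilon><..<t}|lebesgue. LINT y|lebesgue. pd2 i j (heat_kernel a t \<tau>) (x - y) * f (t - \<tau>, y)) = (LINT \<tau>:{\<epsilon><..<t}|lborel. duhamel_slice (\<phi>2 i j) t x \<tau>)"
    by (auto intro: eventually_at_right_less[THEN eventually_mono])
  then show "((\<lambda>\<epsilon>. LINT \<tau>:{\<epsilon><..<t}|lebesgue. LINT y|lebesgue. pd2 i j (heat_kernel a t \<tau>) (x - y) * f (t - \<tau>, y)) \<longlongrightarrow> duhamel (\<phi>2 i j) t x) (at_right 0)"
    by (subst tendsto_cong, assumption) (rule duhamel_slice_limit, rule srcD(3), rule srcD(6))
qed

text \<open>At a regular t and for almost every lag the derivative of the kernel is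
  \<open>a t\<close> contracted with its Hessian, minus the kernel. Here \<open>a t\<close> is
  constant in the integration variables, so the limit is a finite combination of the spatial
  ones.\<close>

lemma source_time_formula:
  assumes t: "0 < t" and r: "regular_time t" and f: "\<And>t x. 0 < t \<Longrightarrow> f (t, x) = \<phi> (t, x)"
  shows "time_formula_terms_exist a f \<psi> t x"
    "((\<lambda>\<epsilon>. LINT \<tau>:{\<epsilon><..<t}|lebesgue. LINT y|lebesgue. heat_kernel_dt_dtau a t \<tau> (x - y) * f (t - \<tau>, y)) \<longlongrightarrow> duhamel_rate \<phi> \<phi>2 t x) (at_right 0)"
    "(LINT y|lebesgue. deriv (\<lambda>s. heat_kernel a s s y) t * \<psi> (x - y)) = flow_rate 0 \<psi> \<psi>2 t x"
proof -
  have P0: "integrable lborel (\<lambda>y. pd2 i j (heat_kernel a t t) y * \<psi> (x - y))"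
    "(LINT y|lborel. pd2 i j (heat_kernel a t t) y * \<psi> (x - y)) = flow 0 t (\<psi>2 i j) x"
    "(\<lambda>y. pd2 i j (heat_kernel a t t) y) \<in> borel_measurable borel" for i j
    using pd2_kernel_integral[OF t ini, of i j t] by (simp_all add: flow_def)
  note [measurable] = Cb_measurable[OF iniD(1)] P0(3)
  have ge: "deriv (\<lambda>s. heat_kernel a s s y) t * \<psi> (x - y)
     = (\<Sum>i\<in>UNIV. \<Sum>j\<in>UNIV. a t $ i $ j * (pd2 i j (heat_kernel a t t) y * \<psi> (x - y))) - heat_kernel a t t y * \<psi> (x - y)" for y
    by (simp add: heat_kernel_diagonal_deriv[OF t r] left_diff_distrib sum_distrib_right mult.assoc)
  have gi: "integrable lborel (\<lambda>y. deriv (\<lambda>s. heat_kernel a s s y) t * \<psi> (x - y))"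
    unfolding ge by (intro Bochner_Integration.integrable_diff Bochner_Integration.integrable_sum integrable_mult_right P0 Cb_flow_integrable iniD)
  have gm: "(\<lambda>y. deriv (\<lambda>s. heat_kernel a s s y) t * \<psi> (x - y)) \<in> borel_measurable borel"
    using borel_measurable_integrable[OF gi] by simp
  have gil: "integrable lebesgue (\<lambda>y. deriv (\<lambda>s. heat_kernel a s s y) t * \<psi> (x - y))"
    using gi gm by (simp add: integrable_completion)
  show "(LINT y|lebesgue. deriv (\<lambda>s. heat_kernel a s s y) t * \<psi> (x - y)) = flow_rate 0 \<psi> \<psi>2 t x"
  proof -
    have "(LINT y|lebesgue. deriv (\<lambda>s. heat_kernel a s s y) t * \<psi> (x - y)) = (LINT y|lborel. deriv (\<lambda>s. heat_kernel a s s y) t * \<psi> (x - y))"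
      by (rule integral_completion) (use gm in simp)
    also have "\<dots> = (\<Sum>i\<in>UNIV. \<Sum>j\<in>UNIV. a t $ i $ j * flow 0 t (\<psi>2 i j) x) - (LINT y|lborel. heat_kernel a t t y * \<psi> (x - y))"
      unfolding ge using P0 Cb_flow_integrable[OF iniD(1), of t t x] by (simp add: integrable_sum integral_sum)
    finally show ?thesis by (simp add: flow_rate_def flow_def)
  qed
  have rae: "AE \<tau> in lborel. regular_time (t - \<tau>)" by (rule AE_lborel_reflect[OF AE_regular_time])
  have de: "heat_kernel_dt_dtau a t \<tau> (x - y) * f (t - \<tau>, y)
      = (\<Sum>i\<in>UNIV. \<Sum>j\<in>UNIV. a t $ i $ j * (pd2 i j (heat_kernel a t \<tau>) (x - y) * \<phi> (t - \<tau>, y))) - heat_kernel a t \<tau> (x - y) * \<phi> (t - \<tau>, y)"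
    if "\<tau> \<in> {0<..<t}" "regular_time (t - \<tau>)" for \<tau> y
    using that f by (simp add: heat_kernel_dt_dtau_eq[OF _ r that(2)] left_diff_distrib sum_distrib_right mult.assoc)
  have si: "set_integrable lebesgue ({\<epsilon><..<t} \<times> UNIV) (\<lambda>(\<tau>, y). heat_kernel_dt_dtau a t \<tau> (x - y) * f (t - \<tau>, y))"
    if \<epsilon>: "\<epsilon> \<in> {0<..<t}" for \<epsilon>
  proof -
    have \<epsilon>0: "0 < \<epsilon>" using \<epsilon> by simp
    define I where "I = (\<lambda>z::real \<times> (real^'n). indicator ({\<epsilon><..<t} \<times> UNIV) z :: real)"
    note s = pd2_strip[OF \<epsilon>0 srcD(1), where t=t and x=x, folded I_def]
    define G where "G z = (\<Sum>i\<in>UNIV. \<Sum>j\<in>UNIV. a t $ i $ j * (I z *\<^sub>R (pd2 i j (heat_kernel a t (fst z)) (x - snd z) * \<phi> (t - fst z, snd z))))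
        - I z *\<^sub>R (heat_kernel a t (fst z) (x - snd z) * \<phi> (t - fst z, snd z))" for z
    have Gi: "integrable lborel G"
      unfolding G_def by (intro Bochner_Integration.integrable_diff Bochner_Integration.integrable_sum integrable_mult_right s)
    have "AE z in lborel. I z *\<^sub>R (case z of (\<tau>, y) \<Rightarrow> heat_kernel_dt_dtau a t \<tau> (x - y) * f (t - \<tau>, y)) = G z"
      using AE_lborel_fst[OF rae]
    proof eventually_elim
      case (elim z)
      then show ?case using \<epsilon> de[of "fst z" "snd z"] by (cases z) (auto simp: G_def I_def indicator_def)
    qed
    then show ?thesis
      unfolding set_integrable_def I_def[symmetric]
      by (subst lebesgue_AE_eq_borel(3)) (use Gi in auto)
  qed
  have "AE \<tau> in lebesgue. \<tau> \<in> {0<..<t} \<longrightarrow>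
        (\<forall>z. (\<lambda>s. heat_kernel a s \<tau> z) differentiable (at t) \<and> (\<lambda>s. heat_kernel a t s z) differentiable (at \<tau>))"
    unfolding AE_completion_iff using rae
  proof eventually_elim
    case (elim \<tau>)
    then show ?case
      using heat_kernel_dt[OF _ r elim] heat_kernel_dtau[OF _ elim] unfolding real_differentiable_def by auto
  qed
  moreover have "\<forall>z. (\<lambda>s. heat_kernel a s s z) differentiable (at t)"
    using heat_kernel_diagonal_dt[OF t r] unfolding real_differentiable_def by blast
  ultimately show "time_formula_terms_exist a f \<psi> t x"
    using si gil by (simp add: time_formula_terms_exist_def)
  have "(LINT \<tau>:{\<epsilon><..<t}|lebesgue. LINT y|lebesgue. heat_kernel_dt_dtau a t \<tau> (x - y) * f (t - \<tau>, y))
      = (\<Sum>i\<in>UNIV. \<Sum>j\<in>UNIV. a t $ i $ j * (LINT \<tau>:{\<epsilon><..<t}|lborel. duhamel_slice (\<phi>2 i j) t x \<tau>)) - (LINT \<tau>:{\<epsilon><..<t}|lborel. duhamel_slice \<phi> t x \<tau>)"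
    if \<epsilon>: "0 < \<epsilon>" for \<epsilon>
  proof -
    note [measurable] = duhamel_slice_measurable[OF Cb_measurable[OF srcD(3)], of _ _ t x] duhamel_slice_measurable[OF Cb_measurable[OF srcD(1)], of t x]
    have mi: "integrable lborel (\<lambda>\<tau>. indicator {\<epsilon><..<t} \<tau> *\<^sub>R duhamel_slice h t x \<tau>)" if "Cb h" for h
      using integrable_mult_indicator[OF _ duhamel_slice_integrable(1)[OF that], of "{\<epsilon><..<t}" t x] by simp
    have "AE \<tau> in lborel. indicator {\<epsilon><..<t} \<tau> *\<^sub>R (LINT y|lebesgue. heat_kernel_dt_dtau a t \<tau> (x - y) * f (t - \<tau>, y))
       = (\<Sum>i\<in>UNIV. \<Sum>j\<in>UNIV. a t $ i $ j * (indicator {\<epsilon><..<t} \<tau> *\<^sub>R duhamel_slice (\<phi>2 i j) t x \<tau>)) - indicator {\<epsilon><..<t} \<tau> *\<^sub>R duhamel_slice \<phi> t x \<tau>"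
      using rae
    proof eventually_elim
      case (elim \<tau>)
      show ?case
      proof (cases "\<tau> \<in> {\<epsilon><..<t}")
        case True
        then have \<tau>: "0 < \<tau>" "\<tau> \<in> {0<..<t}" using \<epsilon> by auto
        have P: "integrable lborel (\<lambda>y. pd2 i j (heat_kernel a t \<tau>) (x - y) * \<phi> (t - \<tau>, y))"
          "(LINT y|lborel. pd2 i j (heat_kernel a t \<tau>) (x - y) * \<phi> (t - \<tau>, y)) = duhamel_slice (\<phi>2 i j) t x \<tau>" for i j
          using pd2_kernel_integral(3,4)[OF \<tau>(1) srcD(9)[of "t - \<tau>"], of i j t x] by (simp_all add: duhamel_slice_def)
        note Q = kernel_integral_reflect[OF Cb_slice[OF srcD(1), of "t - \<tau>"], of t \<tau> x]
        have i: "integrable lborel (\<lambda>y. (\<Sum>i\<in>UNIV. \<Sum>j\<in>UNIV. a t $ i $ j * (pd2 i j (heat_kernel a t \<tau>) (x - y) * \<phi> (t - \<tau>, y))) - heat_kernel a t \<tau> (x - y) * \<phi> (t - \<tau>, y))"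
          by (intro Bochner_Integration.integrable_diff Bochner_Integration.integrable_sum integrable_mult_right P Q)
        have "(LINT y|lebesgue. heat_kernel_dt_dtau a t \<tau> (x - y) * f (t - \<tau>, y))
          = (LINT y|lborel. (\<Sum>i\<in>UNIV. \<Sum>j\<in>UNIV. a t $ i $ j * (pd2 i j (heat_kernel a t \<tau>) (x - y) * \<phi> (t - \<tau>, y))) - heat_kernel a t \<tau> (x - y) * \<phi> (t - \<tau>, y))"
          unfolding de[OF \<tau>(2) elim] by (rule integral_completion) (use borel_measurable_integrable[OF i] in simp)
        also have "\<dots> = (\<Sum>i\<in>UNIV. \<Sum>j\<in>UNIV. a t $ i $ j * duhamel_slice (\<phi>2 i j) t x \<tau>) - duhamel_slice \<phi> t x \<tau>"
          using P Q by (simp add: integrable_sum integral_sum duhamel_slice_def)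
        finally show ?thesis using True by simp
      qed simp
    qed
    then have "(LINT \<tau>:{\<epsilon><..<t}|lebesgue. LINT y|lebesgue. heat_kernel_dt_dtau a t \<tau> (x - y) * f (t - \<tau>, y))
       = (LINT \<tau>|lborel. (\<Sum>i\<in>UNIV. \<Sum>j\<in>UNIV. a t $ i $ j * (indicator {\<epsilon><..<t} \<tau> *\<^sub>R duhamel_slice (\<phi>2 i j) t x \<tau>)) - indicator {\<epsilon><..<t} \<tau> *\<^sub>R duhamel_slice \<phi> t x \<tau>)"
      unfolding set_lebesgue_integral_def by (intro lebesgue_AE_eq_borel(2)) measurable
    also have "\<dots> = (\<Sum>i\<in>UNIV. \<Sum>j\<in>UNIV. a t $ i $ j * (LINT \<tau>:{\<epsilon><..<t}|lborel. duhamel_slice (\<phi>2 i j) t x \<tau>)) - (LINT \<tau>:{\<epsilon><..<t}|lborel. duhamel_slice \<phi> t x \<tau>)"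
      unfolding set_lebesgue_integral_def using mi[OF srcD(3)] mi[OF srcD(1)] by (simp add: integrable_sum integral_sum)
    finally show ?thesis .
  qed
  then have "\<forall>\<^sub>F \<epsilon> in at_right 0. (LINT \<tau>:{\<epsilon><..<t}|lebesgue. LINT y|lebesgue. heat_kernel_dt_dtau a t \<tau> (x - y) * f (t - \<tau>, y))
      = (\<Sum>i\<in>UNIV. \<Sum>j\<in>UNIV. a t $ i $ j * (LINT \<tau>:{\<epsilon><..<t}|lborel. duhamel_slice (\<phi>2 i j) t x \<tau>)) - (LINT \<tau>:{\<epsilon><..<t}|lborel. duhamel_slice \<phi> t x \<tau>)"
    by (auto intro: eventually_at_right_less[THEN eventually_mono])
  moreover have "((\<lambda>\<epsilon>. (\<Sum>i\<in>UNIV. \<Sum>j\<in>UNIV. a t $ i $ j * (LINT \<tau>:{\<epsilon><..<t}|lborel. duhamel_slice (\<phi>2 i j) t x \<tau>)) - (LINT \<tau>:{\<epsilon><..<t}|lborel. duhamel_slice \<phi> t x \<tau>)) \<longlongrightarrow> duhamel_rate \<phi> \<phi>2 t x) (at_right 0)"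
    unfolding duhamel_rate_def by (intro tendsto_intros duhamel_slice_limit srcD)
  ultimately show "((\<lambda>\<epsilon>. LINT \<tau>:{\<epsilon><..<t}|lebesgue. LINT y|lebesgue. heat_kernel_dt_dtau a t \<tau> (x - y) * f (t - \<tau>, y)) \<longlongrightarrow> duhamel_rate \<phi> \<phi>2 t x) (at_right 0)"
    by (simp add: tendsto_cong)
qed

lemma heat_potential_eq_W:
  assumes f: "\<And>t x. 0 < t \<Longrightarrow> f (t, x) = \<phi> (t, x)"
  shows "heat_potential a f \<psi> (t, x) = W t x" "heat_potential_converges a f \<psi> t x"
proof -
  have f': "AE z in lborel. 0 < fst z \<longrightarrow> f z = \<phi> z" using f by (auto intro!: AE_I2)
  have g': "AE x in lborel. \<psi> x = \<psi> x" by simp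
  note m = Cb_measurable[OF srcD(1)] Cb_measurable[OF iniD(1)]
  have "heat_potential a f \<psi> (t, x) = (LINT \<tau>|lborel. duhamel_slice \<phi> t x \<tau>) + flow 0 t \<psi> x"
    by (rule heat_potential_AE(1)[OF m(1) _ f' m(2) g']) (rule srcD(4))
  then show "heat_potential a f \<psi> (t, x) = W t x"
    by (simp add: W_def duhamel_slice_integrable(2)[OF srcD(1)])
  have "heat_potential_converges a f \<psi> t x \<longleftrightarrow>
       integrable lborel (\<lambda>z. heat_kernel a t (fst z) (snd z) * \<phi> (t - fst z, x - snd z)) \<and>
       integrable lborel (\<lambda>y. heat_kernel a t t y * \<psi> (x - y))"
    by (rule heat_potential_AE(2)[OF m(1) _ f' m(2) g']) (rule srcD(4))
  then show "heat_potential_converges a f \<psi> t x"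
    using Cb_duhamel_integrable[OF srcD(1), of t x] Cb_flow_integrable[OF iniD(1), of t t x] by simp
qed

lemma lipschitz_abs_cont_on:
  assumes "\<And>r r'. b \<le> r \<Longrightarrow> r \<le> r' \<Longrightarrow> r' \<le> c \<Longrightarrow> \<bar>h r' - h r\<bar> \<le> K * (r' - r)" and K: "0 \<le> K"
  shows "abs_cont_on b c h"
  unfolding abs_cont_on_def
proof (intro allI impI)
  fix \<epsilon> :: real assume \<epsilon>: "0 < \<epsilon>"
  show "\<exists>\<delta>>0. \<forall>(N::nat) l r. (\<forall>k<N. b \<le> l k \<and> l k \<le> r k \<and> r k \<le> c) \<longrightarrow>
        (\<forall>k<N. \<forall>m<N. k \<noteq> m \<longrightarrow> {l k<..<r k} \<inter> {l m<..<r m} = {}) \<longrightarrow>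
        (\<Sum>k<N. r k - l k) < \<delta> \<longrightarrow> (\<Sum>k<N. \<bar>h (r k) - h (l k)\<bar>) < \<epsilon>"
  \<comment> \<open>With K + 1 in place of K the final inequality is strict also when K = 0.\<close>
  proof (intro exI[of _ "\<epsilon> / (K + 1)"] conjI allI impI)
    show "0 < \<epsilon> / (K + 1)" using \<epsilon> K by simp
    fix N :: nat and l r :: "nat \<Rightarrow> real"
    assume lr: "\<forall>k<N. b \<le> l k \<and> l k \<le> r k \<and> r k \<le> c" and s: "(\<Sum>k<N. r k - l k) < \<epsilon> / (K + 1)"
    have "(\<Sum>k<N. \<bar>h (r k) - h (l k)\<bar>) \<le> (\<Sum>k<N. (K + 1) * (r k - l k))"
    proof (rule sum_mono)
      fix k assume "k \<in> {..<N}"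
      then have "b \<le> l k" "l k \<le> r k" "r k \<le> c" using lr by auto
      then show "\<bar>h (r k) - h (l k)\<bar> \<le> (K + 1) * (r k - l k)"
        using assms(1)[of "l k" "r k"] by (simp add: distrib_right)
    qed
    also have "\<dots> = (K + 1) * (\<Sum>k<N. r k - l k)" by (simp add: sum_distrib_left)
    also have "\<dots> < (K + 1) * (\<epsilon> / (K + 1))" using s K by (intro mult_strict_left_mono) auto
    also have "\<dots> = \<epsilon>" using K by simp
    finally show "(\<Sum>k<N. \<bar>h (r k) - h (l k)\<bar>) < \<epsilon>" .
  qed
qed

lemma W_classical_solution:
  assumes f: "\<And>t x. 0 < t \<Longrightarrow> f (t, x) = \<phi> (t, x)"
  shows "bounded_classical_solution a f \<psi> (\<lambda>(t, x). if t = 0 then \<psi> x else W t x)"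
proof -
  define w where "w = (\<lambda>(t, x). if t = 0 then \<psi> x else W t x)"
  obtain K where K: "\<And>x. bounded_borel (rate x) K" using rate_bounded_borel by blast
  have K0: "0 \<le> K" using K bounded_borel.K_nonneg by blast
  obtain B where B: "0 \<le> B" "\<And>t x. \<bar>W t x\<bar> \<le> B" "\<And>t x i j. \<bar>W2 t x $ i $ j\<bar> \<le> B" "\<And>z. \<bar>\<phi> z\<bar> \<le> B"
    using W_bounded by metis
  obtain B' where B': "0 \<le> B'" "\<And>z. \<bar>\<psi> z\<bar> \<le> B'" using Cb_D(2)[OF iniD(1)] by blast
  have wt: "(\<lambda>y. w (t, y)) = W t" if "0 < t" for t using that by (auto simp: w_def fun_eq_iff)
  have "\<bar>w z\<bar> \<le> B + B'" for z
    using B(2)[of "fst z" "snd z"] B'(2)[of "snd z"] B(1) B'(1) by (cases z) (auto simp: w_def)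
  then have 1: "bounded (w ` ({0..} \<times> UNIV))" by (intro boundedI[where B="B + B'"]) auto
  \<comment> \<open>The convergence to the datum is uniform in x; together with the continuity of
    \<psi> this gives joint continuity at t = 0.\<close>
  have lip: "\<bar>w (t, x) - \<psi> x\<bar> \<le> K * \<bar>t\<bar>" if "0 \<le> t" for t x
    using W_identity[of t x] bounded_borel.prim_diff_le[OF K, of x t 0] that K0 by (auto simp: w_def)
  have 2: "continuous_on ({0..} \<times> UNIV) w"
    unfolding continuous_on_eq_continuous_within
  proof
    fix p :: "real \<times> (real^'n)" assume p: "p \<in> {0..} \<times> UNIV"
    show "continuous (at p within {0..} \<times> UNIV) w"
    proof (cases "fst p = 0")
      case False
      then have pp: "p \<in> {0<..} \<times> UNIV" using p by (cases p) auto
      have "continuous_on ({0<..} \<times> UNIV) w"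
        using W_continuous(1) by (rule continuous_on_eq) (auto simp: w_def)
      moreover have "open ({0<..} \<times> (UNIV :: (real^'n) set) :: (real \<times> (real^'n)) set)" by (intro open_Times) auto
      ultimately show ?thesis using pp continuous_on_eq_continuous_at continuous_at_imp_continuous_within by blast
    next
      case True
      have "((\<lambda>q. w q - \<psi> (snd q)) \<longlongrightarrow> 0) (at p within {0..} \<times> UNIV)"
      proof (rule Lim_null_comparison)
        show "\<forall>\<^sub>F q in at p within {0..} \<times> UNIV. norm (w q - \<psi> (snd q)) \<le> K * \<bar>fst q\<bar>"
          unfolding eventually_at_filter by (intro always_eventually) (use lip in auto)
        have "((\<lambda>q. K * \<bar>fst q\<bar>) \<longlongrightarrow> K * \<bar>fst p\<bar>) (at p within {0..} \<times> UNIV)" by (intro tendsto_intros)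
        then show "((\<lambda>q. K * \<bar>fst q\<bar>) \<longlongrightarrow> 0) (at p within {0..} \<times> UNIV)" using True by simp
      qed
      moreover have "((\<lambda>q. \<psi> (snd q)) \<longlongrightarrow> \<psi> (snd p)) (at p within {0..} \<times> UNIV)"
        by (rule continuous_on_tendsto_compose[OF Cb_D(1)[OF iniD(1), of UNIV]]) (auto intro!: tendsto_intros)
      ultimately have "((\<lambda>q. (w q - \<psi> (snd q)) + \<psi> (snd q)) \<longlongrightarrow> 0 + \<psi> (snd p)) (at p within {0..} \<times> UNIV)"
        by (rule tendsto_add)
      moreover have "w p = \<psi> (snd p)" using True by (cases p) (simp add: w_def)
      ultimately show ?thesis by (simp add: continuous_within)
    qed
  qed
  have p1: "pd i (\<lambda>y. w (t, y)) = W1 i t" "pdiff i (\<lambda>y. w (t, y)) x" if "0 < t" for i t x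
    using has_pd_imp_pd[OF W_has_pd(1)] by (simp_all add: wt[OF that])
  have p2: "pd2 i j (\<lambda>y. w (t, y)) x = W2 t x $ i $ j" "pdiff i (pd j (\<lambda>y. w (t, y))) x" if "0 < t" for i j t x
    using has_pd_imp_pd[OF W_has_pd(2)] by (simp_all add: pd2_def p1[OF that])
  have 4: "(\<forall>(t, x)\<in>half_space. pdiff i (\<lambda>y. w (t, y)) x) \<and> continuous_on half_space (\<lambda>(t, x). pd i (\<lambda>y. w (t, y)) x)" for i
    using p1 continuous_on_eq[OF W_continuous(2)[of i], of "\<lambda>(t, x). pd i (\<lambda>y. w (t, y)) x"] by (auto simp: half_space_def)
  have cW: "continuous_on ({0<..} \<times> UNIV) (\<lambda>z. (case z of (t, x) \<Rightarrow> W2 t x) $ i $ j)" for i j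
    by (intro continuous_intros W_continuous)
  have "continuous_on half_space (\<lambda>(t, x). pd2 i j (\<lambda>y. w (t, y)) x)" for i j
    unfolding half_space_def by (rule continuous_on_eq[OF cW[of i j]]) (auto simp: p2)
  then have 5: "(\<forall>(t, x)\<in>half_space. pdiff i (pd j (\<lambda>y. w (t, y))) x) \<and> continuous_on half_space (\<lambda>(t, x). pd2 i j (\<lambda>y. w (t, y)) x)" for i j
    using p2(2) by (auto simp: half_space_def)
  have 6: "abs_cont_on b c (\<lambda>t. w (t, x))" if b: "0 < b" "b \<le> c" for x b c
  proof (rule lipschitz_abs_cont_on[OF _ K0])
    fix r r' assume r: "b \<le> r" "r \<le> r'" "r' \<le> c"
    then show "\<bar>w (r', x) - w (r, x)\<bar> \<le> K * (r' - r)"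
      using W_identity[of r x] W_identity[of r' x] bounded_borel.prim_diff_le[OF K, of x r' r] b by (simp add: w_def)
  qed
  have "AE t in lebesgue. 0 < t \<longrightarrow> (\<forall>x. (\<lambda>s. w (s, x)) differentiable (at t) \<and>
        deriv (\<lambda>s. w (s, x)) t - (\<Sum>i\<in>UNIV. \<Sum>j\<in>UNIV. a t $ i $ j * pd2 i j (\<lambda>y. w (t, y)) x) + w (t, x) = f (t, x))"
    unfolding AE_completion_iff using AE_regular_time
  proof eventually_elim
    case (elim t)
    show ?case
    proof (intro impI allI)
      fix x assume t: "0 < t"
      have d: "((\<lambda>s. w (s, x)) has_real_derivative a t \<bullet> W2 t x - W t x + \<phi> (t, x)) (at t)"
        by (rule has_field_derivative_transform_within_open[OF W_has_derivative[OF t elim[unfolded regular_time_def]], of "{0<..}"])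
           (use t in \<open>auto simp: w_def\<close>)
      have "w (t, x) = W t x" using t by (simp add: w_def)
      then show "(\<lambda>s. w (s, x)) differentiable (at t) \<and>
        deriv (\<lambda>s. w (s, x)) t - (\<Sum>i\<in>UNIV. \<Sum>j\<in>UNIV. a t $ i $ j * pd2 i j (\<lambda>y. w (t, y)) x) + w (t, x) = f (t, x)"
        using d DERIV_imp_deriv[OF d] f[OF t] p2(1)[OF t]
        by (auto simp: real_differentiable_def inner_matrix_eq_sum)
    qed
  qed
  moreover have "\<forall>x. w (0, x) = \<psi> x" by (simp add: w_def)
  ultimately show ?thesis
    unfolding w_def[symmetric] bounded_classical_solution_def using 1 2 4 5 6 by blast
qed

end

section \<open>Uniqueness\<close>

lemma abs_cont_onE:
  assumes "abs_cont_on b c h" "0 < \<epsilon>"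
  obtains \<delta> where "0 < \<delta>" "\<And>(N::nat) l r. (\<forall>k<N. b \<le> l k \<and> l k \<le> r k \<and> r k \<le> c) \<Longrightarrow>
        (\<forall>k<N. \<forall>m<N. k \<noteq> m \<longrightarrow> {l k<..<r k} \<inter> {l m<..<r m} = {}) \<Longrightarrow>
        (\<Sum>k<N. r k - l k) < \<delta> \<Longrightarrow> (\<Sum>k<N. \<bar>h (r k) - h (l k)\<bar>) < \<epsilon>"
proof -
  obtain \<delta> where d: "0 < \<delta>" "\<forall>(N::nat) l r. (\<forall>k<N. b \<le> l k \<and> l k \<le> r k \<and> r k \<le> c) \<longrightarrow>
        (\<forall>k<N. \<forall>m<N. k \<noteq> m \<longrightarrow> {l k<..<r k} \<inter> {l m<..<r m} = {}) \<longrightarrow>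
        (\<Sum>k<N. r k - l k) < \<delta> \<longrightarrow> (\<Sum>k<N. \<bar>h (r k) - h (l k)\<bar>) < \<epsilon>"
    using assms(1)[unfolded abs_cont_on_def, rule_format, OF assms(2)] by (elim exE conjE) (rule that)
  show ?thesis
    by (rule that[OF d(1)]) (rule d(2)[rule_format], blast+)
qed

lemma abs_cont_on_diff:
  assumes "abs_cont_on b c h" "abs_cont_on b c k"
  shows "abs_cont_on b c (\<lambda>t. h t - k t)"
  unfolding abs_cont_on_def
proof (intro allI impI)
  fix \<epsilon> :: real assume "0 < \<epsilon>"
  then have e: "0 < \<epsilon> / 2" by simp
  from assms(1) e obtain d where d: "0 < d" "\<And>(N::nat) l r. (\<forall>k<N. b \<le> l k \<and> l k \<le> r k \<and> r k \<le> c) \<Longrightarrow>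
        (\<forall>k<N. \<forall>m<N. k \<noteq> m \<longrightarrow> {l k<..<r k} \<inter> {l m<..<r m} = {}) \<Longrightarrow>
        (\<Sum>k<N. r k - l k) < d \<Longrightarrow> (\<Sum>k<N. \<bar>h (r k) - h (l k)\<bar>) < \<epsilon> / 2"
    by (rule abs_cont_onE) (rule that; blast)
  from assms(2) e obtain d' where d': "0 < d'" "\<And>(N::nat) l r. (\<forall>k<N. b \<le> l k \<and> l k \<le> r k \<and> r k \<le> c) \<Longrightarrow>
        (\<forall>k<N. \<forall>m<N. k \<noteq> m \<longrightarrow> {l k<..<r k} \<inter> {l m<..<r m} = {}) \<Longrightarrow>
        (\<Sum>k<N. r k - l k) < d' \<Longrightarrow> (\<Sum>j<N. \<bar>k (r j) - k (l j)\<bar>) < \<epsilon> / 2"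
    by (rule abs_cont_onE) (rule that; blast)
  show "\<exists>\<delta>>0. \<forall>(N::nat) l r. (\<forall>k<N. b \<le> l k \<and> l k \<le> r k \<and> r k \<le> c) \<longrightarrow>
        (\<forall>k<N. \<forall>m<N. k \<noteq> m \<longrightarrow> {l k<..<r k} \<inter> {l m<..<r m} = {}) \<longrightarrow>
        (\<Sum>k<N. r k - l k) < \<delta> \<longrightarrow> (\<Sum>j<N. \<bar>(h (r j) - k (r j)) - (h (l j) - k (l j))\<bar>) < \<epsilon>"
  proof (intro exI[of _ "min d d'"] conjI allI impI)
    fix N :: nat and l r :: "nat \<Rightarrow> real"
    assume A: "\<forall>k<N. b \<le> l k \<and> l k \<le> r k \<and> r k \<le> c"
      "\<forall>k<N. \<forall>m<N. k \<noteq> m \<longrightarrow> {l k<..<r k} \<inter> {l m<..<r m} = {}" "(\<Sum>k<N. r k - l k) < min d d'"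
    have "(\<Sum>j<N. \<bar>(h (r j) - k (r j)) - (h (l j) - k (l j))\<bar>) \<le> (\<Sum>j<N. \<bar>h (r j) - h (l j)\<bar> + \<bar>k (r j) - k (l j)\<bar>)"
      by (intro sum_mono) linarith
    also have "\<dots> < \<epsilon>" using d(2)[OF A(1,2)] d'(2)[OF A(1,2)] A(3) by (simp add: sum.distrib)
    finally show "(\<Sum>j<N. \<bar>(h (r j) - k (r j)) - (h (l j) - k (l j))\<bar>) < \<epsilon>" .
  qed (use d(1) d'(1) in auto)
qed

text \<open>A Cousin-type argument: the intervals of a fine tagged division whose tags lie in the
  exceptional null set are controlled by absolute continuity, the others by the derivative.\<close>

lemma abs_cont_on_increment_le:
  fixes h :: "real \<Rightarrow> real"
  assumes bc: "b \<le> c" and ac: "abs_cont_on b c h" and M: "0 \<le> M"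
    and d: "AE t in lebesgue. t \<in> {b<..<c} \<longrightarrow> (\<exists>D. (h has_real_derivative D) (at t) \<and> D \<le> M)"
  shows "h c - h b \<le> M * (c - b)"
proof (rule field_le_epsilon)
  fix e0 :: real assume e0: "0 < e0"
  \<comment> \<open>Exceptional intervals contribute at most e, the others an excess of at most e *
    (c - b); the total is e0.\<close>
  define e where "e = e0 / (c - b + 1)"
  have e: "0 < e" using e0 bc by (simp add: e_def)
  from ac e obtain \<delta> where \<delta>: "0 < \<delta>" "\<And>(N::nat) l r. (\<forall>k<N. b \<le> l k \<and> l k \<le> r k \<and> r k \<le> c) \<Longrightarrow>
        (\<forall>k<N. \<forall>m<N. k \<noteq> m \<longrightarrow> {l k<..<r k} \<inter> {l m<..<r m} = {}) \<Longrightarrow>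
        (\<Sum>k<N. r k - l k) < \<delta> \<Longrightarrow> (\<Sum>k<N. \<bar>h (r k) - h (l k)\<bar>) < e"
    by (rule abs_cont_onE) (rule that; blast)
  obtain N0 where N0: "{t \<in> space lebesgue. \<not> (t \<in> {b<..<c} \<longrightarrow> (\<exists>D. (h has_real_derivative D) (at t) \<and> D \<le> M))} \<subseteq> N0"
    "emeasure lebesgue N0 = 0" "N0 \<in> sets lebesgue"
    using d by (rule AE_E)
  \<comment> \<open>The derivative is controlled only on the open interval, so the end points join
    the exceptional set.\<close>
  define N where "N = insert b (insert c N0)"
  have "N \<in> null_sets lebesgue" using N0 by (auto simp: N_def intro: null_setsI)
  then have Ns: "N \<in> sets lebesgue" "emeasure lebesgue N = 0" by auto
  obtain U where U: "open U" "N \<subseteq> U" "U - N \<in> lmeasurable" "emeasure lebesgue (U - N) < ennreal \<delta>"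
    using sets_lebesgue_outer_open[OF Ns(1) \<delta>(1)] by blast
  have Us: "U \<in> sets lebesgue" using U(1) by auto
  have "emeasure lebesgue U = emeasure lebesgue (U - N) + emeasure lebesgue N"
  proof -
    have "emeasure lebesgue (U - N) + emeasure lebesgue N = emeasure lebesgue ((U - N) \<union> N)"
      by (rule plus_emeasure) (use Ns(1) Us in auto)
    moreover have "(U - N) \<union> N = U" using U(2) by blast
    ultimately show ?thesis by metis
  qed
  then have mU: "emeasure lebesgue U < ennreal \<delta>" using U(4) Ns(2) by simp
  have "\<exists>r>0. (x \<in> N \<longrightarrow> ball x r \<subseteq> U) \<and>
      (x \<in> {b..c} - N \<longrightarrow> (\<forall>y z. y \<le> x \<longrightarrow> x \<le> z \<longrightarrow> y \<in> ball x r \<longrightarrow> z \<in> ball x r \<longrightarrow> h z - h y \<le> (M + e) * (z - y)))" for x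
  proof (cases "x \<in> N")
    case True
    then have "x \<in> U" using U by blast
    then show ?thesis using U(1) True unfolding open_contains_ball by blast
  next
    case False
    show ?thesis
    proof (cases "x \<in> {b..c}")
      case True
      with False N0(1) have "\<exists>D. (h has_real_derivative D) (at x) \<and> D \<le> M" by (force simp: N_def)
      then obtain D where D: "(h has_real_derivative D) (at x)" "D \<le> M" by blast
      obtain r where r: "0 < r" "\<And>y. norm (y - x) < r \<Longrightarrow> norm (h y - h x - D * (y - x)) \<le> e * norm (y - x)"
        using D(1) e unfolding has_field_derivative_def has_derivative_at_alt by meson
      have "h z - h y \<le> (M + e) * (z - y)" if "y \<le> x" "x \<le> z" "y \<in> ball x r" "z \<in> ball x r" for y z
      proof -
        have "\<bar>h z - h x - D * (z - x)\<bar> \<le> e * (z - x)" "\<bar>h y - h x - D * (y - x)\<bar> \<le> e * (x - y)"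
          using r(2)[of z] r(2)[of y] that by (auto simp: dist_norm abs_minus_commute)
        then have "h z - h y \<le> D * (z - y) + e * (z - y)" by (simp add: algebra_simps abs_le_iff)
        also have "\<dots> \<le> (M + e) * (z - y)" using D(2) that by (simp add: distrib_right mult_right_mono)
        finally show ?thesis .
      qed
      then show ?thesis using r(1) False by blast
    qed (use False in \<open>auto intro: exI[of _ 1]\<close>)
  qed
  then obtain \<rho> where \<rho>: "\<And>x. 0 < \<rho> x" "\<And>x. x \<in> N \<Longrightarrow> ball x (\<rho> x) \<subseteq> U"
    "\<And>x y z. x \<in> {b..c} - N \<Longrightarrow> y \<le> x \<Longrightarrow> x \<le> z \<Longrightarrow> y \<in> ball x (\<rho> x) \<Longrightarrow> z \<in> ball x (\<rho> x) \<Longrightarrow> h z - h y \<le> (M + e) * (z - y)"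
    by metis
  have "gauge (\<lambda>x. ball x (\<rho> x))" using \<rho>(1) by (simp add: gauge_def)
  then obtain p where p: "p tagged_division_of {b..c}" "(\<lambda>x. ball x (\<rho> x)) fine p"
    using fine_division_exists_real by blast
  have fp: "finite p" using p(1) by blast
  define I where "I q = Inf (snd q)" for q :: "real \<times> real set"
  define S where "S q = Sup (snd q)" for q :: "real \<times> real set"
  have k: "snd q = {I q..S q}" "I q \<le> fst q" "fst q \<le> S q" "b \<le> I q" "S q \<le> c" "fst q \<in> {b..c}" if q: "q \<in> p" for q
  proof -
    obtain x K where xK: "q = (x, K)" by (cases q)
    obtain u v where "K = cbox u v" using tagged_division_ofD(4)[OF p(1)] q xK by blast
    then have K: "K = {u..v}" by simp
    have x: "x \<in> K" "K \<subseteq> {b..c}" using tagged_division_ofD(2,3)[OF p(1)] q xK by blast+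
    then have "u \<le> v" using K by auto
    then have "I q = u" "S q = v" using xK K by (simp_all add: I_def S_def)
    then show "snd q = {I q..S q}" "I q \<le> fst q" "fst q \<le> S q" "b \<le> I q" "S q \<le> c" "fst q \<in> {b..c}"
      using xK K x \<open>u \<le> v\<close> by auto
  qed
  have sub: "{I q..S q} \<subseteq> ball (fst q) (\<rho> (fst q))" if "q \<in> p" for q
    using p(2) that k(1)[OF that] unfolding fine_def by (cases q) force
  have IS: "I q \<le> S q" if "q \<in> p" for q using k(2,3)[OF that] by linarith
  define P0 where "P0 = {q \<in> p. fst q \<in> N}"
  define P1 where "P1 = {q \<in> p. fst q \<notin> N}"
  have P: "p = P0 \<union> P1" "P0 \<inter> P1 = {}" "finite P0" "finite P1" using fp by (auto simp: P0_def P1_def)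
  have tel: "(\<Sum>q\<in>p. g (S q) - g (I q)) = g c - g b" for g :: "real \<Rightarrow> real"
    using additive_tagged_division_1[OF bc p(1), of g] by (simp add: S_def I_def case_prod_beta)
  have "(\<Sum>q\<in>P1. h (S q) - h (I q)) \<le> (\<Sum>q\<in>P1. (M + e) * (S q - I q))"
  proof (rule sum_mono)
    fix q assume q: "q \<in> P1"
    then have qp: "q \<in> p" "fst q \<notin> N" by (auto simp: P1_def)
    show "h (S q) - h (I q) \<le> (M + e) * (S q - I q)"
    proof (rule \<rho>(3)[of "fst q"])
      show "I q \<in> ball (fst q) (\<rho> (fst q))" "S q \<in> ball (fst q) (\<rho> (fst q))"
        by (rule subsetD[OF sub[OF qp(1)]], use IS[OF qp(1)] in simp)+
    qed (use qp k[OF qp(1)] in auto)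
  qed
  \<comment> \<open>This is where M \<ge> 0 enters: the terms added are nonnegative, and the full
    sum telescopes.\<close>
  also have "\<dots> \<le> (\<Sum>q\<in>p. (M + e) * (S q - I q))"
    by (rule sum_mono2[OF fp]) (use P IS M e in auto)
  also have "\<dots> = (M + e) * (c - b)" using tel[of "\<lambda>x. x"] by (simp add: sum_distrib_left[symmetric])
  finally have 1: "(\<Sum>q\<in>P1. h (S q) - h (I q)) \<le> (M + e) * (c - b)" .
  have dis: "{I q<..<S q} \<inter> {I q'<..<S q'} = {}" if "q \<in> p" "q' \<in> p" "q \<noteq> q'" for q q'
  proof -
    have "interior (snd q) \<inter> interior (snd q') = {}"
      using tagged_division_ofD(5)[OF p(1), of "fst q" "snd q" "fst q'" "snd q'"] that by simp
    then show ?thesis using k(1)[OF that(1)] k(1)[OF that(2)] by (simp add: interior_atLeastAtMost_real)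
  qed
  have len: "(\<Sum>q\<in>P0. S q - I q) < \<delta>"
  proof -
    have "ennreal (\<Sum>q\<in>P0. S q - I q) = (\<Sum>q\<in>P0. emeasure lebesgue {I q<..<S q})"
      using P IS by (subst sum_ennreal[symmetric]) auto
    also have "\<dots> = emeasure lebesgue (\<Union>q\<in>P0. {I q<..<S q})"
      by (rule sum_emeasure) (use P dis in \<open>auto simp: disjoint_family_on_def\<close>)
    also have "\<dots> \<le> emeasure lebesgue U"
    proof (rule emeasure_mono[OF _ Us])
      show "(\<Union>q\<in>P0. {I q<..<S q}) \<subseteq> U"
      proof (rule UN_least)
        fix q assume q: "q \<in> P0"
        then have qp: "q \<in> p" "fst q \<in> N" by (auto simp: P0_def)
        have "{I q<..<S q} \<subseteq> {I q..S q}" by auto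
        then show "{I q<..<S q} \<subseteq> U" using sub[OF qp(1)] \<rho>(2)[OF qp(2)] by blast
      qed
    qed
    also have "\<dots> < ennreal \<delta>" by (rule mU)
    finally show ?thesis using P IS by (subst (asm) ennreal_less_iff) (auto intro!: sum_nonneg)
  qed
  obtain \<pi> where \<pi>: "bij_betw \<pi> {..<card P0} P0" using ex_bij_betw_nat_finite[OF P(3)] by (auto simp: atLeast0LessThan)
  have \<pi>p: "\<pi> j \<in> p" if "j < card P0" for j using bij_betwE[OF \<pi>] that P by blast
  have "(\<Sum>j<card P0. \<bar>h (S (\<pi> j)) - h (I (\<pi> j))\<bar>) < e"
  proof (rule \<delta>(2))
    show "\<forall>j<card P0. b \<le> I (\<pi> j) \<and> I (\<pi> j) \<le> S (\<pi> j) \<and> S (\<pi> j) \<le> c" using \<pi>p k by (meson order_trans)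
    show "\<forall>j<card P0. \<forall>m<card P0. j \<noteq> m \<longrightarrow> {I (\<pi> j)<..<S (\<pi> j)} \<inter> {I (\<pi> m)<..<S (\<pi> m)} = {}"
      by (intro allI impI dis \<pi>p) (use bij_betw_imp_inj_on[OF \<pi>] in \<open>auto dest: inj_onD\<close>)
    show "(\<Sum>j<card P0. S (\<pi> j) - I (\<pi> j)) < \<delta>"
      using len sum.reindex_bij_betw[OF \<pi>, of "\<lambda>q. S q - I q"] by simp
  qed
  then have "(\<Sum>q\<in>P0. \<bar>h (S q) - h (I q)\<bar>) < e"
    using sum.reindex_bij_betw[OF \<pi>, of "\<lambda>q. \<bar>h (S q) - h (I q)\<bar>"] by simp
  then have 2: "(\<Sum>q\<in>P0. h (S q) - h (I q)) \<le> e"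
    using sum_mono[of P0 "\<lambda>q. h (S q) - h (I q)" "\<lambda>q. \<bar>h (S q) - h (I q)\<bar>"] by linarith
  have "h c - h b = (\<Sum>q\<in>P0. h (S q) - h (I q)) + (\<Sum>q\<in>P1. h (S q) - h (I q))"
    using tel[of h] sum.union_disjoint[OF P(3,4,2), of "\<lambda>q. h (S q) - h (I q)"] unfolding P(1)[symmetric] by linarith
  then have "h c - h b \<le> M * (c - b) + e * (c - b + 1)" using 1 2 by (simp add: algebra_simps)
  also have "e * (c - b + 1) = e0" using bc by (simp add: e_def)
  finally show "h c - h b \<le> M * (c - b) + e0" .
qed

text \<open>A classical solution is given by continuous partial derivatives only, whereas the
  argument at a maximum differentiates along arbitrary lines. The coordinates are changed one at a
  time, with the mean value inequality on each axis-parallel segment.\<close>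

lemma partials_has_derivative:
  fixes h :: "real^'n \<Rightarrow> real"
  assumes pd: "\<And>i. has_pd i h (h1 i)" and c: "\<And>i. continuous_on UNIV (h1 i)"
  shows "(h has_derivative (\<lambda>v. \<Sum>i\<in>UNIV. v $ i * h1 i x)) (at x)"
  unfolding has_derivative_at_alt
proof (intro conjI allI impI)
  show "bounded_linear (\<lambda>v. \<Sum>i\<in>UNIV. v $ i * h1 i x)"
    by (intro bounded_linear_sum bounded_linear_mult_const bounded_linear_vec_nth)
  fix e0 :: real assume e0: "0 < e0"
  define e where "e = e0 / real CARD('n)"
  have e: "0 < e" using e0 by (simp add: e_def)
  have "\<forall>i. \<exists>d>0. \<forall>y. dist y x < d \<longrightarrow> dist (h1 i y) (h1 i x) < e"
    using c e unfolding continuous_on_iff by blast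
  then obtain d where d: "\<And>i. 0 < d i" "\<And>i y. dist y x < d i \<Longrightarrow> dist (h1 i y) (h1 i x) < e" by metis
  define \<delta> where "\<delta> = Min (range d)"
  have \<delta>: "0 < \<delta>" using d(1) by (simp add: \<delta>_def)
  have \<delta>i: "dist (h1 i y) (h1 i x) < e" if "dist y x < \<delta>" for i y
    using d(2)[of y i] that Min_le[of "range d" "d i"] by (simp add: \<delta>_def)
  show "\<exists>d>0. \<forall>y. norm (y - x) < d \<longrightarrow> norm (h y - h x - (\<Sum>i\<in>UNIV. (y - x) $ i * h1 i x)) \<le> e0 * norm (y - x)"
  proof (intro exI[of _ \<delta>] conjI \<delta> allI impI)
    fix y assume y: "norm (y - x) < \<delta>"
    define v where "v = y - x"
    \<comment> \<open>The displacement restricted to the coordinates in S. All intermediate points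
      stay within norm v of x, so the partial derivatives vary by less than e there.\<close>
    define r where "r S = (\<chi> i. if i \<in> S then v $ i else 0)" for S :: "'n set"
    have ins: "r (insert k S) = r S + v $ k *\<^sub>R axis k 1" if "k \<notin> S" for k S
      using that by (auto simp: r_def vec_eq_iff axis_def)
    have nr: "norm (r S + s *\<^sub>R axis k 1) \<le> norm v" if "k \<notin> S" "\<bar>s\<bar> \<le> \<bar>v $ k\<bar>" for k S s
    proof (rule norm_le_componentwise_cart)
      show "norm ((r S + s *\<^sub>R axis k 1) $ i) \<le> norm (v $ i)" for i
        using that by (auto simp: r_def axis_def)
    qed
    have "\<bar>h (x + r S) - h x - (\<Sum>i\<in>S. v $ i * h1 i x)\<bar> \<le> e * (\<Sum>i\<in>S. \<bar>v $ i\<bar>)" for S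
    proof (induction S rule: finite_induct[OF finite])
      case 1
      have "r {} = 0" by (simp add: r_def vec_eq_iff)
      then show ?case by simp
    next
      case (2 k S)
      define g where "g s = h (x + r S + s *\<^sub>R axis k 1) - s * h1 k x" for s
      have g: "(g has_field_derivative h1 k (x + r S + s *\<^sub>R axis k 1) - h1 k x) (at s within closed_segment 0 (v $ k))" for s
        unfolding g_def
        by (rule DERIV_subset[OF _ subset_UNIV]) (auto intro!: derivative_eq_intros has_pd_line[OF pd])
      have "norm (g (v $ k) - g 0) \<le> e * norm (v $ k - 0)"
      proof (rule field_differentiable_bound[OF _ g])
        fix s assume "s \<in> closed_segment 0 (v $ k)"
        then have "\<bar>s\<bar> \<le> \<bar>v $ k\<bar>" by (auto simp: closed_segment_eq_real_ivl split: if_splits)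
        then have "norm (r S + s *\<^sub>R axis k 1) < \<delta>" using nr[of k S s] 2 y by (simp add: v_def)
        then have "dist (h1 k (x + r S + s *\<^sub>R axis k 1)) (h1 k x) < e"
          by (intro \<delta>i) (simp add: dist_norm add.assoc)
        then show "norm (h1 k (x + r S + s *\<^sub>R axis k 1) - h1 k x) \<le> e" by (simp add: dist_norm)
      qed auto
      then have "\<bar>h (x + r (insert k S)) - h (x + r S) - v $ k * h1 k x\<bar> \<le> e * \<bar>v $ k\<bar>"
        using 2 by (simp add: g_def ins add.assoc algebra_simps)
      then show ?case using 2 by (simp add: distrib_left abs_le_iff)
    qed
    moreover have "r UNIV = v" by (simp add: r_def vec_eq_iff)
    ultimately have "\<bar>h y - h x - (\<Sum>i\<in>UNIV. v $ i * h1 i x)\<bar> \<le> e * (\<Sum>i\<in>UNIV. \<bar>v $ i\<bar>)"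
      by (metis v_def add.commute diff_add_cancel)
    also have "\<dots> \<le> e * (\<Sum>i\<in>(UNIV::'n set). norm v)"
      using e by (intro mult_left_mono sum_mono component_le_norm_cart) auto
    also have "\<dots> = e0 * norm v" by (simp add: e_def)
    finally show "norm (h y - h x - (\<Sum>i\<in>UNIV. (y - x) $ i * h1 i x)) \<le> e0 * norm (y - x)" by (simp add: v_def)
  qed
qed

lemma partials_line_derivative:
  fixes h :: "real^'n \<Rightarrow> real"
  assumes pd: "\<And>i. has_pd i h (h1 i)" and c: "\<And>i. continuous_on UNIV (h1 i)"
  shows "((\<lambda>s. h (x + s *\<^sub>R \<xi>)) has_real_derivative (\<Sum>i\<in>UNIV. \<xi> $ i * h1 i (x + s *\<^sub>R \<xi>))) (at s)"
proof -
  have "((\<lambda>s. h (x + s *\<^sub>R \<xi>)) has_derivative (\<lambda>r. \<Sum>i\<in>UNIV. (r *\<^sub>R \<xi>) $ i * h1 i (x + s *\<^sub>R \<xi>))) (at s)"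
    by (rule has_derivative_compose[of "\<lambda>s. x + s *\<^sub>R \<xi>" "\<lambda>r. r *\<^sub>R \<xi>" s UNIV h])
       (auto intro!: derivative_eq_intros partials_has_derivative[OF pd c])
  moreover have "(\<lambda>r. \<Sum>i\<in>UNIV. (r *\<^sub>R \<xi>) $ i * h1 i (x + s *\<^sub>R \<xi>)) = (*) (\<Sum>i\<in>UNIV. \<xi> $ i * h1 i (x + s *\<^sub>R \<xi>))"
    by (rule ext) (simp add: sum_distrib_left sum_distrib_right mult_ac)
  ultimately show ?thesis unfolding has_field_derivative_def by simp
qed

text \<open>On the line through x0 in direction \<xi> the penalised function q has a maximum at 0,
  so q1 vanishes there. A positive second derivative q2 would make q1 positive just to the right of
  0 and q increase.\<close>

lemma hessian_at_max:
  fixes h :: "real^'n \<Rightarrow> real"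
  assumes pd: "\<And>i. has_pd i h (h1 i)" and pd2: "\<And>i j. has_pd i (h1 j) (h2 i j)"
    and c1: "\<And>i. continuous_on UNIV (h1 i)" and c2: "\<And>i j. continuous_on UNIV (h2 i j)"
    and max: "\<And>x. h x - \<epsilon> * (norm x)\<^sup>2 \<le> h x0 - \<epsilon> * (norm x0)\<^sup>2"
  shows "((\<chi> i j. h2 i j x0) *v \<xi>) \<bullet> \<xi> \<le> 2 * \<epsilon> * (norm \<xi>)\<^sup>2"
proof (rule ccontr)
  assume n: "\<not> ?thesis"
  define q where "q s = h (x0 + s *\<^sub>R \<xi>) - \<epsilon> * (norm (x0 + s *\<^sub>R \<xi>))\<^sup>2" for s
  define q1 where "q1 s = (\<Sum>j\<in>UNIV. \<xi> $ j * h1 j (x0 + s *\<^sub>R \<xi>)) - \<epsilon> * (2 * ((x0 + s *\<^sub>R \<xi>) \<bullet> \<xi>))" for s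
  define q2 where "q2 = (\<Sum>j\<in>UNIV. \<xi> $ j * (\<Sum>i\<in>UNIV. \<xi> $ i * h2 i j x0)) - \<epsilon> * (2 * (\<xi> \<bullet> \<xi>))"
  have nq: "(norm (x0 + s *\<^sub>R \<xi>))\<^sup>2 = x0 \<bullet> x0 + 2 * s * (x0 \<bullet> \<xi>) + s\<^sup>2 * (\<xi> \<bullet> \<xi>)" for s
    by (simp add: power2_norm_eq_inner inner_add_left inner_add_right inner_commute) (simp add: power2_eq_square algebra_simps)
  have dq: "(q has_real_derivative q1 s) (at s)" for s
    unfolding q_def nq q1_def
    by (auto intro!: derivative_eq_intros partials_line_derivative[OF pd c1] simp: inner_add_left algebra_simps)
  have dq1: "(q1 has_real_derivative q2) (at 0)"
    unfolding q1_def q2_def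
    using partials_line_derivative[OF pd2 c2, of _ x0 \<xi> 0]
    by (auto intro!: derivative_eq_intros simp: inner_add_left algebra_simps)
  have mx: "q s \<le> q 0" for s using max[of "x0 + s *\<^sub>R \<xi>"] by (simp add: q_def)
  have "q1 0 = 0" using DERIV_local_max[OF dq[of 0], of 1] mx by auto
  have e: "(\<Sum>j\<in>UNIV. \<xi> $ j * (\<Sum>i\<in>UNIV. \<xi> $ i * h2 i j x0)) = ((\<chi> i j. h2 i j x0) *v \<xi>) \<bullet> \<xi>"
    unfolding inner_matrix_vector_eq_sum by (subst sum.swap) (simp add: sum_distrib_left mult_ac)
  have "0 < q2" using n unfolding q2_def e by (simp add: power2_norm_eq_inner)
  then obtain d where d: "0 < d" "\<And>s. 0 < s \<Longrightarrow> s < d \<Longrightarrow> q1 0 < q1 (0 + s)"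
    using DERIV_pos_inc_right[OF dq1] by blast
  have "q 0 < q (d / 2)"
  proof (rule DERIV_pos_imp_increasing_open[where f=q])
    show "\<exists>y. (q has_real_derivative y) (at s) \<and> 0 < y" if "0 < s" "s < d / 2" for s
      using dq[of s] d(2)[of s] that d(1) \<open>q1 0 = 0\<close> by auto
    show "continuous_on {0..d / 2} q"
      using dq by (intro continuous_at_imp_continuous_on ballI DERIV_isCont) blast
  qed (use d in simp)
  then show False using mx[of "d / 2"] by simp
qed

context elliptic_coeff
begin

text \<open>At the maximum (t0, x0) of F the Hessian of z is controlled at time t0. Continuity of
  the space derivatives carries this to earlier times near t0 with a loss of \<epsilon> / 2, however
  \<open>a\<close> oscillates, and near t0 the term - z helps. So z (., x0) grows at rate at most
  \<epsilon> (C + 1/2), while maximality against the barrier requires an increment of at least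
  \<epsilon> K per unit of time.\<close>

lemma maximum_principle:
  fixes z :: "real \<times> (real^'n) \<Rightarrow> real"
  assumes bd: "\<And>t x. 0 \<le> t \<Longrightarrow> z (t, x) \<le> B" and c: "continuous_on ({0..} \<times> UNIV) z" and z0: "\<And>x. z (0, x) \<le> 0"
    and pd: "\<And>i t. 0 < t \<Longrightarrow> has_pd i (\<lambda>x. z (t, x)) (\<lambda>x. z1 i (t, x))"
    and pd2: "\<And>i j t. 0 < t \<Longrightarrow> has_pd i (\<lambda>x. z1 j (t, x)) (\<lambda>x. z2 i j (t, x))"
    and c1: "\<And>i. continuous_on ({0<..} \<times> UNIV) (z1 i)" and c2: "\<And>i j. continuous_on ({0<..} \<times> UNIV) (z2 i j)"
    and ac: "\<And>x b c. 0 < b \<Longrightarrow> b \<le> c \<Longrightarrow> abs_cont_on b c (\<lambda>t. z (t, x))"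
    and eq: "AE t in lebesgue. 0 < t \<longrightarrow> (\<forall>x. ((\<lambda>s. z (s, x)) has_real_derivative (a t \<bullet> (\<chi> i j. z2 i j (t, x)) - z (t, x))) (at t))"
    and t: "0 \<le> t"
  shows "z (t, x) \<le> 0"
proof (rule ccontr)
  assume "\<not> ?thesis"
  then have pos: "0 < z (t, x)" by simp
  note L = Lambda_pos
  \<comment> \<open>A bound for \<open>a\<close> contracted with 2 I, the Hessian of |x|^2, as
    diagonal entries of \<open>a\<close> are at most 1 / \<Lambda>. The choice K = C + 1 beats the
    rate C + 1/2 found below.\<close>
  define C where "C = 2 * (real CARD('n) * (1 / \<Lambda>))"
  have C: "0 < C" using L by (simp add: C_def)
  define K where "K = C + 1"
  have K: "0 < K" using C by (simp add: K_def)
  define D where "D = (norm x)\<^sup>2 + K * t + 1"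
  \<comment> \<open>\<epsilon> D is half of z (t, x), and the barrier at (t, x) is \<epsilon> (D -
    1); hence F is still positive at that point.\<close>
  define \<epsilon> where "\<epsilon> = z (t, x) / (2 * D)"
  have den: "0 < D" using K t by (simp add: D_def add_nonneg_pos)
  have \<epsilon>: "0 < \<epsilon>" using pos den by (simp add: \<epsilon>_def)
  have \<epsilon>2: "\<epsilon> * D < z (t, x)" using pos den by (simp add: \<epsilon>_def)
  define F where "F p = z p - \<epsilon> * ((norm (snd p))\<^sup>2 + K * fst p)" for p
  have Fpos: "0 < F (t, x)" using \<epsilon>2 \<epsilon> by (simp add: F_def D_def algebra_simps)
  \<comment> \<open>Beyond this radius \<epsilon> |y|^2 exceeds the bound B on z, so the supremum of
    F is attained in a compact set.\<close>
  define R where "R = sqrt (\<bar>B\<bar> / \<epsilon>)"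
  have far: "F (s, y) \<le> 0" if "0 \<le> s" "R < norm y" for s y
  proof -
    have R0: "0 \<le> R" using \<epsilon> by (simp add: R_def)
    have "R\<^sup>2 \<le> (norm y)\<^sup>2" using that(2) R0 by (intro power_mono) auto
    then have "\<bar>B\<bar> \<le> \<epsilon> * (norm y)\<^sup>2" using \<epsilon> by (simp add: R_def field_simps)
    moreover have "0 \<le> \<epsilon> * (K * s)" using \<epsilon> K that by simp
    ultimately show ?thesis using bd[OF that(1), of y] by (simp add: F_def distrib_left)
  qed
  have "norm x \<le> R" using far[OF t, of x] Fpos by force
  then have tx: "(t, x) \<in> {0..t} \<times> cball 0 R" using t by simp
  have "continuous_on ({0..t} \<times> cball 0 R) F"
    unfolding F_def by (intro continuous_intros continuous_on_subset[OF c]) auto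
  then obtain p where p: "p \<in> {0..t} \<times> cball 0 R" "\<And>q. q \<in> {0..t} \<times> cball 0 R \<Longrightarrow> F q \<le> F p"
    using continuous_attains_sup[of "{0..t} \<times> cball 0 R" F] tx by (metis compact_Icc compact_Times compact_cball empty_iff)
  obtain t0 x0 where px: "p = (t0, x0)" by (cases p)
  have F0: "0 < F (t0, x0)" using p(2)[OF tx] Fpos px by simp
  have t0: "0 \<le> t0" "t0 \<le> t" using p(1) px by auto
  have mx: "F (s, y) \<le> F (t0, x0)" if "s \<in> {0..t}" for s y
  proof (cases "norm y \<le> R")
    case True then show ?thesis using p(2)[of "(s, y)"] that px by simp
  next
    case False then show ?thesis using far[of s y] that F0 by simp
  qed
  have "t0 \<noteq> 0"
  proof
    assume "t0 = 0"
    moreover have "0 \<le> \<epsilon> * (norm x0)\<^sup>2" using \<epsilon> by simp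
    ultimately have "F (t0, x0) \<le> 0" using z0[of x0] by (simp add: F_def)
    with F0 show False by simp
  qed
  with t0 have t0p: "0 < t0" by simp
  have zp: "0 < z (t0, x0)"
  proof -
    have "0 \<le> \<epsilon> * ((norm x0)\<^sup>2 + K * t0)" using \<epsilon> K t0 by simp
    then show ?thesis using F0 by (simp add: F_def)
  qed
  define Z2 where "Z2 r = (\<chi> i j. z2 i j (r, x0))" for r
  have sl: "continuous_on UNIV (\<lambda>y. k (t0, y))" if "continuous_on ({0<..} \<times> UNIV) k" for k :: "real \<times> (real^'n) \<Rightarrow> real"
    by (rule continuous_on_compose2[OF that]) (use t0p in \<open>auto intro!: continuous_intros\<close>)
  have hess: "(Z2 t0 *v \<xi>) \<bullet> \<xi> \<le> 2 * \<epsilon> * (norm \<xi>)\<^sup>2" for \<xi>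
    unfolding Z2_def
  proof (rule hessian_at_max[OF pd[OF t0p] pd2[OF t0p] sl[OF c1] sl[OF c2]])
    show "z (t0, y) - \<epsilon> * (norm y)\<^sup>2 \<le> z (t0, x0) - \<epsilon> * (norm x0)\<^sup>2" for y
      using mx[of t0 y] t0 by (simp add: F_def distrib_left)
  qed
  \<comment> \<open>The Hessian is frozen at t0, where its sign is known, while the coefficients are
    taken at an arbitrary time r.\<close>
  have tr: "a r \<bullet> Z2 t0 \<le> \<epsilon> * C" for r
  proof -
    have "a r \<bullet> (Z2 t0 - (2 * \<epsilon>) *\<^sub>R mat 1) \<le> 0"
    proof (rule posdef_inner_nonpos[OF elliptic_imp_posdef[OF a_elliptic]])
      fix \<xi> :: "real^'n"
      show "((Z2 t0 - (2 * \<epsilon>) *\<^sub>R mat 1) *v \<xi>) \<bullet> \<xi> \<le> 0"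
        using hess[of \<xi>]
        by (simp add: matrix_vector_mult_diff_rdistrib inner_diff_left scaleR_matrix_vector_assoc[symmetric] power2_norm_eq_inner)
    qed
    then have "a r \<bullet> Z2 t0 \<le> (2 * \<epsilon>) * (a r \<bullet> mat 1)" by (simp add: inner_diff_right)
    moreover have "a r \<bullet> mat 1 \<le> real CARD('n) * (1 / \<Lambda>)"
    proof -
      have "a r \<bullet> mat 1 = (\<Sum>i\<in>UNIV. a r $ i $ i)"
        unfolding inner_matrix_eq_sum by (intro sum.cong refl) (simp add: mat_def if_distrib cong: if_cong)
      also have "\<dots> \<le> (\<Sum>i\<in>(UNIV::'n set). 1 / \<Lambda>)"
        by (intro sum_mono order_trans[OF abs_ge_self bounded_borel_matrix(1)[OF a_borel a_elliptic]])
      finally show ?thesis by simp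
    qed
    then have "(2 * \<epsilon>) * (a r \<bullet> mat 1) \<le> (2 * \<epsilon>) * (real CARD('n) * (1 / \<Lambda>))" using \<epsilon> by (intro mult_left_mono) auto
    moreover have "(2 * \<epsilon>) * (real CARD('n) * (1 / \<Lambda>)) = \<epsilon> * C" by (simp add: C_def)
    ultimately show ?thesis by linarith
  qed
  define Ka where "Ka = real CARD('n) * real CARD('n) * (1 / \<Lambda>)"
  have Ka: "0 \<le> Ka" "\<And>r. norm (a r) \<le> Ka" using a.K_nonneg a.bound by (simp_all add: Ka_def)
  have cZ: "continuous_on {0<..} Z2"
    unfolding Z2_def by (intro continuous_intros continuous_on_compose2[OF c2]) auto
  have cz: "continuous_on {0<..} (\<lambda>r. z (r, x0))"
    by (rule continuous_on_compose2[OF c]) (auto intro!: continuous_intros)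
  \<comment> \<open>Multiplied by the bound Ka on \<open>a\<close>, this tolerance costs at most
    \<epsilon> / 2; d2 keeps z (., x0) positive, and t1 lies within both distances of t0.\<close>
  obtain d1 where d1: "0 < d1" "\<And>r. 0 < r \<Longrightarrow> dist r t0 < d1 \<Longrightarrow> dist (Z2 r) (Z2 t0) < \<epsilon> / (2 * (Ka + 1))"
    using cZ t0p \<epsilon> Ka(1) unfolding continuous_on_iff by (metis add_nonneg_pos divide_pos_pos greaterThan_iff mult_pos_pos zero_less_numeral zero_less_one)
  obtain d2 where d2: "0 < d2" "\<And>r. 0 < r \<Longrightarrow> dist r t0 < d2 \<Longrightarrow> dist (z (r, x0)) (z (t0, x0)) < z (t0, x0)"
    using cz t0p zp unfolding continuous_on_iff by (metis greaterThan_iff)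
  define t1 where "t1 = t0 - min (t0 / 2) (min d1 d2 / 2)"
  have t1: "0 < t1" "t1 < t0" "t0 - t1 < d1" "t0 - t1 < d2"
    using t0p d1(1) d2(1) by (auto simp: t1_def min_def)
  have "z (t0, x0) - z (t1, x0) \<le> \<epsilon> * (C + 1/2) * (t0 - t1)"
  proof (rule abs_cont_on_increment_le)
    show "abs_cont_on t1 t0 (\<lambda>t. z (t, x0))" using ac t1 by simp
    show "0 \<le> \<epsilon> * (C + 1/2)" using \<epsilon> C by simp
    show "AE r in lebesgue. r \<in> {t1<..<t0} \<longrightarrow> (\<exists>D. ((\<lambda>t. z (t, x0)) has_real_derivative D) (at r) \<and> D \<le> \<epsilon> * (C + 1/2))"
      using eq
    proof eventually_elim
      case (elim r)
      show ?case
      proof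
        assume r: "r \<in> {t1<..<t0}"
        then have r0: "0 < r" "dist r t0 < d1" "dist r t0 < d2" using t1 by (auto simp: dist_real_def)
        have "a r \<bullet> (Z2 r - Z2 t0) \<le> norm (a r) * norm (Z2 r - Z2 t0)" by (rule norm_cauchy_schwarz)
        also have "\<dots> \<le> Ka * (\<epsilon> / (2 * (Ka + 1)))"
          using Ka d1(2)[OF r0(1,2)] by (intro mult_mono) (auto simp: dist_norm)
        also have "\<dots> \<le> \<epsilon> / 2" using Ka(1) \<epsilon> by (simp add: field_simps)
        finally have "a r \<bullet> Z2 r \<le> \<epsilon> * C + \<epsilon> / 2" using tr[of r] by (simp add: inner_diff_right)
        moreover have "0 < z (r, x0)" using d2(2)[OF r0(1,3)] by (simp add: dist_real_def abs_if split: if_splits)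
        ultimately have "a r \<bullet> Z2 r - z (r, x0) \<le> \<epsilon> * (C + 1/2)" by (simp add: distrib_left)
        then show "\<exists>D. ((\<lambda>t. z (t, x0)) has_real_derivative D) (at r) \<and> D \<le> \<epsilon> * (C + 1/2)"
          using elim r0(1) unfolding Z2_def by blast
      qed
    qed
  qed (use t1 in simp)
  moreover have "z (t0, x0) - z (t1, x0) \<ge> \<epsilon> * K * (t0 - t1)"
    using mx[of t1 x0] t1 t0 by (simp add: F_def algebra_simps)
  ultimately have "\<epsilon> * K * (t0 - t1) \<le> \<epsilon> * (C + 1/2) * (t0 - t1)" by linarith
  then have "\<epsilon> * K \<le> \<epsilon> * (C + 1/2)" using t1 by (simp add: mult_right_le_imp_le)
  then show False using \<epsilon> by (simp add: K_def)
qed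

lemma has_pd_pd:
  fixes h :: "real^'m \<Rightarrow> real"
  assumes "\<And>x. pdiff i h x" shows "has_pd i h (pd i h)"
  using assms unfolding has_pd_def pdiff_def pd_def by (simp add: DERIV_deriv_iff_real_differentiable)

lemma classical_solution_le:
  assumes u: "bounded_classical_solution a f g u" and w: "bounded_classical_solution a f g w" and t: "0 \<le> t"
  shows "u (t, x) \<le> w (t, x)"
proof -
  have pdd: "has_pd i (\<lambda>y. v (t, y)) (\<lambda>y. pd i (\<lambda>y. v (t, y)) y)" "has_pd i (pd j (\<lambda>y. v (t, y))) (\<lambda>y. pd2 i j (\<lambda>y. v (t, y)) y)"
    if "bounded_classical_solution a f g v" "0 < t" for v t i j
  proof -
    have "pdiff i (\<lambda>y. v (t, y)) x" "pdiff i (pd j (\<lambda>y. v (t, y))) x" for x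
      using that by (simp_all add: bounded_classical_solution_def half_space_def)
    then show "has_pd i (\<lambda>y. v (t, y)) (\<lambda>y. pd i (\<lambda>y. v (t, y)) y)" "has_pd i (pd j (\<lambda>y. v (t, y))) (\<lambda>y. pd2 i j (\<lambda>y. v (t, y)) y)"
      unfolding pd2_def by (simp_all add: has_pd_pd)
  qed
  have md: "has_pd i (\<lambda>y. p y - q y) (\<lambda>y. p' y - q' y)" if "has_pd i p p'" "has_pd i q q'" for i :: 'n and p q p' q'
    using that unfolding has_pd_def by (auto intro!: DERIV_diff)
  define z where "z q = u q - w q" for q
  define z1 where "z1 i = (\<lambda>(t, x). pd i (\<lambda>y. u (t, y)) x - pd i (\<lambda>y. w (t, y)) x)" for i
  define z2 where "z2 i j = (\<lambda>(t, x). pd2 i j (\<lambda>y. u (t, y)) x - pd2 i j (\<lambda>y. w (t, y)) x)" for i j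
  have "bounded (u ` ({0..} \<times> UNIV))" using u by (simp add: bounded_classical_solution_def)
  then obtain B where B: "\<And>t x. 0 \<le> t \<Longrightarrow> \<bar>u (t, x)\<bar> \<le> B" by (force simp: bounded_iff)
  have "bounded (w ` ({0..} \<times> UNIV))" using w by (simp add: bounded_classical_solution_def)
  then obtain B' where B': "\<And>t x. 0 \<le> t \<Longrightarrow> \<bar>w (t, x)\<bar> \<le> B'" by (force simp: bounded_iff)
  have "z (t, x) \<le> 0"
  proof (rule maximum_principle[where z=z and ?z1.0=z1 and ?z2.0=z2 and B="B + B'"])
    show "z (t, x) \<le> B + B'" if "0 \<le> t" for t x
      using B[OF that, of x] B'[OF that, of x] by (simp add: z_def)
    show "continuous_on ({0..} \<times> UNIV) z" unfolding z_def
      using u w by (intro continuous_on_diff) (auto simp: bounded_classical_solution_def)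
    show "z (0, x) \<le> 0" for x using u w by (simp add: z_def bounded_classical_solution_def)
    show "has_pd i (\<lambda>x. z (t, x)) (\<lambda>x. z1 i (t, x))" if "0 < t" for i t
      using md[OF pdd(1)[OF u that] pdd(1)[OF w that]] by (simp add: z_def z1_def)
    show "has_pd i (\<lambda>x. z1 j (t, x)) (\<lambda>x. z2 i j (t, x))" if "0 < t" for i j t
      using md[OF pdd(2)[OF u that] pdd(2)[OF w that]] by (simp add: z1_def z2_def)
    show "continuous_on ({0<..} \<times> UNIV) (z1 i)" for i
      using u w unfolding z1_def case_prod_beta bounded_classical_solution_def half_space_def
      by (intro continuous_on_diff) (auto simp: case_prod_beta)
    show "continuous_on ({0<..} \<times> UNIV) (z2 i j)" for i j
      using u w unfolding z2_def case_prod_beta bounded_classical_solution_def half_space_def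
      by (intro continuous_on_diff) (auto simp: case_prod_beta)
    show "abs_cont_on b c (\<lambda>t. z (t, x))" if "0 < b" "b \<le> c" for x b c
      unfolding z_def by (rule abs_cont_on_diff) (use u w that in \<open>auto simp: bounded_classical_solution_def\<close>)
    have "AE t in lebesgue. 0 < t \<longrightarrow> (\<forall>x. ((\<lambda>s. v (s, x)) has_real_derivative
        (\<Sum>i\<in>UNIV. \<Sum>j\<in>UNIV. a t $ i $ j * pd2 i j (\<lambda>y. v (t, y)) x) - v (t, x) + f (t, x)) (at t))"
      if v: "bounded_classical_solution a f g v" for v
    proof -
      have "AE t in lebesgue. 0 < t \<longrightarrow> (\<forall>x. (\<lambda>s. v (s, x)) differentiable (at t) \<and>
        deriv (\<lambda>s. v (s, x)) t - (\<Sum>i\<in>UNIV. \<Sum>j\<in>UNIV. a t $ i $ j * pd2 i j (\<lambda>y. v (t, y)) x) + v (t, x) = f (t, x))"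
        using v by (simp add: bounded_classical_solution_def)
      then show ?thesis
      proof eventually_elim
        case (elim t)
        show ?case
        proof (intro impI allI)
          fix x assume "0 < t"
          then have "(\<lambda>s. v (s, x)) differentiable (at t)"
            and e: "deriv (\<lambda>s. v (s, x)) t = (\<Sum>i\<in>UNIV. \<Sum>j\<in>UNIV. a t $ i $ j * pd2 i j (\<lambda>y. v (t, y)) x) - v (t, x) + f (t, x)"
            using elim by (auto simp: algebra_simps)
          then obtain D where D: "((\<lambda>s. v (s, x)) has_real_derivative D) (at t)" by (auto simp: real_differentiable_def)
          then show "((\<lambda>s. v (s, x)) has_real_derivative
            (\<Sum>i\<in>UNIV. \<Sum>j\<in>UNIV. a t $ i $ j * pd2 i j (\<lambda>y. v (t, y)) x) - v (t, x) + f (t, x)) (at t)"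
            unfolding e[symmetric] using DERIV_imp_deriv[OF D] by simp
        qed
      qed
    qed
    from this[OF u] this[OF w]
    show "AE t in lebesgue. 0 < t \<longrightarrow> (\<forall>x. ((\<lambda>s. z (s, x)) has_real_derivative (a t \<bullet> (\<chi> i j. z2 i j (t, x)) - z (t, x))) (at t))"
    proof eventually_elim
      case (elim t)
      show ?case
      proof (intro impI allI)
        fix x assume t: "0 < t"
        have e: "a t \<bullet> (\<chi> i j. z2 i j (t, x)) - z (t, x)
          = ((\<Sum>i\<in>UNIV. \<Sum>j\<in>UNIV. a t $ i $ j * pd2 i j (\<lambda>y. u (t, y)) x) - u (t, x) + f (t, x))
          - ((\<Sum>i\<in>UNIV. \<Sum>j\<in>UNIV. a t $ i $ j * pd2 i j (\<lambda>y. w (t, y)) x) - w (t, x) + f (t, x))"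
          by (simp add: inner_matrix_eq_sum z_def z2_def right_diff_distrib sum_subtractf)
        show "((\<lambda>s. z (s, x)) has_real_derivative (a t \<bullet> (\<chi> i j. z2 i j (t, x)) - z (t, x))) (at t)"
          unfolding e unfolding z_def by (rule DERIV_diff[where f="\<lambda>s. u (s, x)" and g="\<lambda>s. w (s, x)"]) (use elim t in blast)+
      qed
    qed
  qed (rule t)
  then show ?thesis by (simp add: z_def)
qed

lemma classical_solution_unique:
  assumes "bounded_classical_solution a f g u" "bounded_classical_solution a f g w" "0 \<le> t"
  shows "u (t, x) = w (t, x)"
  using classical_solution_le[OF assms] classical_solution_le[OF assms(2,1,3)] by (rule antisym)

end

section \<open>Estimates in Lebesgue spaces\<close>

text \<open>The convexity of s powr q, which here is Young's inequality for s and c powr (q - 1).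
  The tangent line is arranged with nonnegative terms on both sides, so that it can be integrated in
  \<open>ennreal\<close>.\<close>

lemma powr_tangent_line:
  fixes q s c :: real
  assumes q: "1 \<le> q" and s: "0 \<le> s" and c: "0 \<le> c"
  shows "q * c powr (q - 1) * s \<le> s powr q + (q - 1) * c powr q"
proof (cases "s = 0 \<or> c = 0")
  case True
  then show ?thesis using q by auto
next
  case False
  then have sc: "0 < s" "0 < c" using s c by auto
  have "(s powr q) powr (1 / q) * (c powr q) powr ((q - 1) / q) \<le> 1 / q * s powr q + (q - 1) / q * c powr q"
    using q sc by (intro Youngs_inequality_0) (auto simp: field_simps)
  then have "s * c powr (q - 1) \<le> 1 / q * s powr q + (q - 1) / q * c powr q"
    using q sc by (simp add: powr_powr)
  then have "q * (s * c powr (q - 1)) \<le> q * (1 / q * s powr q + (q - 1) / q * c powr q)"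
    using q by (intro mult_left_mono) auto
  also have "\<dots> = s powr q + (q - 1) * c powr q" using q by (simp add: distrib_left)
  finally show ?thesis by (simp add: mult_ac)
qed

text \<open>Normalise by x + y and use z \<le> z powr r on the unit interval. With r = 1 / p this
  turns a sum of p-th powers of norms into a sum of norms.\<close>

lemma powr_add_le:
  fixes x y r :: real
  assumes "0 \<le> x" "0 \<le> y" "0 \<le> r" "r \<le> 1"
  shows "(x + y) powr r \<le> x powr r + y powr r"
proof (cases "x + y = 0")
  case False
  then have s: "0 < x + y" using assms by linarith
  have "z \<le> z powr r" if "0 \<le> z" "z \<le> 1" for z :: real
    using powr_mono'[of r 1 z] that assms(4) by simp
  from this[of "x / (x + y)"] this[of "y / (x + y)"]
  have "x / (x + y) + y / (x + y) \<le> (x / (x + y)) powr r + (y / (x + y)) powr r"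
    using assms s by (intro add_mono) (auto simp: field_simps)
  also have "x / (x + y) + y / (x + y) = 1" using s by (simp add: add_divide_distrib[symmetric])
  finally have "1 \<le> (x powr r + y powr r) / (x + y) powr r"
    using assms s by (simp add: powr_divide add_divide_distrib)
  then show ?thesis using s by (simp add: le_divide_eq)
qed simp

text \<open>The tangent line at \<open>c\<close> of \<open>s \<mapsto> s powr q\<close> is integrated twice: at \<open>c = 1\<close> to see that
  \<open>S\<close> is finite, and then at \<open>c = S\<close>.\<close>

lemma nn_integral_powr_le:
  fixes h1 :: "'a \<Rightarrow> real" and h2 :: "'b \<Rightarrow> real"
  assumes q: "1 \<le> q"
    and [measurable]: "h1 \<in> borel_measurable M1" "h2 \<in> borel_measurable M2"
    and h: "\<And>x. 0 \<le> h1 x" "\<And>x. 0 \<le> h2 x"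
    and m: "emeasure M1 (space M1) + emeasure M2 (space M2) \<le> 1"
    and T: "T = (\<integral>\<^sup>+ x. ennreal (h1 x powr q) \<partial>M1) + (\<integral>\<^sup>+ x. ennreal (h2 x powr q) \<partial>M2)" "T < \<infinity>"
    and S: "S = (\<integral>\<^sup>+ x. ennreal (h1 x) \<partial>M1) + (\<integral>\<^sup>+ x. ennreal (h2 x) \<partial>M2)"
  shows "S < \<infinity>" "ennreal (enn2real S powr q) \<le> T"
proof -
  have one: "ennreal (q * c powr (q - 1)) * (\<integral>\<^sup>+ x. ennreal (h x) \<partial>M)
      \<le> (\<integral>\<^sup>+ x. ennreal (h x powr q) \<partial>M) + ennreal ((q - 1) * c powr q) * emeasure M (space M)"
    if c: "0 \<le> c" and [measurable]: "h \<in> borel_measurable M" and h: "\<And>x. 0 \<le> h x" for c and h :: "'c \<Rightarrow> real" and M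
  proof -
    have "ennreal (q * c powr (q - 1)) * (\<integral>\<^sup>+ x. ennreal (h x) \<partial>M) = (\<integral>\<^sup>+ x. ennreal (q * c powr (q - 1)) * ennreal (h x) \<partial>M)"
      by (simp add: nn_integral_cmult)
    also have "\<dots> \<le> (\<integral>\<^sup>+ x. ennreal (h x powr q) + ennreal ((q - 1) * c powr q) \<partial>M)"
    proof (rule nn_integral_mono)
      show "ennreal (q * c powr (q - 1)) * ennreal (h x) \<le> ennreal (h x powr q) + ennreal ((q - 1) * c powr q)" for x
        using powr_tangent_line[OF q h c, of x] q h[of x] c
        by (simp add: ennreal_mult[symmetric] ennreal_plus[symmetric] ennreal_leI del: ennreal_plus)
    qed
    also have "\<dots> = (\<integral>\<^sup>+ x. ennreal (h x powr q) \<partial>M) + ennreal ((q - 1) * c powr q) * emeasure M (space M)"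
      by (subst nn_integral_add) auto
    finally show ?thesis .
  qed
  \<comment> \<open>The constant terms are multiplied by the total mass of both measures together,
    which is at most 1.\<close>
  have key: "ennreal (q * c powr (q - 1)) * S \<le> T + ennreal ((q - 1) * c powr q)" if c: "0 \<le> c" for c
  proof -
    have "ennreal (q * c powr (q - 1)) * S \<le> T + ennreal ((q - 1) * c powr q) * (emeasure M1 (space M1) + emeasure M2 (space M2))"
      using add_mono[OF one[OF c assms(2) h(1)] one[OF c assms(3) h(2)]] by (simp add: S T distrib_left ac_simps)
    also have "\<dots> \<le> T + ennreal ((q - 1) * c powr q) * 1"
      by (intro add_left_mono mult_left_mono m) simp
    finally show ?thesis by simp
  qed
  have "ennreal q * S < \<infinity>"
    using key[of 1] T(2) by (simp add: less_top[symmetric]) (auto simp: top_unique)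
  then show Sf: "S < \<infinity>" using q by (auto simp: less_top[symmetric] ennreal_mult_eq_top_iff)
  define s where "s = enn2real S"
  have s: "0 \<le> s" "S = ennreal s" using Sf by (simp_all add: s_def less_top)
  have t: "0 \<le> enn2real T" "T = ennreal (enn2real T)" using T(2) by (simp_all add: less_top)
  have "ennreal (q * s powr (q - 1) * s) \<le> ennreal (enn2real T + (q - 1) * s powr q)"
    using key[OF s(1)] s q t by (simp add: ennreal_mult ennreal_plus)
  then have "q * s powr (q - 1) * s \<le> enn2real T + (q - 1) * s powr q"
    using q by (subst (asm) ennreal_le_iff) (auto intro!: add_nonneg_nonneg)
  moreover have "s powr (q - 1) * s = s powr q"
    using s(1) by (cases "s = 0") (auto simp: powr_diff)
  ultimately have "s powr q \<le> enn2real T" by (simp add: algebra_simps)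
  then show "ennreal (enn2real S powr q) \<le> T"
    by (subst t(2)) (simp add: s_def ennreal_leI)
qed

lemma nn_integral_lborel_prod:
  fixes g :: "'a::euclidean_space \<times> 'b::euclidean_space \<Rightarrow> ennreal"
  assumes "g \<in> borel_measurable borel"
  shows "(\<integral>\<^sup>+ z. g z \<partial>lborel) = (\<integral>\<^sup>+ x. \<integral>\<^sup>+ y. g (x, y) \<partial>lborel \<partial>lborel)"
  using lborel.nn_integral_fst[of g "lborel :: 'a measure"] assms by (simp add: lborel_prod)

lemma nn_integral_lborel_translate:
  fixes f :: "'a::euclidean_space \<Rightarrow> ennreal"
  assumes "f \<in> borel_measurable borel"
  shows "(\<integral>\<^sup>+ x. f (x - c) \<partial>lborel) = (\<integral>\<^sup>+ x. f x \<partial>lborel)"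
  using nn_integral_distr[of "(+) (- c)" lborel borel f] assms by (simp add: lborel_distr_plus)

text \<open>No integrability is assumed: a divergent integral has the default value 0.\<close>

lemma ennreal_abs_integral_le: "ennreal \<bar>LINT x|M. f x\<bar> \<le> (\<integral>\<^sup>+ x. ennreal \<bar>f x :: real\<bar> \<partial>M)"
proof (cases "integrable M f")
  case True
  then show ?thesis using integral_norm_bound_ennreal[OF True] by simp
qed (simp add: not_integrable_integral_eq)

context elliptic_coeff
begin

text \<open>The two potentials of absolute values, with values in \<open>ennreal\<close>: Fubini is
  then free of integrability conditions, and finiteness means absolute convergence of the original
  integrals.\<close>

definition abs_duhamel :: "(real \<times> (real^'n) \<Rightarrow> real) \<Rightarrow> real \<Rightarrow> real^'n \<Rightarrow> ennreal" where
  "abs_duhamel h t x = (\<integral>\<^sup>+ z. ennreal (heat_kernel a t (fst z) (snd z)) * ennreal \<bar>h (t - fst z, x - snd z)\<bar> \<partial>lborel)"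

definition abs_flow :: "(real^'n \<Rightarrow> real) \<Rightarrow> real \<Rightarrow> real^'n \<Rightarrow> ennreal" where
  "abs_flow h t x = (\<integral>\<^sup>+ y. ennreal (heat_kernel a t t y) * ennreal \<bar>h (x - y)\<bar> \<partial>lborel)"

lemma abs_duhamel_measurable:
  assumes [measurable]: "h \<in> borel_measurable borel"
  shows "(\<lambda>w. abs_duhamel h (fst w) (snd w)) \<in> borel_measurable borel"
  unfolding abs_duhamel_def by measurable

lemma abs_flow_measurable:
  assumes [measurable]: "h \<in> borel_measurable borel"
  shows "(\<lambda>w. abs_flow h (fst w) (snd w)) \<in> borel_measurable borel"
  unfolding abs_flow_def by measurable

lemma heat_kernel_nn_integral:
  "(\<integral>\<^sup>+ y. ennreal (heat_kernel a t \<tau> y) \<partial>lborel) = indicator {0<..} \<tau> * ennreal (exp (- \<tau>))"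
proof (cases "0 < \<tau>")
  case True
  then show ?thesis using nn_integral_eq_integral[OF heat_kernel_integral(1)[OF True, of t]] heat_kernel_integral(2)[OF True, of t]
    by (simp add: heat_kernel_nonneg)
qed (simp add: heat_kernel_eq)

lemma heat_kernel_mass_le:
  assumes t: "0 < t"
  shows "(\<integral>\<^sup>+ z. indicator {0<..<t} (fst z) * ennreal (heat_kernel a t (fst z) (snd z)) \<partial>lborel)
       + (\<integral>\<^sup>+ y. ennreal (heat_kernel a t t y) \<partial>lborel) \<le> 1"
proof -
  have "(\<integral>\<^sup>+ z. indicator {0<..<t} (fst z) * ennreal (heat_kernel a t (fst z) (snd z)) \<partial>lborel)
      = (\<integral>\<^sup>+ \<tau>. indicator {0<..<t} \<tau> * (indicator {0<..} \<tau> * ennreal (exp (- \<tau>))) \<partial>lborel)"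
    by (subst nn_integral_lborel_prod) (simp_all add: nn_integral_cmult heat_kernel_nn_integral)
  also have "\<dots> \<le> (\<integral>\<^sup>+ \<tau>. ennreal (exp (- \<tau>)) * indicator {0..t} \<tau> \<partial>lborel)"
    by (intro nn_integral_mono) (auto simp: indicator_def)
  also have "\<dots> = ennreal (- exp (- t) - (- exp (- 0)))"
    using t by (intro nn_integral_FTC_Icc) (auto intro!: derivative_eq_intros)
  finally have "(\<integral>\<^sup>+ z. indicator {0<..<t} (fst z) * ennreal (heat_kernel a t (fst z) (snd z)) \<partial>lborel)
       + (\<integral>\<^sup>+ y. ennreal (heat_kernel a t t y) \<partial>lborel) \<le> ennreal (1 - exp (- t)) + ennreal (exp (- t))"
    using t by (intro add_mono) (simp_all add: heat_kernel_nn_integral)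
  also have "\<dots> = 1" using t by (simp add: ennreal_plus[symmetric] del: ennreal_plus)
  finally show ?thesis .
qed

lemma abs_flow_total:
  assumes [measurable]: "h \<in> borel_measurable borel"
  shows "(\<integral>\<^sup>+ x. abs_flow h t x \<partial>lborel) = indicator {0<..} t * ennreal (exp (- t)) * (\<integral>\<^sup>+ x. ennreal \<bar>h x\<bar> \<partial>lborel)"
proof -
  have "(\<integral>\<^sup>+ x. abs_flow h t x \<partial>lborel)
      = (\<integral>\<^sup>+ y. \<integral>\<^sup>+ x. ennreal (heat_kernel a t t y) * ennreal \<bar>h (x - y)\<bar> \<partial>lborel \<partial>lborel)"
    unfolding abs_flow_def by (rule lborel_pair.Fubini') measurable
  also have "\<dots> = (\<integral>\<^sup>+ y. ennreal (heat_kernel a t t y) * (\<integral>\<^sup>+ x. ennreal \<bar>h x\<bar> \<partial>lborel) \<partial>lborel)"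
    using nn_integral_lborel_translate[of "\<lambda>x. ennreal \<bar>h x\<bar>"] by (simp add: nn_integral_cmult)
  also have "\<dots> = indicator {0<..} t * ennreal (exp (- t)) * (\<integral>\<^sup>+ x. ennreal \<bar>h x\<bar> \<partial>lborel)"
    by (simp add: nn_integral_multc heat_kernel_nn_integral)
  finally show ?thesis .
qed

text \<open>The order of integration matters because the kernel depends on t. First x is integrated,
  where translation leaves \<Phi> (t - \<tau>); then y, where the mass exp (- \<tau>) of the kernel
  no longer depends on t; then t, by translation again; and finally \<tau>, where the exponential
  has integral 1.\<close>

lemma abs_duhamel_total:
  assumes [measurable]: "h \<in> borel_measurable borel"
  shows "(\<integral>\<^sup>+ w. abs_duhamel h (fst w) (snd w) \<partial>lborel) = (\<integral>\<^sup>+ z. ennreal \<bar>h z\<bar> \<partial>lborel)"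
proof -
  define \<Phi> where "\<Phi> t = (\<integral>\<^sup>+ x. ennreal \<bar>h (t, x)\<bar> \<partial>lborel)" for t
  have [measurable]: "\<Phi> \<in> borel_measurable borel" unfolding \<Phi>_def by measurable
  have \<Phi>: "(\<integral>\<^sup>+ t. \<Phi> t \<partial>lborel) = (\<integral>\<^sup>+ z. ennreal \<bar>h z\<bar> \<partial>lborel)"
    unfolding \<Phi>_def by (rule nn_integral_lborel_prod[symmetric]) measurable
  have "(\<integral>\<^sup>+ w. abs_duhamel h (fst w) (snd w) \<partial>lborel)
      = (\<integral>\<^sup>+ z. \<integral>\<^sup>+ w. ennreal (heat_kernel a (fst w) (fst z) (snd z)) * ennreal \<bar>h (fst w - fst z, snd w - snd z)\<bar> \<partial>lborel \<partial>lborel)"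
    unfolding abs_duhamel_def by (rule lborel_pair.Fubini') measurable
  also have "\<dots> = (\<integral>\<^sup>+ z. \<integral>\<^sup>+ t. ennreal (heat_kernel a t (fst z) (snd z)) * \<Phi> (t - fst z) \<partial>lborel \<partial>lborel)"
  proof (rule nn_integral_cong)
    fix z :: "real \<times> (real^'n)"
    have "(\<integral>\<^sup>+ w. ennreal (heat_kernel a (fst w) (fst z) (snd z)) * ennreal \<bar>h (fst w - fst z, snd w - snd z)\<bar> \<partial>lborel)
        = (\<integral>\<^sup>+ t. \<integral>\<^sup>+ x. ennreal (heat_kernel a t (fst z) (snd z)) * ennreal \<bar>h (t - fst z, x - snd z)\<bar> \<partial>lborel \<partial>lborel)"
      by (subst nn_integral_lborel_prod) simp_all
    also have "\<dots> = (\<integral>\<^sup>+ t. ennreal (heat_kernel a t (fst z) (snd z)) * \<Phi> (t - fst z) \<partial>lborel)"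
    proof (rule nn_integral_cong)
      fix t
      show "(\<integral>\<^sup>+ x. ennreal (heat_kernel a t (fst z) (snd z)) * ennreal \<bar>h (t - fst z, x - snd z)\<bar> \<partial>lborel)
          = ennreal (heat_kernel a t (fst z) (snd z)) * \<Phi> (t - fst z)"
        using nn_integral_lborel_translate[of "\<lambda>x. ennreal \<bar>h (t - fst z, x)\<bar>" "snd z"]
        by (simp add: nn_integral_cmult \<Phi>_def)
    qed
    finally show "(\<integral>\<^sup>+ w. ennreal (heat_kernel a (fst w) (fst z) (snd z)) * ennreal \<bar>h (fst w - fst z, snd w - snd z)\<bar> \<partial>lborel)
        = (\<integral>\<^sup>+ t. ennreal (heat_kernel a t (fst z) (snd z)) * \<Phi> (t - fst z) \<partial>lborel)" .
  qed
  also have "\<dots> = (\<integral>\<^sup>+ \<tau>. \<integral>\<^sup>+ y. \<integral>\<^sup>+ t. ennreal (heat_kernel a t \<tau> y) * \<Phi> (t - \<tau>) \<partial>lborel \<partial>lborel \<partial>lborel)"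
    by (subst nn_integral_lborel_prod) simp_all
  also have "\<dots> = (\<integral>\<^sup>+ \<tau>. \<integral>\<^sup>+ t. \<integral>\<^sup>+ y. ennreal (heat_kernel a t \<tau> y) * \<Phi> (t - \<tau>) \<partial>lborel \<partial>lborel \<partial>lborel)"
    by (intro nn_integral_cong lborel_pair.Fubini') measurable
  also have "\<dots> = (\<integral>\<^sup>+ \<tau>. indicator {0<..} \<tau> * ennreal (exp (- \<tau>)) * (\<integral>\<^sup>+ t. \<Phi> t \<partial>lborel) \<partial>lborel)"
    by (intro nn_integral_cong)
       (simp add: nn_integral_multc nn_integral_cmult heat_kernel_nn_integral nn_integral_lborel_translate[of \<Phi>])
  also have "\<dots> = (\<integral>\<^sup>+ t. \<Phi> t \<partial>lborel)"
    by (simp add: nn_integral_multc nn_integral_exp_Ioi)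
  finally show ?thesis by (simp only: \<Phi>)
qed

lemma abs_duhamel_abs_flow_integrable:
  assumes [measurable]: "f0 \<in> borel_measurable borel" "g0 \<in> borel_measurable borel"
    and S: "abs_duhamel f0 t x + abs_flow g0 t x < \<infinity>"
  shows "integrable lborel (\<lambda>z. heat_kernel a t (fst z) (snd z) * f0 (t - fst z, x - snd z))"
    "integrable lborel (\<lambda>y. heat_kernel a t t y * g0 (x - y))"
proof -
  have "abs_duhamel f0 t x < \<infinity>" "abs_flow g0 t x < \<infinity>" using S by (auto simp: less_top[symmetric])
  then show "integrable lborel (\<lambda>z. heat_kernel a t (fst z) (snd z) * f0 (t - fst z, x - snd z))"
    "integrable lborel (\<lambda>y. heat_kernel a t t y * g0 (x - y))"
    unfolding abs_duhamel_def abs_flow_def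
    by (intro integrableI_bounded; simp add: abs_mult heat_kernel_nonneg ennreal_mult)+
qed

lemma abs_potential_le:
  assumes [measurable]: "f0 \<in> borel_measurable borel"
  shows "ennreal \<bar>(LINT \<tau>|lborel. duhamel_slice f0 t x \<tau>) + flow 0 t g0 x\<bar> \<le> abs_duhamel f0 t x + abs_flow g0 t x"
proof -
  have "ennreal \<bar>duhamel_slice f0 t x \<tau>\<bar> \<le> (\<integral>\<^sup>+ y. ennreal (heat_kernel a t \<tau> y) * ennreal \<bar>f0 (t - \<tau>, x - y)\<bar> \<partial>lborel)" for \<tau>
    using ennreal_abs_integral_le[of lborel "\<lambda>y. heat_kernel a t \<tau> y * f0 (t - \<tau>, x - y)"]
    by (simp add: duhamel_slice_def abs_mult heat_kernel_nonneg ennreal_mult)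
  then have "(\<integral>\<^sup>+ \<tau>. ennreal \<bar>duhamel_slice f0 t x \<tau>\<bar> \<partial>lborel) \<le> abs_duhamel f0 t x"
    unfolding abs_duhamel_def by (subst nn_integral_lborel_prod) (auto intro!: nn_integral_mono)
  then have "ennreal \<bar>LINT \<tau>|lborel. duhamel_slice f0 t x \<tau>\<bar> \<le> abs_duhamel f0 t x"
    by (rule order_trans[OF ennreal_abs_integral_le])
  moreover have "ennreal \<bar>flow 0 t g0 x\<bar> \<le> abs_flow g0 t x"
    using ennreal_abs_integral_le[of lborel "\<lambda>y. heat_kernel a t t y * g0 (x - y)"]
    by (simp add: flow_def abs_flow_def abs_mult heat_kernel_nonneg ennreal_mult)
  ultimately have "ennreal \<bar>LINT \<tau>|lborel. duhamel_slice f0 t x \<tau>\<bar> + ennreal \<bar>flow 0 t g0 x\<bar> \<le> abs_duhamel f0 t x + abs_flow g0 t x"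
    by (rule add_mono)
  moreover have "ennreal \<bar>(LINT \<tau>|lborel. duhamel_slice f0 t x \<tau>) + flow 0 t g0 x\<bar> \<le> ennreal \<bar>LINT \<tau>|lborel. duhamel_slice f0 t x \<tau>\<bar> + ennreal \<bar>flow 0 t g0 x\<bar>"
    using ennreal_leI[OF abs_triangle_ineq[of "LINT \<tau>|lborel. duhamel_slice f0 t x \<tau>" "flow 0 t g0 x"]] by simp
  ultimately show ?thesis by (rule order_trans[rotated])
qed

lemma potential_measurable:
  assumes [measurable]: "f0 \<in> borel_measurable borel" "g0 \<in> borel_measurable borel"
  shows "(\<lambda>w. (LINT \<tau>|lborel. duhamel_slice f0 (fst w) (snd w) \<tau>) + flow 0 (fst w) g0 (snd w)) \<in> borel_measurable borel"
  unfolding duhamel_slice_def flow_def by measurable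

text \<open>The cutoff to lags below t leaves the value unchanged for a source that vanishes at
  nonpositive times, and it brings the two measures together to total mass at most 1.\<close>

lemma abs_duhamel_eq_density:
  assumes [measurable]: "h \<in> borel_measurable borel" and z: "\<And>t x. t \<le> 0 \<Longrightarrow> h (t, x) = 0"
  shows "abs_duhamel h t x = (\<integral>\<^sup>+ z. ennreal \<bar>h (t - fst z, x - snd z)\<bar>
     \<partial>density lborel (\<lambda>z. indicator {0<..<t} (fst z) * ennreal (heat_kernel a t (fst z) (snd z))))"
proof -
  have "ennreal (heat_kernel a t (fst w) (snd w)) * ennreal \<bar>h (t - fst w, x - snd w)\<bar>
     = indicator {0<..<t} (fst w) * ennreal (heat_kernel a t (fst w) (snd w)) * ennreal \<bar>h (t - fst w, x - snd w)\<bar>" for w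
    using z[of "t - fst w" "x - snd w"] by (auto simp: indicator_def heat_kernel_eq)
  then show ?thesis unfolding abs_duhamel_def by (subst nn_integral_density) simp_all
qed

lemma abs_flow_eq_density:
  assumes [measurable]: "h \<in> borel_measurable borel"
  shows "abs_flow h t x = (\<integral>\<^sup>+ y. ennreal \<bar>h (x - y)\<bar> \<partial>density lborel (\<lambda>y. ennreal (heat_kernel a t t y)))"
  unfolding abs_flow_def by (subst nn_integral_density) simp_all

lemma potential_Jensen:
  assumes t: "0 < t" and q: "1 \<le> q"
    and [measurable]: "f0 \<in> borel_measurable borel" "g0 \<in> borel_measurable borel" and z: "\<And>t x. t \<le> 0 \<Longrightarrow> f0 (t, x) = 0"
    and T: "T = abs_duhamel (\<lambda>z. \<bar>f0 z\<bar> powr q) t x + abs_flow (\<lambda>y. \<bar>g0 y\<bar> powr q) t x" "T < \<infinity>"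
  shows "abs_duhamel f0 t x + abs_flow g0 t x < \<infinity>" "ennreal (enn2real (abs_duhamel f0 t x + abs_flow g0 t x) powr q) \<le> T"
proof -
  let ?M1 = "density lborel (\<lambda>z. indicator {0<..<t} (fst z) * ennreal (heat_kernel a t (fst z) (snd z)))"
  let ?M2 = "density lborel (\<lambda>y. ennreal (heat_kernel a t t y))"
  have m: "emeasure ?M1 (space ?M1) + emeasure ?M2 (space ?M2) \<le> 1"
    using heat_kernel_mass_le[OF t] by (simp add: emeasure_density)
  have T': "T = (\<integral>\<^sup>+ z. ennreal (\<bar>f0 (t - fst z, x - snd z)\<bar> powr q) \<partial>?M1) + (\<integral>\<^sup>+ y. ennreal (\<bar>g0 (x - y)\<bar> powr q) \<partial>?M2)"
    using abs_duhamel_eq_density[of "\<lambda>z. \<bar>f0 z\<bar> powr q" t x] abs_flow_eq_density[of "\<lambda>y. \<bar>g0 y\<bar> powr q" t x] z q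
    by (simp add: T)
  have S': "abs_duhamel f0 t x + abs_flow g0 t x = (\<integral>\<^sup>+ z. ennreal \<bar>f0 (t - fst z, x - snd z)\<bar> \<partial>?M1) + (\<integral>\<^sup>+ y. ennreal \<bar>g0 (x - y)\<bar> \<partial>?M2)"
    by (subst abs_duhamel_eq_density, measurable) (simp_all add: z abs_flow_eq_density)
  show "abs_duhamel f0 t x + abs_flow g0 t x < \<infinity>" "ennreal (enn2real (abs_duhamel f0 t x + abs_flow g0 t x) powr q) \<le> T"
    by (rule nn_integral_powr_le[OF q _ _ _ _ m T' T(2) S']; simp)+
qed

lemma potential_bounded:
  assumes t: "0 < t" and M: "0 \<le> M" "0 \<le> N"
    and [measurable]: "f0 \<in> borel_measurable borel" "g0 \<in> borel_measurable borel" and z: "\<And>t x. t \<le> 0 \<Longrightarrow> f0 (t, x) = 0"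
    and b: "\<And>z. \<bar>f0 z\<bar> \<le> M" "\<And>y. \<bar>g0 y\<bar> \<le> N"
  shows "abs_duhamel f0 t x + abs_flow g0 t x \<le> ennreal M + ennreal N"
proof -
  let ?m1 = "\<integral>\<^sup>+ z. indicator {0<..<t} (fst z) * ennreal (heat_kernel a t (fst z) (snd z)) \<partial>(lborel :: (real \<times> (real^'n)) measure)"
  let ?m2 = "\<integral>\<^sup>+ y. ennreal (heat_kernel a t t y) \<partial>lborel"
  have "?m1 + ?m2 \<le> 1" by (rule heat_kernel_mass_le[OF t])
  then have m: "?m1 \<le> 1" "?m2 \<le> 1" by (auto intro: order_trans[rotated])
  have "abs_duhamel f0 t x \<le> (\<integral>\<^sup>+ z. ennreal M \<partial>density lborel (\<lambda>z :: real \<times> (real^'n). indicator {0<..<t} (fst z) * ennreal (heat_kernel a t (fst z) (snd z))))"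
    by (subst abs_duhamel_eq_density[OF assms(4)], erule z) (intro nn_integral_mono ennreal_leI b)
  also have "\<dots> = ennreal M * ?m1" by (simp add: emeasure_density)
  also have "\<dots> \<le> ennreal M * 1" by (intro mult_left_mono m) simp
  finally have 1: "abs_duhamel f0 t x \<le> ennreal M" by simp
  have "abs_flow g0 t x \<le> (\<integral>\<^sup>+ y. ennreal N \<partial>density lborel (\<lambda>y. ennreal (heat_kernel a t t y)))"
    unfolding abs_flow_eq_density[OF assms(5)] by (intro nn_integral_mono ennreal_leI b)
  also have "\<dots> = ennreal N * ?m2" by (simp add: emeasure_density)
  also have "\<dots> \<le> ennreal N * 1" by (intro mult_left_mono m) simp
  finally have 2: "abs_flow g0 t x \<le> ennreal N" by simp
  show ?thesis using 1 2 by (rule add_mono)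
qed

lemma potential_Lq:
  assumes q: "1 \<le> q"
    and [measurable]: "f0 \<in> borel_measurable borel" "g0 \<in> borel_measurable borel" and z: "\<And>t x. t \<le> 0 \<Longrightarrow> f0 (t, x) = 0"
    and I: "I = (\<integral>\<^sup>+ z. ennreal (\<bar>f0 z\<bar> powr q) \<partial>lborel)" "I < \<infinity>"
    and J: "J = (\<integral>\<^sup>+ y. ennreal (\<bar>g0 y\<bar> powr q) \<partial>lborel)" "J < \<infinity>"
    and v: "v = (\<lambda>w. (LINT \<tau>|lborel. duhamel_slice f0 (fst w) (snd w) \<tau>) + flow 0 (fst w) g0 (snd w))"
  shows "AE w in lborel. 0 < fst w \<longrightarrow> abs_duhamel f0 (fst w) (snd w) + abs_flow g0 (fst w) (snd w) < \<infinity>"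
    "(\<integral>\<^sup>+ w. ennreal (\<bar>v w\<bar> powr q) * indicator half_space w \<partial>lborel) \<le> I + J"
proof -
  define T where "T w = abs_duhamel (\<lambda>z. \<bar>f0 z\<bar> powr q) (fst w) (snd w) + abs_flow (\<lambda>y. \<bar>g0 y\<bar> powr q) (fst w) (snd w)" for w
  have [measurable]: "(\<lambda>w. abs_duhamel (\<lambda>z. \<bar>f0 z\<bar> powr q) (fst w) (snd w)) \<in> borel_measurable borel"
    "(\<lambda>w. abs_flow (\<lambda>z. \<bar>g0 z\<bar> powr q) (fst w) (snd w)) \<in> borel_measurable borel"
    by (intro abs_duhamel_measurable abs_flow_measurable; measurable)+
  have Tm[measurable]: "T \<in> borel_measurable borel" unfolding T_def by measurable
  \<comment> \<open>The flow part contributes J at each time with weight exp (- t), which integrates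
    to 1 over positive times.\<close>
  have "(\<integral>\<^sup>+ w. T w \<partial>lborel) = I + (\<integral>\<^sup>+ t. \<integral>\<^sup>+ x. abs_flow (\<lambda>y. \<bar>g0 y\<bar> powr q) t x \<partial>lborel \<partial>lborel)"
    unfolding T_def by (subst nn_integral_add) (simp_all add: abs_duhamel_total I nn_integral_lborel_prod[of "\<lambda>w. abs_flow _ (fst w) (snd w)"])
  also have "\<dots> = I + (\<integral>\<^sup>+ t. indicator {0<..} t * ennreal (exp (- t)) * J \<partial>lborel)"
    by (simp add: abs_flow_total J)
  also have "\<dots> = I + J" by (simp add: nn_integral_multc nn_integral_exp_Ioi)
  finally have TT: "(\<integral>\<^sup>+ w. T w \<partial>lborel) = I + J" .
  have "AE w in lborel. T w \<noteq> \<infinity>"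
    by (rule nn_integral_noteq_infinite) (use TT I(2) J(2) in \<open>auto simp: less_top[symmetric]\<close>)
  then have Tf: "AE w in lborel. T w < \<infinity>" by eventually_elim (simp add: less_top)
  then show "AE w in lborel. 0 < fst w \<longrightarrow> abs_duhamel f0 (fst w) (snd w) + abs_flow g0 (fst w) (snd w) < \<infinity>"
  proof eventually_elim
    case (elim w)
    show ?case using potential_Jensen(1)[OF _ q assms(2,3) z T_def elim] by blast
  qed
  have "(\<integral>\<^sup>+ w. ennreal (\<bar>v w\<bar> powr q) * indicator half_space w \<partial>lborel) \<le> (\<integral>\<^sup>+ w. T w \<partial>lborel)"
  proof (rule nn_integral_mono_AE)
    show "AE w in lborel. ennreal (\<bar>v w\<bar> powr q) * indicator half_space w \<le> T w"
      using Tf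
    proof eventually_elim
      case (elim w)
      show ?case
      proof (cases "0 < fst w")
        case True
        note P = potential_Jensen[OF True q assms(2,3) z T_def elim]
        have "ennreal \<bar>v w\<bar> \<le> abs_duhamel f0 (fst w) (snd w) + abs_flow g0 (fst w) (snd w)"
          unfolding v by (rule abs_potential_le) measurable
        then have "\<bar>v w\<bar> \<le> enn2real (abs_duhamel f0 (fst w) (snd w) + abs_flow g0 (fst w) (snd w))"
          using enn2real_mono[of "ennreal \<bar>v w\<bar>"] P(1) by simp
        then have "ennreal (\<bar>v w\<bar> powr q) \<le> ennreal (enn2real (abs_duhamel f0 (fst w) (snd w) + abs_flow g0 (fst w) (snd w)) powr q)"
          using q by (intro ennreal_leI powr_mono2) auto
        also note P(2)
        finally show ?thesis by (auto simp: indicator_def)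
      qed (auto simp: half_space_def indicator_def)
    qed
  qed
  then show "(\<integral>\<^sup>+ w. ennreal (\<bar>v w\<bar> powr q) * indicator half_space w \<partial>lborel) \<le> I + J" by (simp only: TT)
qed

text \<open>For \<open>p < \<infinity>\<close>, Jensen's inequality applied to both terms of the potential at once bounds
  \<open>\<bar>v\<bar> powr p\<close> by a potential whose total mass is the sum of the \<open>p\<close>-th powers of the norms.\<close>

lemma heat_potential_Lp:
  fixes f :: "real \<times> (real^'n) \<Rightarrow> real" and g :: "real^'n \<Rightarrow> real"
  assumes p: "1 \<le> p" and g: "in_Lp p lebesgue g" and f: "in_Lp p (lebesgue_on half_space) f"
    and v: "v = heat_potential a f g"
  shows "AE (t, x) in lebesgue_on half_space. heat_potential_converges a f g t x"
    "in_Lp p (lebesgue_on half_space) v"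
    "Lp_norm p (lebesgue_on half_space) v \<le> Lp_norm p (lebesgue_on half_space) f + Lp_norm p lebesgue g"
proof -
  let ?H = "half_space :: (real \<times> (real^'n)) set"
  have H0: "?H \<in> sets borel" by (rule borel_open[OF open_half_space])
  then have H: "?H \<in> sets borel" "?H \<in> sets lebesgue" using sets_completionI_sets[of ?H lborel] by simp_all
  have hs: "z \<in> ?H \<longleftrightarrow> 0 < fst z" for z by (cases z) (simp add: half_space_def)
  have AEH: "(AE z in lebesgue_on ?H. P z) \<longleftrightarrow> (AE z in lborel. 0 < fst z \<longrightarrow> P z)" for P
    using H by (subst AE_restrict_space_iff) (auto simp: AE_completion_iff hs)
  have NH: "(\<integral>\<^sup>+ z. k z \<partial>lebesgue_on ?H) = (\<integral>\<^sup>+ z. k z * indicator ?H z \<partial>lborel)" for k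
    using H by (subst nn_integral_restrict_space) (auto simp: nn_integral_completion)
  have fm: "f \<in> borel_measurable (lebesgue_on ?H)" and fn: "Lp_norm p (lebesgue_on ?H) f < \<infinity>"
    and gm: "g \<in> borel_measurable lebesgue" and gn: "Lp_norm p lebesgue g < \<infinity>"
    using f g by (auto simp: in_Lp_def)
  obtain f1 where f1[measurable]: "f1 \<in> borel_measurable borel" and f1e: "AE z in lborel. (if z \<in> ?H then f z else 0) = f1 z"
    using completion_ex_borel_measurable_real[OF borel_measurable_if_I[OF fm H(2)]] by auto
  obtain g1 where g1[measurable]: "g1 \<in> borel_measurable borel" and g1e: "AE z in lborel. g z = g1 z"
    using completion_ex_borel_measurable_real[OF gm] by auto
  define f2 where "f2 z = (if 0 < fst z then f1 z else 0)" for z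
  have f2[measurable]: "f2 \<in> borel_measurable borel" unfolding f2_def by measurable
  have f2e: "AE z in lborel. 0 < fst z \<longrightarrow> f z = f2 z"
    using f1e by eventually_elim (auto simp: f2_def hs)
  \<comment> \<open>All conclusions follow from Borel representatives with almost everywhere finite
    absolute potentials and the norm estimate. The representatives f0 and g0 are left open because
    the case p = \<infinity> uses truncated ones.\<close>
  have main: "(AE (t, x) in lebesgue_on ?H. heat_potential_converges a f g t x) \<and> in_Lp p (lebesgue_on ?H) v
      \<and> Lp_norm p (lebesgue_on ?H) v \<le> Lp_norm p (lebesgue_on ?H) f + Lp_norm p lebesgue g"
    if f0: "f0 \<in> borel_measurable borel" "\<And>t x. t \<le> 0 \<Longrightarrow> f0 (t, x) = 0" "AE z in lborel. 0 < fst z \<longrightarrow> f z = f0 z"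
      and g0: "g0 \<in> borel_measurable borel" "AE z in lborel. g z = g0 z"
      and S: "AE w in lborel. 0 < fst w \<longrightarrow> abs_duhamel f0 (fst w) (snd w) + abs_flow g0 (fst w) (snd w) < \<infinity>"
      and n: "(\<lambda>w. (LINT \<tau>|lborel. duhamel_slice f0 (fst w) (snd w) \<tau>) + flow 0 (fst w) g0 (snd w)) = v
        \<Longrightarrow> v \<in> borel_measurable (lebesgue_on ?H)
        \<Longrightarrow> Lp_norm p (lebesgue_on ?H) v \<le> Lp_norm p (lebesgue_on ?H) f + Lp_norm p lebesgue g"
    for f0 g0
  proof -
    have pot: "heat_potential a f g (t, x) = (LINT \<tau>|lborel. duhamel_slice f0 t x \<tau>) + flow 0 t g0 x"
      "heat_potential_converges a f g t x \<longleftrightarrow>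
         integrable lborel (\<lambda>z. heat_kernel a t (fst z) (snd z) * f0 (t - fst z, x - snd z)) \<and>
         integrable lborel (\<lambda>y. heat_kernel a t t y * g0 (x - y))" for t x
      by (rule heat_potential_AE[OF f0(1) _ f0(3) g0], rule f0(2), assumption)+
    have ve: "(\<lambda>w. (LINT \<tau>|lborel. duhamel_slice f0 (fst w) (snd w) \<tau>) + flow 0 (fst w) g0 (snd w)) = v"
      by (auto simp: v pot(1))
    have vb: "v \<in> borel_measurable borel" unfolding ve[symmetric] by (rule potential_measurable[OF f0(1) g0(1)])
    have vm: "v \<in> borel_measurable (lebesgue_on ?H)"
      by (rule measurable_restrict_space1, rule measurable_completion) (use vb in simp)
    have "AE w in lborel. 0 < fst w \<longrightarrow> heat_potential_converges a f g (fst w) (snd w)"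
      using S
    proof eventually_elim
      case (elim w)
      then show ?case using abs_duhamel_abs_flow_integrable[OF f0(1) g0(1)] by (simp add: pot(2))
    qed
    then have "AE (t, x) in lebesgue_on ?H. heat_potential_converges a f g t x"
      by (simp add: AEH case_prod_beta)
    moreover have "Lp_norm p (lebesgue_on ?H) f + Lp_norm p lebesgue g < \<infinity>" using fn gn by simp
    then have "Lp_norm p (lebesgue_on ?H) v < \<infinity>" by (rule le_less_trans[OF n[OF ve vm]])
    ultimately show ?thesis using n[OF ve vm] vm by (simp add: in_Lp_def)
  qed
  have "(AE (t, x) in lebesgue_on ?H. heat_potential_converges a f g t x) \<and> in_Lp p (lebesgue_on ?H) v
      \<and> Lp_norm p (lebesgue_on ?H) v \<le> Lp_norm p (lebesgue_on ?H) f + Lp_norm p lebesgue g"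
  proof (cases "p = \<infinity>")
    case True
    define M where "M = enn2real (Lp_norm p (lebesgue_on ?H) f)"
    define N where "N = enn2real (Lp_norm p lebesgue g)"
    have MN: "0 \<le> M" "0 \<le> N" "Lp_norm p (lebesgue_on ?H) f = ennreal M" "Lp_norm p lebesgue g = ennreal N"
      using fn gn by (simp_all add: M_def N_def less_top)
    have "AE z in lebesgue_on ?H. ennreal \<bar>f z\<bar> \<le> ennreal M"
      unfolding MN(3)[symmetric] using True esssup_AE[of "\<lambda>z. ennreal \<bar>f z\<bar>"] by (simp add: Lp_norm_def)
    then have fM: "AE z in lborel. 0 < fst z \<longrightarrow> \<bar>f z\<bar> \<le> M" unfolding AEH using MN(1) by simp
    have "AE z in lebesgue. ennreal \<bar>g z\<bar> \<le> ennreal N"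
      unfolding MN(4)[symmetric] using True esssup_AE[of "\<lambda>z. ennreal \<bar>g z\<bar>"] by (simp add: Lp_norm_def)
    then have gN: "AE z in lborel. \<bar>g z\<bar> \<le> N" using MN(2) by (simp add: AE_completion_iff)
    \<comment> \<open>Truncation at the essential supremum changes f2 and g1 only on null sets, and
      the bounds then hold everywhere.\<close>
    define f0 where "f0 z = (if \<bar>f2 z\<bar> \<le> M then f2 z else 0)" for z
    define g0 where "g0 z = (if \<bar>g1 z\<bar> \<le> N then g1 z else 0)" for z
    have m: "f0 \<in> borel_measurable borel" "g0 \<in> borel_measurable borel" unfolding f0_def g0_def by measurable
    have z: "f0 (t, x) = 0" if "t \<le> 0" for t x using that by (simp add: f0_def f2_def)
    have b: "\<bar>f0 z\<bar> \<le> M" "\<bar>g0 y\<bar> \<le> N" for z y using MN by (auto simp: f0_def g0_def)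
    have S: "abs_duhamel f0 t x + abs_flow g0 t x \<le> ennreal M + ennreal N" if "0 < t" for t x
      by (rule potential_bounded[OF that MN(1,2) m z b])
    show ?thesis
    proof (rule main[OF m(1) z _ m(2)])
      show "AE z in lborel. 0 < fst z \<longrightarrow> f z = f0 z" using fM f2e by eventually_elim (auto simp: f0_def)
      show "AE z in lborel. g z = g0 z" using gN g1e by eventually_elim (auto simp: g0_def)
      show "AE w in lborel. 0 < fst w \<longrightarrow> abs_duhamel f0 (fst w) (snd w) + abs_flow g0 (fst w) (snd w) < \<infinity>"
        by (intro AE_I2 impI le_less_trans[OF S]) auto
      assume ve: "(\<lambda>w. (LINT \<tau>|lborel. duhamel_slice f0 (fst w) (snd w) \<tau>) + flow 0 (fst w) g0 (snd w)) = v"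
        and [measurable]: "v \<in> borel_measurable (lebesgue_on ?H)"
      have "ennreal \<bar>v w\<bar> \<le> ennreal M + ennreal N" if "0 < fst w" for w
        unfolding ve[symmetric] by (rule order_trans[OF abs_potential_le[OF m(1)] S[OF that]])
      then have "AE w in lebesgue_on ?H. ennreal \<bar>v w\<bar> \<le> ennreal M + ennreal N"
        unfolding AEH by (intro AE_I2) blast
      then have "esssup (lebesgue_on ?H) (\<lambda>w. ennreal \<bar>v w\<bar>) \<le> ennreal M + ennreal N"
        by (rule esssup_I[rotated]) measurable
      then show "Lp_norm p (lebesgue_on ?H) v \<le> Lp_norm p (lebesgue_on ?H) f + Lp_norm p lebesgue g"
        unfolding MN(3,4) using True by (simp add: Lp_norm_def)
    qed
  next
    case False
    define q where "q = enn2real p"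
    have pq: "p = ennreal q" using False by (simp add: q_def less_top)
    have q: "1 \<le> q" using p unfolding pq by (metis ennreal_1 ennreal_le_iff2 zero_neq_one not_one_le_zero order_trans linear)
    have Lp: "Lp_norm p M h = (if (\<integral>\<^sup>+ x. ennreal (\<bar>h x\<bar> powr q) \<partial>M) = \<infinity> then \<infinity>
        else ennreal (enn2real (\<integral>\<^sup>+ x. ennreal (\<bar>h x\<bar> powr q) \<partial>M) powr (1 / q)))" for M :: "'c measure" and h
      using False by (simp add: Lp_norm_def q_def Let_def)
    define I where "I = (\<integral>\<^sup>+ z. ennreal (\<bar>f2 z\<bar> powr q) \<partial>lborel)"
    define J where "J = (\<integral>\<^sup>+ z. ennreal (\<bar>g1 z\<bar> powr q) \<partial>lborel)"
    have If: "(\<integral>\<^sup>+ z. ennreal (\<bar>f z\<bar> powr q) \<partial>lebesgue_on ?H) = I"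
      unfolding NH I_def
    proof (rule nn_integral_cong_AE)
      show "AE z in lborel. ennreal (\<bar>f z\<bar> powr q) * indicator ?H z = ennreal (\<bar>f2 z\<bar> powr q)"
        using f2e by eventually_elim (auto simp: indicator_def hs f2_def)
    qed
    have Jg: "(\<integral>\<^sup>+ z. ennreal (\<bar>g z\<bar> powr q) \<partial>lebesgue) = J"
      unfolding nn_integral_completion J_def using g1e by (intro nn_integral_cong_AE) (auto elim: eventually_mono)
    have IJ: "I < \<infinity>" "J < \<infinity>" using fn gn by (auto simp: Lp If Jg less_top[symmetric] split: if_splits)
    have z: "f2 (t, x) = 0" if "t \<le> 0" for t x using that by (simp add: f2_def)
    show ?thesis
    proof (rule main[OF f2 z f2e g1 g1e])
      show "AE w in lborel. 0 < fst w \<longrightarrow> abs_duhamel f2 (fst w) (snd w) + abs_flow g1 (fst w) (snd w) < \<infinity>"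
        by (rule potential_Lq(1)[OF q f2 g1 z I_def IJ(1) J_def IJ(2) refl])
      assume ve: "(\<lambda>w. (LINT \<tau>|lborel. duhamel_slice f2 (fst w) (snd w) \<tau>) + flow 0 (fst w) g1 (snd w)) = v"
      define K where "K = (\<integral>\<^sup>+ w. ennreal (\<bar>v w\<bar> powr q) \<partial>lebesgue_on ?H)"
      have K: "K \<le> I + J"
        unfolding K_def NH by (rule potential_Lq(2)[OF q f2 g1 z I_def IJ(1) J_def IJ(2) ve[symmetric]])
      then have Kf: "K < \<infinity>" using IJ by (auto intro: le_less_trans)
      have "enn2real K \<le> enn2real I + enn2real J"
        using enn2real_mono[OF K] IJ by (simp add: enn2real_plus)
      then have "enn2real K powr (1 / q) \<le> (enn2real I + enn2real J) powr (1 / q)"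
        using q by (intro powr_mono2) auto
      also have "\<dots> \<le> enn2real I powr (1 / q) + enn2real J powr (1 / q)"
        using q by (intro powr_add_le) auto
      finally have "ennreal (enn2real K powr (1 / q)) \<le> ennreal (enn2real I powr (1 / q)) + ennreal (enn2real J powr (1 / q))"
        using ennreal_leI by fastforce
      then show "Lp_norm p (lebesgue_on ?H) v \<le> Lp_norm p (lebesgue_on ?H) f + Lp_norm p lebesgue g"
        using Kf IJ by (simp only: Lp If Jg K_def[symmetric]) (auto simp: less_top[symmetric])
    qed
  qed
  then show "AE (t, x) in lebesgue_on ?H. heat_potential_converges a f g t x"
    "in_Lp p (lebesgue_on ?H) v"
    "Lp_norm p (lebesgue_on ?H) v \<le> Lp_norm p (lebesgue_on ?H) f + Lp_norm p lebesgue g" by blast+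
qed

end

section \<open>Measurable coefficients\<close>

lemma completion_ex_borel_measurable_matrix:
  fixes a :: "real \<Rightarrow> real^'n^'n"
  assumes "a \<in> borel_measurable lebesgue"
  obtains b where "b \<in> borel_measurable borel" "AE t in lborel. a t = b t"
proof -
  have "\<exists>b\<in>borel_measurable lborel. AE t in lborel. a t $ i $ j = b t" for i j
    using assms by (intro completion_ex_borel_measurable_real) measurable
  then obtain b where b: "\<And>i j. b i j \<in> borel_measurable borel" "\<And>i j. AE t in lborel. a t $ i $ j = b i j t"
    unfolding measurable_lborel2 by metis
  have "(\<lambda>t. \<chi> i j. b i j t) \<in> borel_measurable borel"
    by (subst borel_measurable_euclidean_space) (use b(1) in \<open>auto simp: Basis_vec_def inner_axis\<close>)
  moreover have "AE t in lborel. \<forall>i\<in>UNIV. \<forall>j\<in>UNIV. a t $ i $ j = b i j t"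
    using b(2) by (intro AE_finite_allI finite)
  then have "AE t in lborel. a t = (\<chi> i j. b i j t)" by eventually_elim (simp add: vec_eq_iff)
  ultimately show ?thesis by (rule that)
qed

lemma admissible_coeff_borel_version:
  fixes a :: "real \<Rightarrow> real^'n^'n"
  assumes L: "0 < \<Lambda>" and a: "admissible_coeff \<Lambda> a"
  obtains b where "elliptic_coeff b \<Lambda>" "AE t in lborel. a t = b t"
proof -
  have am: "a \<in> borel_measurable lebesgue" and sym: "\<And>t. transpose (a t) = a t"
    and q: "AE t in lborel. \<forall>\<xi>.
        \<Lambda> * (norm \<xi>)\<^sup>2 \<le> (\<Sum>i\<in>UNIV. \<Sum>j\<in>UNIV. a t $ i $ j * \<xi> $ i * \<xi> $ j) \<and>
        (\<Sum>i\<in>UNIV. \<Sum>j\<in>UNIV. a t $ i $ j * \<xi> $ i * \<xi> $ j) \<le> inverse \<Lambda> * (norm \<xi>)\<^sup>2"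
    using a by (auto simp: admissible_coeff_def AE_completion_iff)
  obtain b where b[measurable]: "b \<in> borel_measurable borel" and ab: "AE t in lborel. a t = b t"
    by (rule completion_ex_borel_measurable_matrix[OF am])
  have "AE t in lborel. elliptic \<Lambda> (1 / \<Lambda>) (b t) \<and> a t = b t"
    using q ab
  proof eventually_elim
    case (elim t)
    then have "elliptic \<Lambda> (1 / \<Lambda>) (a t)"
      using L sym[of t] by (simp only: elliptic_def inner_matrix_vector_eq_sum inverse_eq_divide) blast
    then show ?case using elim by simp
  qed
  then obtain N where N: "{t \<in> space lborel. \<not> (elliptic \<Lambda> (1 / \<Lambda>) (b t) \<and> a t = b t)} \<subseteq> N"
    "emeasure lborel N = 0" "N \<in> sets lborel"
    by (rule AE_E)
  \<comment> \<open>A null set is not the whole line, so a good time s exists; the value of b there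
    is used at all exceptional times and keeps the constant \<Lambda>.\<close>
  have "N \<noteq> UNIV" using N(2) by auto
  then obtain s where "s \<notin> N" by blast
  define b0 where "b0 t = (if t \<in> N then b s else b t)" for t
  have [measurable]: "N \<in> sets borel" using N(3) by simp
  have "elliptic_coeff b0 \<Lambda>"
  proof
    show "b0 \<in> borel_measurable borel" unfolding b0_def by measurable
    show "elliptic \<Lambda> (1 / \<Lambda>) (b0 t)" for t using N(1) \<open>s \<notin> N\<close> by (auto simp: b0_def)
  qed
  moreover have "AE t in lborel. a t = b0 t"
    by (rule AE_I'[of N]) (use N in \<open>auto simp: b0_def null_sets_def\<close>)
  ultimately show ?thesis by (rule that)
qed

text \<open>The coefficients enter the kernel only through their integrals. Hence the kernels agree
  at all arguments, together with all their derivatives.\<close>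

lemma heat_kernel_cong_AE:
  fixes a b :: "real \<Rightarrow> real^'n^'n"
  assumes b: "b \<in> borel_measurable borel" and ab: "AE t in lborel. a t = b t"
  shows "heat_kernel a = heat_kernel b"
proof -
  have "(LINT r:{t - \<tau>..t}|lebesgue. a r) = (LINT r:{t - \<tau>..t}|lebesgue. b r)" for t \<tau>
  proof -
    have m: "(\<lambda>r. indicator {t - \<tau>..t} r *\<^sub>R b r) \<in> borel_measurable borel" using b by measurable
    have "AE r in lborel. indicator {t - \<tau>..t} r *\<^sub>R a r = indicator {t - \<tau>..t} r *\<^sub>R b r"
      using ab by eventually_elim simp
    from lebesgue_AE_eq_borel(2)[OF m this] lebesgue_AE_eq_borel(2)[OF m, of "\<lambda>r. indicator {t - \<tau>..t} r *\<^sub>R b r"]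
    show ?thesis unfolding set_lebesgue_integral_def by simp
  qed
  then show ?thesis by (simp add: fun_eq_iff heat_kernel_def B_mat_def A_mat_def)
qed

lemma bounded_classical_solution_cong_AE:
  assumes ab: "AE t in lborel. a t = b t" and u: "bounded_classical_solution a f g u"
  shows "bounded_classical_solution b f g u"
proof -
  have "AE t in lebesgue. 0 < t \<longrightarrow> (\<forall>x.
        (\<lambda>s. u (s, x)) differentiable (at t) \<and>
        deriv (\<lambda>s. u (s, x)) t - (\<Sum>i\<in>UNIV. \<Sum>j\<in>UNIV. a t $ i $ j * pd2 i j (\<lambda>y. u (t, y)) x) + u (t, x) = f (t, x))"
    using u by (simp add: bounded_classical_solution_def)
  then have "AE t in lebesgue. 0 < t \<longrightarrow> (\<forall>x.
        (\<lambda>s. u (s, x)) differentiable (at t) \<and>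
        deriv (\<lambda>s. u (s, x)) t - (\<Sum>i\<in>UNIV. \<Sum>j\<in>UNIV. b t $ i $ j * pd2 i j (\<lambda>y. u (t, y)) x) + u (t, x) = f (t, x))"
    using AE_completion[OF ab] by eventually_elim simp
  then show ?thesis using u unfolding bounded_classical_solution_def by blast
qed

text \<open>The witnesses L are the Duhamel parts of the derivatives of the potential,
  \<open>duhamel (\<phi>2 i j) t x\<close> and \<open>duhamel_rate \<phi> \<phi>2 t x\<close>; the
  flow parts are the integrals against the initial datum.\<close>

lemma (in C2_data) W_limit_formulas:
  assumes t: "0 < t" and f: "\<And>t x. 0 < t \<Longrightarrow> f (t, x) = \<phi> (t, x)"
    and v: "v = heat_potential a f \<psi>"
  shows "space_formula_terms_exist a f \<psi> i j t x \<and>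
      (\<exists>L. ((\<lambda>\<epsilon>. LINT \<tau>:{\<epsilon><..<t}|lebesgue. LINT y|lebesgue.
                pd2 i j (heat_kernel a t \<tau>) (x - y) * f (t - \<tau>, y)) \<longlongrightarrow> L) (at_right 0) \<and>
           pd2 i j (\<lambda>y. v (t, y)) x = L + (LINT y|lebesgue. pd2 i j (heat_kernel a t t) y * \<psi> (x - y)))"
    and "regular_time t \<Longrightarrow> time_formula_terms_exist a f \<psi> t x \<and>
      (\<exists>L. ((\<lambda>\<epsilon>. LINT \<tau>:{\<epsilon><..<t}|lebesgue. LINT y|lebesgue.
                heat_kernel_dt_dtau a t \<tau> (x - y) * f (t - \<tau>, y)) \<longlongrightarrow> L) (at_right 0) \<and>
           deriv (\<lambda>s. v (s, x)) t =
             L + (LINT y|lebesgue. deriv (\<lambda>s. heat_kernel a s s y) t * \<psi> (x - y)) + f (t, x))"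
proof -
  have vW: "v (t, x) = W t x" for t x unfolding v by (rule heat_potential_eq_W(1)[OF f])
  note SF = source_space_formula[where x=x and i=i and j=j, OF t f]
  have SF3: "(LINT y|lebesgue. pd2 i j (heat_kernel a t t) y * \<psi> (x - y)) = flow 0 t (\<psi>2 i j) x"
    by (rule source_space_formula(3)[OF t f])
  have "pd2 i j (W t) x = W2 t x $ i $ j"
    unfolding pd2_def has_pd_imp_pd(1)[OF W_has_pd(1)] has_pd_imp_pd(1)[OF W_has_pd(2)] ..
  then have "pd2 i j (\<lambda>y. v (t, y)) x = duhamel (\<phi>2 i j) t x + (LINT y|lebesgue. pd2 i j (heat_kernel a t t) y * \<psi> (x - y))"
    unfolding vW SF3 by (simp add: W2_def)
  then show "space_formula_terms_exist a f \<psi> i j t x \<and>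
      (\<exists>L. ((\<lambda>\<epsilon>. LINT \<tau>:{\<epsilon><..<t}|lebesgue. LINT y|lebesgue.
                pd2 i j (heat_kernel a t \<tau>) (x - y) * f (t - \<tau>, y)) \<longlongrightarrow> L) (at_right 0) \<and>
           pd2 i j (\<lambda>y. v (t, y)) x = L + (LINT y|lebesgue. pd2 i j (heat_kernel a t t) y * \<psi> (x - y)))"
    using SF(1,2) by blast
  assume r: "regular_time t"
  note TF = source_time_formula[where x=x, OF t r f]
  have TF3: "(LINT y|lebesgue. deriv (\<lambda>s. heat_kernel a s s y) t * \<psi> (x - y)) = flow_rate 0 \<psi> \<psi>2 t x"
    by (rule source_time_formula(3)[OF t r f])
  have "deriv (\<lambda>s. v (s, x)) t = a t \<bullet> W2 t x - W t x + \<phi> (t, x)"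
    unfolding vW by (rule DERIV_imp_deriv[OF W_has_derivative[OF t r[unfolded regular_time_def]]])
  also have "a t \<bullet> W2 t x - W t x = duhamel_rate \<phi> \<phi>2 t x + flow_rate 0 \<psi> \<psi>2 t x"
    by (simp add: inner_matrix_eq_sum W2_def W_def duhamel_rate_def flow_rate_def distrib_left sum.distrib)
  finally have "deriv (\<lambda>s. v (s, x)) t
      = duhamel_rate \<phi> \<phi>2 t x + (LINT y|lebesgue. deriv (\<lambda>s. heat_kernel a s s y) t * \<psi> (x - y)) + f (t, x)"
    unfolding TF3 f[OF t] .
  then show "time_formula_terms_exist a f \<psi> t x \<and>
      (\<exists>L. ((\<lambda>\<epsilon>. LINT \<tau>:{\<epsilon><..<t}|lebesgue. LINT y|lebesgue.
                heat_kernel_dt_dtau a t \<tau> (x - y) * f (t - \<tau>, y)) \<longlongrightarrow> L) (at_right 0) \<and>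
           deriv (\<lambda>s. v (s, x)) t =
             L + (LINT y|lebesgue. deriv (\<lambda>s. heat_kernel a s s y) t * \<psi> (x - y)) + f (t, x))"
    using TF(1,2) by blast
qed

theorem theorem1p7:
  fixes a :: "real \<Rightarrow> real^'n^'n" and \<Lambda> :: real and p :: ennreal
    and f v :: "real \<times> (real^'n) \<Rightarrow> real" and g :: "real^'n \<Rightarrow> real"
  assumes "0 < \<Lambda>" and "admissible_coeff \<Lambda> a"
    and "1 \<le> p"
    and "in_Lp p lebesgue g"
    and "in_Lp p (lebesgue_on half_space) f"
    and v_def: "v = heat_potential a f g"
  shows
    "(AE (t, x) in lebesgue_on half_space. heat_potential_converges a f g t x) \<and>
     in_Lp p (lebesgue_on half_space) v \<and>
     Lp_norm p (lebesgue_on half_space) v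
       \<le> Lp_norm p (lebesgue_on half_space) f + Lp_norm p lebesgue g \<and>
     (C2c_on half_space f \<and> C2c_on UNIV g \<longrightarrow>
        (\<forall>t>0. \<forall>x. heat_potential_converges a f g t x) \<and>
        (let w = (\<lambda>(t, x). if t = 0 then g x else v (t, x)) in
           bounded_classical_solution a f g w \<and>
           (\<forall>u. bounded_classical_solution a f g u \<longrightarrow> (\<forall>t\<ge>0. \<forall>x. u (t, x) = w (t, x)))) \<and>
        (AE t in lebesgue. 0 < t \<longrightarrow> (\<forall>x.
           (\<forall>i j. space_formula_terms_exist a f g i j t x \<and>
              (\<exists>L. ((\<lambda>\<epsilon>. LINT \<tau>:{\<epsilon><..<t}|lebesgue. LINT y|lebesgue.
                        pd2 i j (heat_kernel a t \<tau>) (x - y) * f (t - \<tau>, y)) \<longlongrightarrow> L) (at_right 0) \<and>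
                   pd2 i j (\<lambda>y. v (t, y)) x =
                     L + (LINT y|lebesgue. pd2 i j (heat_kernel a t t) y * g (x - y)))) \<and>
           time_formula_terms_exist a f g t x \<and>
           (\<exists>L. ((\<lambda>\<epsilon>. LINT \<tau>:{\<epsilon><..<t}|lebesgue. LINT y|lebesgue.
                     heat_kernel_dt_dtau a t \<tau> (x - y) * f (t - \<tau>, y)) \<longlongrightarrow> L) (at_right 0) \<and>
                deriv (\<lambda>s. v (s, x)) t =
                  L + (LINT y|lebesgue. deriv (\<lambda>s. heat_kernel a s s y) t * g (x - y))
                    + f (t, x)))))"
proof -
  \<comment> \<open>The statement refers to \<open>a\<close> either through the kernel or in an
    equation for almost every time, so \<open>a\<close> can be replaced by b throughout.\<close>
  obtain b where Eb: "elliptic_coeff b \<Lambda>" and ab: "AE t in lborel. a t = b t"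
    by (rule admissible_coeff_borel_version[OF assms(1,2)])
  interpret E: elliptic_coeff b \<Lambda> by (rule Eb)
  have ba: "AE t in lborel. b t = a t" using ab by eventually_elim simp
  have hk: "heat_kernel a = heat_kernel b" by (rule heat_kernel_cong_AE[OF E.a_borel ab])
  have hd: "heat_kernel_dt_dtau a = heat_kernel_dt_dtau b" by (simp add: fun_eq_iff heat_kernel_dt_dtau_def hk)
  have hp: "heat_potential a f g = heat_potential b f g" by (simp add: heat_potential_def hk)
  have hc: "heat_potential_converges a f g = heat_potential_converges b f g"
    by (simp add: fun_eq_iff heat_potential_converges_def hk)
  have sf: "space_formula_terms_exist a f g = space_formula_terms_exist b f g"
    by (simp add: fun_eq_iff space_formula_terms_exist_def hk)
  have tf: "time_formula_terms_exist a f g = time_formula_terms_exist b f g"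
    by (simp add: fun_eq_iff time_formula_terms_exist_def hk hd)
  have bcs: "bounded_classical_solution a f g u \<longleftrightarrow> bounded_classical_solution b f g u" for u
    using bounded_classical_solution_cong_AE[OF ab] bounded_classical_solution_cong_AE[OF ba] by blast
  have vb: "v = heat_potential b f g" using v_def hp by simp
  note Lp = E.heat_potential_Lp[OF assms(3,4,5) vb]
  have smooth: "(\<forall>t>0. \<forall>x. heat_potential_converges b f g t x) \<and>
        (let w = (\<lambda>(t, x). if t = 0 then g x else v (t, x)) in
           bounded_classical_solution b f g w \<and>
           (\<forall>u. bounded_classical_solution b f g u \<longrightarrow> (\<forall>t\<ge>0. \<forall>x. u (t, x) = w (t, x)))) \<and>
        (AE t in lebesgue. 0 < t \<longrightarrow> (\<forall>x.
           (\<forall>i j. space_formula_terms_exist b f g i j t x \<and>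
              (\<exists>L. ((\<lambda>\<epsilon>. LINT \<tau>:{\<epsilon><..<t}|lebesgue. LINT y|lebesgue.
                        pd2 i j (heat_kernel b t \<tau>) (x - y) * f (t - \<tau>, y)) \<longlongrightarrow> L) (at_right 0) \<and>
                   pd2 i j (\<lambda>y. v (t, y)) x =
                     L + (LINT y|lebesgue. pd2 i j (heat_kernel b t t) y * g (x - y)))) \<and>
           time_formula_terms_exist b f g t x \<and>
           (\<exists>L. ((\<lambda>\<epsilon>. LINT \<tau>:{\<epsilon><..<t}|lebesgue. LINT y|lebesgue.
                     heat_kernel_dt_dtau b t \<tau> (x - y) * f (t - \<tau>, y)) \<longlongrightarrow> L) (at_right 0) \<and>
                deriv (\<lambda>s. v (s, x)) t =
                  L + (LINT y|lebesgue. deriv (\<lambda>s. heat_kernel b s s y) t * g (x - y))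
                    + f (t, x))))"
    if C2: "C2c_on half_space f" "C2c_on UNIV g"
  proof -
    define \<phi> where "\<phi> z = (if 0 < fst z then f z else 0)" for z
    have f\<phi>: "f (t, x) = \<phi> (t, x)" if "0 < t" for t x using that by (simp add: \<phi>_def)
    obtain \<phi>1 \<phi>2 where src: "C2b_source \<phi> \<phi>1 \<phi>2"
      using C2c_on_half_space_source[OF C2(1)] unfolding \<phi>_def[abs_def] by blast
    obtain \<psi>1 \<psi>2 where ini: "C2b g \<psi>1 \<psi>2" using C2c_on_UNIV_C2b[OF C2(2)] by blast
    interpret D: C2_data b \<Lambda> \<phi> \<phi>1 \<phi>2 g \<psi>1 \<psi>2 by standard (rule src, rule ini)
    define w where "w = (\<lambda>(t, x). if t = 0 then g x else v (t, x))"
    have "w = (\<lambda>(t, x). if t = 0 then g x else D.W t x)"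
      unfolding w_def vb using D.heat_potential_eq_W(1)[OF f\<phi>] by (simp add: fun_eq_iff)
    then have sol: "bounded_classical_solution b f g w" using D.W_classical_solution[OF f\<phi>] by simp
    have "AE t in lebesgue. E.regular_time t" by (rule AE_completion[OF E.AE_regular_time])
    then have lim: "AE t in lebesgue. 0 < t \<longrightarrow> (\<forall>x.
           (\<forall>i j. space_formula_terms_exist b f g i j t x \<and>
              (\<exists>L. ((\<lambda>\<epsilon>. LINT \<tau>:{\<epsilon><..<t}|lebesgue. LINT y|lebesgue.
                        pd2 i j (heat_kernel b t \<tau>) (x - y) * f (t - \<tau>, y)) \<longlongrightarrow> L) (at_right 0) \<and>
                   pd2 i j (\<lambda>y. v (t, y)) x =
                     L + (LINT y|lebesgue. pd2 i j (heat_kernel b t t) y * g (x - y)))) \<and>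
           time_formula_terms_exist b f g t x \<and>
           (\<exists>L. ((\<lambda>\<epsilon>. LINT \<tau>:{\<epsilon><..<t}|lebesgue. LINT y|lebesgue.
                     heat_kernel_dt_dtau b t \<tau> (x - y) * f (t - \<tau>, y)) \<longlongrightarrow> L) (at_right 0) \<and>
                deriv (\<lambda>s. v (s, x)) t =
                  L + (LINT y|lebesgue. deriv (\<lambda>s. heat_kernel b s s y) t * g (x - y))
                    + f (t, x)))"
    proof eventually_elim
      case (elim t)
      show ?case
        by (intro impI allI conjI[OF _ D.W_limit_formulas(2)] D.W_limit_formulas(1) f\<phi> vb elim)
    qed
    have uni: "u (t, x) = w (t, x)" if "bounded_classical_solution b f g u" "0 \<le> t" for u t x
      by (rule E.classical_solution_unique[OF that(1) sol that(2)])
    have conv: "heat_potential_converges b f g t x" for t x by (rule D.heat_potential_eq_W(2)[OF f\<phi>])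
    show ?thesis
      unfolding Let_def w_def[symmetric] using sol uni conv lim by blast
  qed
  show ?thesis
    unfolding hk hd hc sf tf bcs using Lp smooth by blast
qed

end
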